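(* Let $\tau\in\mathbb{C}$ with $\mathrm{Im}\,\tau>0$, let $\mu=p+q\tau$, $\nu=s+t\tau$ with $p,q,s,t\in\mathbb{R}$, and let $\psi=\tilde\psi\,d\bar z$ be a morphism of degree one from $E_{(1,\nu)}$ to $E_{(0,\mu)}$ whose class in $\mathrm{Ext}^1(E_{(1,\nu)},E_{(0,\mu)})$ is non-trivial. Then the mapping cone $C(\psi)$ is isomorphic, as a holomorphic vector bundle, to $E_{(\frac12,\frac{\eta}{2})}$ with $\eta\equiv\mu+\nu+\pi+\pi\tau \pmod{2\pi(\mathbb{Z}\oplus\tau\mathbb{Z})}$. Moreover, when $\psi$ is the normalized bump cocycle described in the context and $\eta=\mu+\nu+\pi+\pi\tau$, the maps $\frac{1}{\sqrt{c_\tau}}\phi: C(\psi)\to E_{(\frac12,\frac{\eta}{2})}$ and $\frac{1}{\sqrt{c_\tau}}\tilde\phi: E_{(\frac12,\frac{\eta}{2})}\to C(\psi)$, with $\phi,\tilde\phi,c_\tau$ as defined in the context, are mutually inverse holomorphic isomorphisms.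
   Context: Notation: $i=\sqrt{-1}$; $\check T^2=\mathbb{C}/2\pi(\mathbb{Z}\oplus\tau\mathbb{Z})$ with real coordinates $(x,y)$, $x\sim x+2\pi$, $y\sim y+2\pi$, and complex coordinate $z=x+\tau y$, so $\bar\partial f=\frac{\tau\partial_xf-\partial_yf}{\tau-\bar\tau}\,d\bar z$. Bundles. Smooth sections are described by smooth functions $f$ on $\mathbb{R}^2$ with quasi-periodicity, and holomorphic structures by an operator ($2$ times the $(0,1)$-part of a connection): (i) $E_{(0,\mu)}$ (rank 1): $f(x+2\pi,y)=f(x,y)$, $f(x,y+2\pi)=f(x,y)$, operator $d_0=2\bar\partial-\frac{i}{\pi(\bar\tau-\tau)}\mu\,d\bar z$. (ii) $E_{(1,\nu)}$ (rank 1, degree 1): $f(x+2\pi,y)=e^{iy}f(x,y)$, $f(x,y+2\pi)=f(x,y)$, operator $d_1=2\bar\partial-\frac{i}{\pi(\bar\tau-\tau)}(x+\nu)\,d\bar z$. (iii) $E_{(\frac12,\frac{\eta}{2})}$ (rank 2, degree 1), $\eta\in\mathbb{C}$: $f:\mathbb{R}^2\to\mathbb{C}^2$, $f(x+2\pi,y)=e^{\frac{i}{2}y}\begin{pmatrix}0&1\\1&0\end{pmatrix}f(x,y)$, $f(x,y+2\pi)=\begin{pmatrix}1&0\\0&-1\end{pmatrix}f(x,y)$, operator $d=\left(2\bar\partial-\frac{i}{\pi(\bar\tau-\tau)}\left(\frac12x+\frac{\eta}{2}\right)d\bar z\right)I_2$. Holomorphic maps between bundles with operators $d',d''$ are smooth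 bundle maps $\Phi$ with $d''\Phi-\Phi d'=0$. Mapping cone. A degree one morphism from $E_{(1,\nu)}$ to $E_{(0,\mu)}$ is $\psi=\tilde\psi\,d\bar z$ with $\tilde\psi$ a smooth bundle map $E_{(1,\nu)}\to E_{(0,\mu)}$, i.e. $\tilde\psi:\mathbb{R}^2\to\mathbb{C}$ smooth, $\tilde\psi(x+2\pi,y)=e^{-iy}\tilde\psi(x,y)$, $\tilde\psi(x,y+2\pi)=\tilde\psi(x,y)$. Its class in $\mathrm{Ext}^1(E_{(1,\nu)},E_{(0,\mu)})=H^1$ is non-trivial if $\psi$ is not of the form $d_0f-fd_1$ with $f$ a smooth bundle map $E_{(1,\nu)}\to E_{(0,\mu)}$. The mapping cone $C(\psi)$ is the smooth bundle $E_{(0,\mu)}\oplus E_{(1,\nu)}$ with holomorphic structure given by the operator $\tilde d=\begin{pmatrix}d_0&\psi\\0&d_1\end{pmatrix}$. Normalized bump cocycle. Fix $0<\varepsilon<\pi$ and a smooth $\rho:\mathbb{R}\to\mathbb{R}$ that increases on $[-\varepsilon,0]$, decreases on $[0,\varepsilon]$ and vanishes outside $[-\varepsilon,\varepsilon]$. Put $\tilde\psi(x,y)=\sum_{H\in\mathbb{Z}}\psi_H(x)e^{iHy}$, $\psi_H(x)=\kappa\,\rho(x-(-2\pi H+p-s))$, where it is assumed that the class is non-trivial (equivalently, the integral below is non-zero for $\kappa\neq0$) and $\kappa\in\mathbb{C}\setminus\{0\}$ is chosen so that, for all $H\in\mathbb{Z}$ (equivalently for $H=0$), $$\lambda_{\tau,H}:=\int_{-\infty}^{\infty}e^{-\frac{i}{\tau}\left(\frac{x^2}{4\pi}+\left(-\frac{p}{2\pi}+\frac{s}{2\pi}-\frac{q}{2\pi}\tau+\frac{t}{2\pi}\tau+H\right)x\right)}\psi_H(x)\,dx=e^{\frac{i}{\tau}\left(\pi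 H^2+(-p+s-q\tau+t\tau)H-\frac{\pi}{2}\tau-\frac{\pi}{4}\right)}.$$ Define $\theta_\varepsilon:\mathbb{R}\to\mathbb{C}$ (independent of $H$) by $$\lambda_{\tau,H}\,\theta_\varepsilon(x-(-2\pi H+p-s))=\int_{-\infty}^{x}e^{-\frac{i}{\tau}\left(\frac{r^2}{4\pi}+\left(-\frac{p}{2\pi}+\frac{s}{2\pi}-\frac{q}{2\pi}\tau+\frac{t}{2\pi}\tau+H\right)r\right)}\psi_H(r)\,dr,$$ so $\theta_\varepsilon(w)=0$ for $w\le-\varepsilon$ and $\theta_\varepsilon(w)=1$ for $w\ge\varepsilon$. Write $\theta_H(x):=\theta_\varepsilon(x-(-2\pi H+p-s))$. The map $\tilde\phi=(\tilde\phi_{jk})_{1\le j,k\le2}$: $$\tilde\phi_{11}=-\tfrac{\bar\tau-\tau}{2\tau}\,i\,e^{-\frac{i}{4\pi}(q-t-\pi)x-\frac{i}{8\pi\tau}(p-s-\pi)^2}\sum_{I\in\mathbb{Z}}\sum_{H\in\mathbb{Z}}(-1)^{I+H}e^{-i(q-t)I-\frac{\pi i}{\tau}(H-2I-\frac12)^2}\theta_H(x)\,e^{\frac{i}{8\pi\tau}(x+4\pi I-p+s+\pi)^2}e^{iIy},$$ $$\tilde\phi_{12}=-\tfrac{\bar\tau-\tau}{2\tau}\,e^{-\frac{i}{4\pi}(q-t-\pi)x+\frac{i}{2}y-\frac{i}{8\pi\tau}(p-s-\pi)^2-\frac{i}{2}(q-t)}\sum_{J\in\mathbb{Z}}\sum_{H\in\mathbb{Z}}(-1)^{J+H}e^{-i(q-t)J-\frac{\pi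 i}{\tau}(H-2J-\frac32)^2}\theta_H(x)\,e^{\frac{i}{8\pi\tau}(x+4\pi J-p+s+3\pi)^2}e^{iJy},$$ $$\tilde\phi_{21}=e^{\frac{i}{4\pi}(q-t+\pi)x+\frac{i}{8\pi\tau}(p-s+\pi)^2}\sum_{K\in\mathbb{Z}}(-1)^Ke^{-i(q-t)K-\frac{i}{8\pi\tau}(x-4\pi K-p+s-\pi)^2}e^{iKy},$$ $$\tilde\phi_{22}=-i\,e^{\frac{i}{4\pi}(q-t+\pi)x+\frac{i}{2}y+\frac{i}{8\pi\tau}(p-s+\pi)^2-\frac{i}{2}(q-t)}\sum_{L\in\mathbb{Z}}(-1)^Le^{-i(q-t)L-\frac{i}{8\pi\tau}(x-4\pi L-p+s-3\pi)^2}e^{iLy}.$$ The map $\phi=(\phi_{jk})_{1\le j,k\le2}$: $$\phi_{11}=e^{\frac{i}{4\pi}(q-t-\pi)x+\frac{i}{8\pi\tau}(p-s-\pi)^2}\sum_{M\in\mathbb{Z}}(-1)^Me^{-i(q-t)M-\frac{i}{8\pi\tau}(x-4\pi M-p+s+\pi)^2}e^{iMy},$$ $$\phi_{12}=\tfrac{\bar\tau-\tau}{2\tau}\,i\,e^{-\frac{i}{4\pi}(q-t+\pi)x-\frac{i}{8\pi\tau}(p-s+\pi)^2}\sum_{N\in\mathbb{Z}}\sum_{H\in\mathbb{Z}}(-1)^{N+H}e^{-i(q-t)N-\frac{\pi i}{\tau}(H-2N+\frac12)^2}\theta_H(x)\,e^{\frac{i}{8\pi\tau}(x+4\pi N-p+s-\pi)^2}e^{iNy},$$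 $$\phi_{21}=i\,e^{\frac{i}{4\pi}(q-t-\pi)x+\frac{i}{2}y+\frac{i}{8\pi\tau}(p-s-\pi)^2-\frac{i}{2}(q-t)}\sum_{P\in\mathbb{Z}}(-1)^Pe^{-i(q-t)P-\frac{i}{8\pi\tau}(x-4\pi P-p+s-\pi)^2}e^{iPy},$$ $$\phi_{22}=-\tfrac{\bar\tau-\tau}{2\tau}\,e^{-\frac{i}{4\pi}(q-t+\pi)x+\frac{i}{2}y-\frac{i}{8\pi\tau}(p-s+\pi)^2-\frac{i}{2}(q-t)}\sum_{R\in\mathbb{Z}}\sum_{H\in\mathbb{Z}}(-1)^{R+H}e^{-i(q-t)R-\frac{\pi i}{\tau}(H-2R-\frac12)^2}\theta_H(x)\,e^{\frac{i}{8\pi\tau}(x+4\pi R-p+s+\pi)^2}e^{iRy}.$$ Double sums are iterated: the sum over $H$ is performed first. The constant is $c_\tau=\frac{\bar\tau-\tau}{4\tau}\,i\sum_{l\in\mathbb{Z}}(-1)^l(2l+1)e^{-\frac{\pi i}{\tau}(l+\frac12)^2}$, which is non-zero; $\sqrt{c_\tau}$ is any fixed square root. *)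

theory Defs
  imports "HOL-Analysis.Analysis"
begin

section \<open>Smooth functions on the plane\<close>

definition partial_x :: "(real \<Rightarrow> real \<Rightarrow> 'a::real_normed_vector) \<Rightarrow> real \<Rightarrow> real \<Rightarrow> 'a" where
  "partial_x f x y = vector_derivative (\<lambda>u. f u y) (at x)"

definition partial_y :: "(real \<Rightarrow> real \<Rightarrow> 'a::real_normed_vector) \<Rightarrow> real \<Rightarrow> real \<Rightarrow> 'a" where
  "partial_y f x y = vector_derivative (\<lambda>v. f x v) (at y)"

primrec C_diff :: "nat \<Rightarrow> (real \<Rightarrow> real \<Rightarrow> 'a::real_normed_vector) \<Rightarrow> bool" where
  "C_diff 0 f \<longleftrightarrow> continuous_on UNIV (\<lambda>(x, y). f x y)"
| "C_diff (Suc k) f \<longleftrightarrow>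
     (\<forall>w. (\<lambda>(x, y). f x y) differentiable (at w)) \<and> C_diff k (partial_x f) \<and> C_diff k (partial_y f)"

definition smooth :: "(real \<Rightarrow> real \<Rightarrow> 'a::real_normed_vector) \<Rightarrow> bool" where
  "smooth f \<longleftrightarrow> (\<forall>k. C_diff k f)"

definition smooth_real :: "(real \<Rightarrow> real) \<Rightarrow> bool" where
  "smooth_real \<rho> \<longleftrightarrow> (\<forall>n x. (deriv ^^ n) \<rho> differentiable (at x))"


section \<open>Holomorphic bundles on the torus\<close>

text \<open>
  The torus is $\mathbb{C}/2\pi(\mathbb{Z}\oplus\tau\mathbb{Z})$ with $z = x + \tau y$.  All
  $(0,1)$-forms are identified with their coefficient of $d\bar z$.  A bundle of rank
  \<open>CARD('n)\<close> consists of its transition matrices and of the coefficient \<open>conn\<close> of the zeroth order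
  part of its operator:  sections satisfy
  \<open>f (x + 2 * pi) y = trans_x x y *v f x y\<close> and \<open>f x (y + 2 * pi) = trans_y x y *v f x y\<close>,
  and the operator is $2\bar\partial + \mathit{conn}\, d\bar z$.  Identities between operators are
  required on all smooth global sections; since these span every fibre, this is the same as
  equality of the operators.
\<close>

record 'n::finite hbundle =
  trans_x :: "real \<Rightarrow> real \<Rightarrow> complex^'n^'n"
  trans_y :: "real \<Rightarrow> real \<Rightarrow> complex^'n^'n"
  conn :: "real \<Rightarrow> real \<Rightarrow> complex^'n^'n"

definition dbar :: "complex \<Rightarrow> (real \<Rightarrow> real \<Rightarrow> complex^'n) \<Rightarrow> real \<Rightarrow> real \<Rightarrow> complex^'n::finite" where
  "dbar \<tau> f x y = (1 / (\<tau> - cnj \<tau>)) *s (\<tau> *s partial_x f x y - partial_y f x y)"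

definition hol_op ::
  "complex \<Rightarrow> 'n::finite hbundle \<Rightarrow> (real \<Rightarrow> real \<Rightarrow> complex^'n) \<Rightarrow> real \<Rightarrow> real \<Rightarrow> complex^'n" where
  "hol_op \<tau> E f x y = 2 *s dbar \<tau> f x y + conn E x y *v f x y"

definition smooth_section :: "'n::finite hbundle \<Rightarrow> (real \<Rightarrow> real \<Rightarrow> complex^'n) \<Rightarrow> bool" where
  "smooth_section E f \<longleftrightarrow> smooth f \<and>
     (\<forall>x y. f (x + 2 * pi) y = trans_x E x y *v f x y \<and>
            f x (y + 2 * pi) = trans_y E x y *v f x y)"

definition bundle_map ::
  "'n::finite hbundle \<Rightarrow> 'm::finite hbundle \<Rightarrow> (real \<Rightarrow> real \<Rightarrow> complex^'n^'m) \<Rightarrow> bool" where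
  "bundle_map E F \<Phi> \<longleftrightarrow> smooth \<Phi> \<and>
     (\<forall>x y. \<Phi> (x + 2 * pi) y ** trans_x E x y = trans_x F x y ** \<Phi> x y \<and>
            \<Phi> x (y + 2 * pi) ** trans_y E x y = trans_y F x y ** \<Phi> x y)"

definition holomorphic_map ::
  "complex \<Rightarrow> 'n::finite hbundle \<Rightarrow> 'm::finite hbundle \<Rightarrow> (real \<Rightarrow> real \<Rightarrow> complex^'n^'m) \<Rightarrow> bool" where
  "holomorphic_map \<tau> E F \<Phi> \<longleftrightarrow> bundle_map E F \<Phi> \<and>
     (\<forall>f. smooth_section E f \<longrightarrow>
        (\<forall>x y. hol_op \<tau> F (\<lambda>x y. \<Phi> x y *v f x y) x y - \<Phi> x y *v hol_op \<tau> E f x y = 0))"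

definition inverse_isos ::
  "complex \<Rightarrow> 'n::finite hbundle \<Rightarrow> 'm::finite hbundle \<Rightarrow>
     (real \<Rightarrow> real \<Rightarrow> complex^'n^'m) \<Rightarrow> (real \<Rightarrow> real \<Rightarrow> complex^'m^'n) \<Rightarrow> bool" where
  "inverse_isos \<tau> E F \<Phi> \<Psi> \<longleftrightarrow> holomorphic_map \<tau> E F \<Phi> \<and> holomorphic_map \<tau> F E \<Psi> \<and>
     (\<forall>x y. \<Psi> x y ** \<Phi> x y = mat 1 \<and> \<Phi> x y ** \<Psi> x y = mat 1)"

definition hol_isomorphic :: "complex \<Rightarrow> 'n::finite hbundle \<Rightarrow> 'm::finite hbundle \<Rightarrow> bool" where
  "hol_isomorphic \<tau> E F \<longleftrightarrow> (\<exists>\<Phi> \<Psi>. inverse_isos \<tau> E F \<Phi> \<Psi>)"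


section \<open>The bundles $E_{(0,\mu)}$, $E_{(1,\nu)}$ and $E_{(1/2,w)}$\<close>

definition mat22 :: "complex \<Rightarrow> complex \<Rightarrow> complex \<Rightarrow> complex \<Rightarrow> complex^2^2" where
  "mat22 a b c d = vector [vector [a, b], vector [c, d]]"

definition E_deg0 :: "complex \<Rightarrow> complex \<Rightarrow> 1 hbundle" where
  "E_deg0 \<tau> \<mu> = \<lparr>
     trans_x = (\<lambda>x y. mat 1),
     trans_y = (\<lambda>x y. mat 1),
     conn = (\<lambda>x y. mat (- (\<i> / (pi * (cnj \<tau> - \<tau>))) * \<mu>)) \<rparr>"

definition E_deg1 :: "complex \<Rightarrow> complex \<Rightarrow> 1 hbundle" where
  "E_deg1 \<tau> \<nu> = \<lparr>
     trans_x = (\<lambda>x y. mat (exp (\<i> * complex_of_real y))),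
     trans_y = (\<lambda>x y. mat 1),
     conn = (\<lambda>x y. mat (- (\<i> / (pi * (cnj \<tau> - \<tau>))) * (complex_of_real x + \<nu>))) \<rparr>"

text \<open>The second argument of \<open>E_half\<close> is the whole second index, i.e.\ $\eta/2$ for $E_{(1/2,\eta/2)}$.\<close>

definition E_half :: "complex \<Rightarrow> complex \<Rightarrow> 2 hbundle" where
  "E_half \<tau> w = \<lparr>
     trans_x = (\<lambda>x y. mat (exp (\<i> / 2 * complex_of_real y)) ** mat22 0 1 1 0),
     trans_y = (\<lambda>x y. mat22 1 0 0 (-1)),
     conn = (\<lambda>x y. mat (- (\<i> / (pi * (cnj \<tau> - \<tau>))) * (complex_of_real x / 2 + w))) \<rparr>"


section \<open>Degree one morphisms and mapping cones\<close>

text \<open>A degree one morphism $\psi = \tilde\psi\, d\bar z$ is represented by $\tilde\psi$; its class in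
  $\mathrm{Ext}^1(E,F)$ is trivial iff $\psi = d_F f - f d_E$ for some smooth bundle map \<open>f\<close>.\<close>

abbreviation degree_one_morphism ::
  "'n::finite hbundle \<Rightarrow> 'm::finite hbundle \<Rightarrow> (real \<Rightarrow> real \<Rightarrow> complex^'n^'m) \<Rightarrow> bool" where
  "degree_one_morphism E F \<psi> \<equiv> bundle_map E F \<psi>"

definition ext_trivial ::
  "complex \<Rightarrow> 'n::finite hbundle \<Rightarrow> 'm::finite hbundle \<Rightarrow> (real \<Rightarrow> real \<Rightarrow> complex^'n^'m) \<Rightarrow> bool" where
  "ext_trivial \<tau> E F \<psi> \<longleftrightarrow> (\<exists>f. bundle_map E F f \<and>
     (\<forall>g. smooth_section E g \<longrightarrow>
        (\<forall>x y. \<psi> x y *v g x y =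
                 hol_op \<tau> F (\<lambda>x y. f x y *v g x y) x y - f x y *v hol_op \<tau> E g x y)))"

text \<open>The cone of a degree one morphism \<open>\<psi>\<close> from the line bundle \<open>L1\<close> to the line bundle \<open>L0\<close>, on the
  smooth bundle $L_0 \oplus L_1$.\<close>

definition mapping_cone :: "1 hbundle \<Rightarrow> 1 hbundle \<Rightarrow> (real \<Rightarrow> real \<Rightarrow> complex^1^1) \<Rightarrow> 2 hbundle" where
  "mapping_cone L0 L1 \<psi> = \<lparr>
     trans_x = (\<lambda>x y. mat22 (trans_x L0 x y $ 1 $ 1) 0 0 (trans_x L1 x y $ 1 $ 1)),
     trans_y = (\<lambda>x y. mat22 (trans_y L0 x y $ 1 $ 1) 0 0 (trans_y L1 x y $ 1 $ 1)),
     conn = (\<lambda>x y. mat22 (conn L0 x y $ 1 $ 1) (\<psi> x y $ 1 $ 1) 0 (conn L1 x y $ 1 $ 1)) \<rparr>"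


section \<open>The normalized bump cocycle\<close>

definition psi_H :: "real \<Rightarrow> real \<Rightarrow> (real \<Rightarrow> real) \<Rightarrow> complex \<Rightarrow> int \<Rightarrow> real \<Rightarrow> complex" where
  "psi_H p s \<rho> \<kappa> H x = \<kappa> * \<rho> (x - (- 2 * pi * H + p - s))"

definition bump_cocycle ::
  "real \<Rightarrow> real \<Rightarrow> (real \<Rightarrow> real) \<Rightarrow> complex \<Rightarrow> real \<Rightarrow> real \<Rightarrow> complex^1^1" where
  "bump_cocycle p s \<rho> \<kappa> x y = mat (\<Sum>\<^sub>\<infinity>H\<in>(UNIV::int set). psi_H p s \<rho> \<kappa> H x * exp (\<i> * of_int H * y))"

definition weight :: "complex \<Rightarrow> real \<Rightarrow> real \<Rightarrow> real \<Rightarrow> real \<Rightarrow> int \<Rightarrow> real \<Rightarrow> complex" where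
  "weight \<tau> p q s t H x =
     exp (- (\<i> / \<tau>) * (x^2 / (4 * pi) +
       (- (p / (2 * pi)) + s / (2 * pi) - q / (2 * pi) * \<tau> + t / (2 * pi) * \<tau> + of_int H) * x))"
  for \<tau> :: complex and p q s t x :: real

definition lambda_H ::
  "complex \<Rightarrow> real \<Rightarrow> real \<Rightarrow> real \<Rightarrow> real \<Rightarrow> (real \<Rightarrow> real) \<Rightarrow> complex \<Rightarrow> int \<Rightarrow> complex" where
  "lambda_H \<tau> p q s t \<rho> \<kappa> H = (LINT x|lborel. weight \<tau> p q s t H x * psi_H p s \<rho> \<kappa> H x)"

definition normalized_bump ::
  "complex \<Rightarrow> real \<Rightarrow> real \<Rightarrow> real \<Rightarrow> real \<Rightarrow> real \<Rightarrow> (real \<Rightarrow> real) \<Rightarrow> complex \<Rightarrow> bool" where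
  "normalized_bump \<tau> p q s t \<epsilon> \<rho> \<kappa> \<longleftrightarrow>
     0 < \<epsilon> \<and> \<epsilon> < pi \<and>
     smooth_real \<rho> \<and> mono_on {-\<epsilon>..0} \<rho> \<and> antimono_on {0..\<epsilon>} \<rho> \<and> (\<forall>x. x \<notin> {-\<epsilon>..\<epsilon>} \<longrightarrow> \<rho> x = 0) \<and>
     \<kappa> \<noteq> 0 \<and>
     (\<forall>H::int. lambda_H \<tau> p q s t \<rho> \<kappa> H =
        exp (\<i> / \<tau> * (pi * (of_int H)^2 + (- p + s - q * \<tau> + t * \<tau>) * of_int H - pi / 2 * \<tau> - pi / 4)))"
  for \<tau> :: complex and p q s t :: real

text \<open>The function $\theta_\varepsilon$ is read off from its defining equation at $H = 0$; the equations
  for all other $H$ then hold as well, see \<open>theta_H_eq\<close>.\<close>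

definition theta_eps ::
  "complex \<Rightarrow> real \<Rightarrow> real \<Rightarrow> real \<Rightarrow> real \<Rightarrow> (real \<Rightarrow> real) \<Rightarrow> complex \<Rightarrow> real \<Rightarrow> complex" where
  "theta_eps \<tau> p q s t \<rho> \<kappa> w =
     (LINT r:{..w + (p - s)}|lborel. weight \<tau> p q s t 0 r * psi_H p s \<rho> \<kappa> 0 r) / lambda_H \<tau> p q s t \<rho> \<kappa> 0"

definition theta_H ::
  "complex \<Rightarrow> real \<Rightarrow> real \<Rightarrow> real \<Rightarrow> real \<Rightarrow> (real \<Rightarrow> real) \<Rightarrow> complex \<Rightarrow> int \<Rightarrow> real \<Rightarrow> complex" where
  "theta_H \<tau> p q s t \<rho> \<kappa> H x = theta_eps \<tau> p q s t \<rho> \<kappa> (x - (- 2 * pi * H + p - s))"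

lemma weight_shift:
  fixes \<tau> :: complex and p q s t w :: real
  assumes "\<tau> \<noteq> 0"
  shows "weight \<tau> p q s t H (w + (- 2 * pi * H)) =
     exp (\<i> / \<tau> * (pi * (of_int H)^2 + (- p + s - q * \<tau> + t * \<tau>) * of_int H)) * weight \<tau> p q s t 0 w"
  unfolding weight_def exp_add[symmetric]
  by (rule arg_cong[where f = exp]) (use assms in \<open>simp add: field_simps power2_eq_square\<close>)

lemma theta_H_eq:
  fixes \<tau> :: complex and p q s t x :: real
  assumes "\<tau> \<noteq> 0" "lambda_H \<tau> p q s t \<rho> \<kappa> 0 \<noteq> 0"
  shows "lambda_H \<tau> p q s t \<rho> \<kappa> H * theta_H \<tau> p q s t \<rho> \<kappa> H x =
     (LINT r:{..x}|lborel. weight \<tau> p q s t H r * psi_H p s \<rho> \<kappa> H r)"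
proof -
  define C where "C = exp (\<i> / \<tau> * (pi * (of_int H)^2 + (- p + s - q * \<tau> + t * \<tau>) * of_int H))"
  have eq: "weight \<tau> p q s t H (- 2 * pi * H + 1 * w) * psi_H p s \<rho> \<kappa> H (- 2 * pi * H + 1 * w) =
      C * (weight \<tau> p q s t 0 w * psi_H p s \<rho> \<kappa> 0 w)" for w
    using weight_shift[OF assms(1), of p q s t H w] by (simp add: C_def psi_H_def algebra_simps)
  have l: "lambda_H \<tau> p q s t \<rho> \<kappa> H = C * lambda_H \<tau> p q s t \<rho> \<kappa> 0"
    unfolding lambda_H_def
    by (subst lborel_integral_real_affine[of 1 _ "- 2 * pi * H"]) (simp_all only: eq, simp_all)
  have ind: "indicator {..x} (- 2 * pi * H + 1 * w) = (indicator {..x + 2 * pi * H} w :: real)" for w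
    by (auto simp: indicator_def)
  have "(LINT r:{..x}|lborel. weight \<tau> p q s t H r * psi_H p s \<rho> \<kappa> H r) =
      C * (LINT r:{..x + 2 * pi * H}|lborel. weight \<tau> p q s t 0 r * psi_H p s \<rho> \<kappa> 0 r)"
    unfolding set_lebesgue_integral_def
    by (subst lborel_integral_real_affine[of 1 _ "- 2 * pi * H"]) (simp_all only: eq ind mult_scaleR_right[symmetric] integral_mult_right_zero, simp_all)
  then show ?thesis
    using assms(2) by (simp add: l theta_H_def theta_eps_def algebra_simps)
qed


section \<open>The maps $\phi$ and $\tilde\phi$\<close>

text \<open>In all double sums \<open>\<theta>\<close> stands for the family \<open>theta_H\<close>, and the sum over \<open>H\<close> is the inner one: they
  are iterated sums that do not converge as sums over pairs.\<close>

definition phit11 :: "complex \<Rightarrow> real \<Rightarrow> real \<Rightarrow> real \<Rightarrow> real \<Rightarrow> (int \<Rightarrow> real \<Rightarrow> complex) \<Rightarrow> real \<Rightarrow> real \<Rightarrow> complex" where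
  "phit11 \<tau> p q s t \<theta> x y =
     - ((cnj \<tau> - \<tau>) / (2 * \<tau>)) * \<i> * exp (- (\<i> / (4 * pi)) * (q - t - pi) * x - \<i> / (8 * pi * \<tau>) * (p - s - pi)^2) *
     (\<Sum>\<^sub>\<infinity>I\<in>(UNIV::int set). (\<Sum>\<^sub>\<infinity>H\<in>(UNIV::int set).
         (-1) powi (I + H) * exp (- \<i> * (q - t) * of_int I - pi * \<i> / \<tau> * (of_int H - 2 * of_int I - 1/2)^2) * \<theta> H x
         * exp (\<i> / (8 * pi * \<tau>) * (x + 4 * pi * of_int I - p + s + pi)^2) * exp (\<i> * of_int I * y)))"
  for \<tau> :: complex and p q s t x y :: real

definition phit12 :: "complex \<Rightarrow> real \<Rightarrow> real \<Rightarrow> real \<Rightarrow> real \<Rightarrow> (int \<Rightarrow> real \<Rightarrow> complex) \<Rightarrow> real \<Rightarrow> real \<Rightarrow> complex" where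
  "phit12 \<tau> p q s t \<theta> x y =
     - ((cnj \<tau> - \<tau>) / (2 * \<tau>)) * exp (- (\<i> / (4 * pi)) * (q - t - pi) * x + \<i> / 2 * y - \<i> / (8 * pi * \<tau>) * (p - s - pi)^2 - \<i> / 2 * (q - t)) *
     (\<Sum>\<^sub>\<infinity>J\<in>(UNIV::int set). (\<Sum>\<^sub>\<infinity>H\<in>(UNIV::int set).
         (-1) powi (J + H) * exp (- \<i> * (q - t) * of_int J - pi * \<i> / \<tau> * (of_int H - 2 * of_int J - 3/2)^2) * \<theta> H x
         * exp (\<i> / (8 * pi * \<tau>) * (x + 4 * pi * of_int J - p + s + 3 * pi)^2) * exp (\<i> * of_int J * y)))"
  for \<tau> :: complex and p q s t x y :: real

definition phit21 :: "complex \<Rightarrow> real \<Rightarrow> real \<Rightarrow> real \<Rightarrow> real \<Rightarrow> real \<Rightarrow> real \<Rightarrow> complex" where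
  "phit21 \<tau> p q s t x y =
     exp (\<i> / (4 * pi) * (q - t + pi) * x + \<i> / (8 * pi * \<tau>) * (p - s + pi)^2) *
     (\<Sum>\<^sub>\<infinity>K\<in>(UNIV::int set).
         (-1) powi K * exp (- \<i> * (q - t) * of_int K - \<i> / (8 * pi * \<tau>) * (x - 4 * pi * of_int K - p + s - pi)^2)
         * exp (\<i> * of_int K * y))"
  for \<tau> :: complex and p q s t x y :: real

definition phit22 :: "complex \<Rightarrow> real \<Rightarrow> real \<Rightarrow> real \<Rightarrow> real \<Rightarrow> real \<Rightarrow> real \<Rightarrow> complex" where
  "phit22 \<tau> p q s t x y =
     - \<i> * exp (\<i> / (4 * pi) * (q - t + pi) * x + \<i> / 2 * y + \<i> / (8 * pi * \<tau>) * (p - s + pi)^2 - \<i> / 2 * (q - t)) *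
     (\<Sum>\<^sub>\<infinity>L\<in>(UNIV::int set).
         (-1) powi L * exp (- \<i> * (q - t) * of_int L - \<i> / (8 * pi * \<tau>) * (x - 4 * pi * of_int L - p + s - 3 * pi)^2)
         * exp (\<i> * of_int L * y))"
  for \<tau> :: complex and p q s t x y :: real

definition phi_tilde ::
  "complex \<Rightarrow> real \<Rightarrow> real \<Rightarrow> real \<Rightarrow> real \<Rightarrow> (real \<Rightarrow> real) \<Rightarrow> complex \<Rightarrow> real \<Rightarrow> real \<Rightarrow> complex^2^2" where
  "phi_tilde \<tau> p q s t \<rho> \<kappa> x y =
     (let \<theta> = theta_H \<tau> p q s t \<rho> \<kappa> in
      mat22 (phit11 \<tau> p q s t \<theta> x y) (phit12 \<tau> p q s t \<theta> x y)
            (phit21 \<tau> p q s t x y) (phit22 \<tau> p q s t x y))"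

definition phi11 :: "complex \<Rightarrow> real \<Rightarrow> real \<Rightarrow> real \<Rightarrow> real \<Rightarrow> real \<Rightarrow> real \<Rightarrow> complex" where
  "phi11 \<tau> p q s t x y =
     exp (\<i> / (4 * pi) * (q - t - pi) * x + \<i> / (8 * pi * \<tau>) * (p - s - pi)^2) *
     (\<Sum>\<^sub>\<infinity>M\<in>(UNIV::int set).
         (-1) powi M * exp (- \<i> * (q - t) * of_int M - \<i> / (8 * pi * \<tau>) * (x - 4 * pi * of_int M - p + s + pi)^2)
         * exp (\<i> * of_int M * y))"
  for \<tau> :: complex and p q s t x y :: real

definition phi12 :: "complex \<Rightarrow> real \<Rightarrow> real \<Rightarrow> real \<Rightarrow> real \<Rightarrow> (int \<Rightarrow> real \<Rightarrow> complex) \<Rightarrow> real \<Rightarrow> real \<Rightarrow> complex" where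
  "phi12 \<tau> p q s t \<theta> x y =
     (cnj \<tau> - \<tau>) / (2 * \<tau>) * \<i> * exp (- (\<i> / (4 * pi)) * (q - t + pi) * x - \<i> / (8 * pi * \<tau>) * (p - s + pi)^2) *
     (\<Sum>\<^sub>\<infinity>N\<in>(UNIV::int set). (\<Sum>\<^sub>\<infinity>H\<in>(UNIV::int set).
         (-1) powi (N + H) * exp (- \<i> * (q - t) * of_int N - pi * \<i> / \<tau> * (of_int H - 2 * of_int N + 1/2)^2) * \<theta> H x
         * exp (\<i> / (8 * pi * \<tau>) * (x + 4 * pi * of_int N - p + s - pi)^2) * exp (\<i> * of_int N * y)))"
  for \<tau> :: complex and p q s t x y :: real

definition phi21 :: "complex \<Rightarrow> real \<Rightarrow> real \<Rightarrow> real \<Rightarrow> real \<Rightarrow> real \<Rightarrow> real \<Rightarrow> complex" where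
  "phi21 \<tau> p q s t x y =
     \<i> * exp (\<i> / (4 * pi) * (q - t - pi) * x + \<i> / 2 * y + \<i> / (8 * pi * \<tau>) * (p - s - pi)^2 - \<i> / 2 * (q - t)) *
     (\<Sum>\<^sub>\<infinity>P\<in>(UNIV::int set).
         (-1) powi P * exp (- \<i> * (q - t) * of_int P - \<i> / (8 * pi * \<tau>) * (x - 4 * pi * of_int P - p + s - pi)^2)
         * exp (\<i> * of_int P * y))"
  for \<tau> :: complex and p q s t x y :: real

definition phi22 :: "complex \<Rightarrow> real \<Rightarrow> real \<Rightarrow> real \<Rightarrow> real \<Rightarrow> (int \<Rightarrow> real \<Rightarrow> complex) \<Rightarrow> real \<Rightarrow> real \<Rightarrow> complex" where
  "phi22 \<tau> p q s t \<theta> x y =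
     - ((cnj \<tau> - \<tau>) / (2 * \<tau>)) * exp (- (\<i> / (4 * pi)) * (q - t + pi) * x + \<i> / 2 * y - \<i> / (8 * pi * \<tau>) * (p - s + pi)^2 - \<i> / 2 * (q - t)) *
     (\<Sum>\<^sub>\<infinity>R\<in>(UNIV::int set). (\<Sum>\<^sub>\<infinity>H\<in>(UNIV::int set).
         (-1) powi (R + H) * exp (- \<i> * (q - t) * of_int R - pi * \<i> / \<tau> * (of_int H - 2 * of_int R - 1/2)^2) * \<theta> H x
         * exp (\<i> / (8 * pi * \<tau>) * (x + 4 * pi * of_int R - p + s + pi)^2) * exp (\<i> * of_int R * y)))"
  for \<tau> :: complex and p q s t x y :: real

definition phi ::
  "complex \<Rightarrow> real \<Rightarrow> real \<Rightarrow> real \<Rightarrow> real \<Rightarrow> (real \<Rightarrow> real) \<Rightarrow> complex \<Rightarrow> real \<Rightarrow> real \<Rightarrow> complex^2^2" where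
  "phi \<tau> p q s t \<rho> \<kappa> x y =
     (let \<theta> = theta_H \<tau> p q s t \<rho> \<kappa> in
      mat22 (phi11 \<tau> p q s t x y) (phi12 \<tau> p q s t \<theta> x y)
            (phi21 \<tau> p q s t x y) (phi22 \<tau> p q s t \<theta> x y))"

definition c_const :: "complex \<Rightarrow> complex" where
  "c_const \<tau> = (cnj \<tau> - \<tau>) / (4 * \<tau>) * \<i> *
     (\<Sum>\<^sub>\<infinity>l\<in>(UNIV::int set). (-1) powi l * of_int (2 * l + 1) * exp (- (pi * \<i> / \<tau>) * (of_int l + 1/2)^2))"

end

theory Submission
  imports Defs "HOL-Probability.Sinc_Integral"
begin

text \<open>
  Expanding in Fourier series in $y$ identifies the bundle maps between line bundles of relative degree
  $\pm 1$ with Schwartz functions on the line (via the Zak transform), and the operators with first order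
  ordinary differential equations whose homogeneous solutions are Gaussians.

  A holomorphic map from the rank two bundle to the cone has theta functions as its second row, while its
  first row solves an inhomogeneous equation with right hand side $\tilde\psi$ times the second row.  The
  Gaussian prefactor of a solution grows, but it is multiplied by an alternating theta-like sum of
  translates of $\theta_\varepsilon$, which tends to 0 at both ends because $\sum_n (-1)^n
  e^{-\pi i (n - 1/2)^2/\tau} = 0$.  All Fourier coefficients of the determinant but one vanish for the
  same kind of reason, and the remaining one is $c_\tau$ times an exponential.  Hence $\tilde\phi$ is
  invertible, its inverse being the adjugate over the determinant, as soon as $c_\tau \neq 0$; this is
  Jacobi's identity $\sum_{m \ge 0} (-1)^m (2m+1) Q^{m(m+1)/2} = \prod_{n \ge 1} (1 - Q^n)^3$.

  For an arbitrary cocycle, the zero mode takes the role of $\psi_0$.  If its weighted integral vanishes, the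
  ordinary differential equation for a primitive has a decaying solution and the class is trivial;
  otherwise the cocycle can be normalized by rescaling.  Translating $\eta$ by the lattice amounts to a
  character times one of the constant matrices that normalize the transition matrices.
\<close>

section \<open>Calculus of smooth functions on the plane\<close>

text \<open>The obstacle is that the double series of the first row converge only as iterated sums,
  since \<open>\<theta>\<close> tends to 1 at one end; no interchange of their sums is available.
  Two devices avoid it. Recentring the inner index by twice the outer one turns the inner sums into
  translates of one function \<open>Theta\<close>. And the determinant is computed from the
  differences of consecutive values of \<open>Theta\<close>, where only differences of
  \<open>\<theta>\<close> enter, which decay at both ends. The decay of \<open>Theta\<close> is
  bootstrapped. At first it is only known to tend to 0; the differential equation then makes its
  product \<open>kk\<close> with a growing Gaussian a Schwartz function, so \<open>Theta\<close>
  itself is bounded by a decaying Gaussian, as the exponentially twisted lattice sums require. The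
  constants are forced: the prescribed value of the weighted integral leaves the bare phase
  \<open>\<i>\<close> in \<open>kernel_identity\<close>, and the prefactor of the first row makes
  the source exactly minus the cocycle times the second row. A smooth inverse of a holomorphic map
  is holomorphic, so the operator identity is checked in one direction only.\<close>

definition has_partials ::
  "(real \<Rightarrow> real \<Rightarrow> 'a::real_normed_vector) \<Rightarrow> (real \<Rightarrow> real \<Rightarrow> 'a) \<Rightarrow> (real \<Rightarrow> real \<Rightarrow> 'a) \<Rightarrow> bool" where
  "has_partials f fx fy \<longleftrightarrow>
     (\<forall>x y. ((\<lambda>(u, v). f u v) has_derivative (\<lambda>(h, k). h *\<^sub>R fx x y + k *\<^sub>R fy x y)) (at (x, y)))"

lemma has_partialsD_x:
  assumes "has_partials f fx fy"
  shows "((\<lambda>u. f u y) has_vector_derivative fx x y) (at x)"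
proof -
  have 1: "((\<lambda>(u, v). f u v) has_derivative (\<lambda>(h, k). h *\<^sub>R fx x y + k *\<^sub>R fy x y)) (at (x, y))"
    using assms by (simp add: has_partials_def)
  have 2: "((\<lambda>u::real. (u, y)) has_derivative (\<lambda>h. (h, 0))) (at x)"
    by (auto intro!: derivative_eq_intros)
  show ?thesis
    using has_derivative_compose[OF 2 1] by (simp add: has_vector_derivative_def)
qed

lemma has_partialsD_y:
  assumes "has_partials f fx fy"
  shows "((\<lambda>v. f x v) has_vector_derivative fy x y) (at y)"
proof -
  have 1: "((\<lambda>(u, v). f u v) has_derivative (\<lambda>(h, k). h *\<^sub>R fx x y + k *\<^sub>R fy x y)) (at (x, y))"
    using assms by (simp add: has_partials_def)
  have 2: "((\<lambda>v::real. (x, v)) has_derivative (\<lambda>h. (0, h))) (at y)"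
    by (auto intro!: derivative_eq_intros)
  show ?thesis
    using has_derivative_compose[OF 2 1] by (simp add: has_vector_derivative_def)
qed

lemma has_partials_partial_x: "has_partials f fx fy \<Longrightarrow> partial_x f = fx"
  unfolding partial_x_def fun_eq_iff by (blast intro: vector_derivative_at has_partialsD_x)

lemma has_partials_partial_y: "has_partials f fx fy \<Longrightarrow> partial_y f = fy"
  unfolding partial_y_def fun_eq_iff by (blast intro: vector_derivative_at has_partialsD_y)

lemma differentiable_imp_has_partials:
  assumes "\<forall>w. (\<lambda>(x, y). f x y) differentiable (at w)"
  shows "has_partials f (partial_x f) (partial_y f)"
  unfolding has_partials_def
proof (intro allI)
  fix x y
  obtain D where D: "((\<lambda>(x, y). f x y) has_derivative D) (at (x, y))"
    using assms unfolding differentiable_def by blast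
  interpret D: bounded_linear D using D by (rule has_derivative_bounded_linear)
  have "((\<lambda>u::real. (u, y)) has_derivative (\<lambda>h. (h, 0))) (at x)"
    by (auto intro!: derivative_eq_intros)
  from has_derivative_compose[OF this D]
  have "((\<lambda>u. f u y) has_derivative (\<lambda>h. D (h, 0))) (at x)"
    by simp
  then have "((\<lambda>u. f u y) has_vector_derivative D (1, 0)) (at x)"
    unfolding has_vector_derivative_def
    by (rule has_derivative_eq_rhs) (simp add: fun_eq_iff D.scaleR[symmetric])
  then have x: "partial_x f x y = D (1, 0)" unfolding partial_x_def by (rule vector_derivative_at)
  have "((\<lambda>v::real. (x, v)) has_derivative (\<lambda>h. (0, h))) (at y)"
    by (auto intro!: derivative_eq_intros)
  from has_derivative_compose[OF this D]
  have "((\<lambda>v. f x v) has_derivative (\<lambda>h. D (0, h))) (at y)"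
    by simp
  then have "((\<lambda>v. f x v) has_vector_derivative D (0, 1)) (at y)"
    unfolding has_vector_derivative_def
    by (rule has_derivative_eq_rhs) (simp add: fun_eq_iff D.scaleR[symmetric])
  then have y: "partial_y f x y = D (0, 1)" unfolding partial_y_def by (rule vector_derivative_at)
  show "((\<lambda>(x, y). f x y) has_derivative (\<lambda>(h, k). h *\<^sub>R partial_x f x y + k *\<^sub>R partial_y f x y)) (at (x, y))"
    using D
    by (rule has_derivative_eq_rhs) (simp add: fun_eq_iff x y D.scaleR[symmetric] D.add[symmetric])
qed

lemma has_partials_imp_differentiable: "has_partials f fx fy \<Longrightarrow> (\<lambda>(x, y). f x y) differentiable (at w)"
  unfolding has_partials_def differentiable_def by (cases w) blast

lemma has_partials_imp_continuous: "has_partials f fx fy \<Longrightarrow> continuous_on UNIV (\<lambda>(x, y). f x y)"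
  by (intro differentiable_imp_continuous_on)
    (simp add: differentiable_on_def has_partials_imp_differentiable)

lemma C_diff_SucI: "has_partials f fx fy \<Longrightarrow> C_diff k fx \<Longrightarrow> C_diff k fy \<Longrightarrow> C_diff (Suc k) f"
  by (simp add: has_partials_partial_x has_partials_partial_y has_partials_imp_differentiable)

lemma C_diff_SucE:
  assumes "C_diff (Suc k) f"
  obtains fx fy where "has_partials f fx fy" "C_diff k fx" "C_diff k fy"
  using assms differentiable_imp_has_partials[of f] by simp

lemma C_diff_Suc_imp: "C_diff (Suc k) f \<Longrightarrow> C_diff k f"
proof (induction k arbitrary: f)
  case 0
  then show ?case using has_partials_imp_continuous by (metis C_diff.simps(1) C_diff_SucE)
next
  case (Suc k)
  from Suc.prems show ?case
    by (rule C_diff_SucE) (blast intro: C_diff_SucI Suc.IH)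
qed

lemma smooth_has_partials: "smooth f \<Longrightarrow> has_partials f (partial_x f) (partial_y f)"
  unfolding smooth_def by (metis C_diff.simps(2) differentiable_imp_has_partials)

lemma smooth_partial_x: "smooth f \<Longrightarrow> smooth (partial_x f)"
  and smooth_partial_y: "smooth f \<Longrightarrow> smooth (partial_y f)"
  unfolding smooth_def by (metis C_diff.simps(2))+

lemma smooth_continuous: "smooth f \<Longrightarrow> continuous_on UNIV (\<lambda>(x, y). f x y)"
  unfolding smooth_def by (metis C_diff.simps(1))

text \<open>Induction on the order of differentiability, for all members of \<open>F\<close> at
  once. A family closed under both partial derivatives is thereby smooth without any count of
  orders; \<open>has_partials\<close> supplies total differentiability together with explicit
  partials.\<close>

lemma smooth_coinduct:
  assumes "f \<in> F"
    and step: "\<And>f. f \<in> F \<Longrightarrow> \<exists>fx\<in>F. \<exists>fy\<in>F. has_partials f fx fy"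
  shows "smooth f"
proof -
  have "\<forall>f\<in>F. C_diff k f" for k
  proof (induction k)
    case 0
    then show ?case using step by (auto dest!: has_partials_imp_continuous)
  next
    case (Suc k)
    then show ?case using step by (blast intro: C_diff_SucI)
  qed
  with assms(1) show ?thesis by (simp add: smooth_def)
qed

lemma has_partials_bounded_bilinear:
  assumes "bounded_bilinear b" "has_partials f fx fy" "has_partials g gx gy"
  shows "has_partials (\<lambda>x y. b (f x y) (g x y))
     (\<lambda>x y. b (f x y) (gx x y) + b (fx x y) (g x y)) (\<lambda>x y. b (f x y) (gy x y) + b (fy x y) (g x y))"
  unfolding has_partials_def
proof (intro allI)
  fix x y
  interpret b: bounded_bilinear b by fact
  show "((\<lambda>(u, v). b (f u v) (g u v)) has_derivative
     (\<lambda>(h, k). h *\<^sub>R (b (f x y) (gx x y) + b (fx x y) (g x y)) + k *\<^sub>R (b (f x y) (gy x y) + b (fy x y) (g x y)))) (at (x, y))"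
    using b.FDERIV[OF assms(2)[unfolded has_partials_def, rule_format, of x y]
        assms(3)[unfolded has_partials_def, rule_format, of x y]]
    by (simp add: case_prod_unfold b.add_left b.add_right b.scaleR_left b.scaleR_right algebra_simps)
qed

lemma has_partials_add:
  "has_partials f fx fy \<Longrightarrow> has_partials g gx gy \<Longrightarrow>
     has_partials (\<lambda>x y. f x y + g x y) (\<lambda>x y. fx x y + gx x y) (\<lambda>x y. fy x y + gy x y)"
  unfolding has_partials_def
proof (intro allI)
  fix x y
  assume "\<forall>x y. ((\<lambda>(u, v). f u v) has_derivative (\<lambda>(h, k). h *\<^sub>R fx x y + k *\<^sub>R fy x y)) (at (x, y))"
    and "\<forall>x y. ((\<lambda>(u, v). g u v) has_derivative (\<lambda>(h, k). h *\<^sub>R gx x y + k *\<^sub>R gy x y)) (at (x, y))"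
  from has_derivative_add[OF this[rule_format, of x y]]
  show "((\<lambda>(u, v). f u v + g u v) has_derivative
     (\<lambda>(h, k). h *\<^sub>R (fx x y + gx x y) + k *\<^sub>R (fy x y + gy x y))) (at (x, y))"
    by (simp add: case_prod_unfold algebra_simps)
qed

lemma has_partials_bounded_linear:
  assumes "bounded_linear L" "has_partials f fx fy"
  shows "has_partials (\<lambda>x y. L (f x y)) (\<lambda>x y. L (fx x y)) (\<lambda>x y. L (fy x y))"
  unfolding has_partials_def
proof (intro allI)
  fix x y
  interpret L: bounded_linear L by fact
  show "((\<lambda>(u, v). L (f u v)) has_derivative (\<lambda>(h, k). h *\<^sub>R L (fx x y) + k *\<^sub>R L (fy x y))) (at (x, y))"
    using L.has_derivative[OF assms(2)[unfolded has_partials_def, rule_format, of x y]]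
    by (simp add: case_prod_unfold L.add L.scaleR)
qed

lemma has_partials_const: "has_partials (\<lambda>x y. c) (\<lambda>x y. 0) (\<lambda>x y. 0)"
  by (simp add: has_partials_def case_prod_unfold)

lemma C_diff_add: "C_diff k f \<Longrightarrow> C_diff k g \<Longrightarrow> C_diff k (\<lambda>x y. f x y + g x y)"
proof (induction k arbitrary: f g)
  case 0
  then show ?case by (auto simp: case_prod_beta intro!: continuous_intros)
next
  case (Suc k)
  from Suc.prems(1) obtain fx fy where f: "has_partials f fx fy" "C_diff k fx" "C_diff k fy"
    by (rule C_diff_SucE)
  from Suc.prems(2) obtain gx gy where g: "has_partials g gx gy" "C_diff k gx" "C_diff k gy"
    by (rule C_diff_SucE)
  show ?case by (rule C_diff_SucI[OF has_partials_add[OF f(1) g(1)]]) (intro Suc.IH f g)+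
qed

lemma smooth_add: "smooth f \<Longrightarrow> smooth g \<Longrightarrow> smooth (\<lambda>x y. f x y + g x y)"
  unfolding smooth_def by (blast intro: C_diff_add)

lemma C_diff_bounded_bilinear:
  assumes "bounded_bilinear b"
  shows "C_diff k f \<Longrightarrow> C_diff k g \<Longrightarrow> C_diff k (\<lambda>x y. b (f x y) (g x y))"
proof (induction k arbitrary: f g)
  case 0
  interpret b: bounded_bilinear b by fact
  from 0 show ?case
    using b.continuous_on[of UNIV "\<lambda>(x, y). f x y" "\<lambda>(x, y). g x y"] by (auto simp: case_prod_beta)
next
  case (Suc k)
  from Suc.prems(1) obtain fx fy where f: "has_partials f fx fy" "C_diff k fx" "C_diff k fy"
    by (rule C_diff_SucE)
  from Suc.prems(2) obtain gx gy where g: "has_partials g gx gy" "C_diff k gx" "C_diff k gy"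
    by (rule C_diff_SucE)
  \<comment> \<open>The product rule pairs each function with a partial of the other, so the
    induction hypothesis is needed for \<open>f\<close> and \<open>g\<close> themselves as
    well.\<close>
  have "C_diff k f" "C_diff k g" using Suc.prems by (blast intro: C_diff_Suc_imp)+
  then show ?case
    by (intro C_diff_SucI[OF has_partials_bounded_bilinear[OF assms f(1) g(1)]] C_diff_add Suc.IH f g)
qed

lemma smooth_bounded_bilinear:
  "bounded_bilinear b \<Longrightarrow> smooth f \<Longrightarrow> smooth g \<Longrightarrow> smooth (\<lambda>x y. b (f x y) (g x y))"
  unfolding smooth_def by (blast intro: C_diff_bounded_bilinear)

lemma smooth_mult:
  "smooth f \<Longrightarrow> smooth g \<Longrightarrow> smooth (\<lambda>x y. f x y * (g x y :: 'a::real_normed_algebra))"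
  by (rule smooth_bounded_bilinear[OF bounded_bilinear_mult])

lemma smooth_const: "smooth (\<lambda>x y. c)"
  by (rule smooth_coinduct[where F = "range (\<lambda>c x y. c)"]) (auto intro: has_partials_const)

lemma smooth_bounded_linear:
  assumes "bounded_linear L" "smooth f"
  shows "smooth (\<lambda>x y. L (f x y))"
proof (rule smooth_coinduct[where F = "{\<lambda>x y. L (f x y) |f. smooth f}"])
  show "(\<lambda>x y. L (f x y)) \<in> {\<lambda>x y. L (f x y) |f. smooth f}" using assms(2) by blast
  fix g assume "g \<in> {\<lambda>x y. L (f x y) |f. smooth f}"
  then obtain f where f: "smooth f" "g = (\<lambda>x y. L (f x y))" by blast
  then show "\<exists>fx\<in>{\<lambda>x y. L (f x y) |f. smooth f}. \<exists>fy\<in>{\<lambda>x y. L (f x y) |f. smooth f}. has_partials g fx fy"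
    using has_partials_bounded_linear[OF assms(1) smooth_has_partials[OF f(1)]]
      smooth_partial_x[OF f(1)] smooth_partial_y[OF f(1)] by blast
qed

lemma smooth_sum: "(\<And>i. i \<in> I \<Longrightarrow> smooth (f i)) \<Longrightarrow> smooth (\<lambda>x y. \<Sum>i\<in>I. f i x y)"
  by (induction I rule: infinite_finite_induct) (auto intro: smooth_add smooth_const)

lemma bounded_linear_axis: "bounded_linear (axis i :: 'a::real_normed_vector \<Rightarrow> 'a^'n::finite)"
  by (rule bounded_linear_intro[where K = 1])
    (auto simp: vec_eq_iff axis_def norm_vec_def L2_set_def if_distrib[of "\<lambda>z. (norm z)\<^sup>2"] cong: if_cong)

lemma smooth_vecI:
  fixes f :: "real \<Rightarrow> real \<Rightarrow> 'a::real_normed_vector^'n::finite"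
  assumes "\<And>i. smooth (\<lambda>x y. f x y $ i)"
  shows "smooth f"
proof -
  have "f = (\<lambda>x y. \<Sum>i\<in>UNIV. axis i (f x y $ i))"
    by (simp add: fun_eq_iff vec_eq_iff sum_component axis_def if_distrib cong: if_cong)
  moreover have "smooth (\<lambda>x y. \<Sum>i\<in>UNIV. axis i (f x y $ i))"
    by (intro smooth_sum smooth_bounded_linear[OF bounded_linear_axis] assms)
  ultimately show ?thesis by simp
qed

lemma smooth_vec_nth: "smooth f \<Longrightarrow> smooth (\<lambda>x y. f x y $ i)"
  by (rule smooth_bounded_linear[OF bounded_linear_vec_nth])

lemma partial_vec_nth:
  assumes "smooth f"
  shows "partial_x (\<lambda>x y. f x y $ i) = (\<lambda>x y. partial_x f x y $ i)"
    and "partial_y (\<lambda>x y. f x y $ i) = (\<lambda>x y. partial_y f x y $ i)"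
  using has_partials_bounded_linear[OF bounded_linear_vec_nth smooth_has_partials[OF assms], of i]
  by (simp_all add: has_partials_partial_x has_partials_partial_y)

lemma partial_mult:
  fixes f g :: "real \<Rightarrow> real \<Rightarrow> 'a::real_normed_algebra"
  assumes "smooth f" "smooth g"
  shows "partial_x (\<lambda>x y. f x y * g x y) = (\<lambda>x y. f x y * partial_x g x y + partial_x f x y * g x y)"
    and "partial_y (\<lambda>x y. f x y * g x y) = (\<lambda>x y. f x y * partial_y g x y + partial_y f x y * g x y)"
  using has_partials_bounded_bilinear[OF bounded_bilinear_mult smooth_has_partials[OF assms(1)] smooth_has_partials[OF assms(2)]]
  by (simp_all add: has_partials_partial_x has_partials_partial_y)

lemma partial_sum:
  assumes "\<And>i. i \<in> I \<Longrightarrow> smooth (f i)" "finite I"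
  shows "partial_x (\<lambda>x y. \<Sum>i\<in>I. f i x y) = (\<lambda>x y. \<Sum>i\<in>I. partial_x (f i) x y)"
    and "partial_y (\<lambda>x y. \<Sum>i\<in>I. f i x y) = (\<lambda>x y. \<Sum>i\<in>I. partial_y (f i) x y)"
proof -
  have "has_partials (\<lambda>x y. \<Sum>i\<in>I. f i x y) (\<lambda>x y. \<Sum>i\<in>I. partial_x (f i) x y) (\<lambda>x y. \<Sum>i\<in>I. partial_y (f i) x y)"
    using assms(2,1)
  proof (induction I)
    case empty
    then show ?case by (simp add: has_partials_const)
  next
    case (insert i I)
    then show ?case by (simp add: has_partials_add smooth_has_partials)
  qed
  then show "partial_x (\<lambda>x y. \<Sum>i\<in>I. f i x y) = (\<lambda>x y. \<Sum>i\<in>I. partial_x (f i) x y)"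
    and "partial_y (\<lambda>x y. \<Sum>i\<in>I. f i x y) = (\<lambda>x y. \<Sum>i\<in>I. partial_y (f i) x y)"
    by (simp_all add: has_partials_partial_x has_partials_partial_y)
qed

text \<open>The free factor \<open>d\<close> makes the family closed under both partials, which the
  coinduction in \<open>smooth_exp_affine\<close> needs.\<close>

lemma has_partials_exp_affine:
  fixes a b c :: complex
  shows "has_partials (\<lambda>x y. d * exp (a * of_real x + b * of_real y + c))
     (\<lambda>x y. (d * a) * exp (a * of_real x + b * of_real y + c)) (\<lambda>x y. (d * b) * exp (a * of_real x + b * of_real y + c))"
  unfolding has_partials_def
proof (intro allI)
  fix x y :: real
  have 1: "((\<lambda>z::real \<times> real. a * of_real (fst z) + b * of_real (snd z) + c) has_derivative
      (\<lambda>z. a * of_real (fst z) + b * of_real (snd z))) (at (x, y))"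
    by (auto intro!: derivative_eq_intros)
  have 2: "((\<lambda>w. d * exp w) has_derivative (\<lambda>h. d * exp (a * of_real x + b * of_real y + c) * h))
      (at (a * of_real (fst (x, y)) + b * of_real (snd (x, y)) + c))"
    unfolding has_field_derivative_def[symmetric] by (auto intro!: derivative_eq_intros)
  show "((\<lambda>(u, v). d * exp (a * complex_of_real u + b * complex_of_real v + c)) has_derivative
     (\<lambda>(h, k). h *\<^sub>R (d * a * exp (a * complex_of_real x + b * complex_of_real y + c)) +
          k *\<^sub>R (d * b * exp (a * complex_of_real x + b * complex_of_real y + c)))) (at (x, y))"
    using has_derivative_compose[OF 1 2]
    by (simp add: case_prod_unfold scaleR_conv_of_real algebra_simps)
qed

lemma smooth_exp_affine:
  fixes a b c :: complex
  shows "smooth (\<lambda>x y. exp (a * of_real x + b * of_real y + c))"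
proof -
  let ?F = "{\<lambda>x y. d * exp (a * of_real x + b * of_real y + c) |d. True}"
  have "smooth (\<lambda>x y. 1 * exp (a * of_real x + b * of_real y + c))"
    by (rule smooth_coinduct[where F = ?F]) (blast, use has_partials_exp_affine in blast)
  then show ?thesis by simp
qed

lemma partial_exp_affine:
  fixes a b c :: complex
  shows "partial_x (\<lambda>x y. exp (a * of_real x + b * of_real y + c)) =
      (\<lambda>x y. a * exp (a * of_real x + b * of_real y + c))"
    and "partial_y (\<lambda>x y. exp (a * of_real x + b * of_real y + c)) =
      (\<lambda>x y. b * exp (a * of_real x + b * of_real y + c))"
  using has_partials_exp_affine[of 1 a b c] by (simp_all add: has_partials_partial_x has_partials_partial_y)

section \<open>Series indexed by the integers\<close>

text \<open>Transfers unordered sums over the integers to ordinary series through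
  \<open>int_decode\<close>, where termwise differentiation and Tannery's theorem are
  stated.\<close>

lemma has_sum_int_imp_sums:
  assumes "(f has_sum s) (UNIV :: int set)"
  shows "(\<lambda>n. f (int_decode n)) sums s"
  using assms has_sum_reindex_bij_betw[OF bij_int_decode, of f s] by (intro has_sum_imp_sums) simp

lemma infsum_int_shift: "(\<Sum>\<^sub>\<infinity>n. f (n + m)) = (\<Sum>\<^sub>\<infinity>n::int. f n)"
  by (rule infsum_reindex_bij_betw) (rule bij_plus_right)

lemma summable_int_inverse_square: "(\<lambda>n::int. 1 / (1 + \<bar>real_of_int n\<bar>)\<^sup>2) summable_on UNIV"
proof -
  have "summable (\<lambda>n. 1 / (real (Suc n))\<^sup>2)"
    using inverse_power_summable[of 2, where 'a = real] summable_Suc_iff[of "\<lambda>n. 1 / (real n)\<^sup>2"]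
    by (simp add: inverse_eq_divide power_one_over)
  then have s: "(\<lambda>n. 1 / (real (Suc n))\<^sup>2) summable_on UNIV"
    by (subst summable_on_UNIV_nonneg_real_iff) auto
  have 1: "(\<lambda>n::int. 1 / (1 + \<bar>real_of_int n\<bar>)\<^sup>2) summable_on range int"
    by (subst summable_on_reindex) (use s in \<open>auto simp: o_def add.commute\<close>)
  have 2: "(\<lambda>n::int. 1 / (1 + \<bar>real_of_int n\<bar>)\<^sup>2) summable_on range (\<lambda>n. - int n)"
    by (subst summable_on_reindex) (use s in \<open>auto simp: o_def add.commute inj_on_def\<close>)
  have "(UNIV::int set) = range int \<union> range (\<lambda>n. - int n)"
    by (auto simp: image_iff) (metis int_cases2)
  with summable_on_union[OF 1 2] show ?thesis by simp
qed

lemma summable_int_quadratic_bound: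
  fixes f :: "int \<Rightarrow> 'b::banach"
  assumes "\<And>n. norm (f n) \<le> C / (1 + \<bar>real_of_int n\<bar>)\<^sup>2"
  shows "(\<lambda>n. norm (f n)) summable_on UNIV"
proof (rule summable_on_comparison_test)
  show "(\<lambda>n::int. C * (1 / (1 + \<bar>real_of_int n\<bar>)\<^sup>2)) summable_on UNIV"
    by (intro summable_on_cmult_right summable_int_inverse_square)
qed (use assms in auto)

text \<open>A Weierstrass test for derivatives: the summable bound \<open>B\<close> on the operator
  norms makes the differentiated series converge uniformly on \<open>S\<close>.\<close>

lemma has_derivative_infsum_int:
  fixes f :: "int \<Rightarrow> 'a::real_normed_vector \<Rightarrow> 'b::banach" and B :: "int \<Rightarrow> real"
  assumes "convex S" "x \<in> S"
    and der: "\<And>n x. x \<in> S \<Longrightarrow> (f n has_derivative f' n x) (at x within S)"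
    and bnd: "\<And>n x h. x \<in> S \<Longrightarrow> norm (f' n x h) \<le> B n * norm h"
    and B: "B summable_on UNIV"
    and sm: "\<And>x. x \<in> S \<Longrightarrow> (\<lambda>n. f n x) summable_on UNIV"
  shows "((\<lambda>x. \<Sum>\<^sub>\<infinity>n. f n x) has_derivative (\<lambda>h. \<Sum>\<^sub>\<infinity>n. f' n x h)) (at x within S)"
proof -
  have sums: "(\<lambda>n. f (int_decode n) x) sums (\<Sum>\<^sub>\<infinity>n. f n x)" if "x \<in> S" for x
    using sm[OF that] by (intro has_sum_int_imp_sums) simp
  have Bs: "(\<lambda>n. B (int_decode n)) sums (\<Sum>\<^sub>\<infinity>n. B n)"
    using B by (intro has_sum_int_imp_sums) simp
  have f's: "(\<lambda>n. f' n x h) summable_on UNIV" if "x \<in> S" for x h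
  proof (rule abs_summable_summable, rule summable_on_comparison_test)
    show "(\<lambda>n. B n * norm h) summable_on UNIV" by (intro summable_on_cmult_left B)
  qed (use bnd[OF that] in auto)
  have f'sums: "(\<lambda>n. f' (int_decode n) x h) sums (\<Sum>\<^sub>\<infinity>n. f' n x h)" if "x \<in> S" for x h
    using f's[OF that] by (intro has_sum_int_imp_sums) simp
  \<comment> \<open>The remainder of the differentiated series is controlled by the remainder of
    \<open>B\<close>, uniformly in the point.\<close>
  have tail: "norm ((\<Sum>i<n. f' (int_decode i) x h) - (\<Sum>\<^sub>\<infinity>n. f' n x h)) \<le>
      ((\<Sum>\<^sub>\<infinity>n. B n) - (\<Sum>i<n. B (int_decode i))) * norm h" if "x \<in> S" for x h and n :: nat
  proof -
    have 1: "(\<lambda>i. f' (int_decode (i + n)) x h) sums ((\<Sum>\<^sub>\<infinity>n. f' n x h) - (\<Sum>i<n. f' (int_decode i) x h))"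
      by (rule sums_split_initial_segment[OF f'sums[OF that]])
    have 2: "(\<lambda>i. B (int_decode (i + n)) * norm h) sums (((\<Sum>\<^sub>\<infinity>n. B n) - (\<Sum>i<n. B (int_decode i))) * norm h)"
      by (intro sums_mult2 sums_split_initial_segment[OF Bs])
    have 3: "norm (\<Sum>i. f' (int_decode (i + n)) x h) \<le> (\<Sum>i. B (int_decode (i + n)) * norm h)"
      by (intro norm_suminf_le bnd that sums_summable[OF 2])
    then show ?thesis
      using sums_unique[OF 1] sums_unique[OF 2] by (simp add: norm_minus_commute)
  qed
  have "\<exists>g. \<forall>x\<in>S. (\<lambda>n. f (int_decode n) x) sums (g x) \<and>
      (g has_derivative (\<lambda>h. \<Sum>\<^sub>\<infinity>n. f' n x h)) (at x within S)"
  proof (rule has_derivative_series[where f = "\<lambda>n x. f (int_decode n) x" and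
        f' = "\<lambda>n x. f' (int_decode n) x" and x = x and S = S])
    show "convex S" "x \<in> S" by fact+
    show "(\<lambda>n. f (int_decode n) x) sums (\<Sum>\<^sub>\<infinity>n. f n x)" by (rule sums[OF \<open>x \<in> S\<close>])
    show "(f (int_decode n) has_derivative f' (int_decode n) x) (at x within S)" if "x \<in> S" for n x
      using that by (rule der)
    fix e :: real assume "e > 0"
    have "(\<lambda>n. \<Sum>i<n. B (int_decode i)) \<longlonglongrightarrow> (\<Sum>\<^sub>\<infinity>n. B n)" using Bs by (simp add: sums_def)
    then have "eventually (\<lambda>n. dist (\<Sum>i<n. B (int_decode i)) (\<Sum>\<^sub>\<infinity>n. B n) < e) sequentially"
      using \<open>e > 0\<close> by (rule tendstoD)
    then show "eventually (\<lambda>n::nat. \<forall>x\<in>S. \<forall>h. norm ((\<Sum>i<n. f' (int_decode i) x h) - (\<Sum>\<^sub>\<infinity>n. f' n x h)) \<le> e * norm h) sequentially"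
    proof eventually_elim
      case (elim n)
      show ?case
      proof (intro ballI allI)
        fix x and h :: 'a assume "x \<in> S"
        have "((\<Sum>\<^sub>\<infinity>n. B n) - (\<Sum>i<n. B (int_decode i))) * norm h \<le> e * norm h"
          using elim by (intro mult_right_mono) (auto simp: dist_real_def)
        with tail[OF \<open>x \<in> S\<close>, where n = n and h = h] show "norm ((\<Sum>i<n. f' (int_decode i) x h) - (\<Sum>\<^sub>\<infinity>n. f' n x h)) \<le> e * norm h"
          by linarith
      qed
    qed
  qed
  then obtain g where g: "\<And>x. x \<in> S \<Longrightarrow> (\<lambda>n. f (int_decode n) x) sums (g x)"
    "\<And>x. x \<in> S \<Longrightarrow> (g has_derivative (\<lambda>h. \<Sum>\<^sub>\<infinity>n. f' n x h)) (at x within S)" by blast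
  have "g x = (\<Sum>\<^sub>\<infinity>n. f n x)" if "x \<in> S" for x
    using sums_unique2[OF g(1)[OF that] sums[OF that]] .
  then show ?thesis
    using g(2)[OF \<open>x \<in> S\<close>] has_derivative_transform[OF \<open>x \<in> S\<close>, of "\<lambda>x. \<Sum>\<^sub>\<infinity>n. f n x" g] by simp
qed

section \<open>Schwartz functions\<close>

definition rapid :: "(real \<Rightarrow> complex) \<Rightarrow> bool" where
  "rapid g \<longleftrightarrow> (\<forall>k::nat. \<exists>C. \<forall>x. norm (g x) * (1 + \<bar>x\<bar>) ^ k \<le> C)"

text \<open>Following the chain of derivatives gives rapid decay of every derivative. The
  coinductive form replaces the double family of seminorms: a proof only exhibits a class of rapid
  functions closed under differentiation.\<close>

coinductive schwartz :: "(real \<Rightarrow> complex) \<Rightarrow> bool" where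
  "rapid g \<Longrightarrow> (\<And>x. (g has_vector_derivative g' x) (at x)) \<Longrightarrow> schwartz g' \<Longrightarrow> schwartz g"

lemma rapidE:
  assumes "rapid g"
  obtains C where "C \<ge> 0" "\<And>x. norm (g x) * (1 + \<bar>x\<bar>) ^ k \<le> C"
proof -
  obtain C where "\<forall>x. norm (g x) * (1 + \<bar>x\<bar>) ^ k \<le> C"
    using assms unfolding rapid_def by blast
  then show ?thesis
    by (intro that[of "max C 0"]) (auto intro: le_max_iff_disj[THEN iffD2])
qed

lemma rapidI: "(\<And>k. \<exists>C. \<forall>x. norm (g x) * (1 + \<bar>x\<bar>) ^ k \<le> C) \<Longrightarrow> rapid g"
  by (simp add: rapid_def)

lemma schwartz_coinduct:
  assumes "f \<in> F"
    and "\<And>f. f \<in> F \<Longrightarrow> rapid f"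
    and "\<And>f. f \<in> F \<Longrightarrow> \<exists>f'\<in>F. \<forall>x. (f has_vector_derivative f' x) (at x)"
  shows "schwartz f"
  using assms(1)
proof (coinduction arbitrary: f rule: schwartz.coinduct)
  case schwartz
  with assms(2,3) show ?case by metis
qed

lemma schwartz_rapid: "schwartz g \<Longrightarrow> rapid g"
  by (erule schwartz.cases) simp

lemma schwartzE:
  assumes "schwartz g"
  obtains g' where "schwartz g'" "\<And>x. (g has_vector_derivative g' x) (at x)"
  using assms by (metis schwartz.cases)

lemma schwartz_continuous: "schwartz g \<Longrightarrow> continuous_on A g"
  by (metis schwartzE has_vector_derivative_continuous continuous_at_imp_continuous_on)

lemma rapid_mono:
  assumes "rapid g" "\<And>x. norm (f x) \<le> M * norm (g x)" "M \<ge> 0"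
  shows "rapid f"
proof (rule rapidI)
  fix k
  obtain C where C: "\<And>x. norm (g x) * (1 + \<bar>x\<bar>) ^ k \<le> C" using rapidE[OF assms(1)] by metis
  have "norm (f x) * (1 + \<bar>x\<bar>) ^ k \<le> M * C" for x
  proof -
    have "norm (f x) * (1 + \<bar>x\<bar>) ^ k \<le> M * norm (g x) * (1 + \<bar>x\<bar>) ^ k"
      by (intro mult_right_mono assms) auto
    also have "\<dots> \<le> M * C" using mult_left_mono[OF C assms(3)] by (simp add: mult.assoc)
    finally show ?thesis .
  qed
  then show "\<exists>C. \<forall>x. norm (f x) * (1 + \<bar>x\<bar>) ^ k \<le> C" by blast
qed

lemma rapid_add:
  assumes "rapid f" "rapid g"
  shows "rapid (\<lambda>x. f x + g x)"
proof (rule rapidI)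
  fix k
  obtain C where C: "\<And>x. norm (f x) * (1 + \<bar>x\<bar>) ^ k \<le> C" using rapidE[OF assms(1)] by metis
  obtain D where D: "\<And>x. norm (g x) * (1 + \<bar>x\<bar>) ^ k \<le> D" using rapidE[OF assms(2)] by metis
  have "norm (f x + g x) * (1 + \<bar>x\<bar>) ^ k \<le> C + D" for x
  proof -
    have "norm (f x + g x) * (1 + \<bar>x\<bar>) ^ k \<le> (norm (f x) + norm (g x)) * (1 + \<bar>x\<bar>) ^ k"
      by (intro mult_right_mono norm_triangle_ineq) auto
    then show ?thesis using C[of x] D[of x] by (simp add: distrib_right)
  qed
  then show "\<exists>C. \<forall>x. norm (f x + g x) * (1 + \<bar>x\<bar>) ^ k \<le> C" by blast
qed

lemma rapid_ident_mult:
  assumes "rapid g"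
  shows "rapid (\<lambda>x. of_real x * g x)"
proof (rule rapidI)
  fix k
  obtain C where C: "\<And>x. norm (g x) * (1 + \<bar>x\<bar>) ^ Suc k \<le> C" using rapidE[OF assms] by metis
  have "norm (of_real x * g x) * (1 + \<bar>x\<bar>) ^ k \<le> C" for x
  proof -
    have "norm (of_real x * g x) * (1 + \<bar>x\<bar>) ^ k \<le> (1 + \<bar>x\<bar>) * norm (g x) * (1 + \<bar>x\<bar>) ^ k"
      by (intro mult_right_mono) (auto simp: norm_mult mult_right_mono)
    also have "\<dots> = norm (g x) * (1 + \<bar>x\<bar>) ^ Suc k" by simp
    also have "\<dots> \<le> C" by (rule C)
    finally show ?thesis .
  qed
  then show "\<exists>C. \<forall>x. norm (of_real x * g x) * (1 + \<bar>x\<bar>) ^ k \<le> C" by blast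
qed

lemma rapid_cmult: "rapid g \<Longrightarrow> rapid (\<lambda>x. c * g x)"
  by (rule rapid_mono[of g _ "norm c"]) (auto simp: norm_mult)

text \<open>The multiplicative form of the triangle inequality, used to move polynomial weights
  between a point and its translates.\<close>

lemma one_plus_abs_le:
  fixes a b c :: real
  assumes "a \<le> \<bar>b\<bar> + \<bar>c\<bar>"
  shows "1 + a \<le> (1 + \<bar>b\<bar>) * (1 + \<bar>c\<bar>)"
proof -
  have "(1 + \<bar>b\<bar>) * (1 + \<bar>c\<bar>) = 1 + \<bar>b\<bar> + \<bar>c\<bar> + \<bar>b\<bar> * \<bar>c\<bar>" by (simp add: algebra_simps)
  moreover have "0 \<le> \<bar>b\<bar> * \<bar>c\<bar>" by simp
  ultimately show ?thesis using assms by linarith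
qed

lemma rapid_shift:
  assumes "rapid g"
  shows "rapid (\<lambda>x. g (x + c))"
proof (rule rapidI)
  fix k
  obtain C where C: "C \<ge> 0" "\<And>x. norm (g x) * (1 + \<bar>x\<bar>) ^ k \<le> C" using rapidE[OF assms] by metis
  have "norm (g (x + c)) * (1 + \<bar>x\<bar>) ^ k \<le> C * (1 + \<bar>c\<bar>) ^ k" for x
  proof -
    have "1 + \<bar>x\<bar> \<le> (1 + \<bar>x + c\<bar>) * (1 + \<bar>c\<bar>)"
      by (rule one_plus_abs_le) linarith
    then have "(1 + \<bar>x\<bar>) ^ k \<le> ((1 + \<bar>x + c\<bar>) * (1 + \<bar>c\<bar>)) ^ k" by (intro power_mono) auto
    then have "norm (g (x + c)) * (1 + \<bar>x\<bar>) ^ k \<le> norm (g (x + c)) * ((1 + \<bar>x + c\<bar>) * (1 + \<bar>c\<bar>)) ^ k"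
      by (intro mult_left_mono) auto
    also have "\<dots> = norm (g (x + c)) * (1 + \<bar>x + c\<bar>) ^ k * (1 + \<bar>c\<bar>) ^ k"
      by (simp add: power_mult_distrib mult.assoc)
    also have "\<dots> \<le> C * (1 + \<bar>c\<bar>) ^ k" by (intro mult_right_mono C) auto
    finally show ?thesis .
  qed
  then show "\<exists>C. \<forall>x. norm (g (x + c)) * (1 + \<bar>x\<bar>) ^ k \<le> C" by blast
qed

lemma schwartz_add:
  assumes "schwartz f" "schwartz g"
  shows "schwartz (\<lambda>x. f x + g x)"
proof (rule schwartz_coinduct[where F = "{\<lambda>x. f x + g x |f g. schwartz f \<and> schwartz g}"])
  fix h assume "h \<in> {\<lambda>x. f x + g x |f g. schwartz f \<and> schwartz g}"
  then obtain f g where h: "h = (\<lambda>x. f x + g x)" "schwartz f" "schwartz g" by blast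
  then show "rapid h" by (simp add: rapid_add schwartz_rapid)
  obtain f' g' where "schwartz f'" "\<And>x. (f has_vector_derivative f' x) (at x)"
    "schwartz g'" "\<And>x. (g has_vector_derivative g' x) (at x)" using h(2,3) by (metis schwartzE)
  then show "\<exists>h'\<in>{\<lambda>x. f x + g x |f g. schwartz f \<and> schwartz g}. \<forall>x. (h has_vector_derivative h' x) (at x)"
    unfolding h by (intro bexI[of _ "\<lambda>x. f' x + g' x"]) (auto intro!: has_vector_derivative_add)
qed (use assms in blast)

lemma schwartz_cmult:
  assumes "schwartz g"
  shows "schwartz (\<lambda>x. c * g x)"
proof (rule schwartz_coinduct[where F = "{\<lambda>x. c * g x |g. schwartz g}"])
  fix h assume "h \<in> {\<lambda>x. c * g x |g. schwartz g}"
  then obtain g where h: "h = (\<lambda>x. c * g x)" "schwartz g" by blast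
  then show "rapid h" by (simp add: rapid_cmult schwartz_rapid)
  obtain g' where "schwartz g'" "\<And>x. (g has_vector_derivative g' x) (at x)" using h(2) by (metis schwartzE)
  then show "\<exists>h'\<in>{\<lambda>x. c * g x |g. schwartz g}. \<forall>x. (h has_vector_derivative h' x) (at x)"
    unfolding h by (intro bexI[of _ "\<lambda>x. c * g' x"]) (auto intro!: has_vector_derivative_mult_right)
qed (use assms in blast)

lemma schwartz_shift:
  assumes "schwartz g"
  shows "schwartz (\<lambda>x. g (x + c))"
proof (rule schwartz_coinduct[where F = "{\<lambda>x. g (x + c) |g. schwartz g}"])
  fix h assume "h \<in> {\<lambda>x. g (x + c) |g. schwartz g}"
  then obtain g where h: "h = (\<lambda>x. g (x + c))" "schwartz g" by blast
  then show "rapid h" by (simp add: rapid_shift schwartz_rapid)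
  obtain g' where g': "schwartz g'" "\<And>x. (g has_vector_derivative g' x) (at x)" using h(2) by (metis schwartzE)
  have "((\<lambda>x. g (x + c)) has_vector_derivative g' (x + c)) (at x)" for x
  proof -
    have "((\<lambda>x. x + c) has_vector_derivative 1) (at x)"
      by (auto intro!: derivative_eq_intros simp flip: has_real_derivative_iff_has_vector_derivative)
    from vector_diff_chain_at[OF this g'(2)] show ?thesis by (simp add: o_def)
  qed
  moreover have "(\<lambda>x. g' (x + c)) \<in> {\<lambda>x. g (x + c) |g. schwartz g}" using g'(1) by blast
  ultimately show "\<exists>h'\<in>{\<lambda>x. g (x + c) |g. schwartz g}. \<forall>x. (h has_vector_derivative h' x) (at x)"
    unfolding h by (rule_tac bexI) auto
qed (use assms in blast)

lemma schwartz_ident_mult: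
  assumes "schwartz g"
  shows "schwartz (\<lambda>x. of_real x * g x)"
proof -
  \<comment> \<open>Differentiating \<open>x * f x\<close> leaves the extra term \<open>f x\<close>,
    so the class has to contain a Schwartz summand to be closed.\<close>
  let ?F = "{\<lambda>x. of_real x * f x + g x |f g. schwartz f \<and> schwartz g}"
  have z: "schwartz (\<lambda>x. 0)" using schwartz_cmult[OF assms, of 0] by simp
  have "schwartz (\<lambda>x. of_real x * g x + 0)"
  proof (rule schwartz_coinduct[where F = ?F])
    fix h assume "h \<in> ?F"
    then obtain f g where h: "h = (\<lambda>x. of_real x * f x + g x)" "schwartz f" "schwartz g" by blast
    then show "rapid h" by (simp add: rapid_add rapid_ident_mult schwartz_rapid)
    obtain f' g' where d: "schwartz f'" "\<And>x. (f has_vector_derivative f' x) (at x)"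
      "schwartz g'" "\<And>x. (g has_vector_derivative g' x) (at x)" using h(2,3) by (metis schwartzE)
    have "(h has_vector_derivative (of_real x * f' x + (f x + g' x))) (at x)" for x
    proof -
      have "(of_real has_vector_derivative (1::complex)) (at x)"
        by (auto intro!: derivative_eq_intros has_vector_derivative_real_field)
      from has_vector_derivative_add[OF has_vector_derivative_mult[OF this d(2)] d(4)]
      show ?thesis unfolding h by (simp add: algebra_simps)
    qed
    moreover have "(\<lambda>x. of_real x * f' x + (f x + g' x)) \<in> ?F"
      using d(1) schwartz_add[OF h(2) d(3)]
      by (intro CollectI exI[of _ f'] exI[of _ "\<lambda>x. f x + g' x"]) simp
    ultimately show "\<exists>h'\<in>?F. \<forall>x. (h has_vector_derivative h' x) (at x)" by (rule_tac bexI) auto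
  next
    have "(\<lambda>x. of_real x * f x + h x) \<in> ?F" if "schwartz f" "schwartz h" for f h
      using that by blast
    from this[OF assms z] show "(\<lambda>x. of_real x * g x + 0) \<in> ?F" .
  qed
  then show ?thesis by simp
qed

lemma schwartz_poly_mult:
  assumes "schwartz g"
  shows "schwartz (\<lambda>x. poly p (of_real x) * g x)"
proof (induction p)
  case 0
  then show ?case using schwartz_cmult[OF assms, of 0] by simp
next
  case (pCons a p)
  from schwartz_add[OF schwartz_cmult[OF assms, of a] schwartz_ident_mult[OF pCons(2)]]
  show ?case by (simp add: algebra_simps)
qed

lemma rapid_poly_mult:
  assumes "rapid g"
  shows "rapid (\<lambda>x. poly p (of_real x) * g x)"
proof (induction p)
  case 0
  then show ?case using rapid_cmult[OF assms, of 0] by simp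
next
  case (pCons a p)
  from rapid_add[OF rapid_cmult[OF assms, of a] rapid_ident_mult[OF pCons(2)]]
  show ?case by (simp add: algebra_simps)
qed

lemma power_le_fact_exp:
  fixes r :: real
  assumes "r \<ge> 0"
  shows "r ^ k \<le> fact k * exp r"
proof -
  have s: "(\<lambda>n. r ^ n /\<^sub>R fact n) sums exp r" by (rule exp_converges)
  have "(\<Sum>n\<in>{k}. r ^ n /\<^sub>R fact n) \<le> (\<Sum>n. r ^ n /\<^sub>R fact n)"
    using assms by (intro sum_le_suminf sums_summable[OF s]) auto
  then show ?thesis using sums_unique[OF s] by (simp add: field_simps)
qed

text \<open>Decay faster than every exponential. Rapid decay would not suffice later, because
  lattice sums are twisted by \<open>exp (c * of_int n)\<close> with \<open>c\<close> off the
  imaginary axis.\<close>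

definition superexp :: "(real \<Rightarrow> complex) \<Rightarrow> bool" where
  "superexp g \<longleftrightarrow> (\<forall>c. \<exists>C. \<forall>x. norm (g x) \<le> C * exp (- c * \<bar>x\<bar>))"

lemma superexp_gaussian:
  fixes \<alpha> \<beta> \<gamma> :: complex
  assumes "Re \<alpha> < 0"
  shows "superexp (\<lambda>x. exp (\<alpha> * of_real x ^ 2 + \<beta> * of_real x + \<gamma>))"
  unfolding superexp_def
proof (intro allI exI)
  fix c x :: real
  let ?B = "\<bar>Re \<beta>\<bar> + c"
  define a where "a = - Re \<alpha>"
  have a: "a > 0" using assms by (simp add: a_def)
  \<comment> \<open>Completing the square bounds the linear term by the quadratic one plus a
    constant that depends on \<open>c\<close>.\<close>
  have "0 \<le> (2 * a * \<bar>x\<bar> - ?B)\<^sup>2" by simp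
  also have "\<dots> = 4 * a * (a * x\<^sup>2) - 4 * a * (?B * \<bar>x\<bar>) + ?B\<^sup>2"
    by (simp add: power2_diff power_mult_distrib) (simp add: power2_eq_square algebra_simps)
  finally have "?B * \<bar>x\<bar> \<le> a * x\<^sup>2 + ?B\<^sup>2 / (4 * a)" using a by (simp add: field_simps)
  moreover have "Re \<beta> * x \<le> \<bar>Re \<beta>\<bar> * \<bar>x\<bar>" by (metis abs_ge_self abs_mult)
  ultimately have "Re \<alpha> * x\<^sup>2 + Re \<beta> * x + Re \<gamma> \<le> (?B\<^sup>2 / (4 * a) + Re \<gamma>) + - c * \<bar>x\<bar>"
    by (simp add: a_def algebra_simps)
  then show "norm (exp (\<alpha> * of_real x ^ 2 + \<beta> * of_real x + \<gamma>)) \<le> exp (?B\<^sup>2 / (4 * a) + Re \<gamma>) * exp (- c * \<bar>x\<bar>)"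
    unfolding exp_add[symmetric] by (simp add: power2_eq_square)
qed

lemma superexp_imp_rapid:
  assumes "superexp g"
  shows "rapid g"
proof (rule rapidI)
  fix k
  obtain C where C: "\<And>x. norm (g x) \<le> C * exp (- 1 * \<bar>x\<bar>)"
    using assms unfolding superexp_def by meson
  have "norm (g x) * (1 + \<bar>x\<bar>) ^ k \<le> C * fact k * exp 1" for x
  proof -
    have "norm (g x) * (1 + \<bar>x\<bar>) ^ k \<le> (C * exp (- 1 * \<bar>x\<bar>)) * (fact k * exp (1 + \<bar>x\<bar>))"
      by (intro mult_mono C power_le_fact_exp order.trans[OF norm_ge_zero C]) auto
    also have "\<dots> = C * fact k * exp 1" by (simp add: exp_minus exp_add field_simps)
    finally show ?thesis .
  qed
  then show "\<exists>C. \<forall>x. norm (g x) * (1 + \<bar>x\<bar>) ^ k \<le> C" by blast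
qed

lemma has_vector_derivative_exp_quadratic:
  fixes \<alpha> \<beta> \<gamma> :: complex
  shows "((\<lambda>x. exp (\<alpha> * of_real x ^ 2 + \<beta> * of_real x + \<gamma>)) has_vector_derivative
     (2 * \<alpha> * of_real x + \<beta>) * exp (\<alpha> * of_real x ^ 2 + \<beta> * of_real x + \<gamma>)) (at x)"
  by (rule has_vector_derivative_real_field)
    (auto intro!: derivative_eq_intros simp: power2_eq_square algebra_simps)

lemma has_vector_derivative_poly:
  "((\<lambda>x. poly p (of_real x :: complex)) has_vector_derivative poly (pderiv p) (of_real x)) (at x)"
  by (rule has_vector_derivative_real_field) (rule poly_DERIV)

lemma schwartz_gaussian:
  fixes \<alpha> \<beta> \<gamma> :: complex
  assumes "Re \<alpha> < 0"
  shows "schwartz (\<lambda>x. exp (\<alpha> * of_real x ^ 2 + \<beta> * of_real x + \<gamma>))"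
proof -
  define E where "E = (\<lambda>x. exp (\<alpha> * complex_of_real x ^ 2 + \<beta> * of_real x + \<gamma>))"
  have E': "(E has_vector_derivative poly [:\<beta>, 2 * \<alpha>:] (of_real x) * E x) (at x)" for x
    using has_vector_derivative_exp_quadratic[of \<alpha> \<beta> \<gamma> x] unfolding E_def by (simp add: algebra_simps)
  \<comment> \<open>Polynomials times the fixed Gaussian form the closed class.\<close>
  let ?F = "{\<lambda>x. poly p (of_real x) * E x |p. True}"
  have "schwartz (\<lambda>x. poly 1 (of_real x) * E x)"
  proof (rule schwartz_coinduct[where F = ?F])
    fix h assume "h \<in> ?F"
    then obtain p where h: "h = (\<lambda>x. poly p (of_real x) * E x)" by blast
    show "rapid h"
      unfolding h E_def by (intro rapid_poly_mult superexp_imp_rapid superexp_gaussian assms)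
    have "(h has_vector_derivative poly (p * [:\<beta>, 2 * \<alpha>:] + pderiv p) (of_real x) * E x) (at x)" for x
      using has_vector_derivative_mult[OF has_vector_derivative_poly[of p x] E'[of x]]
      unfolding h by (simp add: algebra_simps)
    moreover have "(\<lambda>x. poly (p * [:\<beta>, 2 * \<alpha>:] + pderiv p) (of_real x) * E x) \<in> ?F" by blast
    ultimately show "\<exists>h'\<in>?F. \<forall>x. (h has_vector_derivative h' x) (at x)" by (rule_tac bexI) auto
  qed blast
  then show ?thesis by (simp add: E_def)
qed

section \<open>The Zak transform\<close>

definition zak :: "real \<Rightarrow> (real \<Rightarrow> complex) \<Rightarrow> real \<Rightarrow> real \<Rightarrow> complex" where
  "zak P g x y = (\<Sum>\<^sub>\<infinity>n\<in>(UNIV::int set). g (x + P * of_int n) * exp (\<i> * of_int n * of_real y))"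

text \<open>The factor \<open>(\<i> * of_int n) ^ k\<close> is what \<open>k\<close> derivatives in
  \<open>y\<close> produce; with it the family is closed under both partials.\<close>

definition zakk :: "nat \<Rightarrow> real \<Rightarrow> (real \<Rightarrow> complex) \<Rightarrow> real \<Rightarrow> real \<Rightarrow> complex" where
  "zakk k P g x y =
     (\<Sum>\<^sub>\<infinity>n\<in>(UNIV::int set). (\<i> * of_int n) ^ k * g (x + P * of_int n) * exp (\<i> * of_int n * of_real y))"

lemma norm_exp_i_int [simp]: "norm (exp (\<i> * of_int n * complex_of_real y)) = 1"
  by simp

text \<open>Lattice points \<open>x + P * of_int n\<close> move away at least as fast as
  \<open>n\<close> when \<open>\<bar>P\<bar> \<ge> 1\<close>. Besides the \<open>k\<close> powers
  for the factor, two further powers of decay buy the summable bound, uniformly for bounded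
  \<open>x\<close>. Negative \<open>P\<close> is allowed, since \<open>-4 * pi\<close> occurs for
  the second row.\<close>

lemma rapid_lattice_bound:
  assumes "rapid g" "\<bar>P\<bar> \<ge> 1"
  obtains C where "\<And>n::int. \<And>x. \<bar>x\<bar> \<le> M \<Longrightarrow>
     \<bar>real_of_int n\<bar> ^ k * norm (g (x + P * of_int n)) \<le> C / (1 + \<bar>real_of_int n\<bar>)\<^sup>2"
proof -
  obtain C where C: "C \<ge> 0" "\<And>x. norm (g x) * (1 + \<bar>x\<bar>) ^ (k + 2) \<le> C"
    using rapidE[OF assms(1)] by metis
  have "\<bar>real_of_int n\<bar> ^ k * norm (g (x + P * of_int n)) \<le> C * (1 + M) ^ (k + 2) / (1 + \<bar>real_of_int n\<bar>)\<^sup>2"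
    if "\<bar>x\<bar> \<le> M" for n :: int and x
  proof -
    let ?n = "\<bar>real_of_int n\<bar>" and ?z = "x + P * of_int n"
    have "?n \<le> \<bar>P * of_int n\<bar>" using mult_right_mono[OF assms(2), of ?n] by (simp add: abs_mult)
    also have "\<dots> \<le> \<bar>?z\<bar> + \<bar>x\<bar>" by linarith
    finally have "1 + ?n \<le> (1 + \<bar>?z\<bar>) * (1 + \<bar>x\<bar>)"
      by (rule one_plus_abs_le)
    also have "\<dots> \<le> (1 + \<bar>?z\<bar>) * (1 + M)" using that by (intro mult_left_mono) auto
    finally have n: "1 + ?n \<le> (1 + \<bar>?z\<bar>) * (1 + M)" .
    have "?n ^ k * norm (g ?z) * (1 + ?n)\<^sup>2 \<le> (1 + ?n) ^ k * norm (g ?z) * (1 + ?n)\<^sup>2"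
      by (intro mult_right_mono power_mono) auto
    also have "\<dots> = norm (g ?z) * (1 + ?n) ^ (k + 2)" by (simp only: power_add mult.assoc mult.left_commute)
    also have "\<dots> \<le> norm (g ?z) * ((1 + \<bar>?z\<bar>) * (1 + M)) ^ (k + 2)"
      by (intro mult_left_mono power_mono n) auto
    also have "\<dots> = norm (g ?z) * (1 + \<bar>?z\<bar>) ^ (k + 2) * (1 + M) ^ (k + 2)"
      by (simp only: power_mult_distrib mult.assoc)
    also have "\<dots> \<le> C * (1 + M) ^ (k + 2)" using that by (intro mult_right_mono C) auto
    finally show ?thesis by (simp add: pos_le_divide_eq)
  qed
  then show ?thesis by (rule that)
qed

lemma rapid_lattice_summable:
  assumes "rapid g" "\<bar>P\<bar> \<ge> 1"
  shows "(\<lambda>n::int. norm (of_int n ^ k * g (x + P * of_int n))) summable_on UNIV"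
proof -
  obtain C where "\<And>n::int. \<And>u. \<bar>u\<bar> \<le> \<bar>x\<bar> \<Longrightarrow>
     \<bar>real_of_int n\<bar> ^ k * norm (g (u + P * of_int n)) \<le> C / (1 + \<bar>real_of_int n\<bar>)\<^sup>2"
    using rapid_lattice_bound[OF assms, of "\<bar>x\<bar>" k] by metis
  then show ?thesis
    by (intro summable_int_quadratic_bound[where C = C]) (simp add: norm_mult norm_power)
qed

lemma zak_summable:
  assumes "rapid g" "\<bar>P\<bar> \<ge> 1"
  shows "(\<lambda>n::int. norm ((\<i> * of_int n) ^ k * g (x + P * of_int n) * exp (\<i> * of_int n * of_real y))) summable_on UNIV"
  using rapid_lattice_summable[OF assms, of k x] by (simp add: norm_mult norm_power)

lemma zak_summable0:
  assumes "rapid g" "\<bar>P\<bar> \<ge> 1"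
  shows "(\<lambda>n::int. norm (g (x + P * of_int n) * exp (\<i> * of_int n * of_real y))) summable_on UNIV"
  using zak_summable[OF assms, of 0] by simp

lemma has_partials_zakk:
  assumes "rapid g" "rapid g'" "\<And>x. (g has_vector_derivative g' x) (at x)" "\<bar>P\<bar> \<ge> 1"
  shows "has_partials (zakk k P g) (zakk k P g') (zakk (Suc k) P g)"
  unfolding has_partials_def
proof (intro allI)
  fix x y :: real
  \<comment> \<open>The strip is bounded only in \<open>x\<close>: the modes in \<open>y\<close>
    have norm 1, so the domination is uniform in \<open>y\<close>.\<close>
  define S where "S = {-\<bar>x\<bar> - 1 <..< \<bar>x\<bar> + 1} \<times> (UNIV :: real set)"
  let ?M = "\<bar>x\<bar> + 1"
  let ?f = "\<lambda>(n::int) (u, v). (\<i> * of_int n) ^ k * g (u + P * of_int n) * exp (\<i> * of_int n * of_real v)"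
  let ?f' = "\<lambda>(n::int) (u, v) (a, b).
      a *\<^sub>R ((\<i> * of_int n) ^ k * g' (u + P * of_int n) * exp (\<i> * of_int n * of_real v)) +
      b *\<^sub>R ((\<i> * of_int n) ^ Suc k * g (u + P * of_int n) * exp (\<i> * of_int n * of_real v))"
  obtain C1 where C1: "\<And>n::int. \<And>u. \<bar>u\<bar> \<le> ?M \<Longrightarrow>
     \<bar>real_of_int n\<bar> ^ k * norm (g' (u + P * of_int n)) \<le> C1 / (1 + \<bar>real_of_int n\<bar>)\<^sup>2"
    using rapid_lattice_bound[OF assms(2,4), of ?M k] by metis
  obtain C2 where C2: "\<And>n::int. \<And>u. \<bar>u\<bar> \<le> ?M \<Longrightarrow>
     \<bar>real_of_int n\<bar> ^ Suc k * norm (g (u + P * of_int n)) \<le> C2 / (1 + \<bar>real_of_int n\<bar>)\<^sup>2"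
    using rapid_lattice_bound[OF assms(1,4), of ?M "Suc k"] by metis
  have S: "open S" "(x, y) \<in> S" "convex S"
    unfolding S_def by (auto intro!: open_Times convex_Times)
  have "((\<lambda>w. \<Sum>\<^sub>\<infinity>n. ?f n w) has_derivative (\<lambda>h. \<Sum>\<^sub>\<infinity>n. ?f' n (x, y) h)) (at (x, y) within S)"
  proof (rule has_derivative_infsum_int[OF S(3,2), where B = "\<lambda>n::int. (C1 + C2) * (1 / (1 + \<bar>real_of_int n\<bar>)\<^sup>2)"])
    fix n :: int and w :: "real \<times> real" assume "w \<in> S"
    obtain u v where w: "w = (u, v)" by (cases w)
    have gd: "((\<lambda>w. g (fst w + P * of_int n)) has_derivative (\<lambda>h. fst h *\<^sub>R g' (u + P * of_int n))) (at w)"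
    proof -
      have 1: "((\<lambda>w::real \<times> real. fst w + P * of_int n) has_derivative fst) (at w)"
        by (auto intro!: derivative_eq_intros)
      have 2: "(g has_derivative (\<lambda>h. h *\<^sub>R g' (fst w + P * of_int n))) (at (fst w + P * of_int n))"
        using assms(3) by (simp add: has_vector_derivative_def)
      from has_derivative_compose[OF 1 2] show ?thesis by (simp add: w)
    qed
    have ed: "((\<lambda>w::real \<times> real. exp (\<i> * of_int n * complex_of_real (snd w))) has_derivative
        (\<lambda>h. of_real (snd h) * (\<i> * of_int n * exp (\<i> * of_int n * of_real v)))) (at w)"
    proof -
      have 1: "((\<lambda>w::real \<times> real. \<i> * of_int n * complex_of_real (snd w)) has_derivative
          (\<lambda>h. \<i> * of_int n * of_real (snd h))) (at w)"
        by (auto intro!: derivative_eq_intros)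
      from has_derivative_compose[OF 1 DERIV_exp[THEN has_field_derivative_imp_has_derivative]]
      show ?thesis by (simp add: w algebra_simps)
    qed
    have "((\<lambda>w. (\<i> * of_int n) ^ k * g (fst w + P * of_int n) * exp (\<i> * of_int n * complex_of_real (snd w))) has_derivative
        (\<lambda>h. ?f' n w h)) (at w)"
      using has_derivative_mult[OF has_derivative_mult_right[OF gd, of "(\<i> * of_int n) ^ k"] ed]
      by (rule has_derivative_eq_rhs) (simp add: w fun_eq_iff scaleR_conv_of_real algebra_simps)
    then show "(?f n has_derivative ?f' n w) (at w within S)"
      by (auto simp: case_prod_unfold intro: has_derivative_at_withinI)
    fix h :: "real \<times> real"
    obtain a b where h: "h = (a, b)" by (cases h)
    have u: "\<bar>u\<bar> \<le> ?M" using \<open>w \<in> S\<close> by (auto simp: S_def w)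
    have ab: "\<bar>a\<bar> \<le> norm h" "\<bar>b\<bar> \<le> norm h"
      unfolding h by (metis norm_fst_le fst_conv real_norm_def, metis norm_snd_le snd_conv real_norm_def)
    have "norm (?f' n w h) \<le> \<bar>a\<bar> * (\<bar>real_of_int n\<bar> ^ k * norm (g' (u + P * of_int n))) +
        \<bar>b\<bar> * (\<bar>real_of_int n\<bar> ^ Suc k * norm (g (u + P * of_int n)))"
      unfolding w h prod.case by (rule order.trans[OF norm_triangle_ineq]) (simp add: norm_mult norm_power)
    also have "\<dots> \<le> norm h * (C1 / (1 + \<bar>real_of_int n\<bar>)\<^sup>2) + norm h * (C2 / (1 + \<bar>real_of_int n\<bar>)\<^sup>2)"
      by (intro add_mono mult_mono ab C1 C2 u) auto
    also have "\<dots> = (C1 + C2) * (1 / (1 + \<bar>real_of_int n\<bar>)\<^sup>2) * norm h"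
      by (simp add: field_simps)
    finally show "norm (?f' n w h) \<le> (C1 + C2) * (1 / (1 + \<bar>real_of_int n\<bar>)\<^sup>2) * norm h" .
  next
    show "(\<lambda>n::int. (C1 + C2) * (1 / (1 + \<bar>real_of_int n\<bar>)\<^sup>2)) summable_on UNIV"
      by (intro summable_on_cmult_right summable_int_inverse_square)
    show "(\<lambda>n. ?f n w) summable_on UNIV" for w
      using zak_summable[OF assms(1,4), of k "fst w" "snd w"]
      by (auto simp: case_prod_unfold intro: abs_summable_summable)
  qed
  then have *: "((\<lambda>w. \<Sum>\<^sub>\<infinity>n. ?f n w) has_derivative (\<lambda>h. \<Sum>\<^sub>\<infinity>n. ?f' n (x, y) h)) (at (x, y))"
    unfolding at_within_open[OF S(2,1)] .
  have "(\<Sum>\<^sub>\<infinity>n. ?f' n (x, y) (a, b)) = a *\<^sub>R zakk k P g' x y + b *\<^sub>R zakk (Suc k) P g x y" for a b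
    unfolding zakk_def prod.case
    by (intro infsumI has_sum_add has_sum_scaleR has_sum_infsum
        abs_summable_summable[OF zak_summable[OF assms(2,4)]] abs_summable_summable[OF zak_summable[OF assms(1,4)]])
  then have "(\<lambda>h. \<Sum>\<^sub>\<infinity>n. ?f' n (x, y) h) = (\<lambda>(a, b). a *\<^sub>R zakk k P g' x y + b *\<^sub>R zakk (Suc k) P g x y)"
    by (simp add: fun_eq_iff)
  with * show "((\<lambda>(u, v). zakk k P g u v) has_derivative
       (\<lambda>(a, b). a *\<^sub>R zakk k P g' x y + b *\<^sub>R zakk (Suc k) P g x y)) (at (x, y))"
    by (simp add: zakk_def case_prod_unfold)
qed

lemma zakk_0: "zakk 0 P g = zak P g"
  by (simp add: zakk_def zak_def fun_eq_iff)

lemma smooth_zak: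
  assumes "schwartz g" "\<bar>P\<bar> \<ge> 1"
  shows "smooth (zak P g)"
proof (rule smooth_coinduct[where F = "{zakk k P g |k g. schwartz g}"])
  show "zak P g \<in> {zakk k P g |k g. schwartz g}" using assms(1) by (auto simp: zakk_0[symmetric])
  fix f assume "f \<in> {zakk k P g |k g. schwartz g}"
  then obtain k g where f: "f = zakk k P g" "schwartz g" by blast
  obtain g' where "schwartz g'" "\<And>x. (g has_vector_derivative g' x) (at x)" using f(2) by (metis schwartzE)
  with has_partials_zakk[of g g' P k] assms(2) f
  show "\<exists>fx\<in>{zakk k P g |k g. schwartz g}. \<exists>fy\<in>{zakk k P g |k g. schwartz g}. has_partials f fx fy"
    by (blast intro: schwartz_rapid)
qed

lemma zak_shift_y: "zak P g x (y + 2 * pi) = zak P g x y"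
proof -
  have "exp (\<i> * of_int n * complex_of_real (y + 2 * pi)) = exp (\<i> * of_int n * of_real y)" for n
    by (simp add: exp_eq algebra_simps)
  then show ?thesis by (simp add: zak_def)
qed

lemma zak_shift_x: "zak P g (x + P) y = exp (- \<i> * of_real y) * zak P g x y"
proof -
  have "exp (- \<i> * of_real y) * zak P g x y =
      (\<Sum>\<^sub>\<infinity>n. exp (- \<i> * of_real y) * (g (x + P * of_int n) * exp (\<i> * of_int n * of_real y)))"
    by (simp add: zak_def infsum_cmult_right')
  also have "\<dots> = (\<Sum>\<^sub>\<infinity>n. exp (- \<i> * of_real y) * (g (x + P * of_int (n + 1)) * exp (\<i> * of_int (n + 1) * of_real y)))"
    by (rule infsum_int_shift[symmetric])
  also have "\<dots> = zak P g (x + P) y"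
    unfolding zak_def by (rule infsum_cong) (simp add: algebra_simps exp_add exp_minus)
  finally show ?thesis by simp
qed

lemma infsum_int_uminus: "(\<Sum>\<^sub>\<infinity>n. f (- n)) = (\<Sum>\<^sub>\<infinity>n::int. f n)"
  by (rule infsum_reindex_bij_betw) (rule bij_uminus)

lemma summable_int_uminus: "(\<lambda>n::int. f (- n)) summable_on UNIV \<longleftrightarrow> f summable_on UNIV"
  by (rule summable_on_reindex_bij_betw) (rule bij_uminus)

lemma summable_int_shift: "(\<lambda>n::int. f (n + m)) summable_on UNIV \<longleftrightarrow> f summable_on UNIV"
  by (rule summable_on_reindex_bij_betw) (rule bij_plus_right)

section \<open>Convolution of summable series\<close>

text \<open>The product family is absolutely summable on pairs, and the bijection
  \<open>(N, m)\<close> to \<open>(m, N - m)\<close> rearranges it by total degree; Fubini in both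
  coordinates gives the three claims.\<close>

lemma
  fixes f g :: "int \<Rightarrow> complex"
  assumes f: "(\<lambda>n. norm (f n)) summable_on UNIV" and g: "(\<lambda>n. norm (g n)) summable_on UNIV"
  shows convolution_summable: "(\<lambda>N. norm (\<Sum>\<^sub>\<infinity>m. f m * g (N - m))) summable_on UNIV"
    and convolution_summable_inner: "(\<lambda>m. norm (f m * g (N - m))) summable_on UNIV"
    and infsum_convolution: "(\<Sum>\<^sub>\<infinity>N. \<Sum>\<^sub>\<infinity>m. f m * g (N - m)) = (\<Sum>\<^sub>\<infinity>n. f n) * (\<Sum>\<^sub>\<infinity>n. g n)"
proof -
  let ?p = "\<lambda>(m, n). f m * g n"
  have p: "(\<lambda>w. norm (?p w)) summable_on UNIV \<times> UNIV"
    using f g by (subst Infinite_Sum.abs_summable_on_Sigma_iff)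
      (auto simp: norm_mult infsum_cmult_right' infsum_nonneg abs_of_nonneg intro!: summable_on_cmult_right summable_on_cmult_left)
  have bij: "bij_betw (\<lambda>(N, m). (m, N - m)) (UNIV \<times> UNIV) (UNIV \<times> (UNIV :: int set))"
    by (rule bij_betwI[where g = "\<lambda>(m, n). (m + n, m)"]) auto
  let ?q = "\<lambda>(N, m). f m * g (N - m)"
  have pq: "?p (case w of (N, m) \<Rightarrow> (m, N - m)) = ?q w" for w by (cases w) simp
  have q: "(\<lambda>w. norm (?q w)) summable_on UNIV \<times> UNIV"
    using summable_on_reindex_bij_betw[OF bij, of "\<lambda>w. norm (?p w)"] p unfolding pq by simp
  note q' = q[unfolded Infinite_Sum.abs_summable_on_Sigma_iff]
  show inner: "(\<lambda>m. norm (f m * g (N - m))) summable_on UNIV" for N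
    using q' by auto
  have "(\<lambda>N. \<Sum>\<^sub>\<infinity>m. norm (f m * g (N - m))) summable_on UNIV"
    using q' by (auto simp: infsum_nonneg abs_of_nonneg)
  then show "(\<lambda>N. norm (\<Sum>\<^sub>\<infinity>m. f m * g (N - m))) summable_on UNIV"
    by (rule summable_on_comparison_test) (auto intro!: norm_infsum_bound inner)
  have "(\<Sum>\<^sub>\<infinity>N. \<Sum>\<^sub>\<infinity>m. f m * g (N - m)) = infsum ?q (UNIV \<times> UNIV)"
    using infsum_Sigma'_banach[of "\<lambda>N m. f m * g (N - m)" UNIV "\<lambda>_. UNIV"] q
    by (simp add: abs_summable_summable)
  also have "\<dots> = infsum ?p (UNIV \<times> UNIV)"
    using infsum_reindex_bij_betw[OF bij, of ?p] unfolding pq .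
  also have "\<dots> = (\<Sum>\<^sub>\<infinity>m. \<Sum>\<^sub>\<infinity>n. f m * g n)"
    using infsum_Sigma'_banach[of "\<lambda>m n. f m * g n" UNIV "\<lambda>_. UNIV"] p
    by (simp add: abs_summable_summable)
  also have "\<dots> = (\<Sum>\<^sub>\<infinity>n. f n) * (\<Sum>\<^sub>\<infinity>n. g n)"
    by (simp add: infsum_cmult_right' infsum_cmult_left')
  finally show "(\<Sum>\<^sub>\<infinity>N. \<Sum>\<^sub>\<infinity>m. f m * g (N - m)) = (\<Sum>\<^sub>\<infinity>n. f n) * (\<Sum>\<^sub>\<infinity>n. g n)" .
qed

lemma fourier_series_mult:
  fixes f g :: "int \<Rightarrow> complex"
  assumes "(\<lambda>n. norm (f n)) summable_on UNIV" and "(\<lambda>n. norm (g n)) summable_on UNIV"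
  shows "(\<Sum>\<^sub>\<infinity>n. f n * exp (\<i> * of_int n * of_real y)) * (\<Sum>\<^sub>\<infinity>n. g n * exp (\<i> * of_int n * of_real y)) =
     (\<Sum>\<^sub>\<infinity>N. (\<Sum>\<^sub>\<infinity>m. f m * g (N - m)) * exp (\<i> * of_int N * of_real y))"
proof -
  let ?e = "\<lambda>n::int. exp (\<i> * of_int n * complex_of_real y)"
  have "?e m * ?e (N - m) = ?e N" for m N
    by (simp add: algebra_simps flip: exp_add)
  then have eq: "(f m * ?e m) * (g (N - m) * ?e (N - m)) = f m * g (N - m) * ?e N" for m N
    by (metis (no_types, lifting) mult.assoc mult.left_commute)
  have "(\<Sum>\<^sub>\<infinity>N. \<Sum>\<^sub>\<infinity>m. (f m * ?e m) * (g (N - m) * ?e (N - m))) =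
      (\<Sum>\<^sub>\<infinity>N. (\<Sum>\<^sub>\<infinity>m. f m * g (N - m)) * ?e N)"
    by (simp only: eq infsum_cmult_left')
  then show ?thesis
    using infsum_convolution[of "\<lambda>n. f n * ?e n" "\<lambda>n. g n * ?e n"] assms
    by (simp add: norm_mult)
qed

text \<open>Here \<open>T m\<close> is meant to be \<open>\<Sum>h. e h * a (h + m)\<close> for a sequence \<open>a\<close> that tends to 0 and 1 at the two
  ends and has differences \<open>b\<close>. Passing to differences avoids the divergent double series.\<close>

lemma theta_step_sum:
  fixes T b e :: "int \<Rightarrow> complex" and c :: complex
  assumes rel: "\<And>m. T m - T (m - 1) = (\<Sum>\<^sub>\<infinity>h. e h * b (h + m))"
    and T: "(\<lambda>m. norm (T m * exp (c * of_int m))) summable_on UNIV"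
    and b: "(\<lambda>j. norm (b j * exp (c * of_int j))) summable_on UNIV"
    and e: "(\<lambda>h. norm (e h * exp (- c * of_int h))) summable_on UNIV"
    and e0: "(\<Sum>\<^sub>\<infinity>h. e h * exp (- c * of_int h)) = 0"
  shows "(1 - exp c) * (\<Sum>\<^sub>\<infinity>m. T m * exp (c * of_int m)) = 0"
proof -
  let ?f = "\<lambda>n::int. e (- n) * exp (c * of_int n)" and ?g = "\<lambda>n::int. b n * exp (c * of_int n)"
  have f: "(\<lambda>n. norm (?f n)) summable_on UNIV"
    using e summable_int_uminus[of "\<lambda>h. norm (e h * exp (- c * of_int h))"] by simp
  have f0: "(\<Sum>\<^sub>\<infinity>n. ?f n) = 0"
    using e0 infsum_int_uminus[of "\<lambda>h. e h * exp (- c * of_int h)"] by simp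
  have Ts: "(\<lambda>m. T m * exp (c * of_int m)) summable_on UNIV" by (rule abs_summable_summable[OF T])
  have Ts': "(\<lambda>m. T (m - 1) * exp (c * of_int m)) summable_on UNIV"
  proof -
    have "(\<lambda>m::int. exp c * (T (m + - 1) * exp (c * of_int (m + - 1)))) summable_on UNIV"
      by (intro summable_on_cmult_right) (use Ts summable_int_shift[of "\<lambda>m. T m * exp (c * of_int m)" "-1"] in simp)
    then show ?thesis by (simp add: right_diff_distrib exp_diff)
  qed
  have "(\<Sum>\<^sub>\<infinity>m. T (m - 1) * exp (c * of_int m)) = (\<Sum>\<^sub>\<infinity>m. exp c * (T (m + - 1) * exp (c * of_int (m + - 1))))"
    by (simp add: right_diff_distrib exp_diff)
  also have "\<dots> = exp c * (\<Sum>\<^sub>\<infinity>m. T m * exp (c * of_int m))"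
    by (simp only: infsum_cmult_right' infsum_int_shift[of "\<lambda>m. T m * exp (c * of_int m)" "-1"])
  finally have "(1 - exp c) * (\<Sum>\<^sub>\<infinity>m. T m * exp (c * of_int m)) =
      (\<Sum>\<^sub>\<infinity>m. T m * exp (c * of_int m)) + - (\<Sum>\<^sub>\<infinity>m. T (m - 1) * exp (c * of_int m))"
    by (simp add: algebra_simps)
  also have "\<dots> = (\<Sum>\<^sub>\<infinity>m. T m * exp (c * of_int m) + - (T (m - 1) * exp (c * of_int m)))"
    using Ts Ts' by (subst infsum_add) (auto simp: infsum_uminus summable_on_uminus)
  also have "\<dots> = (\<Sum>\<^sub>\<infinity>m. (T m - T (m - 1)) * exp (c * of_int m))" by (simp add: algebra_simps)
  also have "\<dots> = (\<Sum>\<^sub>\<infinity>N. \<Sum>\<^sub>\<infinity>h. e h * b (h + N) * exp (c * of_int N))"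
    by (simp add: rel infsum_cmult_left')
  \<comment> \<open>The exponential splits along \<open>N = (h + N) - h\<close>, so the double sum
    becomes the product of the twisted sum of \<open>b\<close> and the twisted sum of the reflected
    \<open>e\<close>; the latter is 0 by \<open>e0\<close>.\<close>
  also have "\<dots> = (\<Sum>\<^sub>\<infinity>N. \<Sum>\<^sub>\<infinity>h. ?f (- h) * ?g (N - - h))"
    by (intro infsum_cong) (simp add: algebra_simps flip: exp_add)
  also have "\<dots> = (\<Sum>\<^sub>\<infinity>N. \<Sum>\<^sub>\<infinity>m. ?f m * ?g (N - m))"
    by (rule infsum_cong) (rule infsum_int_uminus[of "\<lambda>m. ?f m * ?g (N - m)" for N])
  also have "\<dots> = 0"
    using infsum_convolution[OF f b] f0 by simp
  finally show ?thesis .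
qed

text \<open>The case \<open>c = 0\<close>, where the factor \<open>1 - exp c\<close> of
  \<open>theta_step_sum\<close> carries no information. First moments replace total sums: summation
  by parts gives \<open>- (\<Sum>\<^sub>\<infinity>m. T m)\<close> as the first moment of the
  differences, and of the first moment of a convolution only one half survives because
  \<open>e\<close> sums to 0.\<close>

lemma theta_step_sum_1:
  fixes T b e :: "int \<Rightarrow> complex"
  assumes rel: "\<And>m. T m - T (m - 1) = (\<Sum>\<^sub>\<infinity>h. e h * b (h + m))"
    and T: "(\<lambda>m. norm (T m)) summable_on UNIV" "(\<lambda>m. norm (of_int m * T m)) summable_on UNIV"
    and b: "(\<lambda>j. norm (b j)) summable_on UNIV" "(\<lambda>j. norm (of_int j * b j)) summable_on UNIV"
    and e: "(\<lambda>h. norm (e h)) summable_on UNIV" "(\<lambda>h. norm (of_int h * e h)) summable_on UNIV"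
    and e0: "(\<Sum>\<^sub>\<infinity>h. e h) = 0"
  shows "(\<Sum>\<^sub>\<infinity>m. T m) = (\<Sum>\<^sub>\<infinity>h. of_int h * e h) * (\<Sum>\<^sub>\<infinity>j. b j)"
proof -
  let ?f = "\<lambda>n::int. e (- n)" and ?f' = "\<lambda>n::int. of_int n * e (- n)" and ?b' = "\<lambda>j::int. of_int j * b j"
  have f: "(\<lambda>n. norm (?f n)) summable_on UNIV"
    using e(1) summable_int_uminus[of "\<lambda>h. norm (e h)"] by simp
  have f': "(\<lambda>n. norm (?f' n)) summable_on UNIV"
    using e(2) summable_int_uminus[of "\<lambda>h. norm (of_int h * e h)"] by (simp add: norm_mult)
  have f0: "(\<Sum>\<^sub>\<infinity>n. ?f n) = 0" using e0 infsum_int_uminus[of e] by simp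
  have "- (\<Sum>\<^sub>\<infinity>n. ?f' n) = (\<Sum>\<^sub>\<infinity>h. of_int h * e h)"
    using infsum_int_uminus[of "\<lambda>h. of_int h * e h"] by (simp add: infsum_uminus)
  then have f'0: "(\<Sum>\<^sub>\<infinity>n. ?f' n) = - (\<Sum>\<^sub>\<infinity>h. of_int h * e h)"
    by (metis minus_minus)
  have Ts: "T summable_on UNIV" and Ts1: "(\<lambda>m. of_int m * T m) summable_on UNIV"
    by (rule abs_summable_summable[OF T(1)], rule abs_summable_summable[OF T(2)])
  have Ts2: "(\<lambda>m. of_int (m + 1) * T m) summable_on UNIV"
    using summable_on_add[OF Ts1 Ts] by (simp add: algebra_simps)
  then have Ts3: "(\<lambda>m. of_int m * T (m - 1)) summable_on UNIV"
    using summable_int_shift[of "\<lambda>m. of_int (m + 1) * T m" "-1"] by simp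
  have 1: "(\<Sum>\<^sub>\<infinity>m. of_int m * T (m - 1)) = (\<Sum>\<^sub>\<infinity>m. of_int (m + 1) * T m)"
    using infsum_int_shift[of "\<lambda>m. of_int (m + 1) * T m" "-1"] by simp
  have 2: "(\<Sum>\<^sub>\<infinity>m. of_int (m + 1) * T m) = (\<Sum>\<^sub>\<infinity>m. of_int m * T m) + (\<Sum>\<^sub>\<infinity>m. T m)"
    by (subst infsum_add[OF Ts1 Ts, symmetric]) (simp add: algebra_simps)
  have s1: "(\<lambda>N. \<Sum>\<^sub>\<infinity>m. ?f' m * b (N - m)) summable_on UNIV"
    and s2: "(\<lambda>N. \<Sum>\<^sub>\<infinity>m. ?f m * ?b' (N - m)) summable_on UNIV"
    by (rule abs_summable_summable[OF convolution_summable[OF f' b(1)]],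
        rule abs_summable_summable[OF convolution_summable[OF f b(2)]])
  have "- (\<Sum>\<^sub>\<infinity>m. T m) = (\<Sum>\<^sub>\<infinity>m. of_int m * T m) + - (\<Sum>\<^sub>\<infinity>m. of_int m * T (m - 1))"
    unfolding 1 2 by simp
  also have "\<dots> = (\<Sum>\<^sub>\<infinity>m. of_int m * T m + - (of_int m * T (m - 1)))"
    using Ts1 Ts3 by (subst infsum_add) (auto simp: infsum_uminus summable_on_uminus)
  also have "\<dots> = (\<Sum>\<^sub>\<infinity>N. of_int N * (T N - T (N - 1)))" by (simp add: algebra_simps)
  also have "\<dots> = (\<Sum>\<^sub>\<infinity>N. of_int N * (\<Sum>\<^sub>\<infinity>h. ?f (- h) * b (N - - h)))"
    by (simp add: rel algebra_simps)
  also have "\<dots> = (\<Sum>\<^sub>\<infinity>N. of_int N * (\<Sum>\<^sub>\<infinity>m. ?f m * b (N - m)))"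
    by (rule infsum_cong, rule arg_cong[where f = "\<lambda>w. _ * w"])
      (rule infsum_int_uminus[of "\<lambda>m. ?f m * b (N - m)" for N])
  \<comment> \<open>Leibniz rule for the first moment, from \<open>N = m + (N - m)\<close>.\<close>
  also have "\<dots> = (\<Sum>\<^sub>\<infinity>N. (\<Sum>\<^sub>\<infinity>m. ?f' m * b (N - m)) + (\<Sum>\<^sub>\<infinity>m. ?f m * ?b' (N - m)))"
  proof (rule infsum_cong)
    fix N :: int
    have "of_int N * (\<Sum>\<^sub>\<infinity>m. ?f m * b (N - m)) = (\<Sum>\<^sub>\<infinity>m. ?f' m * b (N - m) + ?f m * ?b' (N - m))"
      by (subst infsum_cmult_right'[symmetric]) (simp add: algebra_simps)
    also have "\<dots> = (\<Sum>\<^sub>\<infinity>m. ?f' m * b (N - m)) + (\<Sum>\<^sub>\<infinity>m. ?f m * ?b' (N - m))"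
      by (intro infsum_add abs_summable_summable[OF convolution_summable_inner[OF f' b(1)]]
          abs_summable_summable[OF convolution_summable_inner[OF f b(2)]])
    finally show "of_int N * (\<Sum>\<^sub>\<infinity>m. ?f m * b (N - m)) =
      (\<Sum>\<^sub>\<infinity>m. ?f' m * b (N - m)) + (\<Sum>\<^sub>\<infinity>m. ?f m * ?b' (N - m))" .
  qed
  also have "\<dots> = (\<Sum>\<^sub>\<infinity>N. \<Sum>\<^sub>\<infinity>m. ?f' m * b (N - m)) + (\<Sum>\<^sub>\<infinity>N. \<Sum>\<^sub>\<infinity>m. ?f m * ?b' (N - m))"
    by (rule infsum_add[OF s1 s2])
  also have "\<dots> = - (\<Sum>\<^sub>\<infinity>h. of_int h * e h) * (\<Sum>\<^sub>\<infinity>j. b j)"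
    unfolding infsum_convolution[OF f' b(1)] infsum_convolution[OF f b(2)] f'0 f0 by simp
  finally show ?thesis by simp
qed

section \<open>A first order equation\<close>

text \<open>As \<open>\<Theta>\<close> vanishes at infinity, its value at \<open>x\<close> is
  bounded by the tail of its derivative. The tail of a decaying Gaussian times a rapid factor is no
  larger than the integrand at \<open>x\<close>, so the growing prefactor is exactly
  compensated.\<close>

lemma rapid_ode_half_line:
  fixes \<alpha> \<beta> \<gamma> :: complex
  assumes \<alpha>: "Re \<alpha> > 0" and R: "rapid R"
    and der: "\<And>x. (\<Theta> has_vector_derivative exp (- (\<alpha> * of_real x ^ 2 + \<beta> * of_real x + \<gamma>)) * R x) (at x)"
    and lim: "(\<Theta> \<longlongrightarrow> 0) at_top"
  shows "\<exists>C. \<forall>x\<ge>0. norm (exp (\<alpha> * of_real x ^ 2 + \<beta> * of_real x + \<gamma>) * \<Theta> x) * (1 + \<bar>x\<bar>) ^ k \<le> C"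
proof -
  define q where "q = (\<lambda>x. Re \<alpha> * x\<^sup>2 + Re \<beta> * x + Re \<gamma>)"
  have nq: "norm (exp (\<alpha> * of_real x ^ 2 + \<beta> * of_real x + \<gamma>)) = exp (q x)"
    and nq': "norm (exp (- (\<alpha> * of_real x ^ 2 + \<beta> * of_real x + \<gamma>))) = exp (- q x)" for x
    by (simp_all add: q_def power2_eq_square)
  obtain C where C: "C \<ge> 0" "\<And>x. norm (R x) * (1 + \<bar>x\<bar>) ^ k \<le> C" using rapidE[OF R] by metis
  \<comment> \<open>Beyond \<open>x0\<close> the exponent \<open>q\<close> has derivative at least
    1.\<close>
  define x0 where "x0 = max 0 ((1 - Re \<beta>) / (2 * Re \<alpha>))"
  have x0: "x0 \<ge> 0" by (simp add: x0_def)
  have q': "2 * Re \<alpha> * x + Re \<beta> \<ge> 1" if "x \<ge> x0" for x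
    using that \<alpha> by (simp add: x0_def field_simps)
  \<comment> \<open>The negative of the desired tail bound, written with a logarithm to be
    differentiated easily. Its derivative dominates that of \<open>\<Theta>\<close> because the
    factor coming from \<open>q\<close> and the power is at least 1.\<close>
  define \<phi> where "\<phi> = (\<lambda>x. - C * exp (- q x - real k * ln (1 + x)))"
  define \<phi>' where "\<phi>' = (\<lambda>x. C * exp (- q x - real k * ln (1 + x)) * (2 * Re \<alpha> * x + Re \<beta> + real k / (1 + x)))"
  have \<phi>': "(\<phi> has_real_derivative \<phi>' x) (at x)" if "x \<ge> 0" for x
    unfolding \<phi>_def \<phi>'_def q_def
    using that by (auto intro!: derivative_eq_intros simp: field_simps)
  have ek: "exp (- q x - real k * ln (1 + x)) = exp (- q x) / (1 + \<bar>x\<bar>) ^ k" if "x \<ge> 0" for x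
    using that by (simp add: exp_diff exp_of_nat_mult)
  have bound: "norm (\<Theta> x) \<le> C * exp (- q x) / (1 + \<bar>x\<bar>) ^ k" if x: "x \<ge> x0" for x
  proof -
    have "norm (\<Theta> T - \<Theta> x) \<le> - \<phi> x" if T: "T > x" for T
    proof -
      have "norm (\<Theta> T - \<Theta> x) \<le> \<phi> T - \<phi> x"
      proof (rule differentiable_bound_general[OF T, where f' = "\<lambda>x. exp (- (\<alpha> * of_real x ^ 2 + \<beta> * of_real x + \<gamma>)) * R x" and \<phi>' = \<phi>'])
        show "continuous_on {x..T} \<Theta>"
          using der by (meson continuous_at_imp_continuous_on has_vector_derivative_continuous)
        show "continuous_on {x..T} \<phi>"
          using \<phi>' x x0 by (meson DERIV_isCont atLeastAtMost_iff continuous_at_imp_continuous_on order_trans)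
        fix u assume u: "x < u" "u < T"
        then have u0: "u \<ge> 0" "u \<ge> x0" using x x0 by auto
        show "(\<Theta> has_vector_derivative exp (- (\<alpha> * of_real u ^ 2 + \<beta> * of_real u + \<gamma>)) * R u) (at u)"
          by (rule der)
        show "(\<phi> has_vector_derivative \<phi>' u) (at u)"
          using \<phi>'[OF u0(1)] by (simp add: has_real_derivative_iff_has_vector_derivative)
        have "norm (exp (- (\<alpha> * of_real u ^ 2 + \<beta> * of_real u + \<gamma>)) * R u) = exp (- q u) * norm (R u)"
          by (simp only: norm_mult nq')
        also have "\<dots> \<le> exp (- q u) * (C / (1 + \<bar>u\<bar>) ^ k)"
          using C(2)[of u] by (intro mult_left_mono) (auto simp: pos_le_divide_eq)
        also have "\<dots> = C * exp (- q u - real k * ln (1 + u)) * 1" by (simp add: ek[OF u0(1)])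
        also have "\<dots> \<le> \<phi>' u"
          unfolding \<phi>'_def using C(1) q'[OF u0(2)] u0 by (intro mult_left_mono) (auto intro: add_increasing2)
        finally show "norm (exp (- (\<alpha> * of_real u ^ 2 + \<beta> * of_real u + \<gamma>)) * R u) \<le> \<phi>' u" .
      qed
      also have "\<dots> \<le> - \<phi> x" using C(1) by (simp add: \<phi>_def)
      finally show ?thesis .
    qed
    \<comment> \<open>Letting \<open>T\<close> tend to infinity removes
      \<open>\<Theta> T\<close>.\<close>
    then have "eventually (\<lambda>T. norm (\<Theta> T - \<Theta> x) \<le> - \<phi> x) at_top"
      by (intro eventually_mono[OF eventually_gt_at_top[of x]])
    moreover have "((\<lambda>T. norm (\<Theta> T - \<Theta> x)) \<longlongrightarrow> norm (0 - \<Theta> x)) at_top"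
      by (intro tendsto_intros lim)
    ultimately have "norm (0 - \<Theta> x) \<le> - \<phi> x" by (intro tendsto_upperbound) auto
    then show ?thesis using ek[of x] x x0 by (simp add: \<phi>_def)
  qed
  have "continuous_on {0..x0} (\<lambda>x. norm (exp (\<alpha> * of_real x ^ 2 + \<beta> * of_real x + \<gamma>) * \<Theta> x) * (1 + \<bar>x\<bar>) ^ k)"
    by (intro continuous_intros continuous_at_imp_continuous_on ballI has_vector_derivative_continuous[OF der])
  then have "bounded ((\<lambda>x. norm (exp (\<alpha> * of_real x ^ 2 + \<beta> * of_real x + \<gamma>) * \<Theta> x) * (1 + \<bar>x\<bar>) ^ k) ` {0..x0})"
    by (intro compact_imp_bounded compact_continuous_image) auto
  then obtain D where D: "\<And>x. 0 \<le> x \<Longrightarrow> x \<le> x0 \<Longrightarrow>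
      norm (exp (\<alpha> * of_real x ^ 2 + \<beta> * of_real x + \<gamma>) * \<Theta> x) * (1 + \<bar>x\<bar>) ^ k \<le> D"
    unfolding bounded_iff by force
  have "norm (exp (\<alpha> * of_real x ^ 2 + \<beta> * of_real x + \<gamma>) * \<Theta> x) * (1 + \<bar>x\<bar>) ^ k \<le> max C D" if "x \<ge> 0" for x
  proof (cases "x \<le> x0")
    case True
    with D[OF that] show ?thesis by (simp add: le_max_iff_disj)
  next
    case False
    have "norm (exp (\<alpha> * of_real x ^ 2 + \<beta> * of_real x + \<gamma>) * \<Theta> x) * (1 + \<bar>x\<bar>) ^ k = exp (q x) * norm (\<Theta> x) * (1 + \<bar>x\<bar>) ^ k"
      by (simp only: norm_mult nq)
    also have "\<dots> \<le> exp (q x) * (C * exp (- q x) / (1 + \<bar>x\<bar>) ^ k) * (1 + \<bar>x\<bar>) ^ k"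
      using bound[of x] False by (intro mult_right_mono mult_left_mono) auto
    also have "\<dots> = C" using that by (simp add: exp_minus field_simps)
    finally show ?thesis by simp
  qed
  then show ?thesis by blast
qed

text \<open>Both ends are treated by the half-line estimate; the reflection of \<open>x\<close>
  changes the signs of \<open>\<beta>\<close> and of the derivative.\<close>

lemma rapid_ode:
  fixes \<alpha> \<beta> \<gamma> :: complex
  assumes \<alpha>: "Re \<alpha> > 0" and R: "rapid R"
    and der: "\<And>x. (\<Theta> has_vector_derivative exp (- (\<alpha> * of_real x ^ 2 + \<beta> * of_real x + \<gamma>)) * R x) (at x)"
    and lim: "(\<Theta> \<longlongrightarrow> 0) at_top" "(\<Theta> \<longlongrightarrow> 0) at_bot"
  shows "rapid (\<lambda>x. exp (\<alpha> * of_real x ^ 2 + \<beta> * of_real x + \<gamma>) * \<Theta> x)"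
proof (rule rapidI)
  fix k
  obtain C where C: "\<And>x. x \<ge> 0 \<Longrightarrow> norm (exp (\<alpha> * of_real x ^ 2 + \<beta> * of_real x + \<gamma>) * \<Theta> x) * (1 + \<bar>x\<bar>) ^ k \<le> C"
    using rapid_ode_half_line[OF \<alpha> R der lim(1)] by blast
  have R': "rapid (\<lambda>x. - R (- x))"
    using R unfolding rapid_def by (metis abs_minus_cancel norm_minus_cancel)
  have lim': "((\<lambda>x. \<Theta> (- x)) \<longlongrightarrow> 0) at_top"
    using lim(2) by (simp add: filterlim_at_bot_mirror)
  have der': "((\<lambda>x. \<Theta> (- x)) has_vector_derivative exp (- (\<alpha> * of_real x ^ 2 + - \<beta> * of_real x + \<gamma>)) * - R (- x)) (at x)" for x
  proof -
    have "((\<lambda>x::real. - x) has_vector_derivative - 1) (at x)"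
      by (auto intro!: derivative_eq_intros simp flip: has_real_derivative_iff_has_vector_derivative)
    from vector_diff_chain_at[OF this der] show ?thesis by (simp add: o_def)
  qed
  obtain D where D: "\<And>x. x \<ge> 0 \<Longrightarrow> norm (exp (\<alpha> * of_real x ^ 2 + - \<beta> * of_real x + \<gamma>) * \<Theta> (- x)) * (1 + \<bar>x\<bar>) ^ k \<le> D"
    using rapid_ode_half_line[OF \<alpha> R' der' lim'] by blast
  have "norm (exp (\<alpha> * of_real x ^ 2 + \<beta> * of_real x + \<gamma>) * \<Theta> x) * (1 + \<bar>x\<bar>) ^ k \<le> max C D" for x
    using C[of x] D[of "- x"] by (cases "x \<ge> 0") (auto simp: le_max_iff_disj)
  then show "\<exists>C. \<forall>x. norm (exp (\<alpha> * of_real x ^ 2 + \<beta> * of_real x + \<gamma>) * \<Theta> x) * (1 + \<bar>x\<bar>) ^ k \<le> C" by blast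
qed

text \<open>The equation trades each derivative of \<open>k\<close> for a polynomial multiple of
  \<open>k\<close> plus a Schwartz function, so rapid decay of \<open>k\<close> alone propagates to
  all derivatives.\<close>

lemma schwartz_ode:
  fixes a b :: complex
  assumes k: "rapid k" "\<And>x. (k has_vector_derivative (a * of_real x + b) * k x + R x) (at x)" and R: "schwartz R"
  shows "schwartz k"
proof -
  let ?F = "{\<lambda>x. poly p (of_real x) * k x + S x |p S. schwartz S}"
  have m: "(\<lambda>x. poly p (of_real x) * k x + S x) \<in> ?F" if "schwartz S" for p S using that by blast
  have "schwartz (\<lambda>x. poly 1 (of_real x) * k x + 0)"
  proof (rule schwartz_coinduct[where F = ?F])
    fix h assume "h \<in> ?F"
    then obtain p S where h: "h = (\<lambda>x. poly p (of_real x) * k x + S x)" "schwartz S" by blast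
    then show "rapid h" by (simp add: rapid_add rapid_poly_mult schwartz_rapid k)
    obtain S' where S': "schwartz S'" "\<And>x. (S has_vector_derivative S' x) (at x)" using h(2) by (metis schwartzE)
    have "(h has_vector_derivative poly (p * [:b, a:] + pderiv p) (of_real x) * k x + (poly p (of_real x) * R x + S' x)) (at x)" for x
      using has_vector_derivative_add[OF has_vector_derivative_mult[OF has_vector_derivative_poly[of p x] k(2)[of x]] S'(2)[of x]]
      unfolding h by (simp add: algebra_simps)
    moreover have "(\<lambda>x. poly (p * [:b, a:] + pderiv p) (of_real x) * k x + (poly p (of_real x) * R x + S' x)) \<in> ?F"
      by (rule m) (intro schwartz_add schwartz_poly_mult R S')
    ultimately show "\<exists>h'\<in>?F. \<forall>x. (h has_vector_derivative h' x) (at x)" by (rule_tac bexI) auto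
  next
    show "(\<lambda>x. poly 1 (of_real x) * k x + 0) \<in> ?F"
      by (rule m) (use schwartz_cmult[OF R, of 0] in simp)
  qed
  then show ?thesis by simp
qed

text \<open>Variation of constants against a growing homogeneous solution. The two limits of
  \<open>\<Theta>\<close> are what singles out the decaying solution.\<close>

lemma schwartz_ode_solution:
  fixes \<alpha> \<beta> \<gamma> :: complex
  assumes \<alpha>: "Re \<alpha> > 0" and R: "schwartz R"
    and der: "\<And>x. (\<Theta> has_vector_derivative exp (- (\<alpha> * of_real x ^ 2 + \<beta> * of_real x + \<gamma>)) * R x) (at x)"
    and lim: "(\<Theta> \<longlongrightarrow> 0) at_top" "(\<Theta> \<longlongrightarrow> 0) at_bot"
  defines "k \<equiv> \<lambda>x. exp (\<alpha> * of_real x ^ 2 + \<beta> * of_real x + \<gamma>) * \<Theta> x"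
  shows "schwartz k" and "\<And>x. (k has_vector_derivative (2 * \<alpha> * of_real x + \<beta>) * k x + R x) (at x)"
proof -
  show *: "(k has_vector_derivative (2 * \<alpha> * of_real x + \<beta>) * k x + R x) (at x)" for x
  proof -
    have "exp w * (exp (- w) * R x) = R x" for w by (simp add: exp_minus)
    with has_vector_derivative_mult[OF has_vector_derivative_exp_quadratic[of \<alpha> \<beta> \<gamma> x] der[of x]]
    show ?thesis by (simp only: k_def) (simp add: mult.assoc add.commute)
  qed
  show "schwartz k"
    by (rule schwartz_ode[OF _ * R]) (unfold k_def, rule rapid_ode[OF \<alpha> schwartz_rapid[OF R] der lim])
qed

section \<open>Fourier series\<close>

abbreviation fmode :: "int \<Rightarrow> real \<Rightarrow> complex" where
  "fmode n y \<equiv> exp (\<i> * of_int n * of_real y)"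

definition fourier_coeff :: "(real \<Rightarrow> complex) \<Rightarrow> int \<Rightarrow> complex" where
  "fourier_coeff g n = integral {0..2 * pi} (\<lambda>y. g y * fmode (- n) y) / (2 * pi)"

lemma fmode_mult_minus: "fmode m y * fmode (- n) y = fmode (m - n) y"
  by (simp add: algebra_simps flip: exp_add)

lemma fmode_2pi [simp]: "fmode n (2 * pi) = 1"
  by (rule exp_eq_1[THEN iffD2]) (auto intro!: exI[of _ n])

lemma fmode_has_vector_derivative: "(fmode n has_vector_derivative (\<i> * of_int n * fmode n y)) (at y)"
  by (rule has_vector_derivative_real_field) (auto intro!: derivative_eq_intros)

lemma has_integral_fourier_series:
  fixes c :: "int \<Rightarrow> complex"
  assumes "(\<lambda>n. norm (c n)) summable_on (UNIV :: int set)"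
  shows "((\<lambda>y. \<Sum>\<^sub>\<infinity>n. c n * fmode n y) has_integral (2 * pi * c 0)) {0..2 * pi}"
proof -
  \<comment> \<open>Termwise primitives. Only the term \<open>n = 0\<close> fails to be periodic, so
    it alone contributes to the difference of the endpoint values.\<close>
  let ?f = "\<lambda>n y. if n = 0 then c 0 * of_real y else c n / (\<i> * of_int n) * fmode n y"
  have cs: "(\<lambda>n. norm (?f n y)) summable_on UNIV" for y
  proof -
    have "(\<lambda>n. norm (?f n y)) summable_on (UNIV - {0})"
    proof (rule summable_on_comparison_test)
      show "(\<lambda>n. norm (c n)) summable_on (UNIV - {0})" using assms by (rule summable_on_subset_banach) auto
      fix n :: int assume "n \<in> UNIV - {0}"
      then have "\<bar>real_of_int n\<bar> \<ge> 1" by auto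
      then show "norm (?f n y) \<le> norm (c n)"
        using \<open>n \<in> UNIV - {0}\<close> mult_right_mono[of 1 "\<bar>real_of_int n\<bar>" "norm (c n)"]
        by (simp add: norm_divide norm_mult divide_le_eq mult.commute)
    qed auto
    from summable_on_union[OF this summable_on_finite[of "{0}" "\<lambda>n. norm (?f n y)"]]
    show ?thesis by (simp add: Un_commute insert_Diff)
  qed
  have der: "((\<lambda>y. \<Sum>\<^sub>\<infinity>n. ?f n y) has_vector_derivative (\<Sum>\<^sub>\<infinity>n. c n * fmode n y)) (at y within {0..2 * pi})" for y
  proof -
    have "((\<lambda>y. \<Sum>\<^sub>\<infinity>n. ?f n y) has_derivative (\<lambda>h. \<Sum>\<^sub>\<infinity>n. h *\<^sub>R (c n * fmode n y))) (at y within UNIV)"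
    proof (rule has_derivative_infsum_int[where B = "\<lambda>n. norm (c n)"])
      fix n :: int and y :: real
      have "((\<lambda>y. c 0 * complex_of_real y) has_vector_derivative c 0) (at y)"
        by (rule has_vector_derivative_real_field) (auto intro!: derivative_eq_intros)
      moreover have "((\<lambda>y. c n / (\<i> * of_int n) * fmode n y) has_vector_derivative c n * fmode n y) (at y)" if "n \<noteq> 0"
        using has_vector_derivative_mult_right[OF fmode_has_vector_derivative[of n y], of "c n / (\<i> * of_int n)"] that by simp
      ultimately have "(?f n has_vector_derivative c n * fmode n y) (at y)" by (cases "n = 0") simp_all
      then show "(?f n has_derivative (\<lambda>h. h *\<^sub>R (c n * fmode n y))) (at y within UNIV)"
        by (simp add: has_vector_derivative_def)
    qed (use assms cs in \<open>auto simp: norm_mult intro: abs_summable_summable\<close>)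
    moreover have "(\<Sum>\<^sub>\<infinity>n. h *\<^sub>R (c n * fmode n y)) = h *\<^sub>R (\<Sum>\<^sub>\<infinity>n. c n * fmode n y)" for h
      by (rule infsum_scaleR_right)
    ultimately show ?thesis
      by (simp add: has_vector_derivative_def has_derivative_at_withinI)
  qed
  have "((\<lambda>y. \<Sum>\<^sub>\<infinity>n. c n * fmode n y) has_integral ((\<Sum>\<^sub>\<infinity>n. ?f n (2 * pi)) - (\<Sum>\<^sub>\<infinity>n. ?f n 0))) {0..2 * pi}"
    by (rule fundamental_theorem_of_calculus[OF _ der]) simp
  also have "(\<Sum>\<^sub>\<infinity>n. ?f n (2 * pi)) - (\<Sum>\<^sub>\<infinity>n. ?f n 0) = (\<Sum>\<^sub>\<infinity>n. ?f n (2 * pi) + - ?f n 0)"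
    using abs_summable_summable[OF cs[of "2 * pi"]] abs_summable_summable[OF cs[of 0]]
    by (subst infsum_add) (auto simp: infsum_uminus summable_on_uminus)
  also have "\<dots> = (\<Sum>\<^sub>\<infinity>n\<in>{0::int}. 2 * pi * c 0)"
    by (rule infsum_cong_neutral) (simp_all only: fmode_2pi, auto)
  finally show ?thesis by simp
qed

text \<open>Multiplication by \<open>fmode (- m)\<close> shifts the coefficients and reduces the
  claim to the mean value of a series.\<close>

lemma fourier_coeff_series:
  fixes c :: "int \<Rightarrow> complex"
  assumes "(\<lambda>n. norm (c n)) summable_on (UNIV :: int set)"
  shows "fourier_coeff (\<lambda>y. \<Sum>\<^sub>\<infinity>n. c n * fmode n y) m = c m"
proof -
  have "(\<Sum>\<^sub>\<infinity>n. c n * fmode n y) * fmode (- m) y = (\<Sum>\<^sub>\<infinity>n. c (n + m) * fmode n y)" for y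
  proof -
    have "(\<Sum>\<^sub>\<infinity>n. c n * fmode n y) * fmode (- m) y = (\<Sum>\<^sub>\<infinity>n. c n * fmode (n - m) y)"
      by (subst infsum_cmult_left'[symmetric]) (metis (no_types, lifting) fmode_mult_minus mult.assoc)
    also have "\<dots> = (\<Sum>\<^sub>\<infinity>n. c (n + m) * fmode n y)"
      using infsum_int_shift[of "\<lambda>n. c n * fmode (n - m) y" m] by simp
    finally show ?thesis .
  qed
  moreover have "(\<lambda>n. norm (c (n + m))) summable_on UNIV"
    using assms summable_int_shift[of "\<lambda>n. norm (c n)" m] by simp
  ultimately show ?thesis
    using has_integral_fourier_series[of "\<lambda>n. c (n + m)"] by (simp add: fourier_coeff_def integral_unique)
qed

lemma fourier_coeff_ex: "fourier_coeff (fmode n) m = (if m = n then 1 else 0)"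
proof -
  let ?c = "\<lambda>k. if k = n then 1 else 0 :: complex"
  have "(\<lambda>k. norm (?c k)) summable_on UNIV"
    by (rule finite_nonzero_values_imp_summable_on) (auto intro: finite_subset[of _ "{n}"])
  moreover have "(\<Sum>\<^sub>\<infinity>k. ?c k * fmode k y) = fmode n y" for y
  proof -
    have "(\<Sum>\<^sub>\<infinity>k. ?c k * fmode k y) = (\<Sum>\<^sub>\<infinity>k\<in>{n}. fmode k y)" by (rule infsum_cong_neutral) auto
    then show ?thesis by simp
  qed
  ultimately show ?thesis using fourier_coeff_series[of ?c m] by simp
qed

lemma fourier_coeff_add:
  assumes "continuous_on {0..2 * pi} f" "continuous_on {0..2 * pi} g"
  shows "fourier_coeff (\<lambda>y. f y + g y) n = fourier_coeff f n + fourier_coeff g n"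
  unfolding fourier_coeff_def distrib_right
  using assms by (subst integral_add) (auto intro!: integrable_continuous_interval continuous_intros simp: add_divide_distrib)

lemma fourier_coeff_cmult: "fourier_coeff (\<lambda>y. c * f y) n = c * fourier_coeff f n"
  by (simp add: fourier_coeff_def mult.assoc)

lemma fourier_coeff_diff:
  assumes "continuous_on {0..2 * pi} f" "continuous_on {0..2 * pi} g"
  shows "fourier_coeff (\<lambda>y. f y - g y) n = fourier_coeff f n - fourier_coeff g n"
  using fourier_coeff_add[of f "\<lambda>y. - 1 * g y" n] fourier_coeff_cmult[of "-1" g n] assms
  by (simp add: continuous_on_minus)

lemma fourier_coeff_mult_ex: "fourier_coeff (\<lambda>y. f y * fmode m y) n = fourier_coeff f (n - m)"
proof -
  have "f y * fmode m y * fmode (- n) y = f y * fmode (- (n - m)) y" for y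
    using fmode_mult_minus[of m y n] by (metis (no_types, lifting) minus_diff_eq mult.assoc uminus_add_conv_diff diff_conv_add_uminus add.commute)
  then show ?thesis unfolding fourier_coeff_def by (simp only:)
qed

lemma fourier_coeff_sum:
  assumes "finite A" "\<And>k. k \<in> A \<Longrightarrow> continuous_on {0..2 * pi} (f k)"
  shows "fourier_coeff (\<lambda>y. \<Sum>k\<in>A. f k y) n = (\<Sum>k\<in>A. fourier_coeff (f k) n)"
  using assms
proof (induction A)
  case empty
  then show ?case by (simp add: fourier_coeff_def)
next
  case (insert a A)
  then show ?case by (simp add: fourier_coeff_add continuous_on_sum)
qed

section \<open>Bessel's inequality, the Riemann-Lebesgue lemma and pointwise Fourier
  inversion\<close>

lemma bessel:
  assumes k: "continuous_on {0..2 * pi} k" and A: "finite A"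
  shows "(\<Sum>n\<in>A. (norm (fourier_coeff k n))\<^sup>2) \<le> integral {0..2 * pi} (\<lambda>y. (norm (k y))\<^sup>2) / (2 * pi)"
proof -
  let ?c = "fourier_coeff k"
  define s where "s = (\<lambda>y. \<Sum>n\<in>A. ?c n * fmode n y)"
  have cs: "continuous_on {0..2 * pi} s" unfolding s_def by (intro continuous_intros)
  have cr: "continuous_on {0..2 * pi} (\<lambda>y. k y - s y)" by (intro continuous_intros k cs)
  \<comment> \<open>The remainder is orthogonal to every mode used in \<open>s\<close>.\<close>
  have rm: "fourier_coeff (\<lambda>y. k y - s y) m = 0" if "m \<in> A" for m
  proof -
    have "fourier_coeff s m = (\<Sum>n\<in>A. ?c n * (if m = n then 1 else 0))"
      unfolding s_def using A
      by (subst fourier_coeff_sum) (auto intro!: continuous_intros simp: fourier_coeff_cmult fourier_coeff_ex)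
    also have "\<dots> = ?c m" using A that by (simp add: if_distrib cong: if_cong)
    finally show ?thesis by (simp add: fourier_coeff_diff k cs)
  qed
  have ip: "integral {0..2 * pi} (\<lambda>y. f y * cnj (s y)) = 2 * pi * (\<Sum>m\<in>A. cnj (?c m) * fourier_coeff f m)"
    if "continuous_on {0..2 * pi} f" for f
  proof -
    have "f y * cnj (s y) = (\<Sum>m\<in>A. cnj (?c m) * (f y * fmode (- m) y))" for y
      by (simp add: s_def sum_distrib_left exp_cnj algebra_simps)
    then have "integral {0..2 * pi} (\<lambda>y. f y * cnj (s y)) =
        (\<Sum>m\<in>A. integral {0..2 * pi} (\<lambda>y. cnj (?c m) * (f y * fmode (- m) y)))"
      using A that by (subst integral_sum[symmetric]) (auto intro!: integrable_continuous_interval continuous_intros)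
    also have "\<dots> = 2 * pi * (\<Sum>m\<in>A. cnj (?c m) * fourier_coeff f m)"
      by (simp add: fourier_coeff_def[of f] sum_distrib_left)
    finally show ?thesis .
  qed
  have ip': "integral {0..2 * pi} (\<lambda>y. s y * cnj (f y)) = cnj (2 * pi * (\<Sum>m\<in>A. cnj (?c m) * fourier_coeff f m))"
    if "continuous_on {0..2 * pi} f" for f
    unfolding ip[OF that, symmetric] integral_cnj by (simp add: mult.commute)
  have norm2: "complex_of_real (integral {0..2 * pi} (\<lambda>y. (norm (f y))\<^sup>2)) = integral {0..2 * pi} (\<lambda>y. f y * cnj (f y))"
    if "continuous_on {0..2 * pi} f" for f :: "real \<Rightarrow> complex"
  proof -
    have "(\<lambda>y. (norm (f y))\<^sup>2) integrable_on {0..2 * pi}"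
      using that by (intro integrable_continuous_interval continuous_intros)
    moreover have "bounded_linear complex_of_real" by (rule bounded_linear_of_real)
    ultimately have "integral {0..2 * pi} (complex_of_real \<circ> (\<lambda>y. (norm (f y))\<^sup>2)) =
        complex_of_real (integral {0..2 * pi} (\<lambda>y. (norm (f y))\<^sup>2))" by (rule integral_linear)
    then show ?thesis
      by (simp add: o_def complex_norm_square del: of_real_power)
  qed
  \<comment> \<open>The square is grouped so that the last term pairs the remainder with
    \<open>s\<close>, which vanishes by \<open>rm\<close>.\<close>
  have "complex_of_real (integral {0..2 * pi} (\<lambda>y. (norm (k y - s y))\<^sup>2)) =
      integral {0..2 * pi} (\<lambda>y. (k y * cnj (k y) - s y * cnj (k y)) - (k y - s y) * cnj (s y))"
    unfolding norm2[OF cr] by (simp add: algebra_simps)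
  also have "\<dots> = integral {0..2 * pi} (\<lambda>y. k y * cnj (k y)) - integral {0..2 * pi} (\<lambda>y. s y * cnj (k y)) -
      integral {0..2 * pi} (\<lambda>y. (k y - s y) * cnj (s y))"
  proof -
    have "(\<lambda>y. k y * cnj (k y)) integrable_on {0..2 * pi}" "(\<lambda>y. s y * cnj (k y)) integrable_on {0..2 * pi}"
      "(\<lambda>y. (k y - s y) * cnj (s y)) integrable_on {0..2 * pi}"
      by (intro integrable_continuous_interval continuous_intros k cs)+
    then show ?thesis by (simp add: integral_diff integrable_diff)
  qed
  also have "\<dots> = complex_of_real (integral {0..2 * pi} (\<lambda>y. (norm (k y))\<^sup>2) - 2 * pi * (\<Sum>m\<in>A. (norm (?c m))\<^sup>2))"
  proof -
    have "cnj (\<Sum>m\<in>A. cnj (?c m) * fourier_coeff k m) = complex_of_real (\<Sum>m\<in>A. (norm (?c m))\<^sup>2)"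
      by (simp add: complex_norm_square mult.commute del: of_real_power)
    then show ?thesis
      unfolding ip[OF cr] ip'[OF k] norm2[OF k, symmetric] by (simp add: rm del: cnj_sum of_real_sum)
  qed
  finally have "integral {0..2 * pi} (\<lambda>y. (norm (k y - s y))\<^sup>2) =
      integral {0..2 * pi} (\<lambda>y. (norm (k y))\<^sup>2) - 2 * pi * (\<Sum>m\<in>A. (norm (?c m))\<^sup>2)"
    by (simp only: of_real_eq_iff)
  moreover have "integral {0..2 * pi} (\<lambda>y. (norm (k y - s y))\<^sup>2) \<ge> 0"
    by (intro integral_nonneg integrable_continuous_interval continuous_intros cr) auto
  ultimately show ?thesis by (simp add: field_simps)
qed

text \<open>Bessel bounds all finite sums of squares, hence the squares are summable and tend to 0
  along any injective enumeration of indices.\<close>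

lemma fourier_coeff_tendsto_0:
  assumes k: "continuous_on {0..2 * pi} k" and inj: "inj (\<pi> :: nat \<Rightarrow> int)"
  shows "(\<lambda>N. fourier_coeff k (\<pi> N)) \<longlonglongrightarrow> 0"
proof -
  have "(\<lambda>n. (norm (fourier_coeff k n))\<^sup>2) summable_on UNIV"
    using bessel[OF k] by (intro nonneg_bdd_above_summable_on bdd_aboveI) auto
  then have "(\<lambda>n. (norm (fourier_coeff k n))\<^sup>2) summable_on range \<pi>"
    by (rule summable_on_subset_banach) auto
  then have "(\<lambda>N. (norm (fourier_coeff k (\<pi> N)))\<^sup>2) summable_on UNIV"
    by (subst (asm) summable_on_reindex[OF inj]) (simp add: o_def)
  then have "summable (\<lambda>N. (norm (fourier_coeff k (\<pi> N)))\<^sup>2)"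
    by (subst (asm) summable_on_UNIV_nonneg_real_iff) auto
  then have "(\<lambda>N. (norm (fourier_coeff k (\<pi> N)))\<^sup>2) \<longlonglongrightarrow> 0" by (rule summable_LIMSEQ_zero)
  then have "(\<lambda>N. sqrt ((norm (fourier_coeff k (\<pi> N)))\<^sup>2)) \<longlonglongrightarrow> sqrt 0" by (rule tendsto_real_sqrt)
  then show ?thesis by (simp add: tendsto_norm_zero_iff)
qed

lemma has_sum_int_symmetric_limit:
  fixes f :: "int \<Rightarrow> complex"
  assumes "(f has_sum S) UNIV"
  shows "(\<lambda>N. \<Sum>n\<in>{- int N..int N}. f n) \<longlonglongrightarrow> S"
proof -
  have "filterlim (\<lambda>N. {- int N..int N}) (finite_subsets_at_top UNIV) sequentially"
    unfolding filterlim_finite_subsets_at_top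
  proof (intro allI impI)
    fix X :: "int set" assume "finite X \<and> X \<subseteq> UNIV"
    then have X: "finite X" by simp
    have "\<exists>M. \<forall>x\<in>X. \<bar>x\<bar> \<le> M" using X
      by (intro exI[of _ "Max (insert 0 (abs ` X))"]) auto
    then obtain M where M: "\<And>x. x \<in> X \<Longrightarrow> \<bar>x\<bar> \<le> M" by blast
    show "eventually (\<lambda>N. finite {- int N..int N} \<and> X \<subseteq> {- int N..int N} \<and> {- int N..int N} \<subseteq> UNIV) sequentially"
      using eventually_ge_at_top[of "nat M"] by eventually_elim (use M in force)
  qed
  with assms show ?thesis unfolding has_sum_def by (rule filterlim_compose)
qed

lemma sum_int_telescope:
  fixes L :: "int \<Rightarrow> complex"
  shows "(\<Sum>n\<in>{- int N..int N}. L (n - 1) - L n) = L (- int N - 1) - L (int N)"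
proof (induction N)
  case (Suc N)
  have "{- int (Suc N)..int (Suc N)} = insert (- int (Suc N)) (insert (int (Suc N)) {- int N..int N})" by auto
  then have "(\<Sum>n\<in>{- int (Suc N)..int (Suc N)}. L (n - 1) - L n) =
      (L (- int (Suc N) - 1) - L (- int (Suc N))) + ((L (int N) - L (int (Suc N))) +
        (\<Sum>n\<in>{- int N..int N}. L (n - 1) - L n))" by simp
  also have "- int N - 1 = - int (Suc N)" by simp
  then have "(\<Sum>n\<in>{- int N..int N}. L (n - 1) - L n) = L (- int (Suc N)) - L (int N)"
    using Suc by presburger
  finally show ?case by simp
qed simp

lemma has_vector_derivative_quotient:
  assumes "(f has_vector_derivative f') (at x)"
  shows "((\<lambda>y. (f y - f x) /\<^sub>R (y - x)) \<longlongrightarrow> f') (at x)"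
proof -
  have "((\<lambda>y. (1 / norm (y - x)) *\<^sub>R (f y - (f x + (y - x) *\<^sub>R f'))) \<longlongrightarrow> 0) (at x)"
    using assms unfolding has_vector_derivative_def has_derivative_within by simp
  then have "((\<lambda>y. norm ((1 / norm (y - x)) *\<^sub>R (f y - (f x + (y - x) *\<^sub>R f')))) \<longlongrightarrow> 0) (at x)"
    by (rule tendsto_norm_zero)
  moreover have "eventually (\<lambda>y. norm ((1 / norm (y - x)) *\<^sub>R (f y - (f x + (y - x) *\<^sub>R f'))) =
      norm ((f y - f x) /\<^sub>R (y - x) - f')) (at x)"
    unfolding eventually_at_filter
  proof (intro always_eventually allI impI)
    fix y assume "y \<noteq> x"
    then have "(f y - f x) /\<^sub>R (y - x) - f' = inverse (y - x) *\<^sub>R (f y - (f x + (y - x) *\<^sub>R f'))"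
      unfolding diff_diff_add[symmetric] scaleR_diff_right[of _ "f y - f x"] by simp
    then show "norm ((1 / norm (y - x)) *\<^sub>R (f y - (f x + (y - x) *\<^sub>R f'))) = norm ((f y - f x) /\<^sub>R (y - x) - f')"
      by (simp add: inverse_eq_divide)
  qed
  ultimately have "((\<lambda>y. norm ((f y - f x) /\<^sub>R (y - x) - f')) \<longlongrightarrow> 0) (at x)"
    by (rule Lim_transform_eventually)
  then show ?thesis by (simp add: tendsto_norm_zero_iff Lim_null[symmetric])
qed

text \<open>Chernoff's argument: dividing \<open>g - g y0\<close> by \<open>fmode 1 - fmode 1 y0\<close> makes the series telescope.\<close>

lemma fourier_inversion:
  assumes per: "\<And>y. g (y + 2 * pi) = g y" and cont: "continuous_on UNIV g"
    and der: "(g has_vector_derivative g') (at y0)"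
    and sm: "(\<lambda>n. norm (fourier_coeff g n)) summable_on UNIV"
  shows "g y0 = (\<Sum>\<^sub>\<infinity>n. fourier_coeff g n * fmode n y0)"
proof -
  interpret g: periodic_fun_simple g "2 * pi" by standard (rule per)
  \<comment> \<open>At the zeros of the denominator the value is the limit of the quotient: the
    derivative of \<open>g\<close> over that of \<open>fmode 1\<close>. This makes \<open>K\<close>
    continuous.\<close>
  define K where "K = (\<lambda>y. if fmode 1 y = fmode 1 y0 then g' / (\<i> * fmode 1 y0) else (g y - g y0) / (fmode 1 y - fmode 1 y0))"
  have eqE: "\<exists>m::int. y = y0 + of_int m * (2 * pi)" if "fmode 1 y = fmode 1 y0" for y
  proof -
    obtain n :: int where "\<i> * complex_of_real y = \<i> * of_real y0 + of_int (2 * n) * of_real pi * \<i>"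
      using \<open>fmode 1 y = fmode 1 y0\<close> exp_eq[of "\<i> * of_real y" "\<i> * of_real y0"] by auto
    then have "Im (\<i> * complex_of_real y) = Im (\<i> * of_real y0 + of_int (2 * n) * of_real pi * \<i>)" by simp
    then have "y = y0 + of_int n * (2 * pi)" by simp
    then show ?thesis by blast
  qed
  have K: "g y - g y0 = K y * (fmode 1 y - fmode 1 y0)" for y
    using eqE[of y] g.plus_of_int[of y0] by (auto simp: K_def)
  have fmode_per: "fmode 1 (y + of_int m * (2 * pi)) = fmode 1 y" for y m
    using exp_plus_2pin[of "\<i> * of_real y" m] by (simp add: algebra_simps)
  have Kper: "K (y + of_int m * (2 * pi)) = K y" for y m
    unfolding K_def fmode_per g.plus_of_int ..
  have K0: "isCont K y0"
  proof -
    note 1 = has_vector_derivative_quotient[OF der]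
    note 2 = has_vector_derivative_quotient[OF fmode_has_vector_derivative[of 1 y0]]
    have 3: "((\<lambda>y. ((g y - g y0) /\<^sub>R (y - y0)) / ((fmode 1 y - fmode 1 y0) /\<^sub>R (y - y0))) \<longlongrightarrow> g' / (\<i> * fmode 1 y0)) (at y0)"
      using tendsto_divide[OF 1 2] by simp
    have "eventually (\<lambda>y. ((g y - g y0) /\<^sub>R (y - y0)) / ((fmode 1 y - fmode 1 y0) /\<^sub>R (y - y0)) = K y) (at y0)"
    proof -
      have "eventually (\<lambda>y. y \<in> {y0 - 2 * pi <..< y0 + 2 * pi} - {y0}) (at y0)"
        by (intro eventually_at_in_open) auto
      then show ?thesis
      proof eventually_elim
        case (elim y)
        have "fmode 1 y \<noteq> fmode 1 y0"
        proof
          assume "fmode 1 y = fmode 1 y0"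
          then obtain m :: int where m: "y = y0 + of_int m * (2 * pi)" using eqE by blast
          have "\<bar>y - y0\<bar> < 1 * (2 * pi)" using elim by (auto simp: abs_if)
          then have "\<bar>real_of_int m * (2 * pi)\<bar> < 1 * (2 * pi)" unfolding m by simp
          then have "\<bar>real_of_int m\<bar> < 1" by (simp add: abs_mult)
          then have "m = 0" by linarith
          with m elim show False by simp
        qed
        moreover have "(r *\<^sub>R a) / (r *\<^sub>R b) = a / b" if "r \<noteq> 0" for r and a b :: complex
          using that by (simp add: scaleR_conv_of_real)
        ultimately show ?case using elim by (simp add: K_def)
      qed
    qed
    with 3 have "(K \<longlongrightarrow> g' / (\<i> * fmode 1 y0)) (at y0)" by (rule Lim_transform_eventually)
    then show ?thesis by (simp add: isCont_def K_def)
  qed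
  have contK: "isCont K y" for y
  proof (cases "fmode 1 y = fmode 1 y0")
    case True
    then obtain m :: int where m: "y = y0 + of_int m * (2 * pi)" using eqE by blast
    have 1: "isCont (\<lambda>u. u + of_int (- m) * (2 * pi)) y" by (intro continuous_intros)
    have 2: "isCont K (y + of_int (- m) * (2 * pi))" using K0 by (simp add: m)
    from isCont_o2[OF 1 2] show ?thesis unfolding Kper .
  next
    case False
    have op: "open {y. fmode 1 y \<noteq> fmode 1 y0}"
      by (intro open_Collect_neq continuous_intros)
    have "isCont (\<lambda>y. (g y - g y0) / (fmode 1 y - fmode 1 y0)) y"
      using cont False by (intro continuous_intros) (auto simp: continuous_on_eq_continuous_at)
    moreover have "eventually (\<lambda>u. (g u - g y0) / (fmode 1 u - fmode 1 y0) = K u) (nhds y)"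
    proof -
      have "eventually (\<lambda>u. u \<in> {y. fmode 1 y \<noteq> fmode 1 y0}) (nhds y)"
        using False by (intro eventually_nhds_in_open op) simp
      then show ?thesis by eventually_elim (simp add: K_def)
    qed
    ultimately show ?thesis by (simp add: isCont_cong)
  qed
  have cK: "continuous_on {0..2 * pi} K"
    using contK by (simp add: continuous_at_imp_continuous_on)
  have cg: "continuous_on {0..2 * pi} g" using cont by (rule continuous_on_subset) simp
  \<comment> \<open>Multiplying \<open>K\<close> by \<open>fmode 1 - fmode 1 y0\<close> shifts its
    coefficients; scaled by powers of \<open>fmode 1 y0\<close>, the result is a difference of
    consecutive values of \<open>L\<close>.\<close>
  define L where "L = (\<lambda>n. fmode (n + 1) y0 * fourier_coeff K n)"
  have L: "fourier_coeff g n * fmode n y0 - (if n = 0 then g y0 else 0) = L (n - 1) - L n" for n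
  proof -
    have "g y - g y0 * fmode 0 y = K y * fmode 1 y - fmode 1 y0 * K y" for y
      using K[of y] by (simp add: right_diff_distrib mult.commute)
    then have "fourier_coeff (\<lambda>y. g y - g y0 * fmode 0 y) n = fourier_coeff (\<lambda>y. K y * fmode 1 y - fmode 1 y0 * K y) n"
      by (simp only:)
    also have "fourier_coeff (\<lambda>y. g y - g y0 * fmode 0 y) n = fourier_coeff g n - fourier_coeff (\<lambda>y. g y0 * fmode 0 y) n"
      by (intro fourier_coeff_diff cg continuous_intros)
    also have "fourier_coeff (\<lambda>y. K y * fmode 1 y - fmode 1 y0 * K y) n =
        fourier_coeff (\<lambda>y. K y * fmode 1 y) n - fourier_coeff (\<lambda>y. fmode 1 y0 * K y) n"
      by (intro fourier_coeff_diff cK continuous_intros)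
    finally have "fourier_coeff g n - g y0 * (if n = 0 then 1 else 0) = fourier_coeff K (n - 1) - fmode 1 y0 * fourier_coeff K n"
      unfolding fourier_coeff_cmult fourier_coeff_mult_ex fourier_coeff_ex .
    from arg_cong[OF this, of "\<lambda>w. w * fmode n y0"] show ?thesis
      unfolding L_def by (simp add: algebra_simps exp_add split: if_splits)
  qed
  have "(\<lambda>n. norm (fourier_coeff g n * fmode n y0)) summable_on UNIV" using sm by (simp add: norm_mult)
  then have "((\<lambda>n. fourier_coeff g n * fmode n y0) has_sum (\<Sum>\<^sub>\<infinity>n. fourier_coeff g n * fmode n y0)) UNIV"
    by (intro has_sum_infsum abs_summable_summable[where f = "\<lambda>n. fourier_coeff g n * fmode n y0"])
  moreover have "((\<lambda>n::int. - 1 * (if n = 0 then g y0 else 0)) has_sum (- 1 * g y0)) UNIV"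
  proof -
    have "((\<lambda>n::int. if n = 0 then g y0 else 0) has_sum (\<Sum>n\<in>{0::int}. if n = 0 then g y0 else 0)) {0}"
      by (rule has_sum_finite) simp
    then have "((\<lambda>n::int. if n = 0 then g y0 else 0) has_sum (\<Sum>n\<in>{0::int}. if n = 0 then g y0 else 0)) UNIV"
      by (rule has_sum_cong_neutral[THEN iffD1, rotated 3]) auto
    then show ?thesis by (intro has_sum_cmult_right) simp
  qed
  ultimately have "((\<lambda>n. fourier_coeff g n * fmode n y0 + - 1 * (if n = 0 then g y0 else 0)) has_sum
      ((\<Sum>\<^sub>\<infinity>n. fourier_coeff g n * fmode n y0) + - 1 * g y0)) UNIV"
    by (rule has_sum_add)
  then have "((\<lambda>n. fourier_coeff g n * fmode n y0 - (if n = 0 then g y0 else 0)) has_sum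
      ((\<Sum>\<^sub>\<infinity>n. fourier_coeff g n * fmode n y0) - g y0)) UNIV"
    by simp
  then have "((\<lambda>n. L (n - 1) - L n) has_sum ((\<Sum>\<^sub>\<infinity>n. fourier_coeff g n * fmode n y0) - g y0)) UNIV"
    unfolding L .
  from has_sum_int_symmetric_limit[OF this]
  have lim: "(\<lambda>N. L (- int N - 1) - L (int N)) \<longlonglongrightarrow> (\<Sum>\<^sub>\<infinity>n. fourier_coeff g n * fmode n y0) - g y0"
    unfolding sum_int_telescope .
  have L0: "(\<lambda>N. L (\<pi> N)) \<longlonglongrightarrow> 0" if "inj \<pi>" for \<pi> :: "nat \<Rightarrow> int"
  proof -
    have "(\<lambda>N. norm (L (\<pi> N))) \<longlonglongrightarrow> 0"
      using tendsto_norm_zero[OF fourier_coeff_tendsto_0[OF cK that]] by (simp add: L_def norm_mult)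
    then show ?thesis by (simp add: tendsto_norm_zero_iff)
  qed
  \<comment> \<open>Both boundary terms of the telescoping sum vanish by Riemann-Lebesgue for
    \<open>K\<close>.\<close>
  have "(\<lambda>N. L (- int N - 1) - L (int N)) \<longlonglongrightarrow> 0 - 0"
    by (intro tendsto_diff L0) (auto simp: inj_on_def)
  with lim have "(\<Sum>\<^sub>\<infinity>n. fourier_coeff g n * fmode n y0) - g y0 = 0" using LIMSEQ_unique by force
  then show ?thesis by simp
qed

section \<open>Sections of the line bundles as Schwartz functions\<close>

definition quasi_periodic :: "real \<Rightarrow> (real \<Rightarrow> real \<Rightarrow> complex) \<Rightarrow> bool" where
  "quasi_periodic P F \<longleftrightarrow> smooth F \<and> (\<forall>x y. F (x + P) y = exp (- \<i> * of_real y) * F x y) \<and>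
     (\<forall>x y. F x (y + 2 * pi) = F x y)"

text \<open>One coefficient is enough for a quasi-periodic function: its \<open>n\<close>-th
  coefficient at \<open>x\<close> is the zero mode at \<open>x + P * of_int n\<close>. This is the
  inverse of the Zak transform.\<close>

definition zero_mode :: "(real \<Rightarrow> real \<Rightarrow> complex) \<Rightarrow> real \<Rightarrow> complex" where
  "zero_mode F x = fourier_coeff (F x) 0"

lemma quasi_periodic_zak: "schwartz g \<Longrightarrow> \<bar>P\<bar> \<ge> 1 \<Longrightarrow> quasi_periodic P (zak P g)"
  by (simp add: quasi_periodic_def smooth_zak zak_shift_x zak_shift_y)

lemma vector_derivative_shift:
  "vector_derivative (\<lambda>u. g (u + c)) (at x) = vector_derivative g (at (x + c))" for g :: "real \<Rightarrow> complex"
proof -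
  have "((\<lambda>u. g (u + c)) has_vector_derivative d) (at x) \<longleftrightarrow> (g has_vector_derivative d) (at (x + c))" for d
  proof
    assume d: "((\<lambda>u. g (u + c)) has_vector_derivative d) (at x)"
    have "((\<lambda>u. u + - c) has_vector_derivative 1) (at (x + c))"
      by (auto intro!: derivative_eq_intros simp flip: has_real_derivative_iff_has_vector_derivative)
    from vector_diff_chain_at[OF this, of "\<lambda>u. g (u + c)" d] d
    show "(g has_vector_derivative d) (at (x + c))" by (simp add: o_def)
  next
    assume d: "(g has_vector_derivative d) (at (x + c))"
    have "((\<lambda>u. u + c) has_vector_derivative 1) (at x)"
      by (auto intro!: derivative_eq_intros simp flip: has_real_derivative_iff_has_vector_derivative)
    from vector_diff_chain_at[OF this d] show "((\<lambda>u. g (u + c)) has_vector_derivative d) (at x)" by (simp add: o_def)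
  qed
  then show ?thesis by (simp add: vector_derivative_def)
qed

lemma quasi_periodic_partial_x:
  assumes "quasi_periodic P F"
  shows "quasi_periodic P (partial_x F)"
proof -
  have F: "smooth F" "\<And>x y. F (x + P) y = exp (- \<i> * of_real y) * F x y" "\<And>x y. F x (y + 2 * pi) = F x y"
    using assms by (auto simp: quasi_periodic_def)
  note d = has_partialsD_x[OF smooth_has_partials[OF F(1)]]
  have "partial_x F (x + P) y = exp (- \<i> * of_real y) * partial_x F x y" for x y
  proof -
    have "partial_x F (x + P) y = vector_derivative (\<lambda>u. F (u + P) y) (at x)"
      by (simp add: partial_x_def vector_derivative_shift[of "\<lambda>u. F u y"])
    also have "\<dots> = exp (- \<i> * of_real y) * partial_x F x y"
      unfolding F(2) by (intro vector_derivative_at has_vector_derivative_mult_right d)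
    finally show ?thesis .
  qed
  moreover have "partial_x F x (y + 2 * pi) = partial_x F x y" for x y
    by (simp add: partial_x_def F(3))
  ultimately show ?thesis using smooth_partial_x[OF F(1)] by (simp add: quasi_periodic_def)
qed

lemma smooth_of_real_x: "smooth (\<lambda>x y. complex_of_real x)"
proof -
  let ?F = "{\<lambda>x y. of_real x, \<lambda>x y. 1, \<lambda>x y. 0 :: complex}"
  have "has_partials (\<lambda>x y. complex_of_real x) (\<lambda>x y. 1) (\<lambda>x y. 0)"
    unfolding has_partials_def
    by (auto simp: case_prod_unfold scaleR_conv_of_real intro!: derivative_eq_intros)
  then show ?thesis
    by (intro smooth_coinduct[where F = ?F]) (auto intro: has_partials_const)
qed

text \<open>The multiplier depends on \<open>y\<close>, so \<open>partial_y\<close> alone leaves the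
  class; the connection term \<open>\<i> / of_real P * of_real x\<close> absorbs the derivative of
  the multiplier.\<close>

lemma quasi_periodic_covariant_y:
  assumes "quasi_periodic P F" "P \<noteq> 0"
  shows "quasi_periodic P (\<lambda>x y. partial_y F x y + \<i> / of_real P * (of_real x * F x y))"
proof -
  have F: "smooth F" "\<And>x y. F (x + P) y = exp (- \<i> * of_real y) * F x y" "\<And>x y. F x (y + 2 * pi) = F x y"
    using assms by (auto simp: quasi_periodic_def)
  note d = has_partialsD_y[OF smooth_has_partials[OF F(1)]]
  have py: "partial_y F (x + P) y = exp (- \<i> * of_real y) * (partial_y F x y - \<i> * F x y)" for x y
  proof -
    have "((\<lambda>v. exp (- \<i> * complex_of_real v)) has_vector_derivative (- \<i> * exp (- \<i> * of_real y))) (at y)"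
      by (rule has_vector_derivative_real_field) (auto intro!: derivative_eq_intros)
    from has_vector_derivative_mult[OF this d[of x y]]
    have "((\<lambda>v. F (x + P) v) has_vector_derivative
        (exp (- \<i> * of_real y) * (partial_y F x y - \<i> * F x y))) (at y)"
      unfolding F(2) by (rule has_vector_derivative_eq_rhs) (simp add: algebra_simps)
    then show ?thesis unfolding partial_y_def by (rule vector_derivative_at)
  qed
  have "partial_y F (x + P) y + \<i> / of_real P * (of_real (x + P) * F (x + P) y) =
      exp (- \<i> * of_real y) * (partial_y F x y + \<i> / of_real P * (of_real x * F x y))" for x y
    unfolding F(2) py using assms(2) by (simp add: field_simps)
  moreover have "partial_y F x (y + 2 * pi) = partial_y F x y" for x y
    using vector_derivative_shift[of "F x" "2 * pi" y] by (simp add: partial_y_def F(3))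
  moreover have "smooth (\<lambda>x y. partial_y F x y + \<i> / of_real P * (of_real x * F x y))"
    by (intro smooth_add smooth_partial_y smooth_mult smooth_const smooth_of_real_x F)
  ultimately show ?thesis using F(3) by (simp add: quasi_periodic_def)
qed

lemma continuous_slice_y: "smooth F \<Longrightarrow> continuous_on A (F x)"
proof -
  assume F: "smooth F"
  have "continuous_on A (\<lambda>y. (x, y))" by (intro continuous_intros)
  from continuous_on_compose2[OF smooth_continuous[OF F] this] show ?thesis by simp
qed

lemma quasi_periodic_shift:
  assumes "quasi_periodic P F" "P \<noteq> 0"
  shows "F (x + P * of_int n) y = fmode (- n) y * F x y"
proof -
  \<comment> \<open>Twisting by this exponential turns quasi-periodicity into honest periodicity in
    \<open>x\<close>, with \<open>y\<close> fixed.\<close>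
  define G where "G = (\<lambda>x. F x y * exp (\<i> * of_real x * of_real y / of_real P))"
  interpret G: periodic_fun_simple G P
    using assms by unfold_locales
      (simp add: G_def quasi_periodic_def add_divide_distrib algebra_simps exp_add exp_minus)
  have "exp (\<i> * of_real (x + of_int n * P) * of_real y / of_real P) = fmode n y * exp (\<i> * of_real x * of_real y / of_real P)"
    using assms(2) by (simp add: exp_add[symmetric] field_simps)
  with G.plus_of_int[of x n] have "F (x + of_int n * P) y * fmode n y = F x y"
    by (simp add: G_def)
  then have "F (x + of_int n * P) y * (fmode n y * fmode (- n) y) = F x y * fmode (- n) y"
    by (metis mult.assoc)
  then show ?thesis unfolding fmode_mult_minus by (simp add: mult.commute)
qed

lemma quasi_periodic_bounded:
  assumes "quasi_periodic P F" "P > 0"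
  obtains B where "\<And>x y. norm (F x y) \<le> B"
proof -
  have "compact ((\<lambda>(x, y). F x y) ` ({0..P} \<times> {0..2 * pi}))"
    using assms by (intro compact_continuous_image compact_Times continuous_on_subset[OF smooth_continuous])
      (auto simp: quasi_periodic_def)
  then obtain B where "\<forall>z\<in>(\<lambda>(x, y). F x y) ` ({0..P} \<times> {0..2 * pi}). norm z \<le> B"
    using compact_imp_bounded bounded_iff by metis
  then have B: "\<And>x y. x \<in> {0..P} \<Longrightarrow> y \<in> {0..2 * pi} \<Longrightarrow> norm (F x y) \<le> B" by auto
  have "norm (F x y) \<le> B" for x y
  proof -
    define m where "m = \<lfloor>x / P\<rfloor>"
    define n where "n = \<lfloor>y / (2 * pi)\<rfloor>"
    have "of_int m * P \<le> x" "x \<le> of_int m * P + P"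
      using assms(2) floor_divide_lower[of P x] floor_divide_upper[of P x] by (simp_all add: m_def algebra_simps)
    then have x: "x + P * of_int (- m) \<in> {0..P}" by (simp add: algebra_simps)
    have "of_int n * (2 * pi) \<le> y" "y \<le> of_int n * (2 * pi) + 2 * pi"
      using floor_divide_lower[of "2 * pi" y] floor_divide_upper[of "2 * pi" y] by (simp_all add: n_def algebra_simps)
    then have y: "y + of_int (- n) * (2 * pi) \<in> {0..2 * pi}" by simp
    interpret G: periodic_fun_simple "\<lambda>y. F w y" "2 * pi" for w
      using assms by unfold_locales (simp add: quasi_periodic_def)
    have "norm (F x y) = norm (F (x + P * of_int (- m)) (y + of_int (- n) * (2 * pi)))"
      unfolding quasi_periodic_shift[OF assms(1) less_imp_neq[OF assms(2), symmetric]] G.plus_of_int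
      by (simp add: norm_mult)
    also have "\<dots> \<le> B" using B x y by blast
    finally show ?thesis .
  qed
  then show ?thesis by (rule that)
qed

section \<open>Smoothness and decay of the zero mode\<close>

lemma zero_mode_has_vector_derivative:
  assumes "smooth F"
  shows "(zero_mode F has_vector_derivative zero_mode (partial_x F) x) (at x)"
proof -
  have "((\<lambda>x. integral (cbox 0 (2 * pi)) (F x)) has_vector_derivative integral (cbox 0 (2 * pi)) (partial_x F x)) (at x within UNIV)"
  proof (rule leibniz_rule_vector_derivative)
    show "((\<lambda>x. F x t) has_vector_derivative partial_x F x t) (at x within UNIV)" for x t
      using has_partialsD_x[OF smooth_has_partials[OF assms]] by simp
    show "F x integrable_on cbox 0 (2 * pi)" for x
      by (intro integrable_continuous continuous_slice_y assms)
    show "continuous_on (UNIV \<times> cbox 0 (2 * pi)) (\<lambda>(x, t). partial_x F x t)"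
      by (rule continuous_on_subset[OF smooth_continuous[OF smooth_partial_x[OF assms]]]) simp
  qed auto
  from has_vector_derivative_mult_right[OF this, of "1 / (2 * pi)"]
  have "((\<lambda>x. complex_of_real (1 / (2 * pi)) * integral (cbox 0 (2 * pi)) (F x)) has_vector_derivative
      complex_of_real (1 / (2 * pi)) * integral (cbox 0 (2 * pi)) (partial_x F x)) (at x)" by simp
  moreover have "zero_mode G = (\<lambda>x. complex_of_real (1 / (2 * pi)) * integral (cbox 0 (2 * pi)) (G x))" for G
    by (simp add: fun_eq_iff zero_mode_def fourier_coeff_def)
  ultimately show ?thesis by (simp only:)
qed

text \<open>The integral of \<open>partial_y F\<close> over a period is 0, so on zero modes the
  covariant derivative is multiplication by \<open>x\<close> up to a constant.\<close>

lemma zero_mode_covariant_y: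
  assumes "quasi_periodic P F" "P \<noteq> 0"
  shows "of_real x * zero_mode F x =
    - \<i> * of_real P * zero_mode (\<lambda>x y. partial_y F x y + \<i> / of_real P * (of_real x * F x y)) x"
proof -
  have F: "smooth F" "F x (0 + 2 * pi) = F x 0"
    using assms(1) unfolding quasi_periodic_def by blast+
  have "(partial_y F x has_integral (F x (2 * pi) - F x 0)) {0..2 * pi}"
    using has_partialsD_y[OF smooth_has_partials[OF F(1)]]
    by (intro fundamental_theorem_of_calculus) (auto intro: has_vector_derivative_at_within)
  then have "fourier_coeff (partial_y F x) 0 = 0"
    using F(2) by (simp add: fourier_coeff_def integral_unique)
  then have "zero_mode (\<lambda>x y. partial_y F x y + \<i> / of_real P * (of_real x * F x y)) x =
      \<i> / of_real P * (of_real x * zero_mode F x)"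
  proof -
    have "fourier_coeff (\<lambda>y. partial_y F x y + \<i> / of_real P * (of_real x * F x y)) 0 =
        fourier_coeff (partial_y F x) 0 + fourier_coeff (\<lambda>y. \<i> / of_real P * (of_real x * F x y)) 0"
      using assms(2) by (intro fourier_coeff_add continuous_intros continuous_slice_y smooth_partial_y F) auto
    then show ?thesis
      unfolding zero_mode_def fourier_coeff_cmult \<open>fourier_coeff (partial_y F x) 0 = 0\<close> by simp
  qed
  then show ?thesis using assms(2) by simp
qed

lemma norm_zero_mode_le:
  assumes "smooth F" "\<And>y. norm (F x y) \<le> B"
  shows "norm (zero_mode F x) \<le> B"
proof -
  have "norm (integral {0..2 * pi} (F x)) \<le> B * (2 * pi - 0)"
    by (intro integral_bound continuous_slice_y assms) auto
  then show ?thesis by (simp add: zero_mode_def fourier_coeff_def norm_divide field_simps)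
qed

text \<open>Quasi-periodic functions are bounded, hence so are their zero modes. Each covariant
  derivative stays in the class and accounts for one more factor \<open>x\<close>, which drives the
  induction on the power.\<close>

lemma rapid_zero_mode:
  assumes "quasi_periodic P F" "P > 0"
  shows "rapid (zero_mode F)"
proof (rule rapidI)
  fix k
  show "\<exists>C. \<forall>x. norm (zero_mode F x) * (1 + \<bar>x\<bar>) ^ k \<le> C"
    using assms(1)
  proof (induction k arbitrary: F)
    case 0
    obtain B where B: "\<And>x y. norm (F x y) \<le> B" using quasi_periodic_bounded[OF 0 assms(2)] by metis
    have "smooth F" using 0 by (simp add: quasi_periodic_def)
    then show ?case using norm_zero_mode_le[OF _ B] by (intro exI[of _ B]) simp
  next
    case (Suc k)
    define DF where "DF = (\<lambda>x y. partial_y F x y + \<i> / of_real P * (of_real x * F x y))"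
    have DF: "quasi_periodic P DF" unfolding DF_def using Suc.prems assms(2) by (intro quasi_periodic_covariant_y) auto
    obtain C where C: "\<And>x. norm (zero_mode F x) * (1 + \<bar>x\<bar>) ^ k \<le> C" using Suc.IH[OF Suc.prems] by blast
    obtain D where D: "\<And>x. norm (zero_mode DF x) * (1 + \<bar>x\<bar>) ^ k \<le> D" using Suc.IH[OF DF] by blast
    have "norm (zero_mode F x) * (1 + \<bar>x\<bar>) ^ Suc k \<le> C + P * D" for x
    proof -
      have "norm (of_real x * zero_mode F x) = P * norm (zero_mode DF x)"
        using zero_mode_covariant_y[OF Suc.prems, of x] assms(2) by (simp add: DF_def norm_mult)
      then have "\<bar>x\<bar> * norm (zero_mode F x) = P * norm (zero_mode DF x)" by (simp add: norm_mult)
      then have "norm (zero_mode F x) * (1 + \<bar>x\<bar>) ^ Suc k =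
          norm (zero_mode F x) * (1 + \<bar>x\<bar>) ^ k + P * (norm (zero_mode DF x) * (1 + \<bar>x\<bar>) ^ k)"
        by (simp add: algebra_simps)
      also have "\<dots> \<le> C + P * D" using C D assms(2) by (intro add_mono mult_left_mono) auto
      finally show ?thesis .
    qed
    then show ?case by blast
  qed
qed

lemma schwartz_zero_mode:
  assumes "quasi_periodic P F" "P > 0"
  shows "schwartz (zero_mode F)"
proof (rule schwartz_coinduct[where F = "{zero_mode F |F. quasi_periodic P F}"])
  fix f assume "f \<in> {zero_mode F |F. quasi_periodic P F}"
  then obtain F where F: "f = zero_mode F" "quasi_periodic P F" by blast
  then show "rapid f" using rapid_zero_mode assms(2) by blast
  have "smooth F" using F(2) by (simp add: quasi_periodic_def)
  with F show "\<exists>f'\<in>{zero_mode F |F. quasi_periodic P F}. \<forall>x. (f has_vector_derivative f' x) (at x)"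
    using zero_mode_has_vector_derivative quasi_periodic_partial_x by blast
qed (use assms(1) in blast)

text \<open>For fixed \<open>x\<close> this is Fourier inversion in \<open>y\<close>;
  quasi-periodicity identifies the coefficients, and rapid decay of the zero mode makes them
  summable.\<close>

lemma zak_zero_mode:
  assumes "quasi_periodic P F" "P \<ge> 1"
  shows "F = zak P (zero_mode F)"
proof (intro ext)
  fix x y
  have F: "smooth F" "\<And>y. F x (y + 2 * pi) = F x y"
    using assms(1) unfolding quasi_periodic_def by blast+
  have P: "P \<noteq> 0" "P > 0" "\<bar>P\<bar> \<ge> 1" using assms(2) by auto
  have c: "fourier_coeff (F x) n = zero_mode F (x + P * of_int n)" for n
    unfolding zero_mode_def fourier_coeff_def quasi_periodic_shift[OF assms(1) P(1)] by (simp add: mult.commute)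
  have "F x y = (\<Sum>\<^sub>\<infinity>n. fourier_coeff (F x) n * fmode n y)"
  proof (rule fourier_inversion[where g = "F x"])
    show "F x (y + 2 * pi) = F x y" for y by (rule F(2))
    show "(F x has_vector_derivative partial_y F x y) (at y)"
      by (rule has_partialsD_y[OF smooth_has_partials[OF F(1)]])
    show "(\<lambda>n. norm (fourier_coeff (F x) n)) summable_on UNIV"
      using rapid_lattice_summable[OF rapid_zero_mode[OF assms(1) P(2)] P(3), of 0 x] by (simp add: c)
  qed (rule continuous_slice_y[OF F(1)])
  then show "F x y = zak P (zero_mode F) x y" by (simp add: c zak_def)
qed

text \<open>In the \<open>n\<close>-th mode, \<open>- partial_y\<close> contributes
  \<open>- \<i> * of_int n\<close>, while translating \<open>x\<close> by
  \<open>P * of_int n\<close> changes the affine coefficient by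
  \<open>a * of_real P * of_int n\<close>. The condition on \<open>a\<close> makes the two equal, so
  every mode satisfies a translate of one ordinary differential equation.\<close>

lemma zak_ode:
  fixes a b \<tau> :: complex
  assumes f: "schwartz f" "\<And>x. (f has_vector_derivative f' x) (at x)" "schwartz f'"
    and ode: "\<And>x. \<tau> * f' x + (a * of_real x + b) * f x = R x" and P: "\<bar>P\<bar> \<ge> 1" and a: "a * of_real P = - \<i>"
  shows "\<tau> * partial_x (zak P f) x y - partial_y (zak P f) x y + (a * of_real x + b) * zak P f x y = zak P R x y"
proof -
  have hp: "has_partials (zak P f) (zak P f') (zakk 1 P f)"
    using has_partials_zakk[OF schwartz_rapid[OF f(1)] schwartz_rapid[OF f(3)] f(2) P, of 0] by (simp add: zakk_0)
  have 1: "((\<lambda>n. f' (x + P * of_int n) * fmode n y) has_sum zak P f' x y) UNIV"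
    unfolding zak_def by (intro has_sum_infsum abs_summable_summable[OF zak_summable0[OF schwartz_rapid[OF f(3)] P]])
  have 2: "((\<lambda>n. (\<i> * of_int n) ^ 1 * f (x + P * of_int n) * fmode n y) has_sum zakk 1 P f x y) UNIV"
    unfolding zakk_def by (intro has_sum_infsum abs_summable_summable[OF zak_summable[OF schwartz_rapid[OF f(1)] P]])
  have 3: "((\<lambda>n. f (x + P * of_int n) * fmode n y) has_sum zak P f x y) UNIV"
    unfolding zak_def by (intro has_sum_infsum abs_summable_summable[OF zak_summable0[OF schwartz_rapid[OF f(1)] P]])
  have "((\<lambda>n. \<tau> * (f' (x + P * of_int n) * fmode n y) + - 1 * ((\<i> * of_int n) ^ 1 * f (x + P * of_int n) * fmode n y) +
      (a * of_real x + b) * (f (x + P * of_int n) * fmode n y)) has_sum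
      (\<tau> * zak P f' x y + - 1 * zakk 1 P f x y + (a * of_real x + b) * zak P f x y)) UNIV"
    by (intro has_sum_add has_sum_cmult_right 1 2 3)
  moreover have "\<tau> * (f' (x + P * of_int n) * fmode n y) + - 1 * ((\<i> * of_int n) ^ 1 * f (x + P * of_int n) * fmode n y) +
      (a * of_real x + b) * (f (x + P * of_int n) * fmode n y) = R (x + P * of_int n) * fmode n y" for n
  proof -
    have "a * of_real (x + P * of_int n) = a * of_real x + (a * of_real P) * of_int n" by (simp add: algebra_simps)
    then have *: "\<tau> * f' (x + P * of_int n) =
        R (x + P * of_int n) + \<i> * of_int n * f (x + P * of_int n) - (a * of_real x + b) * f (x + P * of_int n)"
      unfolding a using ode[of "x + P * of_int n", symmetric] by (simp only:) (simp add: algebra_simps)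
    show ?thesis by (simp only: mult.assoc[symmetric] *) (simp add: algebra_simps)
  qed
  ultimately have "((\<lambda>n. R (x + P * of_int n) * fmode n y) has_sum
      (\<tau> * zak P f' x y + - 1 * zakk 1 P f x y + (a * of_real x + b) * zak P f x y)) UNIV" by simp
  then have "zak P R x y = \<tau> * zak P f' x y + - 1 * zakk 1 P f x y + (a * of_real x + b) * zak P f x y"
    unfolding zak_def[of P R] by (rule infsumI)
  then show ?thesis by (simp add: has_partials_partial_x[OF hp] has_partials_partial_y[OF hp])
qed

section \<open>Antiderivatives of integrable functions\<close>

lemma LINT_atMost_has_vector_derivative:
  fixes f :: "real \<Rightarrow> complex"
  assumes cont: "continuous_on UNIV f" and int: "integrable lborel f"
  shows "((\<lambda>x. LINT r:{..x}|lborel. f r) has_vector_derivative f x) (at x)"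
proof -
  \<comment> \<open>A base point to the left of \<open>x\<close> splits off a constant and leaves a
    compact interval for the fundamental theorem of calculus.\<close>
  let ?a = "x - 1"
  have si: "set_integrable lborel A f" if "A \<in> sets borel" for A
    using int that unfolding set_integrable_def by (intro integrable_mult_indicator) auto
  have eq: "(LINT r:{..u}|lborel. f r) = (LINT r:{..<?a}|lborel. f r) + integral {?a..u} f" if "u \<ge> ?a" for u
  proof -
    have "{..u} = {..<?a} \<union> {?a..u}" using that by auto
    moreover have "(LINT r:{..<?a} \<union> {?a..u}|lborel. f r) = (LINT r:{..<?a}|lborel. f r) + (LINT r:{?a..u}|lborel. f r)"
      by (intro set_integral_Un si) auto
    ultimately have "(LINT r:{..u}|lborel. f r) = (LINT r:{..<?a}|lborel. f r) + (LINT r:{?a..u}|lborel. f r)" by simp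
    also have "(LINT r:{?a..u}|lborel. f r) = integral {?a..u} f"
      by (rule set_borel_integral_eq_integral(2)) (rule si, simp)
    finally show ?thesis .
  qed
  have "((\<lambda>u. integral {?a..u} f) has_vector_derivative f x) (at x within {?a..x + 1})"
    by (rule integral_has_vector_derivative) (auto intro: continuous_on_subset[OF cont])
  then have "((\<lambda>u. integral {?a..u} f) has_vector_derivative f x) (at x)"
    by (simp add: at_within_Icc_at)
  then have "((\<lambda>u. (LINT r:{..<?a}|lborel. f r) + integral {?a..u} f) has_vector_derivative 0 + f x) (at x)"
    by (intro has_vector_derivative_add has_vector_derivative_const)
  then have "((\<lambda>u. (LINT r:{..<?a}|lborel. f r) + integral {?a..u} f) has_vector_derivative f x) (at x)" by simp
  then show ?thesis
    by (rule has_vector_derivative_transform_within_open[of _ _ _ "{?a<..}"]) (auto simp: eq)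
qed

lemma LINT_atMost_at_top:
  fixes f :: "real \<Rightarrow> complex"
  assumes "integrable lborel f"
  shows "((\<lambda>x. LINT r:{..x}|lborel. f r) \<longlongrightarrow> (LINT r|lborel. f r)) at_top"
  unfolding set_lebesgue_integral_def
proof (rule integral_dominated_convergence_at_top[where w = "\<lambda>r. norm (f r)"])
  show "AE x in lborel. ((\<lambda>i. indicator {..i} x *\<^sub>R f x) \<longlongrightarrow> f x) at_top"
  proof (rule AE_I2)
    fix x
    have "eventually (\<lambda>i. indicator {..i} x *\<^sub>R f x = f x) at_top"
      using eventually_ge_at_top[of x] by eventually_elim simp
    then show "((\<lambda>i. indicator {..i} x *\<^sub>R f x) \<longlongrightarrow> f x) at_top" by (rule tendsto_eventually)
  qed
qed (use assms in \<open>auto simp: indicator_def intro!: always_eventually\<close>)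

lemma LINT_atMost_at_bot:
  fixes f :: "real \<Rightarrow> complex"
  assumes "integrable lborel f"
  shows "((\<lambda>x. LINT r:{..x}|lborel. f r) \<longlongrightarrow> 0) at_bot"
  unfolding filterlim_at_bot_mirror
proof -
  have "((\<lambda>x. integral\<^sup>L lborel (\<lambda>r. indicator {..- x} r *\<^sub>R f r)) \<longlongrightarrow> (LINT (r::real)|lborel. (0::complex))) at_top"
  proof (rule integral_dominated_convergence_at_top[where w = "\<lambda>r. norm (f r)"])
    show "AE x in lborel. ((\<lambda>i. indicator {..- i} x *\<^sub>R f x) \<longlongrightarrow> 0) at_top"
    proof (rule AE_I2)
      fix x
      have "eventually (\<lambda>i. indicator {..- i} x *\<^sub>R f x = 0) at_top"
        using eventually_gt_at_top[of "- x"] by eventually_elim simp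
      then show "((\<lambda>i. indicator {..- i} x *\<^sub>R f x) \<longlongrightarrow> 0) at_top" by (rule tendsto_eventually)
    qed
  qed (use assms in \<open>auto simp: indicator_def intro!: always_eventually\<close>)
  then show "((\<lambda>x. LINT r:{..- x}|lborel. f r) \<longlongrightarrow> 0) at_top"
    by (simp add: set_lebesgue_integral_def)
qed

lemma integrable_rapid:
  assumes "rapid g" "continuous_on UNIV g"
  shows "integrable lborel g"
proof -
  obtain C where C: "\<And>x. norm (g x) * (1 + \<bar>x\<bar>) ^ 2 \<le> C" using rapidE[OF assms(1)] by metis
  have "integrable lborel (\<lambda>x::real. 1 / (1 + x\<^sup>2))"
    using integrable_inverse_1_plus_square by (simp add: set_integrable_def inverse_eq_divide)
  then have "integrable lborel (\<lambda>x::real. C * (1 / (1 + x\<^sup>2)))" by (rule integrable_mult_right)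
  then show ?thesis
  proof (rule Bochner_Integration.integrable_bound)
    show "g \<in> borel_measurable lborel" using borel_measurable_continuous_onI[OF assms(2)] by simp
    show "AE x in lborel. norm (g x) \<le> norm (C * (1 / (1 + x\<^sup>2)))"
    proof (rule AE_I2)
      fix x :: real
      have "norm (g x) * (1 + x\<^sup>2) \<le> norm (g x) * (1 + \<bar>x\<bar>) ^ 2"
        by (intro mult_left_mono) (auto simp: power2_eq_square algebra_simps)
      also have "\<dots> \<le> C" by (rule C)
      finally have "norm (g x) \<le> C / (1 + x\<^sup>2)" by (simp add: pos_le_divide_eq add_pos_nonneg)
      also have "\<dots> \<le> \<bar>C\<bar> / (1 + x\<^sup>2)" by (intro divide_right_mono) auto
      finally show "norm (g x) \<le> norm (C * (1 / (1 + x\<^sup>2)))" by simp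
    qed
  qed
qed

section \<open>Holomorphic bundle maps\<close>

text \<open>The factor 2 of the operators is included, so this is the scalar first order part of
  \<open>hol_op\<close>.\<close>

definition dbar_coeff :: "complex \<Rightarrow> (real \<Rightarrow> real \<Rightarrow> complex) \<Rightarrow> real \<Rightarrow> real \<Rightarrow> complex" where
  "dbar_coeff \<tau> f x y = 2 / (\<tau> - cnj \<tau>) * (\<tau> * partial_x f x y - partial_y f x y)"

lemma dbar_coeff_mult:
  assumes "smooth f" "smooth g"
  shows "dbar_coeff \<tau> (\<lambda>x y. f x y * g x y) x y = f x y * dbar_coeff \<tau> g x y + dbar_coeff \<tau> f x y * g x y"
  by (simp add: dbar_coeff_def partial_mult[OF assms] algebra_simps)

lemma dbar_coeff_sum:
  assumes "\<And>i. i \<in> I \<Longrightarrow> smooth (f i)" "finite I"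
  shows "dbar_coeff \<tau> (\<lambda>x y. \<Sum>i\<in>I. f i x y) x y = (\<Sum>i\<in>I. dbar_coeff \<tau> (f i) x y)"
  by (simp add: dbar_coeff_def partial_sum[OF assms] sum_distrib_left sum_subtractf right_diff_distrib)

lemma hol_op_nth:
  assumes "smooth f"
  shows "hol_op \<tau> E f x y $ i = dbar_coeff \<tau> (\<lambda>x y. f x y $ i) x y + (\<Sum>k\<in>UNIV. conn E x y $ i $ k * f x y $ k)"
  by (simp add: hol_op_def dbar_def dbar_coeff_def partial_vec_nth[OF assms] matrix_vector_mult_def right_diff_distrib diff_divide_distrib)

lemma smooth_matrix_vector:
  fixes \<Phi> :: "real \<Rightarrow> real \<Rightarrow> complex^'n::finite^'m::finite"
  assumes "smooth \<Phi>" "smooth f"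
  shows "smooth (\<lambda>x y. \<Phi> x y *v f x y)"
  by (rule smooth_vecI)
    (auto simp: matrix_vector_mult_def intro!: smooth_sum smooth_mult smooth_vec_nth[OF smooth_vec_nth] smooth_vec_nth assms)

text \<open>By the Leibniz rule the derivatives of \<open>f\<close> cancel, leaving a matrix of
  zeroth order applied to \<open>f\<close>. Holomorphy thus becomes an identity of matrix entries,
  as used in \<open>holomorphic_mapI\<close>.\<close>

lemma hol_op_commutator:
  fixes \<Phi> :: "real \<Rightarrow> real \<Rightarrow> complex^'n::finite^'m::finite"
  assumes "smooth \<Phi>" "smooth f"
  shows "(hol_op \<tau> F (\<lambda>x y. \<Phi> x y *v f x y) x y - \<Phi> x y *v hol_op \<tau> E f x y) $ i =
    (\<Sum>j\<in>UNIV. (dbar_coeff \<tau> (\<lambda>x y. \<Phi> x y $ i $ j) x y +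
       (conn F x y ** \<Phi> x y) $ i $ j - (\<Phi> x y ** conn E x y) $ i $ j) * f x y $ j)"
proof -
  note s = smooth_vec_nth[OF smooth_vec_nth[OF assms(1)]] smooth_vec_nth[OF assms(2)]
  have 1: "dbar_coeff \<tau> (\<lambda>x y. (\<Phi> x y *v f x y) $ i) x y =
      (\<Sum>j\<in>UNIV. \<Phi> x y $ i $ j * dbar_coeff \<tau> (\<lambda>x y. f x y $ j) x y + dbar_coeff \<tau> (\<lambda>x y. \<Phi> x y $ i $ j) x y * f x y $ j)"
    unfolding matrix_vector_mult_def vec_lambda_beta
    by (subst dbar_coeff_sum) (auto intro: smooth_mult s simp: dbar_coeff_mult s)
  have 2: "(\<Sum>k\<in>UNIV. conn F x y $ i $ k * (\<Phi> x y *v f x y) $ k) = (\<Sum>j\<in>UNIV. (conn F x y ** \<Phi> x y) $ i $ j * f x y $ j)"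
    unfolding matrix_vector_mult_def matrix_matrix_mult_def vec_lambda_beta sum_distrib_left sum_distrib_right
    by (subst sum.swap) (simp add: mult.assoc)
  have 3: "(\<Phi> x y *v hol_op \<tau> E f x y) $ i =
      (\<Sum>j\<in>UNIV. \<Phi> x y $ i $ j * dbar_coeff \<tau> (\<lambda>x y. f x y $ j) x y) + (\<Sum>j\<in>UNIV. (\<Phi> x y ** conn E x y) $ i $ j * f x y $ j)"
    unfolding matrix_vector_mult_def[of "\<Phi> x y"] matrix_matrix_mult_def vec_lambda_beta hol_op_nth[OF assms(2)]
      sum_distrib_right distrib_left sum_distrib_left sum.distrib
    by (rule arg_cong[where f = "\<lambda>w. _ + w"], subst sum.swap) (simp add: mult.assoc)
  show ?thesis
    unfolding vector_minus_component hol_op_nth[OF smooth_matrix_vector[OF assms]] 1 2 3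
    by (simp add: sum.distrib sum_subtractf algebra_simps)
qed

lemma holomorphic_mapI:
  fixes \<Phi> :: "real \<Rightarrow> real \<Rightarrow> complex^'n::finite^'m::finite"
  assumes "bundle_map E F \<Phi>"
    and "\<And>i j x y. dbar_coeff \<tau> (\<lambda>x y. \<Phi> x y $ i $ j) x y +
       (conn F x y ** \<Phi> x y) $ i $ j - (\<Phi> x y ** conn E x y) $ i $ j = 0"
  shows "holomorphic_map \<tau> E F \<Phi>"
  unfolding holomorphic_map_def
proof (intro conjI allI impI assms(1))
  fix f x y assume "smooth_section E f"
  then show "hol_op \<tau> F (\<lambda>x y. \<Phi> x y *v f x y) x y - \<Phi> x y *v hol_op \<tau> E f x y = 0"
    using assms(1) by (simp add: vec_eq_iff hol_op_commutator smooth_section_def bundle_map_def assms(2) del: vector_minus_component)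
qed

lemma bundle_map_section:
  assumes "bundle_map E F \<Phi>" "smooth_section E f"
  shows "smooth_section F (\<lambda>x y. \<Phi> x y *v f x y)"
  using assms unfolding bundle_map_def smooth_section_def
  by (simp add: smooth_matrix_vector matrix_vector_mul_assoc)

lemma holomorphic_map_compose:
  fixes \<Phi> :: "real \<Rightarrow> real \<Rightarrow> complex^'n::finite^'m::finite" and \<Psi> :: "real \<Rightarrow> real \<Rightarrow> complex^'m^'k::finite"
  assumes "holomorphic_map \<tau> E F \<Phi>" "holomorphic_map \<tau> F G \<Psi>"
  shows "holomorphic_map \<tau> E G (\<lambda>x y. \<Psi> x y ** \<Phi> x y)"
proof -
  have b: "bundle_map E F \<Phi>" "bundle_map F G \<Psi>" using assms by (auto simp: holomorphic_map_def)
  have "smooth (\<lambda>x y. \<Psi> x y ** \<Phi> x y)"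
    using b unfolding bundle_map_def
    by (intro smooth_vecI)
      (auto simp: matrix_matrix_mult_def intro!: smooth_sum smooth_mult smooth_vec_nth[OF smooth_vec_nth])
  moreover have "\<Psi> (x + 2 * pi) y ** \<Phi> (x + 2 * pi) y ** trans_x E x y = trans_x G x y ** (\<Psi> x y ** \<Phi> x y)"
    "\<Psi> x (y + 2 * pi) ** \<Phi> x (y + 2 * pi) ** trans_y E x y = trans_y G x y ** (\<Psi> x y ** \<Phi> x y)" for x y
    using b unfolding bundle_map_def by (metis matrix_mul_assoc)+
  ultimately have "bundle_map E G (\<lambda>x y. \<Psi> x y ** \<Phi> x y)" by (simp add: bundle_map_def)
  moreover have "hol_op \<tau> G (\<lambda>x y. (\<Psi> x y ** \<Phi> x y) *v f x y) x y - (\<Psi> x y ** \<Phi> x y) *v hol_op \<tau> E f x y = 0"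
    if f: "smooth_section E f" for f x y
  proof -
    have "hol_op \<tau> G (\<lambda>x y. \<Psi> x y *v (\<Phi> x y *v f x y)) x y = \<Psi> x y *v hol_op \<tau> F (\<lambda>x y. \<Phi> x y *v f x y) x y"
      using assms(2) bundle_map_section[OF b(1) f] unfolding holomorphic_map_def by simp
    also have "hol_op \<tau> F (\<lambda>x y. \<Phi> x y *v f x y) x y = \<Phi> x y *v hol_op \<tau> E f x y"
      using assms(1) f unfolding holomorphic_map_def by simp
    finally show ?thesis by (simp add: matrix_vector_mul_assoc)
  qed
  ultimately show ?thesis by (simp add: holomorphic_map_def)
qed

text \<open>Transition laws and operators are conjugated by the invertible matrix, so smoothness is
  the only analytic demand on the inverse.\<close>

lemma holomorphic_map_inverse:
  fixes \<Phi> :: "real \<Rightarrow> real \<Rightarrow> complex^'n::finite^'m::finite" and \<Psi> :: "real \<Rightarrow> real \<Rightarrow> complex^'m^'n"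
  assumes \<Phi>: "holomorphic_map \<tau> E F \<Phi>" and \<Psi>: "smooth \<Psi>"
    and inv: "\<And>x y. \<Psi> x y ** \<Phi> x y = mat 1" "\<And>x y. \<Phi> x y ** \<Psi> x y = mat 1"
  shows "holomorphic_map \<tau> F E \<Psi>"
proof -
  have b: "bundle_map E F \<Phi>" using \<Phi> by (simp add: holomorphic_map_def)
  have tr: "\<Psi>' ** A = B ** \<Psi>0" if "\<Phi>' ** B = A ** \<Phi>0" "\<Phi>0 ** \<Psi>0 = mat 1" "\<Psi>' ** \<Phi>' = mat 1"
    for A \<Phi>' \<Psi>0 \<Psi>' B \<Phi>0 by (metis that matrix_mul_assoc matrix_mul_lid matrix_mul_rid)
  have b': "bundle_map F E \<Psi>"
    using \<Psi> b inv unfolding bundle_map_def by (blast intro: tr)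
  moreover have "hol_op \<tau> E (\<lambda>x y. \<Psi> x y *v f x y) x y - \<Psi> x y *v hol_op \<tau> F f x y = 0"
    if f: "smooth_section F f" for f x y
  proof -
    have "hol_op \<tau> F (\<lambda>x y. \<Phi> x y *v (\<Psi> x y *v f x y)) x y = \<Phi> x y *v hol_op \<tau> E (\<lambda>x y. \<Psi> x y *v f x y) x y"
      using \<Phi> bundle_map_section[OF b' f] unfolding holomorphic_map_def by simp
    then have "\<Psi> x y *v hol_op \<tau> F f x y = \<Psi> x y *v (\<Phi> x y *v hol_op \<tau> E (\<lambda>x y. \<Psi> x y *v f x y) x y)"
      by (simp add: matrix_vector_mul_assoc inv)
    then show ?thesis by (simp add: matrix_vector_mul_assoc inv)
  qed
  ultimately show ?thesis by (simp add: holomorphic_map_def)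
qed

lemma inverse_isosI:
  assumes "holomorphic_map \<tau> F E \<Psi>" "smooth \<Phi>"
    and "\<And>x y. \<Psi> x y ** \<Phi> x y = mat 1" "\<And>x y. \<Phi> x y ** \<Psi> x y = mat 1"
  shows "inverse_isos \<tau> E F \<Phi> \<Psi>"
  unfolding inverse_isos_def using assms holomorphic_map_inverse[OF assms(1,2) assms(4,3)] by blast

lemma hol_isomorphic_trans:
  assumes "hol_isomorphic \<tau> E F" "hol_isomorphic \<tau> F G"
  shows "hol_isomorphic \<tau> E G"
proof -
  obtain \<Phi> \<Psi> where 1: "inverse_isos \<tau> E F \<Phi> \<Psi>" using assms(1) by (auto simp: hol_isomorphic_def)
  obtain \<Phi>' \<Psi>' where 2: "inverse_isos \<tau> F G \<Phi>' \<Psi>'" using assms(2) by (auto simp: hol_isomorphic_def)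
  have "inverse_isos \<tau> E G (\<lambda>x y. \<Phi>' x y ** \<Phi> x y) (\<lambda>x y. \<Psi> x y ** \<Psi>' x y)"
    unfolding inverse_isos_def
  proof (intro conjI allI)
    show "holomorphic_map \<tau> E G (\<lambda>x y. \<Phi>' x y ** \<Phi> x y)" "holomorphic_map \<tau> G E (\<lambda>x y. \<Psi> x y ** \<Psi>' x y)"
      using 1 2 by (auto simp: inverse_isos_def intro: holomorphic_map_compose)
    fix x y
    show "\<Psi> x y ** \<Psi>' x y ** (\<Phi>' x y ** \<Phi> x y) = mat 1"
      using 1 2 unfolding inverse_isos_def by (metis matrix_mul_assoc matrix_mul_lid)
    show "\<Phi>' x y ** \<Phi> x y ** (\<Psi> x y ** \<Psi>' x y) = mat 1"
      using 1 2 unfolding inverse_isos_def by (metis matrix_mul_assoc matrix_mul_lid)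
  qed
  then show ?thesis by (auto simp: hol_isomorphic_def)
qed

section \<open>Bundle maps of rank two, entry by entry\<close>

lemma mat22_nth [simp]:
  "mat22 a b c d $ 1 $ 1 = a" "mat22 a b c d $ 1 $ 2 = b" "mat22 a b c d $ 2 $ 1 = c" "mat22 a b c d $ 2 $ 2 = d"
  by (simp_all add: mat22_def)

lemma mat22_eq_iff: "A = B \<longleftrightarrow> A $ 1 $ 1 = B $ 1 $ 1 \<and> A $ 1 $ 2 = B $ 1 $ 2 \<and> A $ 2 $ 1 = B $ 2 $ 1 \<and> A $ 2 $ 2 = B $ 2 $ 2"
  for A B :: "complex^2^2"
  by (auto simp: vec_eq_iff forall_2)

lemma mat_eq_mat22: "(mat c :: complex^2^2) = mat22 c 0 0 c"
  by (simp add: mat22_eq_iff mat_def)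

lemma mat22_mult: "mat22 a b c d ** mat22 a' b' c' d' =
    mat22 (a * a' + b * c') (a * b' + b * d') (c * a' + d * c') (c * b' + d * d')"
  by (simp add: mat22_eq_iff matrix_matrix_mult_def sum_2)

lemma smooth_mat22:
  assumes "smooth a" "smooth b" "smooth c" "smooth d"
  shows "smooth (\<lambda>x y. mat22 (a x y) (b x y) (c x y) (d x y))"
proof (rule smooth_vecI, rule smooth_vecI)
  fix i j :: 2
  show "smooth (\<lambda>x y. mat22 (a x y) (b x y) (c x y) (d x y) $ i $ j)"
    using exhaust_2[of i] exhaust_2[of j] assms by auto
qed

lemma holomorphic_map_mat22I:
  fixes E F :: "2 hbundle"
  assumes s: "smooth a" "smooth b" "smooth c" "smooth d"
    and tx: "\<And>x y. mat22 (a (x + 2 * pi) y) (b (x + 2 * pi) y) (c (x + 2 * pi) y) (d (x + 2 * pi) y) ** trans_x E x y =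
       trans_x F x y ** mat22 (a x y) (b x y) (c x y) (d x y)"
    and ty: "\<And>x y. mat22 (a x (y + 2 * pi)) (b x (y + 2 * pi)) (c x (y + 2 * pi)) (d x (y + 2 * pi)) ** trans_y E x y =
       trans_y F x y ** mat22 (a x y) (b x y) (c x y) (d x y)"
    and op: "\<And>x y. mat22 (dbar_coeff \<tau> a x y) (dbar_coeff \<tau> b x y) (dbar_coeff \<tau> c x y) (dbar_coeff \<tau> d x y) +
       conn F x y ** mat22 (a x y) (b x y) (c x y) (d x y) = mat22 (a x y) (b x y) (c x y) (d x y) ** conn E x y"
  shows "holomorphic_map \<tau> E F (\<lambda>x y. mat22 (a x y) (b x y) (c x y) (d x y))"
proof (rule holomorphic_mapI)
  show "bundle_map E F (\<lambda>x y. mat22 (a x y) (b x y) (c x y) (d x y))"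
    unfolding bundle_map_def using tx ty smooth_mat22[OF s] by blast
  fix i j :: 2 and x y
  have "dbar_coeff \<tau> (\<lambda>x y. mat22 (a x y) (b x y) (c x y) (d x y) $ i $ j) x y =
      mat22 (dbar_coeff \<tau> a x y) (dbar_coeff \<tau> b x y) (dbar_coeff \<tau> c x y) (dbar_coeff \<tau> d x y) $ i $ j"
    using exhaust_2[of i] exhaust_2[of j] by auto
  moreover have "(mat22 (dbar_coeff \<tau> a x y) (dbar_coeff \<tau> b x y) (dbar_coeff \<tau> c x y) (dbar_coeff \<tau> d x y) +
       conn F x y ** mat22 (a x y) (b x y) (c x y) (d x y)) $ i $ j =
       (mat22 (a x y) (b x y) (c x y) (d x y) ** conn E x y) $ i $ j"
    by (simp only: op)
  ultimately show "dbar_coeff \<tau> (\<lambda>x y. mat22 (a x y) (b x y) (c x y) (d x y) $ i $ j) x y +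
       (conn F x y ** mat22 (a x y) (b x y) (c x y) (d x y)) $ i $ j -
       (mat22 (a x y) (b x y) (c x y) (d x y) ** conn E x y) $ i $ j = 0"
    by (simp only: vector_add_component right_minus_eq)
qed

section \<open>Jacobi's identity for the cube of the Euler product\<close>

text \<open>Gaussian binomial coefficients, defined by the Pascal recursion to avoid
  division.\<close>

fun qbinom :: "complex \<Rightarrow> nat \<Rightarrow> nat \<Rightarrow> complex" where
  "qbinom Q n 0 = 1"
| "qbinom Q 0 (Suc k) = 0"
| "qbinom Q (Suc n) (Suc k) = qbinom Q n (Suc k) + Q ^ (n - k) * qbinom Q n k"

definition qfact :: "complex \<Rightarrow> nat \<Rightarrow> complex" where
  "qfact Q n = (\<Prod>i<n. 1 - Q ^ Suc i)"

lemma qfact_Suc: "qfact Q (Suc n) = qfact Q n * (1 - Q ^ Suc n)"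
  by (simp add: qfact_def)

lemma qbinom_eq_0: "n < k \<Longrightarrow> qbinom Q n k = 0"
  by (induction Q n k rule: qbinom.induct) auto

lemma qbinom_self: "qbinom Q n n = 1"
  by (induction n) (auto simp: qbinom_eq_0)

text \<open>The quotient formula in division-free form, valid also where \<open>qfact\<close>
  vanishes.\<close>

lemma qbinom_qfact: "k \<le> n \<Longrightarrow> qbinom Q n k * qfact Q k * qfact Q (n - k) = qfact Q n"
proof (induction Q n k rule: qbinom.induct)
  case (3 Q n k)
  show ?case
  proof (cases "k = n")
    case True
    then show ?thesis by (simp add: qbinom_eq_0 qbinom_self) (simp add: qfact_def)
  next
    case False
    define m where "m = n - Suc k"
    have m: "n - k = Suc m" "n = Suc k + m" using False 3(3) by (auto simp: m_def)
    have 1: "qbinom Q n (Suc k) * qfact Q (Suc k) * qfact Q m = qfact Q n"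
      using 3(1) False 3(3) by (simp add: m_def)
    have 2: "qbinom Q n k * qfact Q k * qfact Q (Suc m) = qfact Q n"
      using 3(2) 3(3) by (simp add: m)
    have "qbinom Q (Suc n) (Suc k) * qfact Q (Suc k) * qfact Q (Suc n - Suc k) =
        (qbinom Q n (Suc k) * qfact Q (Suc k) * qfact Q m) * (1 - Q ^ Suc m) +
        Q ^ Suc m * (qbinom Q n k * qfact Q k * qfact Q (Suc m)) * (1 - Q ^ Suc k)"
      using m by (simp add: qfact_Suc algebra_simps)
    also have "\<dots> = qfact Q n * (1 - Q ^ Suc m * Q ^ Suc k)"
      unfolding 1 2 by (simp add: algebra_simps)
    also have "Q ^ Suc m * Q ^ Suc k = Q ^ Suc n"
    proof -
      have "Suc m + Suc k = Suc n" using m by simp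
      then show ?thesis by (simp only: power_add[symmetric])
    qed
    finally show ?thesis by (simp only: qfact_Suc)
  qed
qed (auto simp: qfact_def)

lemma qbinomial_theorem:
  "(\<Prod>j<n. 1 + x * Q ^ j) = (\<Sum>k\<le>n. Q ^ (k choose 2) * qbinom Q n k * x ^ k)"
proof (induction n)
  case (Suc n)
  let ?a = "\<lambda>k. Q ^ (k choose 2) * qbinom Q n k * x ^ k"
  have "(\<Sum>k\<le>Suc n. Q ^ (k choose 2) * qbinom Q (Suc n) k * x ^ k) =
      1 + (\<Sum>k\<le>n. Q ^ (Suc k choose 2) * qbinom Q (Suc n) (Suc k) * x ^ Suc k)"
    by (subst sum.atMost_Suc_shift) (simp add: numeral_2_eq_2 del: qbinom.simps(3))
  also have "\<dots> = 1 + (\<Sum>k\<le>n. ?a (Suc k) + x * Q ^ n * ?a k)"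
  proof -
    have "Q ^ (Suc k choose 2) * qbinom Q (Suc n) (Suc k) * x ^ Suc k = ?a (Suc k) + x * Q ^ n * ?a k" if "k \<le> n" for k
    proof -
      have "Q ^ (Suc k choose 2) * Q ^ (n - k) = Q ^ n * Q ^ (k choose 2)"
        using that by (simp add: numeral_2_eq_2 power_add[symmetric] add.commute)
      then show ?thesis by (simp add: distrib_left distrib_right)
    qed
    then show ?thesis by simp
  qed
  also have "\<dots> = (?a 0 + (\<Sum>k\<le>n. ?a (Suc k))) + x * Q ^ n * (\<Sum>k\<le>n. ?a k)"
    by (simp add: sum.distrib sum_distrib_left binomial_eq_0)
  also have "?a 0 + (\<Sum>k\<le>n. ?a (Suc k)) = (\<Sum>k\<le>Suc n. ?a k)"
    by (rule sum.atMost_Suc_shift[symmetric])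
  also have "\<dots> = (\<Sum>k\<le>n. ?a k)" by (simp add: qbinom_eq_0)
  finally show ?case using Suc by (simp add: algebra_simps)
qed (simp add: numeral_2_eq_2)

text \<open>The exponents met when the terms of index \<open>n - m\<close> and
  \<open>n + 1 + m\<close> are compared around the middle of the sum: both reduce to the same
  triangular number, up to a power absorbed by the zero of the product.\<close>

lemma triangular_exponents:
  shows "(m + k + 1 choose 2) + (k choose 2) = (m + 1 choose 2) + (m + k) * k"
    and "(n + 1 choose 2) + (n + 1 + m choose 2) = (m + 1 choose 2) + n * (n + 1 + m)"
proof -
  show "(m + k + 1 choose 2) + (k choose 2) = (m + 1 choose 2) + (m + k) * k"
    by (induction k) (simp_all add: numeral_2_eq_2)
  have "(n + 1 choose 2) + (n + 1 choose 2) = n * (n + 1)"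
    by (induction n) (simp_all add: numeral_2_eq_2)
  then show "(n + 1 choose 2) + (n + 1 + m choose 2) = (m + 1 choose 2) + n * (n + 1 + m)"
    by (induction m) (simp_all add: numeral_2_eq_2)
qed

lemma prod_one_minus_inverse_powers:
  fixes Q :: complex
  assumes "Q \<noteq> 0"
  shows "(\<Prod>i<n. 1 - 1 / Q ^ Suc i) * Q ^ (n + 1 choose 2) = (- 1) ^ n * qfact Q n"
proof (induction n)
  case (Suc n)
  have "(\<Prod>i<Suc n. 1 - 1 / Q ^ Suc i) * Q ^ (Suc n + 1 choose 2) =
     ((\<Prod>i<n. 1 - 1 / Q ^ Suc i) * Q ^ (n + 1 choose 2)) * ((1 - 1 / Q ^ Suc n) * Q ^ Suc n)"
    by (simp add: numeral_2_eq_2 power_add)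
  also have "(1 - 1 / Q ^ Suc n) * Q ^ Suc n = Q ^ Suc n - 1"
    using assms by (simp add: left_diff_distrib)
  finally show ?case unfolding Suc qfact_Suc by (simp add: algebra_simps)
qed (simp add: qfact_def numeral_2_eq_2)

lemma sum_split_middle:
  fixes f :: "nat \<Rightarrow> complex"
  shows "(\<Sum>k\<le>2 * n + 1. f k) = (\<Sum>m\<le>n. f (n - m) + f (n + 1 + m))"
proof -
  have "{..2 * n + 1} = {..n} \<union> {Suc n..2 * n + 1}" by auto
  then have "(\<Sum>k\<le>2 * n + 1. f k) = (\<Sum>k\<le>n. f k) + (\<Sum>k\<in>{Suc n..2 * n + 1}. f k)"
    by (simp only:) (rule sum.union_disjoint; auto)
  also have "(\<Sum>k\<le>n. f k) = (\<Sum>m\<le>n. f (n - m))"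
    by (rule sum.reindex_bij_witness[of _ "\<lambda>m. n - m" "\<lambda>m. n - m"]) auto
  also have "(\<Sum>k\<in>{Suc n..2 * n + 1}. f k) = (\<Sum>m\<le>n. f (n + 1 + m))"
    by (rule sum.reindex_bij_witness[of _ "\<lambda>m. n + 1 + m" "\<lambda>k. k - (n + 1)"]) auto
  finally show ?thesis by (simp only: sum.distrib)
qed

text \<open>Differentiating the $q$-binomial theorem at the middle zero of the product.\<close>

lemma jacobi_finite:
  assumes Q: "Q \<noteq> 0" and nz: "\<And>i. Q ^ Suc i \<noteq> 1"
  shows "(\<Sum>m\<le>n. (- 1) ^ m * of_nat (2 * m + 1) * Q ^ (m + 1 choose 2) * qbinom Q (2 * n + 1) (n - m)) = (qfact Q n)\<^sup>2"
proof -
  let ?N = "2 * n + 1"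
  \<comment> \<open>The zero of the factor \<open>j = n\<close>, the middle one of the
    \<open>2 * n + 1\<close> factors; \<open>g\<close> below is the product of the others.\<close>
  let ?w = "- 1 / Q ^ n"
  let ?c = "\<lambda>k. Q ^ (k choose 2) * qbinom Q ?N k"
  define g where "g = (\<Prod>j\<in>{..<?N} - {n}. [:1, Q ^ j:])"
  have f: "(\<Sum>k\<le>?N. ?c k * x ^ k) = (1 + x * Q ^ n) * poly g x" for x
  proof -
    have "(\<Prod>j<?N. 1 + x * Q ^ j) = (1 + x * Q ^ n) * (\<Prod>j\<in>{..<?N} - {n}. 1 + x * Q ^ j)"
      by (subst prod.remove[of _ n]) auto
    then show ?thesis by (simp add: qbinomial_theorem[symmetric] g_def poly_prod)
  qed
  have d1: "((\<lambda>x. \<Sum>k\<le>?N. ?c k * x ^ k) has_field_derivative (\<Sum>k\<le>?N. ?c k * (of_nat k * ?w ^ (k - 1)))) (at ?w)"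
    by (rule DERIV_sum) (auto intro!: derivative_eq_intros)
  have d2: "((\<lambda>x. (1 + x * Q ^ n) * poly g x) has_field_derivative Q ^ n * poly g ?w) (at ?w)"
    using Q by (auto intro!: derivative_eq_intros poly_DERIV)
  have "(\<Sum>k\<le>?N. ?c k * (of_nat k * ?w ^ (k - 1))) = Q ^ n * poly g ?w"
    using DERIV_unique[OF d1 d2[unfolded f[symmetric]]] .
  \<comment> \<open>Multiplying the derivative by \<open>?w\<close> restores the powers
    \<open>?w ^ k\<close>, so that each term is weighted by its index.\<close>
  then have "?w * (\<Sum>k\<le>?N. ?c k * (of_nat k * ?w ^ (k - 1))) = ?w * (Q ^ n * poly g ?w)" by simp
  also have "?w * (\<Sum>k\<le>?N. ?c k * (of_nat k * ?w ^ (k - 1))) = (\<Sum>k\<le>?N. of_nat k * ?c k * ?w ^ k)"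
    unfolding sum_distrib_left
  proof (rule sum.cong)
    fix k :: nat
    show "?w * (?c k * (of_nat k * ?w ^ (k - 1))) = of_nat k * ?c k * ?w ^ k"
      by (cases k) (simp_all only: diff_Suc_1 power_Suc of_nat_0 mult_zero_left mult_zero_right, simp_all add: ac_simps)
  qed simp
  also have "?w * (Q ^ n * poly g ?w) = - poly g ?w" using Q by simp
  also have "poly g ?w = (\<Prod>i<n. 1 - 1 / Q ^ Suc i) * qfact Q n"
  proof -
    have sp: "{..<?N} - {n} = {..<n} \<union> {Suc n..<?N}" by auto
    have "poly g ?w = (\<Prod>j<n. 1 + ?w * Q ^ j) * (\<Prod>j\<in>{Suc n..<?N}. 1 + ?w * Q ^ j)"
      unfolding g_def poly_prod sp by (subst prod.union_disjoint) auto
    also have "(\<Prod>j<n. 1 + ?w * Q ^ j) = (\<Prod>i<n. 1 + ?w * Q ^ (n - Suc i))"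
      by (rule prod.nat_diff_reindex[symmetric])
    also have "\<dots> = (\<Prod>i<n. 1 - 1 / Q ^ Suc i)"
    proof (rule prod.cong)
      fix i assume "i \<in> {..<n}"
      then have "Q ^ n = Q ^ (n - Suc i) * Q ^ Suc i" by (simp only: power_add[symmetric]) simp
      then show "1 + ?w * Q ^ (n - Suc i) = 1 - 1 / Q ^ Suc i" using Q by (simp del: power_Suc)
    qed simp
    also have "(\<Prod>j\<in>{Suc n..<?N}. 1 + ?w * Q ^ j) = qfact Q n"
    proof -
      have "(\<Prod>j\<in>{Suc n..<?N}. 1 + ?w * Q ^ j) = (\<Prod>i\<in>{0..<n}. 1 + ?w * Q ^ (i + Suc n))"
        using prod.shift_bounds_nat_ivl[of "\<lambda>j. 1 + ?w * Q ^ j" 0 "Suc n" n] by (simp add: mult_2 add.commute)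
      also have "\<dots> = qfact Q n"
        unfolding qfact_def lessThan_atLeast0 using Q by (intro prod.cong) (auto simp: power_add)
      finally show ?thesis .
    qed
    finally show ?thesis .
  qed
  finally have main: "(\<Sum>k\<le>?N. of_nat k * ?c k * ?w ^ k) = - ((\<Prod>i<n. 1 - 1 / Q ^ Suc i) * qfact Q n)" .
  have qf: "qfact Q i \<noteq> 0" for i using nz by (simp add: qfact_def del: power_Suc)
  \<comment> \<open>The power of \<open>Q\<close> that clears the negative powers in the first half
    of the remaining product.\<close>
  let ?C = "Q ^ (n + 1 choose 2)"
  let ?h = "\<lambda>k. ?C * (of_nat k * ?c k * ?w ^ k)"
  have wk: "?C * Q ^ (k choose 2) * ?w ^ k = (- 1) ^ k * Q ^ (m + 1 choose 2)"
    if "(n + 1 choose 2) + (k choose 2) = (m + 1 choose 2) + n * k" for k m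
  proof -
    have "?C * Q ^ (k choose 2) = Q ^ (m + 1 choose 2) * Q ^ (n * k)" by (simp only: power_add[symmetric] that)
    moreover have "Q ^ (n * k) * ?w ^ k = (- 1) ^ k"
      using Q by (simp add: power_mult power_mult_distrib[symmetric])
    ultimately show ?thesis by (simp only: mult.assoc) (simp only: mult.commute)
  qed
  \<comment> \<open>The paired indices have opposite signs and equal Gaussian binomials, so their
    weights subtract: \<open>(n + 1 + m) - (n - m) = 2 * m + 1\<close>.\<close>
  have h: "?h (n - m) + ?h (n + 1 + m) =
      - ((- 1) ^ n) * ((- 1) ^ m * of_nat (2 * m + 1) * Q ^ (m + 1 choose 2) * qbinom Q ?N (n - m))" if m: "m \<le> n" for m
  proof -
    have e1: "?C * Q ^ (n - m choose 2) * ?w ^ (n - m) = (- 1) ^ (n - m) * Q ^ (m + 1 choose 2)"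
      by (rule wk) (use triangular_exponents(1)[of m "n - m"] m in simp)
    have e2: "?C * Q ^ (n + 1 + m choose 2) * ?w ^ (n + 1 + m) = (- 1) ^ (n + 1 + m) * Q ^ (m + 1 choose 2)"
      by (rule wk) (rule triangular_exponents(2))
    have sy: "qbinom Q ?N (n + 1 + m) = qbinom Q ?N (n - m)"
    proof -
      have "qbinom Q ?N (n + 1 + m) * (qfact Q (n + 1 + m) * qfact Q (n - m)) = qfact Q ?N"
        using qbinom_qfact[of "n + 1 + m" ?N Q] m by (simp add: mult.assoc mult_2)
      moreover have "qbinom Q ?N (n - m) * (qfact Q (n + 1 + m) * qfact Q (n - m)) = qfact Q ?N"
      proof -
        have "?N - (n - m) = n + 1 + m" using m by simp
        then show ?thesis using qbinom_qfact[of "n - m" ?N Q] m by (simp add: ac_simps)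
      qed
      ultimately have "qbinom Q ?N (n + 1 + m) * (qfact Q (n + 1 + m) * qfact Q (n - m)) =
          qbinom Q ?N (n - m) * (qfact Q (n + 1 + m) * qfact Q (n - m))" by simp
      then show ?thesis using qf by simp
    qed
    have s1: "(- 1 :: complex) ^ (n - m) = (- 1) ^ n * (- 1) ^ m"
      using m by (auto simp: minus_one_power_iff)
    have a1: "?h (n - m) = of_nat (n - m) * qbinom Q ?N (n - m) * (?C * Q ^ (n - m choose 2) * ?w ^ (n - m))" by (simp only: ac_simps)
    have a2: "?h (n + 1 + m) = of_nat (n + 1 + m) * qbinom Q ?N (n + 1 + m) * (?C * Q ^ (n + 1 + m choose 2) * ?w ^ (n + 1 + m))" by (simp only: ac_simps)
    have "?h (n - m) + ?h (n + 1 + m) = of_nat (n - m) * qbinom Q ?N (n - m) * ((- 1) ^ n * (- 1) ^ m * Q ^ (m + 1 choose 2)) +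
        of_nat (n + 1 + m) * qbinom Q ?N (n - m) * ((- 1) ^ (n + 1 + m) * Q ^ (m + 1 choose 2))"
      unfolding sy using a1[unfolded e1 s1] a2[unfolded e2 sy] by (rule arg_cong2[where f = "(+)"])
    then show ?thesis using m by (simp add: power_add of_nat_diff algebra_simps)
  qed
  have "(\<Sum>k\<le>?N. ?h k) = (\<Sum>m\<le>n. ?h (n - m) + ?h (n + 1 + m))"
    by (rule sum_split_middle)
  also have "\<dots> = - ((- 1) ^ n) * (\<Sum>m\<le>n. (- 1) ^ m * of_nat (2 * m + 1) * Q ^ (m + 1 choose 2) * qbinom Q ?N (n - m))"
    unfolding sum_distrib_left by (intro sum.cong h) auto
  also have "(\<Sum>k\<le>?N. ?h k) = - (((\<Prod>i<n. 1 - 1 / Q ^ Suc i) * ?C) * qfact Q n)"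
    unfolding sum_distrib_left[symmetric] main by (simp only: ac_simps mult_minus_right)
  also have "\<dots> = - ((- 1) ^ n) * (qfact Q n)\<^sup>2"
    unfolding prod_one_minus_inverse_powers[OF Q] by (simp add: power2_eq_square)
  finally show ?thesis by (simp add: minus_one_power_iff split: if_splits)
qed

text \<open>The limit of \<open>jacobi_finite\<close>. With \<open>L\<close> the limit of
  \<open>qfact\<close>, the Gaussian binomial tends to \<open>1 / L\<close> and the right side to
  the square of \<open>L\<close>, so the series equals the cube of a convergent product without zero
  factors.\<close>

lemma jacobi_sum_nonzero:
  fixes Q :: complex
  assumes Q: "Q \<noteq> 0" "norm Q < 1"
  shows "summable (\<lambda>m. norm ((- 1) ^ m * of_nat (2 * m + 1) * Q ^ (m + 1 choose 2)))"
    and "(\<Sum>m. (- 1) ^ m * of_nat (2 * m + 1) * Q ^ (m + 1 choose 2)) \<noteq> 0"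
proof -
  let ?t = "\<lambda>m. (- 1) ^ m * of_nat (2 * m + 1) * Q ^ (m + 1 choose 2)"
  have nz: "Q ^ Suc i \<noteq> 1" for i
    using power_Suc_less_one[of "norm Q" i] Q by (metis norm_ge_zero norm_one norm_power order_less_irrefl zero_less_norm_iff)
  then have qf: "qfact Q i \<noteq> 0" for i by (simp add: qfact_def del: power_Suc)
  have "summable (\<lambda>i. norm (1 - Q ^ Suc i - 1))"
    using Q by (simp add: norm_mult norm_power summable_geometric summable_mult)
  then have cp: "convergent_prod (\<lambda>i. 1 - Q ^ Suc i)"
    by (intro abs_convergent_prod_imp_convergent_prod summable_imp_abs_convergent_prod)
  define L where "L = prodinf (\<lambda>i. 1 - Q ^ Suc i)"
  have L: "L \<noteq> 0" unfolding L_def using nz by (intro prodinf_nonzero cp) (simp del: power_Suc)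
  have lim: "qfact Q \<longlonglongrightarrow> L"
    using convergent_prod_LIMSEQ[OF cp] unfolding L_def qfact_def[abs_def] LIMSEQ_lessThan_iff_atMost .
  have "Bseq (qfact Q)" using lim by (rule convergent_imp_Bseq[OF convergentI])
  then obtain K where K: "K > 0" "\<And>n. norm (qfact Q n) \<le> K" by (auto elim: BseqE)
  have "Bseq (\<lambda>n. inverse (qfact Q n))" by (rule convergent_imp_Bseq[OF convergentI[OF tendsto_inverse[OF lim L]]])
  then obtain K' where K': "K' > 0" "\<And>n. norm (inverse (qfact Q n)) \<le> K'" by (auto elim: BseqE)
  have qb: "qbinom Q (2 * n + 1) (n - m) = qfact Q (2 * n + 1) * inverse (qfact Q (n - m)) * inverse (qfact Q (n + 1 + m))" if "m \<le> n" for m n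
  proof -
    have "2 * n + 1 - (n - m) = n + 1 + m" using that by simp
    then show ?thesis using qbinom_qfact[of "n - m" "2 * n + 1" Q] that qf by (simp add: field_simps)
  qed
  have nqb: "norm (qbinom Q (2 * n + 1) (n - m)) \<le> K * K' * K'" if "m \<le> n" for m n
    unfolding qb[OF that] norm_mult using K K' by (intro mult_mono) auto
  show sm: "summable (\<lambda>m. norm (?t m))"
  proof (rule summable_comparison_test)
    show "\<exists>N. \<forall>n\<ge>N. norm (norm (?t n)) \<le> of_nat (2 * n + 1) * norm Q ^ n"
    proof (intro exI[of _ 0] allI impI)
      fix n :: nat
      have "n \<le> (n + 1 choose 2)" by (induction n) (simp_all add: numeral_2_eq_2)
      then have "norm Q ^ (n + 1 choose 2) \<le> norm Q ^ n" using Q by (intro power_decreasing) auto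
      then show "norm (norm (?t n)) \<le> of_nat (2 * n + 1) * norm Q ^ n"
        by (simp add: norm_mult norm_power mult_left_mono del: of_nat_add of_nat_mult of_nat_Suc)
    qed
    have "summable (\<lambda>n. 2 * (of_nat (Suc n) * norm Q ^ n) - norm Q ^ n)"
      using Q by (intro summable_diff summable_mult sums_summable[OF geometric_deriv_sums] summable_geometric) auto
    then show "summable (\<lambda>n. of_nat (2 * n + 1) * norm Q ^ n)" by (simp add: algebra_simps)
  qed
  \<comment> \<open>The finite sums are extended by 0 to series over all \<open>m\<close>, as
    Tannery's theorem needs; \<open>nqb\<close> bounds the binomials uniformly in both
    indices.\<close>
  let ?a = "\<lambda>m n. if m \<le> n then ?t m * qbinom Q (2 * n + 1) (n - m) else 0"
  have "(\<lambda>n. suminf (\<lambda>m. ?a m n)) \<longlonglongrightarrow> (\<Sum>m. ?t m * (L * inverse L * inverse L))"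
  proof -
    have "(\<lambda>n. ?a m n) \<longlonglongrightarrow> ?t m * (L * inverse L * inverse L)" for m
    proof (rule Lim_transform_eventually)
      have "(\<lambda>n. qfact Q (2 * n + 1)) \<longlonglongrightarrow> L"
        by (rule filterlim_compose[OF lim]) (rule filterlim_subseq, simp add: strict_mono_def)
      moreover have "(\<lambda>n. qfact Q (n - m)) \<longlonglongrightarrow> L"
        by (rule filterlim_compose[OF lim]) (rule filterlim_minus_const_nat_at_top)
      moreover have "(\<lambda>n. qfact Q (n + 1 + m)) \<longlonglongrightarrow> L"
        by (rule filterlim_compose[OF lim]) (rule filterlim_subseq, simp add: strict_mono_def)
      ultimately show "(\<lambda>n. ?t m * (qfact Q (2 * n + 1) * inverse (qfact Q (n - m)) * inverse (qfact Q (n + 1 + m))))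
          \<longlonglongrightarrow> ?t m * (L * inverse L * inverse L)"
        using L by (intro tendsto_intros)
      show "eventually (\<lambda>n. ?t m * (qfact Q (2 * n + 1) * inverse (qfact Q (n - m)) * inverse (qfact Q (n + 1 + m))) = ?a m n) sequentially"
        using eventually_ge_at_top[of m] by eventually_elim (simp only: qb if_True)
    qed
    moreover have "eventually (\<lambda>(m, n). norm (?a m n) \<le> norm (?t m) * (K * K' * K')) (at_top \<times>\<^sub>F sequentially)"
    proof (rule always_eventually, clarify)
      fix m n
      show "norm (?a m n) \<le> norm (?t m) * (K * K' * K')"
        using nqb[of m n] K(1) K'(1) by (auto simp: norm_mult intro!: mult_left_mono)
    qed
    moreover have "summable (\<lambda>m. norm (?t m) * (K * K' * K'))" by (rule summable_mult2[OF sm])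
    ultimately show ?thesis
      using tannerys_theorem[of ?a "\<lambda>m. ?t m * (L * inverse L * inverse L)" sequentially "\<lambda>m. norm (?t m) * (K * K' * K')"]
      by (simp only: sequentially_bot not_False_eq_True simp_thms) 
  qed
  also have "(\<lambda>n. suminf (\<lambda>m. ?a m n)) = (\<lambda>n. (qfact Q n)\<^sup>2)"
  proof
    fix n
    have "suminf (\<lambda>m. ?a m n) = (\<Sum>m\<le>n. ?a m n)" by (rule suminf_finite) auto
    also have "\<dots> = (qfact Q n)\<^sup>2" using jacobi_finite[OF Q(1) nz, of n] by (simp del: of_nat_add of_nat_mult of_nat_Suc power_Suc)
    finally show "suminf (\<lambda>m. ?a m n) = (qfact Q n)\<^sup>2" .
  qed
  finally have "(\<Sum>m. ?t m * (L * inverse L * inverse L)) = L\<^sup>2"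
    using LIMSEQ_unique tendsto_power[OF lim, of 2] by blast
  moreover have "(\<Sum>m. ?t m * (L * inverse L * inverse L)) = (\<Sum>m. ?t m) * (L * inverse L * inverse L)"
    by (rule suminf_mult2[symmetric]) (rule summable_norm_cancel[OF sm])
  ultimately show "(\<Sum>m. ?t m) \<noteq> 0" using L by auto
qed

lemma Re_ii_divide: "Re (\<i> / \<tau>) = Im \<tau> / (norm \<tau>)\<^sup>2"
  by (simp add: Re_divide cmod_def real_sqrt_pow2[OF sum_power2_ge_zero])

lemma int_sum_reflection:
  fixes f :: "int \<Rightarrow> complex"
  assumes refl: "\<And>m. f (- 1 - m) = f m" and s: "summable (\<lambda>m. norm (f (int m)))"
  shows "(\<Sum>\<^sub>\<infinity>l. f l) = 2 * (\<Sum>m. f (int m))"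
proof -
  have hs: "((\<lambda>m. f (int m)) has_sum (\<Sum>m. f (int m))) UNIV"
    by (rule norm_summable_imp_has_sum[OF s]) (rule summable_sums[OF summable_norm_cancel[OF s]])
  have 1: "(f has_sum (\<Sum>m. f (int m))) (range int)"
    using hs by (subst has_sum_reindex) (auto simp: o_def)
  have 2: "(f has_sum (\<Sum>m. f (int m))) (range (\<lambda>m. - 1 - int m))"
    using hs by (subst has_sum_reindex) (auto simp: o_def refl inj_on_def)
  have U: "(UNIV :: int set) = range int \<union> range (\<lambda>m. - 1 - int m)"
  proof -
    have "l \<in> range int \<union> range (\<lambda>m. - 1 - int m)" for l
    proof (cases "l \<ge> 0")
      case True
      then have "l = int (nat l)" by simp
      then show ?thesis by blast
    next
      case False
      then have "l = - 1 - int (nat (- 1 - l))" by simp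
      then show ?thesis by blast
    qed
    then show ?thesis by auto
  qed
  have "(f has_sum ((\<Sum>m. f (int m)) + (\<Sum>m. f (int m)))) (range int \<union> range (\<lambda>m. - 1 - int m))"
    by (rule has_sum_Un_disjoint[OF 1 2]) auto
  then show ?thesis unfolding U[symmetric] by (simp add: infsumI)
qed

lemma c_const_nonzero:
  assumes "Im \<tau> > 0"
  shows "c_const \<tau> \<noteq> 0"
proof -
  have \<tau>: "\<tau> \<noteq> 0" using assms by auto
  \<comment> \<open>Since \<open>(m + 1/2)\<^sup>2 = m * (m + 1) + 1/4\<close>, the Gaussian terms
    are triangular powers of this \<open>Q\<close> times the common factor \<open>?E\<close>. Its
    norm is below 1 because \<open>\<i> / \<tau>\<close> has positive real part.\<close>
  define Q where "Q = exp (- 2 * pi * \<i> / \<tau>)"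
  have "Re (- 2 * pi * \<i> / \<tau>) = - 2 * pi * Re (\<i> / \<tau>)" by (simp add: Re_divide)
  also have "\<dots> < 0" unfolding Re_ii_divide using assms \<tau> by simp
  finally have Q: "Q \<noteq> 0" "norm Q < 1" by (simp_all add: Q_def)
  let ?f = "\<lambda>l::int. (-1) powi l * of_int (2 * l + 1) * exp (- (pi * \<i> / \<tau>) * (of_int l + 1/2)^2)"
  let ?E = "exp (- (pi * \<i> / \<tau>) / 4)"
  have f: "?f (int m) = ?E * ((- 1) ^ m * of_nat (2 * m + 1) * Q ^ (m + 1 choose 2))" for m
  proof -
    have "2 * (m + 1 choose 2) = m * (m + 1)" by (induction m) (simp_all add: numeral_2_eq_2)
    then have c: "2 * (of_nat (m + 1 choose 2) :: complex) = of_nat m * (of_nat m + 1)"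
      by (metis of_nat_1 of_nat_add of_nat_mult of_nat_numeral)
    have "Q ^ (m + 1 choose 2) = exp (of_nat (m + 1 choose 2) * (- 2 * pi * \<i> / \<tau>))"
      unfolding Q_def exp_of_nat_mult ..
    also have "of_nat (m + 1 choose 2) * (- 2 * pi * \<i> / \<tau>) = - (2 * of_nat (m + 1 choose 2)) * (pi * \<i> / \<tau>)" by simp
    also have "\<dots> = - (pi * \<i> / \<tau>) * (of_int (int m) + 1/2)^2 + (pi * \<i> / \<tau>) / 4"
      unfolding c by (simp add: power2_eq_square algebra_simps add_divide_distrib)
    finally have "?E * Q ^ (m + 1 choose 2) = exp (- (pi * \<i> / \<tau>) * (of_int (int m) + 1/2)^2)"
      by (simp add: exp_add[symmetric])
    from this[symmetric] show ?thesis by (simp only: power_int_of_nat) (simp add: algebra_simps)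
  qed
  \<comment> \<open>The parity sign and the odd weight both change sign, so the negative half of the
    series repeats the nonnegative half.\<close>
  have refl: "?f (- 1 - m) = ?f m" for m
  proof -
    have "(-1 :: complex) powi (- 1 - m) = - ((-1) powi m)"
      by (simp add: power_int_diff power_int_minus_left) 
    moreover have "(of_int (- 1 - m) + 1/2 :: complex)^2 = (of_int m + 1/2)^2"
      by (simp add: power2_eq_square algebra_simps)
    ultimately show ?thesis by (simp only:) (simp add: algebra_simps)
  qed
  have sm: "summable (\<lambda>m. norm (?f (int m)))"
    unfolding f norm_mult[of ?E] by (rule summable_mult[OF jacobi_sum_nonzero(1)[OF Q]])
  have "(\<Sum>\<^sub>\<infinity>l. ?f l) = 2 * (\<Sum>m. ?f (int m))"
    by (rule int_sum_reflection[OF refl sm])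
  also have "(\<Sum>m. ?f (int m)) = ?E * (\<Sum>m. (- 1) ^ m * of_nat (2 * m + 1) * Q ^ (m + 1 choose 2))"
    unfolding f by (rule suminf_mult[OF summable_norm_cancel[OF jacobi_sum_nonzero(1)[OF Q]]])
  finally have "(\<Sum>\<^sub>\<infinity>l. ?f l) \<noteq> 0" using jacobi_sum_nonzero(2)[OF Q] by simp
  moreover have "cnj \<tau> - \<tau> \<noteq> 0" using assms by (simp add: complex_eq_iff)
  ultimately show ?thesis using \<tau> by (simp add: c_const_def)
qed

section \<open>Superexponential decay\<close>

lemma superexpE:
  assumes "superexp g"
  obtains C where "C \<ge> 0" "\<And>x. norm (g x) \<le> C * exp (- c * \<bar>x\<bar>)"
proof -
  obtain C where C: "\<And>x. norm (g x) \<le> C * exp (- c * \<bar>x\<bar>)" using assms unfolding superexp_def by metis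
  have "C * exp (- c * \<bar>0\<bar>) \<ge> 0" using order.trans[OF norm_ge_zero C[of 0]] .
  then have "C \<ge> 0" by simp
  with C show ?thesis by (rule_tac that)
qed

lemma superexp_mult_bounded:
  assumes "superexp g" "\<And>x. norm (f x) \<le> B"
  shows "superexp (\<lambda>x. f x * g x)"
  unfolding superexp_def
proof
  fix c
  obtain C where C: "C \<ge> 0" "\<And>x. norm (g x) \<le> C * exp (- c * \<bar>x\<bar>)" using superexpE[OF assms(1)] by metis
  have B: "B \<ge> 0" using order.trans[OF norm_ge_zero assms(2)] .
  have "norm (f x * g x) \<le> (B * C) * exp (- c * \<bar>x\<bar>)" for x
  proof -
    have "norm (f x * g x) \<le> B * (C * exp (- c * \<bar>x\<bar>))"
      unfolding norm_mult by (intro mult_mono assms C B) auto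
    then show ?thesis by (simp add: mult.assoc)
  qed
  then show "\<exists>C. \<forall>x. norm (f x * g x) \<le> C * exp (- c * \<bar>x\<bar>)" by blast
qed

lemma superexp_mult_exp:
  assumes "superexp g"
  shows "superexp (\<lambda>x. g x * exp (a * of_real x + b))"
  unfolding superexp_def
proof
  fix c
  obtain C where C: "C \<ge> 0" "\<And>x. norm (g x) \<le> C * exp (- (c + \<bar>Re a\<bar>) * \<bar>x\<bar>)" using superexpE[OF assms] by metis
  have "norm (g x * exp (a * of_real x + b)) \<le> (C * exp (Re b)) * exp (- c * \<bar>x\<bar>)" for x
  proof -
    have "Re a * x \<le> \<bar>Re a\<bar> * \<bar>x\<bar>" by (metis abs_ge_self abs_mult)
    then have "norm (exp (a * of_real x + b)) \<le> exp (\<bar>Re a\<bar> * \<bar>x\<bar> + Re b)" by simp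
    then have "norm (g x * exp (a * of_real x + b)) \<le> (C * exp (- (c + \<bar>Re a\<bar>) * \<bar>x\<bar>)) * exp (\<bar>Re a\<bar> * \<bar>x\<bar> + Re b)"
      unfolding norm_mult using C(1) by (intro mult_mono C) auto
    also have "\<dots> = (C * exp (Re b)) * exp (- c * \<bar>x\<bar>)"
      by (simp add: exp_add[symmetric] mult.assoc) (simp add: algebra_simps exp_add[symmetric])
    finally show ?thesis .
  qed
  then show "\<exists>C. \<forall>x. norm (g x * exp (a * of_real x + b)) \<le> C * exp (- c * \<bar>x\<bar>)" by blast
qed

text \<open>The twist \<open>exp (c * of_int n)\<close> is an exponential of the lattice point
  itself, up to a constant, and superexponential decay absorbs it for every complex
  \<open>c\<close>.\<close>

lemma superexp_lattice_summable:
  assumes "superexp g" "P \<ge> 1"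
  shows "(\<lambda>n::int. norm (of_int n ^ k * (g (x + P * of_int n) * exp (c * of_int n)))) summable_on UNIV"
proof -
  let ?g = "\<lambda>v. g v * exp (c / of_real P * of_real v + (- c / of_real P * of_real x))"
  have "c / of_real P * of_real (x + P * of_int n) + (- c / of_real P * of_real x) = c * of_int n" for n
    using assms(2) by (simp add: field_simps)
  moreover have "rapid ?g" by (intro superexp_imp_rapid superexp_mult_exp assms)
  from rapid_lattice_summable[OF this, of P k x] assms(2)
  have "(\<lambda>n::int. norm (of_int n ^ k * ?g (x + P * of_int n))) summable_on UNIV" by simp
  ultimately show ?thesis by (simp only:)
qed

text \<open>A mean value estimate on an interval of fixed length: the increments decay like the
  derivative, whatever the limits of \<open>g\<close> are.\<close>

lemma superexp_difference:
  assumes "superexp g'" "\<And>x. (g has_vector_derivative g' x) (at x)" "d > 0"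
  shows "superexp (\<lambda>x. g x - g (x - d))"
  unfolding superexp_def
proof
  fix c
  obtain C where C: "C \<ge> 0" "\<And>x. norm (g' x) \<le> C * exp (- \<bar>c\<bar> * \<bar>x\<bar>)" using superexpE[OF assms(1)] by metis
  have "norm (g x - g (x - d)) \<le> (C * d * exp (\<bar>c\<bar> * d)) * exp (- c * \<bar>x\<bar>)" for x
  proof -
    let ?M = "C * exp (- \<bar>c\<bar> * (\<bar>x\<bar> - d))"
    have "norm (g x - g (x - d)) \<le> ?M * x - ?M * (x - d)"
    proof (rule differentiable_bound_general[where f' = g' and \<phi>' = "\<lambda>_. ?M"])
      show "continuous_on {x - d..x} g"
        using assms(2) by (meson continuous_at_imp_continuous_on has_vector_derivative_continuous)
      fix u assume u: "x - d < u" "u < x"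
      then have "\<bar>c\<bar> * (\<bar>x\<bar> - d) \<le> \<bar>c\<bar> * \<bar>u\<bar>" by (intro mult_left_mono) auto
      then have "C * exp (- \<bar>c\<bar> * \<bar>u\<bar>) \<le> ?M" using C(1) by (intro mult_left_mono) auto
      with C(2)[of u] show "norm (g' u) \<le> ?M" by linarith
      show "((\<lambda>u. ?M * u) has_vector_derivative ?M) (at u)"
        by (auto intro!: derivative_eq_intros simp flip: has_real_derivative_iff_has_vector_derivative)
    qed (use assms in \<open>auto intro!: continuous_intros\<close>)
    also have "\<dots> = (C * d * exp (\<bar>c\<bar> * d)) * exp (- \<bar>c\<bar> * \<bar>x\<bar>)"
      by (simp add: algebra_simps exp_add[symmetric])
    also have "\<dots> \<le> (C * d * exp (\<bar>c\<bar> * d)) * exp (- c * \<bar>x\<bar>)"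
    proof -
      have "c * \<bar>x\<bar> \<le> \<bar>c\<bar> * \<bar>x\<bar>" by (intro mult_right_mono) auto
      then show ?thesis using C(1) assms(3) by (intro mult_left_mono) auto
    qed
    finally show ?thesis .
  qed
  then show "\<exists>C. \<forall>x. norm (g x - g (x - d)) \<le> C * exp (- c * \<bar>x\<bar>)" by blast
qed

lemma rapid_bounded:
  assumes "rapid g"
  obtains B where "B \<ge> 0" "\<And>x. norm (g x) \<le> B"
  using rapidE[OF assms, of 0] by (metis mult.right_neutral power_0)

section \<open>Cancellation and limits in alternating series over the integers\<close>

lemma infsum_antisymmetric:
  fixes f :: "int \<Rightarrow> complex"
  assumes "\<And>h. f (r - h) = - f h"
  shows "(\<Sum>\<^sub>\<infinity>h. f h) = 0"
proof -
  have "(\<Sum>\<^sub>\<infinity>h. f (r - h)) = (\<Sum>\<^sub>\<infinity>h. f h)"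
    by (rule infsum_reindex_bij_betw) (rule bij_betwI[where g = "\<lambda>h. r - h"], auto)
  then show ?thesis by (simp add: assms infsum_uminus)
qed

text \<open>Tannery's theorem for a weighted sum of translates. The limit is 0 either through
  \<open>L\<close> or through the sum of the weights; \<open>Theta\<close> uses one at each
  end.\<close>

lemma infsum_tendsto_zero:
  fixes e :: "int \<Rightarrow> complex" and g :: "real \<Rightarrow> complex"
  assumes e: "(\<lambda>n. norm (e n)) summable_on UNIV" and bd: "\<And>x. norm (g x) \<le> B"
    and lim: "(g \<longlongrightarrow> L) F'" and sh: "\<And>c. filterlim (\<lambda>x. x + c) F' F'" and nb: "F' \<noteq> bot"
  shows "((\<lambda>x. \<Sum>\<^sub>\<infinity>n. e n * g (x + d * of_int n)) \<longlongrightarrow> (\<Sum>\<^sub>\<infinity>n. e n) * L) F'"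
proof -
  have B: "B \<ge> 0" using order.trans[OF norm_ge_zero bd] .
  have su: "(\<lambda>n. norm (e (int_decode n))) summable_on UNIV"
    using e summable_on_reindex_bij_betw[OF bij_int_decode, of "\<lambda>n. norm (e n)"] by simp
  then have sme: "summable (\<lambda>n. norm (e (int_decode n)))" by (simp add: summable_on_UNIV_nonneg_real_iff)
  have sums: "(\<Sum>\<^sub>\<infinity>n. e n * g (x + d * of_int n)) = (\<Sum>n. e (int_decode n) * g (x + d * of_int (int_decode n)))" for x
  proof -
    have "(\<lambda>n. norm (e n * g (x + d * of_int n))) summable_on UNIV"
    proof (rule summable_on_comparison_test)
      show "(\<lambda>n. norm (e n) * B) summable_on UNIV" by (intro summable_on_cmult_left e)
    qed (auto simp: norm_mult intro!: mult_left_mono bd)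
    then have "((\<lambda>n. e n * g (x + d * of_int n)) has_sum (\<Sum>\<^sub>\<infinity>n. e n * g (x + d * of_int n))) UNIV"
      by (intro has_sum_infsum) (rule abs_summable_summable)
    from sums_unique[OF has_sum_int_imp_sums[OF this]] show ?thesis .
  qed
  have sums': "(\<Sum>\<^sub>\<infinity>n. e n) * L = (\<Sum>n. e (int_decode n) * L)"
  proof -
    have "((\<lambda>n. e n) has_sum (\<Sum>\<^sub>\<infinity>n. e n)) UNIV"
      by (intro has_sum_infsum abs_summable_summable[where f = e] e)
    from sums_unique[OF sums_mult2[OF has_sum_int_imp_sums[OF this], of L]] show ?thesis .
  qed
  have "((\<lambda>x. \<Sum>n. e (int_decode n) * g (x + d * of_int (int_decode n))) \<longlongrightarrow> (\<Sum>n. e (int_decode n) * L)) F'"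
  proof -
    have l: "((\<lambda>x. e (int_decode n) * g (x + d * of_int (int_decode n))) \<longlongrightarrow> e (int_decode n) * L) F'" for n
      by (intro tendsto_mult_left filterlim_compose[OF lim sh])
    have b: "eventually (\<lambda>(n, x). norm (e (int_decode n) * g (x + d * of_int (int_decode n))) \<le> norm (e (int_decode n)) * B) (at_top \<times>\<^sub>F F')"
      by (rule always_eventually) (auto simp: norm_mult intro!: mult_left_mono bd)
    from tannerys_theorem[OF l b summable_mult2[OF sme] nb] show ?thesis by blast
  qed
  then show ?thesis unfolding sums sums' .
qed

lemma minus_one_powi_exp: "(-1 :: complex) powi n = exp (\<i> * pi * of_int n)"
  using exp_power_int[of "\<i> * of_real pi" n] by (simp add: mult.commute mult.left_commute)

text \<open>Read from right to left it merges the two products of a determinant, living on even and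
  on odd lattice points, into one alternating series.\<close>

lemma infsum_parity:
  fixes f :: "int \<Rightarrow> complex"
  assumes "(\<lambda>n. norm (f n)) summable_on UNIV"
  shows "(\<Sum>\<^sub>\<infinity>m. exp (\<i> * pi * of_int m) * f m) = (\<Sum>\<^sub>\<infinity>m. f (2 * m)) - (\<Sum>\<^sub>\<infinity>m. f (2 * m + 1))"
proof -
  let ?g = "\<lambda>m. exp (\<i> * pi * of_int m) * f m"
  have gs: "?g summable_on UNIV"
    by (rule abs_summable_summable) (use assms in \<open>simp add: norm_mult\<close>)
  have inj: "inj (\<lambda>m::int. 2 * m)" "inj (\<lambda>m::int. 2 * m + 1)" by (auto simp: inj_on_def)
  have e: "exp (\<i> * pi * of_int (2 * m)) = 1" "exp (\<i> * pi * of_int (2 * m + 1)) = - 1" for m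
    unfolding minus_one_powi_exp[symmetric] by (simp_all add: power_int_minus_left)
  have U: "(UNIV::int set) = range (\<lambda>m. 2 * m) \<union> range (\<lambda>m. 2 * m + 1)"
  proof -
    have "m \<in> range (\<lambda>m. 2 * m) \<union> range (\<lambda>m. 2 * m + 1)" for m :: int
    proof (cases "even m")
      case True
      then show ?thesis by (elim evenE) blast
    next
      case False
      then show ?thesis by (elim oddE) blast
    qed
    then show ?thesis by auto
  qed
  have disj: "range (\<lambda>m::int. 2 * m) \<inter> range (\<lambda>m. 2 * m + 1) = {}"
  proof -
    have "2 * m \<noteq> 2 * n + 1" for m n :: int by presburger
    then show ?thesis by blast
  qed
  have "(\<Sum>\<^sub>\<infinity>m. ?g m) = infsum ?g (range (\<lambda>m. 2 * m) \<union> range (\<lambda>m. 2 * m + 1))"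
    by (rule arg_cong[OF U])
  also have "\<dots> = infsum ?g (range (\<lambda>m. 2 * m)) + infsum ?g (range (\<lambda>m. 2 * m + 1))"
    by (rule infsum_Un_disjoint[OF _ _ disj]) (rule summable_on_subset_banach[OF gs], simp)+
  also have "infsum ?g (range (\<lambda>m. 2 * m)) = (\<Sum>\<^sub>\<infinity>m. f (2 * m))"
    by (subst infsum_reindex[OF inj(1)]) (simp add: o_def e del: of_int_mult)
  also have "infsum ?g (range (\<lambda>m. 2 * m + 1)) = - (\<Sum>\<^sub>\<infinity>m. f (2 * m + 1))"
    by (subst infsum_reindex[OF inj(2)]) (simp add: o_def e infsum_uminus del: of_int_mult of_int_add)
  finally show ?thesis by simp
qed

lemma bounded_of_limits:
  fixes g :: "real \<Rightarrow> complex"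
  assumes "continuous_on UNIV g" "(g \<longlongrightarrow> L) at_top" "(g \<longlongrightarrow> M) at_bot"
  obtains B where "\<And>x. norm (g x) \<le> B"
proof -
  have "eventually (\<lambda>x. dist (g x) L < 1) at_top" using tendstoD[OF assms(2)] by simp
  then obtain b where b: "\<And>x. x \<ge> b \<Longrightarrow> dist (g x) L < 1" by (auto simp: eventually_at_top_linorder)
  have "eventually (\<lambda>x. dist (g x) M < 1) at_bot" using tendstoD[OF assms(3)] by simp
  then obtain a where a: "\<And>x. x \<le> a \<Longrightarrow> dist (g x) M < 1" by (auto simp: eventually_at_bot_linorder)
  have "compact (g ` {a..b})" by (intro compact_continuous_image continuous_on_subset[OF assms(1)]) auto
  then obtain D where "\<forall>z\<in>g ` {a..b}. norm z \<le> D" using compact_imp_bounded bounded_iff by metis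
  then have D: "\<And>x. a \<le> x \<Longrightarrow> x \<le> b \<Longrightarrow> norm (g x) \<le> D" by auto
  have "norm (g x) \<le> max D (max (norm L + 1) (norm M + 1))" for x
  proof (cases "x \<le> a")
    case True
    have "norm (g x) \<le> norm M + dist (g x) M" by (metis dist_norm norm_triangle_sub)
    with a[OF True] show ?thesis by simp
  next
    case False
    show ?thesis
    proof (cases "x \<ge> b")
      case True
      have "norm (g x) \<le> norm L + dist (g x) L" by (metis dist_norm norm_triangle_sub)
      with b[OF True] show ?thesis by simp
    next
      case False
      with \<open>\<not> x \<le> a\<close> D[of x] show ?thesis by simp
    qed
  qed
  then show ?thesis by (rule that)
qed

lemma Re_of_real_mult: "Re (complex_of_real r * z) = r * Re z"
  by simp

text \<open>The cocycle is \<open>zak (2 * pi) \<psi>0\<close>, the normalizing constant is the prescribed value of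
  $\lambda_{\tau,0}$, and $\theta_H(x)$ is \<open>\<theta> (x + 2 * pi * H)\<close>.\<close>

locale cone_setup =
  fixes \<tau> :: complex and p q s t :: real and \<psi>0 \<theta> :: "real \<Rightarrow> complex"
  assumes Im_tau: "Im \<tau> > 0" and psi0: "schwartz \<psi>0"
    and theta_deriv: "\<And>x. (\<theta> has_vector_derivative
      weight \<tau> p q s t 0 x * \<psi>0 x / exp (\<i> / \<tau> * (- pi / 2 * \<tau> - pi / 4))) (at x)"
    and theta_bot: "(\<theta> \<longlongrightarrow> 0) at_bot" and theta_top: "(\<theta> \<longlongrightarrow> 1) at_top"
begin

section \<open>Exponents, weights and the functions that generate the two rows\<close>

definition sigma :: complex where "sigma = of_real p - of_real s"
definition delta :: complex where "delta = of_real q - of_real t"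
text \<open>\<open>alpha\<close> and \<open>beta\<close> are the coefficients obtained by expanding
  the exponents of the term \<open>K = 0\<close> of \<open>phit21\<close>; \<open>- alpha\<close>
  and \<open>beta'\<close> are those of the term \<open>I = 0\<close> of \<open>phit11\<close>. In
  both cases the constant terms cancel, whence the \<open>+ 0\<close> in the Gaussians
  below.\<close>

definition alpha :: complex where "alpha = - (\<i> / (8 * pi * \<tau>))"
definition beta :: complex where "beta = \<i> / (4 * pi) * (delta + pi) + \<i> / (4 * pi * \<tau>) * (sigma + pi)"
definition beta' :: complex where "beta' = \<i> / (4 * pi * \<tau>) * (pi - sigma) - \<i> / (4 * pi) * (delta - pi)"

definition theta' :: "real \<Rightarrow> complex" where
  "theta' x = weight \<tau> p q s t 0 x * \<psi>0 x / exp (\<i> / \<tau> * (- pi / 2 * \<tau> - pi / 4))"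

text \<open>The weights of the inner sums after the substitution \<open>H = n + 2 * I\<close>. They
  no longer depend on \<open>I\<close>, so all modes in \<open>y\<close> are translates of one
  function.\<close>

definition eps :: "int \<Rightarrow> complex" where
  "eps n = (-1) powi n * exp (- (pi * \<i> / \<tau>) * (of_int n - 1/2)^2)"

definition Theta :: "real \<Rightarrow> complex" where
  "Theta x = (\<Sum>\<^sub>\<infinity>n. eps n * \<theta> (x + 2 * pi * of_int n))"

definition hh :: "real \<Rightarrow> complex" where
  "hh x = exp (alpha * of_real x ^ 2 + beta * of_real x + 0)"

definition Ck :: complex where "Ck = - ((cnj \<tau> - \<tau>) / (2 * \<tau>)) * \<i>"

definition kk :: "real \<Rightarrow> complex" where
  "kk x = Ck * (exp (- alpha * of_real x ^ 2 + beta' * of_real x + 0) * Theta x)"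

lemma tau_nz [simp]: "\<tau> \<noteq> 0"
  using Im_tau by auto

lemma Re_ii_div: "Re (\<i> / \<tau>) > 0"
  unfolding Re_ii_divide using Im_tau by simp

section \<open>Decay of the weights and of Theta\<close>

lemma Re_alpha: "Re alpha < 0"
proof -
  have "alpha = of_real (- 1 / (8 * pi)) * (\<i> / \<tau>)" by (simp add: alpha_def)
  then have "Re alpha = - 1 / (8 * pi) * Re (\<i> / \<tau>)" by (simp only: Re_of_real_mult)
  then show ?thesis by (simp only:) (rule mult_neg_pos[OF _ Re_ii_div], simp)
qed

lemma Ck_nz: "Ck \<noteq> 0"
proof -
  have "cnj \<tau> - \<tau> \<noteq> 0" using Im_tau by (simp add: complex_eq_iff)
  then show ?thesis by (simp add: Ck_def)
qed

text \<open>A general cocycle gives no compact support, so the decay comes from the Gaussian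
  \<open>weight\<close>, with \<open>\<psi>0\<close> merely bounded.\<close>

lemma superexp_theta': "superexp theta'"
proof -
  let ?a = "- (\<i> / (4 * pi * \<tau>))" and ?b = "\<i> / (2 * pi) * (sigma / \<tau> + delta)"
  let ?c = "- (\<i> / \<tau> * (- pi / 2 * \<tau> - pi / 4))"
  have "?a = of_real (- 1 / (4 * pi)) * (\<i> / \<tau>)" by simp
  then have "Re ?a = - 1 / (4 * pi) * Re (\<i> / \<tau>)" by (simp only: Re_of_real_mult)
  then have a: "Re ?a < 0" by (simp only:) (rule mult_neg_pos[OF _ Re_ii_div], simp)
  have "weight \<tau> p q s t 0 x / exp (\<i> / \<tau> * (- pi / 2 * \<tau> - pi / 4)) = exp (?a * of_real x ^ 2 + ?b * of_real x + ?c)" for x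
    unfolding weight_def exp_diff[symmetric]
    by (rule arg_cong[where f = exp]) (simp add: sigma_def delta_def field_simps power2_eq_square)
  moreover have "theta' x = \<psi>0 x * (weight \<tau> p q s t 0 x / exp (\<i> / \<tau> * (- pi / 2 * \<tau> - pi / 4)))" for x
    by (simp add: theta'_def)
  ultimately have eq: "theta' = (\<lambda>x. \<psi>0 x * exp (?a * of_real x ^ 2 + ?b * of_real x + ?c))"
    by (intro ext) (simp only:)
  obtain B where "\<And>x. norm (\<psi>0 x) \<le> B" using rapid_bounded[OF schwartz_rapid[OF psi0]] by metis
  then show ?thesis unfolding eq by (rule superexp_mult_bounded[OF superexp_gaussian[OF a]])
qed

lemma theta_has_vector_derivative: "(\<theta> has_vector_derivative theta' x) (at x)"
  unfolding theta'_def by (rule theta_deriv)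

lemma theta_bounded: obtains B where "\<And>x. norm (\<theta> x) \<le> B"
proof -
  have "continuous_on UNIV \<theta>"
    using theta_has_vector_derivative by (meson continuous_at_imp_continuous_on has_vector_derivative_continuous)
  from bounded_of_limits[OF this theta_top theta_bot] show ?thesis using that by blast
qed

lemma eps_summable: "(\<lambda>n. norm (of_int n ^ k * (eps n * exp (c * of_int n)))) summable_on UNIV"
proof -
  let ?g = "\<lambda>x. exp (- (pi * (\<i> / \<tau>)) * of_real x ^ 2 + (pi * (\<i> / \<tau>)) * of_real x + - (pi * (\<i> / \<tau>)) / 4)"
  have "- (pi * (\<i> / \<tau>)) = of_real (- pi) * (\<i> / \<tau>)" by simp
  then have "Re (- (pi * (\<i> / \<tau>))) = - pi * Re (\<i> / \<tau>)" by (simp only: Re_of_real_mult)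
  then have "Re (- (pi * (\<i> / \<tau>))) < 0" using Re_ii_div by simp
  then have "superexp ?g" by (rule superexp_gaussian)
  from superexp_lattice_summable[OF this, of 1 k 0 c]
  have "(\<lambda>n::int. norm (of_int n ^ k * (?g (real_of_int n) * exp (c * of_int n)))) summable_on UNIV" by simp
  moreover have "norm (of_int n ^ k * (eps n * exp (c * of_int n))) = norm (of_int n ^ k * (?g (real_of_int n) * exp (c * of_int n)))" for n
  proof -
    have "eps n = exp (\<i> * pi * of_int n) * ?g (real_of_int n)"
      unfolding eps_def minus_one_powi_exp
      by (rule arg_cong[where f = "\<lambda>w. _ * exp w"]) (simp add: power2_eq_square field_simps)
    then show ?thesis by (simp add: norm_mult)
  qed
  ultimately show ?thesis by (simp only:)
qed

lemma eps_summable0: "(\<lambda>n. norm (eps n)) summable_on UNIV"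
  using eps_summable[of 0 0] by simp

text \<open>Completing the square moves the centre of the Gaussian from \<open>1/2\<close> to
  \<open>1/2 - M\<close>. The reflection about it has the odd sum \<open>1 - 2 * M\<close>, so it
  reverses parity and the terms cancel in pairs.\<close>

lemma eps_sum: "(\<Sum>\<^sub>\<infinity>h. eps h * exp (- (2 * pi * \<i> * of_int M / \<tau>) * of_int h)) = 0"
proof (rule infsum_antisymmetric[where r = "1 - 2 * M"])
  fix h
  have "eps (1 - 2 * M - h) * exp (- (2 * pi * \<i> * of_int M / \<tau>) * of_int (1 - 2 * M - h)) =
     exp (\<i> * pi * of_int (1 - 2 * M - h)) * (exp (- (pi * \<i> / \<tau>) * (of_int h - 1/2)^2) * exp (- (2 * pi * \<i> * of_int M / \<tau>) * of_int h))"
    unfolding eps_def minus_one_powi_exp mult.assoc mult_exp_exp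
    by (rule arg_cong[where f = exp]) (simp add: field_simps power2_eq_square)
  also have "exp (\<i> * pi * of_int (1 - 2 * M - h)) = - ((-1) powi h)"
    unfolding minus_one_powi_exp[symmetric] by (simp add: power_int_diff power_int_mult power_int_minus_left)
  finally show "eps (1 - 2 * M - h) * exp (- (2 * pi * \<i> * of_int M / \<tau>) * of_int (1 - 2 * M - h)) =
     - (eps h * exp (- (2 * pi * \<i> * of_int M / \<tau>) * of_int h))"
    by (simp add: eps_def)
qed

lemma Theta_summable: "(\<lambda>n. norm (eps n * \<theta> (x + 2 * pi * of_int n))) summable_on UNIV"
proof -
  obtain B where B: "\<And>x. norm (\<theta> x) \<le> B" by (rule theta_bounded, rule that)
  show ?thesis
  proof (rule summable_on_comparison_test)
    show "(\<lambda>n. norm (eps n) * B) summable_on UNIV" by (intro summable_on_cmult_left eps_summable0)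
  qed (auto simp: norm_mult intro!: mult_left_mono B)
qed

lemma Theta_has_vector_derivative:
  "(Theta has_vector_derivative (\<Sum>\<^sub>\<infinity>n. eps n * theta' (x + 2 * pi * of_int n))) (at x)"
proof -
  obtain B where B: "B \<ge> 0" "\<And>x. norm (theta' x) \<le> B"
    using rapid_bounded[OF superexp_imp_rapid[OF superexp_theta']] by metis
  have "((\<lambda>x. \<Sum>\<^sub>\<infinity>n. eps n * \<theta> (x + 2 * pi * of_int n)) has_derivative
      (\<lambda>h. \<Sum>\<^sub>\<infinity>n. h *\<^sub>R (eps n * theta' (x + 2 * pi * of_int n)))) (at x within UNIV)"
  proof (rule has_derivative_infsum_int[where B = "\<lambda>n. norm (eps n) * B"])
    fix n :: int and x :: real
    have "((\<lambda>x. x + 2 * pi * of_int n) has_vector_derivative 1) (at x)"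
      by (auto intro!: derivative_eq_intros simp flip: has_real_derivative_iff_has_vector_derivative)
    from has_vector_derivative_mult_right[OF vector_diff_chain_at[OF this theta_has_vector_derivative], of "eps n"]
    have "((\<lambda>x. eps n * \<theta> (x + 2 * pi * of_int n)) has_vector_derivative eps n * theta' (x + 2 * pi * of_int n)) (at x)"
      by (simp add: o_def)
    then show "((\<lambda>x. eps n * \<theta> (x + 2 * pi * of_int n)) has_derivative
        (\<lambda>h. h *\<^sub>R (eps n * theta' (x + 2 * pi * of_int n)))) (at x within UNIV)"
      by (simp add: has_vector_derivative_def)
    show "norm (h *\<^sub>R (eps n * theta' (x + 2 * pi * of_int n))) \<le> norm (eps n) * B * norm h" for h :: real
    proof -
      have "\<bar>h\<bar> * (norm (eps n) * norm (theta' (x + 2 * pi * of_int n))) \<le> \<bar>h\<bar> * (norm (eps n) * B)"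
        by (intro mult_left_mono B) auto
      then show ?thesis by (simp add: norm_mult ac_simps)
    qed
  next
    show "(\<lambda>n. norm (eps n) * B) summable_on UNIV" by (intro summable_on_cmult_left eps_summable0)
    show "(\<lambda>n. eps n * \<theta> (x + 2 * pi * of_int n)) summable_on UNIV" for x
      by (rule abs_summable_summable[OF Theta_summable])
  qed auto
  then show ?thesis
    unfolding has_vector_derivative_def Theta_def[abs_def] by (simp add: infsum_scaleR_right)
qed

text \<open>At the bottom every translate of \<open>\<theta>\<close> tends to 0; at the top they
  tend to 1 and the total weight is 0, by \<open>eps_sum\<close> with \<open>M = 0\<close>.\<close>

lemma Theta_top: "(Theta \<longlongrightarrow> 0) at_top" and Theta_bot: "(Theta \<longlongrightarrow> 0) at_bot"
proof -
  obtain B where B: "\<And>x. norm (\<theta> x) \<le> B" by (rule theta_bounded, rule that)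
  have e0: "(\<Sum>\<^sub>\<infinity>n. eps n) = 0" using eps_sum[of 0] by simp
  have t: "filterlim (\<lambda>x::real. x + c) at_top at_top" for c
    unfolding filterlim_at_top
  proof
    fix Z :: real
    show "eventually (\<lambda>x. Z \<le> x + c) at_top" using eventually_ge_at_top[of "Z - c"] by eventually_elim simp
  qed
  have b: "filterlim (\<lambda>x::real. x + c) at_bot at_bot" for c
    unfolding filterlim_at_bot
  proof
    fix Z :: real
    show "eventually (\<lambda>x. x + c \<le> Z) at_bot" using eventually_le_at_bot[of "Z - c"] by eventually_elim simp
  qed
  show "(Theta \<longlongrightarrow> 0) at_top"
    using infsum_tendsto_zero[OF eps_summable0 B theta_top t, of "2 * pi"] by (simp add: Theta_def[abs_def] e0)
  show "(Theta \<longlongrightarrow> 0) at_bot"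
    using infsum_tendsto_zero[OF eps_summable0 B theta_bot b, of "2 * pi"] by (simp add: Theta_def[abs_def])
qed

text \<open>The three Gaussians combine into one because the weight is a character times \<open>exp (2 * alpha * x\<^sup>2)\<close>.\<close>

lemma kernel_identity:
  "exp (- alpha * of_real x ^ 2 + beta' * of_real x + 0) * (eps n * theta' (x + 2 * pi * of_int n)) =
     \<i> * (\<psi>0 (x + 2 * pi * of_int n) * hh (x + 4 * pi * of_int n))"
proof -
  \<comment> \<open>Dividing by \<open>exp ?L\<close> removes the \<open>1/4\<close> of
    \<open>(of_int n - 1/2)\<^sup>2\<close> and leaves \<open>exp (\<i> * pi / 2)\<close> as the
    only constant factor.\<close>
  let ?L = "\<i> / \<tau> * (- pi / 2 * \<tau> - pi / 4)"
  have "exp (- alpha * of_real x ^ 2 + beta' * of_real x + 0) *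
      (eps n * (weight \<tau> p q s t 0 (x + 2 * pi * of_int n) / exp ?L)) = exp (\<i> * pi / 2) * hh (x + 4 * pi * of_int n)"
    unfolding eps_def weight_def hh_def minus_one_powi_exp exp_diff[symmetric] mult_exp_exp
    by (rule arg_cong[where f = exp])
      (simp add: alpha_def beta_def beta'_def sigma_def delta_def field_simps power2_eq_square)
  also have "exp (\<i> * pi / 2) = \<i>" using cis_pi_half by (simp add: cis_conv_exp)
  finally have key: "exp (- alpha * of_real x ^ 2 + beta' * of_real x + 0) *
      (eps n * (weight \<tau> p q s t 0 (x + 2 * pi * of_int n) / exp ?L)) = \<i> * hh (x + 4 * pi * of_int n)" .
  have "exp (- alpha * of_real x ^ 2 + beta' * of_real x + 0) * (eps n * theta' (x + 2 * pi * of_int n)) =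
      \<psi>0 (x + 2 * pi * of_int n) * (exp (- alpha * of_real x ^ 2 + beta' * of_real x + 0) *
      (eps n * (weight \<tau> p q s t 0 (x + 2 * pi * of_int n) / exp ?L)))" by (simp add: theta'_def)
  also have "\<dots> = \<psi>0 (x + 2 * pi * of_int n) * (\<i> * hh (x + 4 * pi * of_int n))" by (simp only: key)
  finally show ?thesis by (simp only: mult.left_commute)
qed

text \<open>The rows of $\tilde\phi$ are \<open>a1\<close>, \<open>a2\<close> and \<open>u1\<close>, \<open>u2\<close>.\<close>

definition psi :: "real \<Rightarrow> real \<Rightarrow> complex" where "psi = zak (2 * pi) \<psi>0"
definition a1 :: "real \<Rightarrow> real \<Rightarrow> complex" where "a1 = zak (4 * pi) kk"
definition a2 :: "real \<Rightarrow> real \<Rightarrow> complex" where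
  "a2 x y = exp (\<i> / 2 * of_real y) * zak (4 * pi) (\<lambda>x. kk (x + 2 * pi)) x y"
definition u1 :: "real \<Rightarrow> real \<Rightarrow> complex" where "u1 = zak (- 4 * pi) hh"
definition u2 :: "real \<Rightarrow> real \<Rightarrow> complex" where
  "u2 x y = exp (\<i> / 2 * of_real y) * zak (- 4 * pi) (\<lambda>x. hh (x + - 2 * pi)) x y"
definition RR :: "real \<Rightarrow> complex" where "RR = zero_mode (\<lambda>x y. psi x y * u1 x y)"

section \<open>The source of the equation for the first row\<close>

lemma pi_ge_1: "\<bar>2 * pi\<bar> \<ge> 1" "\<bar>4 * pi\<bar> \<ge> 1" "\<bar>- 4 * pi\<bar> \<ge> 1" "2 * pi \<ge> 1" "4 * pi \<ge> 1"
  using pi_gt3 by auto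

lemma schwartz_hh: "schwartz hh"
  unfolding hh_def[abs_def] by (rule schwartz_gaussian[OF Re_alpha])

lemma zak_shift_arg: "zak P (\<lambda>x. g (x + c)) x y = zak P g (x + c) y"
  by (simp add: zak_def ac_simps)

lemma u1_shift: "u1 (x + 4 * pi) y = exp (\<i> * of_real y) * u1 x y"
proof -
  have "u1 x y = exp (- \<i> * of_real y) * u1 (x + 4 * pi) y"
    using zak_shift_x[of "- 4 * pi" hh "x + 4 * pi" y] by (simp add: u1_def)
  then show ?thesis by (simp add: exp_minus)
qed

lemma psi_shift: "psi (x + 2 * pi) y = exp (- \<i> * of_real y) * psi x y"
  by (simp add: psi_def zak_shift_x)

lemma smooth_psi: "smooth psi"
  unfolding psi_def by (rule smooth_zak[OF psi0 pi_ge_1(1)])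

lemma smooth_u1: "smooth u1"
  unfolding u1_def by (rule smooth_zak[OF schwartz_hh pi_ge_1(3)])

text \<open>Over \<open>4 * pi\<close> the cocycle gains \<open>exp (- \<i> * of_real y)\<close>
  twice and \<open>u1\<close> gains its inverse once.\<close>

lemma quasi_periodic_psi_u1: "quasi_periodic (4 * pi) (\<lambda>x y. psi x y * u1 x y)"
proof -
  have "psi (x + 4 * pi) y = exp (- \<i> * of_real y) * (exp (- \<i> * of_real y) * psi x y)" for x y
    using psi_shift[of "x + 2 * pi" y] psi_shift[of x y] by (simp add: algebra_simps)
  then have "psi (x + 4 * pi) y * u1 (x + 4 * pi) y = exp (- \<i> * of_real y) * (psi x y * u1 x y)" for x y
    unfolding u1_shift by (simp add: exp_minus)
  then show ?thesis
    by (simp add: quasi_periodic_def smooth_mult[OF smooth_psi smooth_u1]) (simp add: psi_def u1_def zak_shift_y)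
qed

lemma schwartz_RR: "schwartz RR"
  unfolding RR_def by (rule schwartz_zero_mode[OF quasi_periodic_psi_u1]) simp

lemma zak_RR: "zak (4 * pi) RR x y = psi x y * u1 x y"
  unfolding RR_def by (rule fun_cong[OF fun_cong[OF zak_zero_mode[OF quasi_periodic_psi_u1 pi_ge_1(5), symmetric]]])

text \<open>A product of Fourier series convolves coefficients; this is the coefficient of index
  0.\<close>

lemma RR_eq: "RR x = (\<Sum>\<^sub>\<infinity>m. \<psi>0 (x + 2 * pi * of_int m) * hh (x + 4 * pi * of_int m))"
proof -
  let ?f = "\<lambda>n::int. \<psi>0 (x + 2 * pi * of_int n)" and ?g = "\<lambda>n::int. hh (x + - 4 * pi * of_int n)"
  have f: "(\<lambda>n. norm (?f n)) summable_on UNIV"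
    using rapid_lattice_summable[OF schwartz_rapid[OF psi0] pi_ge_1(1), of 0] by simp
  have g: "(\<lambda>n. norm (?g n)) summable_on UNIV"
    using rapid_lattice_summable[OF schwartz_rapid[OF schwartz_hh] pi_ge_1(3), of 0] by simp
  have "(\<lambda>y. psi x y * u1 x y) = (\<lambda>y. \<Sum>\<^sub>\<infinity>N. (\<Sum>\<^sub>\<infinity>m. ?f m * ?g (N - m)) * fmode N y)"
    unfolding psi_def u1_def zak_def by (rule ext) (rule fourier_series_mult[OF f g])
  then have "RR x = (\<Sum>\<^sub>\<infinity>m. ?f m * ?g (0 - m))"
    unfolding RR_def zero_mode_def by (simp only: fourier_coeff_series[OF convolution_summable[OF f g]])
  then show ?thesis by simp
qed

text \<open>Summing \<open>kernel_identity\<close> over \<open>n\<close> turns the derivative of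
  \<open>Theta\<close> into the convolution \<open>RR_eq\<close>: the normalized weights were made
  for this match.\<close>

lemma Theta_derivative_RR:
  "(Theta has_vector_derivative exp (- (- alpha * of_real x ^ 2 + beta' * of_real x + 0)) * (\<i> * RR x)) (at x)"
proof -
  let ?Q = "- alpha * of_real x ^ 2 + beta' * of_real x + 0"
  let ?S = "\<Sum>\<^sub>\<infinity>n. eps n * theta' (x + 2 * pi * of_int n)"
  have e: "exp (- w) * (exp w * z) = z" for w z :: complex by (simp add: exp_minus)
  have "exp ?Q * ?S = \<i> * RR x"
    unfolding RR_eq infsum_cmult_right'[symmetric] kernel_identity ..
  then have "?S = exp (- ?Q) * (\<i> * RR x)" using e[of ?Q ?S] by (simp only:)
  then show ?thesis using Theta_has_vector_derivative[of x] by (simp only:)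
qed

text \<open>An instance of variation of constants; the two limits of \<open>Theta\<close> are what
  permits a decaying solution despite the growing Gaussian.\<close>

lemma schwartz_kk: "schwartz kk"
  and kk_has_vector_derivative: "(kk has_vector_derivative (2 * (- alpha) * of_real x + beta') * kk x + (Ck * \<i>) * RR x) (at x)"
proof -
  have a: "Re (- alpha) > 0" using Re_alpha by simp
  have R: "schwartz (\<lambda>x. \<i> * RR x)" by (intro schwartz_cmult schwartz_RR)
  note sol = schwartz_ode_solution[OF a R Theta_derivative_RR Theta_top Theta_bot]
  show "schwartz kk" unfolding kk_def[abs_def] by (rule schwartz_cmult[OF sol(1)])
  show "(kk has_vector_derivative (2 * (- alpha) * of_real x + beta') * kk x + (Ck * \<i>) * RR x) (at x)"
    unfolding kk_def[abs_def]
    by (rule has_vector_derivative_eq_rhs[OF has_vector_derivative_mult_right[OF sol(2)]]) (simp add: algebra_simps)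
qed

lemma smooth_a1: "smooth a1"
  unfolding a1_def by (rule smooth_zak[OF schwartz_kk pi_ge_1(2)])

lemma smooth_half_twist: "smooth f \<Longrightarrow> smooth (\<lambda>x y. exp (\<i> / 2 * of_real y) * f x y)"
  using smooth_mult[OF smooth_exp_affine[of 0 "\<i> / 2" 0]] by simp

lemma dbar_half_twist:
  assumes "smooth f"
  shows "\<tau> * partial_x (\<lambda>x y. exp (\<i> / 2 * of_real y) * f x y) x y - partial_y (\<lambda>x y. exp (\<i> / 2 * of_real y) * f x y) x y =
    exp (\<i> / 2 * of_real y) * (\<tau> * partial_x f x y - partial_y f x y - \<i> / 2 * f x y)"
  using partial_mult[OF smooth_exp_affine[of 0 "\<i> / 2" 0] assms] partial_exp_affine[of 0 "\<i> / 2" 0]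
  by (simp add: algebra_simps)

lemma smooth_a2: "smooth a2"
  unfolding a2_def[abs_def] by (intro smooth_half_twist smooth_zak schwartz_shift schwartz_kk pi_ge_1)

lemma smooth_u2: "smooth u2"
  unfolding u2_def[abs_def] by (intro smooth_half_twist smooth_zak schwartz_shift schwartz_hh pi_ge_1)

section \<open>Transition laws of the rows\<close>

lemma u1_y: "u1 x (y + 2 * pi) = u1 x y" and a1_y: "a1 x (y + 2 * pi) = a1 x y"
  by (simp_all add: u1_def a1_def zak_shift_y)

lemma exp_half_y: "exp (\<i> / 2 * complex_of_real (y + 2 * pi)) = - exp (\<i> / 2 * of_real y)"
proof -
  have "\<i> / 2 * complex_of_real (y + 2 * pi) = \<i> / 2 * of_real y + of_real pi * \<i>" by (simp add: algebra_simps)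
  then show ?thesis by (simp only: exp_add exp_pi_i mult_minus_right mult_1_right)
qed

lemma u2_y: "u2 x (y + 2 * pi) = - u2 x y" and a2_y: "a2 x (y + 2 * pi) = - a2 x y"
  by (simp_all only: u2_def a2_def zak_shift_y exp_half_y mult_minus_left)

lemma exp_half_square: "exp (\<i> / 2 * of_real y) * exp (\<i> / 2 * of_real y) = exp (\<i> * complex_of_real y)"
  by (simp add: exp_add[symmetric])

lemma a2_eq: "a2 x y = exp (\<i> / 2 * of_real y) * a1 (x + 2 * pi) y"
  unfolding a2_def a1_def zak_shift_arg ..

text \<open>The backward shift in the definition of \<open>u2\<close> is traded for a forward one
  with the multiplier of \<open>u1\<close>, so that translation by \<open>2 * pi\<close> exchanges
  \<open>u1\<close> and \<open>u2\<close> directly.\<close>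

lemma u2_eq: "u2 x y = exp (- (\<i> / 2 * of_real y)) * u1 (x + 2 * pi) y"
proof -
  have "u1 (x + 2 * pi) y = exp (\<i> * of_real y) * u1 (x + - 2 * pi) y"
    using u1_shift[of "x + - 2 * pi" y] by (simp add: algebra_simps)
  then show ?thesis unfolding u2_def zak_shift_arg u1_def[symmetric] exp_half_square[symmetric]
    by (simp add: exp_minus)
qed

lemma a1_x: "a1 (x + 2 * pi) y * exp (\<i> / 2 * of_real y) = a2 x y"
  by (simp add: a2_eq)

lemma a2_x: "a2 (x + 2 * pi) y * exp (\<i> / 2 * of_real y) = a1 x y"
proof -
  have "a1 (x + 4 * pi) y = exp (- \<i> * of_real y) * a1 x y" unfolding a1_def by (rule zak_shift_x)
  then have "a2 (x + 2 * pi) y * exp (\<i> / 2 * of_real y) = exp (\<i> * of_real y) * (exp (- \<i> * of_real y) * a1 x y)"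
    unfolding a2_eq exp_half_square[symmetric] by (simp add: algebra_simps)
  then show ?thesis by (simp add: exp_minus)
qed

lemma u1_x: "u1 (x + 2 * pi) y * exp (\<i> / 2 * of_real y) = exp (\<i> * of_real y) * u2 x y"
  unfolding u2_eq exp_half_square[symmetric] by (simp add: exp_minus)

lemma u2_x: "u2 (x + 2 * pi) y * exp (\<i> / 2 * of_real y) = exp (\<i> * of_real y) * u1 x y"
proof -
  have "u1 (x + 2 * pi + 2 * pi) y = exp (\<i> * of_real y) * u1 x y" using u1_shift[of x y] by (simp add: algebra_simps)
  then show ?thesis unfolding u2_eq by (simp add: exp_minus)
qed

section \<open>First order equations of the rows\<close>

lemma u1_dbar: "\<tau> * partial_x u1 x y - partial_y u1 x y =
    - (\<i> / (4 * pi) * (of_real x - sigma - delta * \<tau> - pi - pi * \<tau>)) * u1 x y"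
proof -
  let ?b = "\<i> / (4 * pi) * (- sigma - delta * \<tau> - pi - pi * \<tau>)"
  obtain hh' where hh': "schwartz hh'" "\<And>x. (hh has_vector_derivative hh' x) (at x)"
    using schwartz_hh by (metis schwartzE)
  have e: "hh' x = (2 * alpha * of_real x + beta) * hh x" for x
    using vector_derivative_unique_at[OF hh'(2) has_vector_derivative_exp_quadratic[of alpha beta 0 x, folded hh_def[abs_def]]]
    by (simp add: hh_def)
  \<comment> \<open>The logarithmic derivative of the Gaussian cancels the affine coefficient, so
    the equation for \<open>hh\<close> is homogeneous.\<close>
  have c: "\<tau> * (2 * alpha * of_real x + beta) = - (\<i> / (4 * pi) * of_real x + ?b)" for x
    by (simp add: alpha_def beta_def field_simps)
  have ode: "\<tau> * hh' x + (\<i> / (4 * pi) * of_real x + ?b) * hh x = 0" for x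
    unfolding e mult.assoc[symmetric] c by (simp only: mult_minus_left left_minus)
  have "\<tau> * partial_x u1 x y - partial_y u1 x y + (\<i> / (4 * pi) * of_real x + ?b) * u1 x y = zak (- 4 * pi) (\<lambda>x. 0) x y"
    unfolding u1_def by (rule zak_ode[OF schwartz_hh hh'(2,1) ode pi_ge_1(3)]) simp
  then show ?thesis by (simp add: zak_def algebra_simps add_eq_0_iff2)
qed

lemma a1_dbar: "\<tau> * partial_x a1 x y - partial_y a1 x y =
    - (\<i> / (4 * pi) * (sigma + delta * \<tau> - of_real x - pi - pi * \<tau>)) * a1 x y + (cnj \<tau> - \<tau>) / 2 * (psi x y * u1 x y)"
proof -
  let ?b = "\<i> / (4 * pi) * (sigma + delta * \<tau> - pi - pi * \<tau>)"
  obtain kk' where kk': "schwartz kk'" "\<And>x. (kk has_vector_derivative kk' x) (at x)"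
    using schwartz_kk by (metis schwartzE)
  have "kk' x = (2 * (- alpha) * of_real x + beta') * kk x + (Ck * \<i>) * RR x" for x
    using vector_derivative_unique_at[OF kk'(2) kk_has_vector_derivative] .
  moreover have "\<tau> * (2 * (- alpha) * of_real x + beta') = - (- \<i> / (4 * pi) * of_real x + ?b)" for x
    by (simp add: alpha_def beta'_def field_simps)
  \<comment> \<open>This fixes \<open>Ck\<close>: after the factor
    \<open>2 / (\<tau> - cnj \<tau>)\<close> of \<open>dbar_coeff\<close> the source becomes exactly
    \<open>- psi x y * u1 x y\<close>.\<close>
  moreover have "\<tau> * (Ck * \<i>) = (cnj \<tau> - \<tau>) / 2" by (simp add: Ck_def field_simps)
  ultimately have "\<tau> * kk' x = - (- \<i> / (4 * pi) * of_real x + ?b) * kk x + (cnj \<tau> - \<tau>) / 2 * RR x" for x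
    by (metis (no_types, lifting) distrib_left mult.assoc)
  then have ode: "\<tau> * kk' x + (- \<i> / (4 * pi) * of_real x + ?b) * kk x = (cnj \<tau> - \<tau>) / 2 * RR x" for x
    by (simp add: algebra_simps)
  have "\<tau> * partial_x a1 x y - partial_y a1 x y + (- \<i> / (4 * pi) * of_real x + ?b) * a1 x y =
      zak (4 * pi) (\<lambda>x. (cnj \<tau> - \<tau>) / 2 * RR x) x y"
    unfolding a1_def by (rule zak_ode[OF schwartz_kk kk'(2,1) ode pi_ge_1(2)]) simp
  also have "\<dots> = (cnj \<tau> - \<tau>) / 2 * (psi x y * u1 x y)"
    unfolding zak_RR[symmetric] by (simp only: zak_def infsum_cmult_right' mult.assoc)
  finally have "\<tau> * partial_x a1 x y - partial_y a1 x y =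
      - (- \<i> / (4 * pi) * of_real x + ?b) * a1 x y + (cnj \<tau> - \<tau>) / 2 * (psi x y * u1 x y)"
    by (metis (no_types, lifting) add_diff_cancel_left' add.commute diff_conv_add_uminus mult_minus_left)
  also have "- \<i> / (4 * pi) * of_real x + ?b = \<i> / (4 * pi) * (sigma + delta * \<tau> - of_real x - pi - pi * \<tau>)"
    by (simp add: field_simps)
  finally show ?thesis .
qed

lemma partial_shift_x:
  "partial_x (\<lambda>x y. f (x + c) y) x y = partial_x f (x + c) y" "partial_y (\<lambda>x y. f (x + c) y) x y = partial_y f (x + c) y"
  for f :: "real \<Rightarrow> real \<Rightarrow> complex"
  by (simp_all add: partial_x_def partial_y_def vector_derivative_shift[of "\<lambda>u. f u y"])

lemma u2_dbar: "\<tau> * partial_x u2 x y - partial_y u2 x y =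
    - (\<i> / (4 * pi) * (of_real x - sigma - delta * \<tau> - pi - pi * \<tau>)) * u2 x y"
proof -
  have u2: "u2 = (\<lambda>x y. exp (\<i> / 2 * of_real y) * u1 (x + - 2 * pi) y)"
    unfolding fun_eq_iff u2_def zak_shift_arg u1_def by (intro allI refl)
  have sm: "smooth (\<lambda>x y. u1 (x + - 2 * pi) y)"
    unfolding u1_def zak_shift_arg[symmetric] by (intro smooth_zak schwartz_shift schwartz_hh pi_ge_1)
  show ?thesis
    unfolding u2 dbar_half_twist[OF sm] partial_shift_x u1_dbar by (simp add: field_simps)
qed

lemma a2_dbar: "\<tau> * partial_x a2 x y - partial_y a2 x y =
    - (\<i> / (4 * pi) * (sigma + delta * \<tau> - of_real x - pi - pi * \<tau>)) * a2 x y + (cnj \<tau> - \<tau>) / 2 * (psi x y * u2 x y)"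
proof -
  have a2: "a2 = (\<lambda>x y. exp (\<i> / 2 * of_real y) * a1 (x + 2 * pi) y)"
    by (simp add: fun_eq_iff a2_eq)
  have sm: "smooth (\<lambda>x y. a1 (x + 2 * pi) y)"
    unfolding a1_def zak_shift_arg[symmetric] by (intro smooth_zak schwartz_shift schwartz_kk pi_ge_1)
  \<comment> \<open>The multiplier of \<open>psi\<close> over \<open>2 * pi\<close> is what converts
    the half twist of \<open>u2_eq\<close> into that of \<open>a2\<close>.\<close>
  have pu: "psi x y * u2 x y = exp (\<i> / 2 * of_real y) * (psi (x + 2 * pi) y * u1 (x + 2 * pi) y)"
  proof -
    have e: "exp (- (\<i> / 2 * complex_of_real y)) = exp (\<i> / 2 * of_real y) * exp (- \<i> * of_real y)"
      by (simp add: exp_add[symmetric])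
    have "b * ((a * c) * d) = a * ((c * b) * d)" for a b c d :: complex by simp
    then show ?thesis unfolding psi_shift u2_eq e .
  qed
  show ?thesis
    unfolding pu unfolding a2 dbar_half_twist[OF sm] partial_shift_x a1_dbar by (simp add: field_simps)
qed

end

section \<open>The explicit maps\<close>

text \<open>The reciprocal of the determinant of the first map times \<open>c_const \<tau>\<close>,
  as \<open>adj_factor_det\<close> shows. The four identities below exhibit the entries of
  \<open>phi\<close> as this factor times the adjugate of \<open>phi_tilde\<close>.\<close>

definition adj_factor :: "complex \<Rightarrow> real \<Rightarrow> real \<Rightarrow> real \<Rightarrow> real \<Rightarrow> real \<Rightarrow> real \<Rightarrow> complex" where
  "adj_factor \<tau> p q s t x y =
     - \<i> * exp (- \<i> / 2 * x + \<i> / 2 * y - \<i> / (2 * \<tau>) * (p - s) - \<i> / 2 * (q - t))"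
  for \<tau> :: complex and p q s t x y :: real

lemma minus_one_powi_succ: "(-1 :: complex) powi (n + 1) = - ((-1) powi n)"
  by (simp add: power_int_minus_left)

lemma minus_one_powi_uminus: "(-1 :: complex) powi (- n) = (-1) powi n"
  using power_int_minus_one_minus[of n] by simp

section \<open>The entries of phi as multiples of the adjugate of phi tilde\<close>

lemma phi22_eq:
  assumes "\<tau> \<noteq> 0"
  shows "phi22 \<tau> p q s t \<theta> x y = adj_factor \<tau> p q s t x y * phit11 \<tau> p q s t \<theta> x y"
proof -
  have e: "exp (- (\<i> / (4 * pi)) * (q - t + pi) * x + \<i> / 2 * y - \<i> / (8 * pi * \<tau>) * (p - s + pi)^2 - \<i> / 2 * (q - t)) =
    exp (- \<i> / 2 * x + \<i> / 2 * y - \<i> / (2 * \<tau>) * (p - s) - \<i> / 2 * (q - t)) *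
    exp (- (\<i> / (4 * pi)) * (q - t - pi) * x - \<i> / (8 * pi * \<tau>) * (p - s - pi)^2)"
    unfolding exp_add[symmetric]
    by (rule arg_cong[where f = exp]) (use assms in \<open>simp add: field_simps power2_eq_square\<close>)
  have gen: "- c * (A * B) * S = (- \<i> * A) * (- c * \<i> * B * S)" for c A B S :: complex
  proof -
    have "(- \<i> * A) * (- c * \<i> * B * S) = (\<i> * \<i>) * (c * (A * B) * S)" by algebra
    then show ?thesis by simp
  qed
  show ?thesis unfolding phi22_def phit11_def adj_factor_def e by (rule gen)
qed

lemma phi21_eq:
  assumes "\<tau> \<noteq> 0"
  shows "phi21 \<tau> p q s t x y = - (adj_factor \<tau> p q s t x y * phit21 \<tau> p q s t x y)"
proof -
  have e: "exp (\<i> / (4 * pi) * (q - t - pi) * x + \<i> / 2 * y + \<i> / (8 * pi * \<tau>) * (p - s - pi)^2 - \<i> / 2 * (q - t)) =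
    exp (- \<i> / 2 * x + \<i> / 2 * y - \<i> / (2 * \<tau>) * (p - s) - \<i> / 2 * (q - t)) *
    exp (\<i> / (4 * pi) * (q - t + pi) * x + \<i> / (8 * pi * \<tau>) * (p - s + pi)^2)"
    unfolding exp_add[symmetric]
    by (rule arg_cong[where f = exp]) (use assms in \<open>simp add: field_simps power2_eq_square\<close>)
  show ?thesis unfolding phi21_def phit21_def adj_factor_def e by simp
qed

text \<open>The centres of the two Gaussian series agree after the substitution
  \<open>M = L + 1\<close>; the sign this produces is the square of the two factors
  \<open>- \<i>\<close>.\<close>

lemma phi11_eq:
  assumes "\<tau> \<noteq> 0"
  shows "phi11 \<tau> p q s t x y = adj_factor \<tau> p q s t x y * phit22 \<tau> p q s t x y"
proof -
  let ?t = "\<lambda>L::int. (-1) powi L * exp (- \<i> * (q - t) * of_int L - \<i> / (8 * pi * \<tau>) * (x - 4 * pi * of_int L - p + s - 3 * pi)^2)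
         * exp (\<i> * of_int L * y)"
  let ?P = "exp (\<i> / (4 * pi) * (q - t - pi) * x + \<i> / (8 * pi * \<tau>) * (p - s - pi)^2)"
  let ?P' = "- \<i> * exp (\<i> / (4 * pi) * (q - t + pi) * x + \<i> / 2 * y + \<i> / (8 * pi * \<tau>) * (p - s + pi)^2 - \<i> / 2 * (q - t))"
  have term_eq: "?P * ((-1) powi (L + 1) * exp (- \<i> * (q - t) * of_int (L + 1) - \<i> / (8 * pi * \<tau>) * (x - 4 * pi * of_int (L + 1) - p + s + pi)^2)
         * exp (\<i> * of_int (L + 1) * y)) = adj_factor \<tau> p q s t x y * (?P' * ?t L)" for L
  proof -
    have gen: "P * (- w * e1 * e2) = (- \<i> * A) * (- \<i> * P' * (w * e3 * e4))"
      if "P * (e1 * e2) = A * P' * e3 * e4" for P w e1 e2 A P' e3 e4 :: complex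
    proof -
      have "P * (- w * e1 * e2) = - w * (P * (e1 * e2))" by simp
      also have "\<dots> = (\<i> * \<i>) * (w * (A * P' * e3 * e4))" unfolding that by simp
      also have "\<dots> = (- \<i> * A) * (- \<i> * P' * (w * e3 * e4))" by algebra
      finally show ?thesis .
    qed
    have e: "?P * (exp (- \<i> * (q - t) * of_int (L + 1) - \<i> / (8 * pi * \<tau>) * (x - 4 * pi * of_int (L + 1) - p + s + pi)^2)
         * exp (\<i> * of_int (L + 1) * y)) =
      exp (- \<i> / 2 * x + \<i> / 2 * y - \<i> / (2 * \<tau>) * (p - s) - \<i> / 2 * (q - t)) *
      exp (\<i> / (4 * pi) * (q - t + pi) * x + \<i> / 2 * y + \<i> / (8 * pi * \<tau>) * (p - s + pi)^2 - \<i> / 2 * (q - t)) *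
      exp (- \<i> * (q - t) * of_int L - \<i> / (8 * pi * \<tau>) * (x - 4 * pi * of_int L - p + s - 3 * pi)^2)
         * exp (\<i> * of_int L * y)"
      unfolding mult_exp_exp
      by (rule arg_cong[where f = exp]) (use assms in \<open>simp add: field_simps power2_eq_square\<close>)
    show ?thesis unfolding minus_one_powi_succ adj_factor_def by (rule gen[OF e])
  qed
  have "phi11 \<tau> p q s t x y = (\<Sum>\<^sub>\<infinity>M\<in>(UNIV::int set). ?P * ((-1) powi M * exp (- \<i> * (q - t) * of_int M - \<i> / (8 * pi * \<tau>) * (x - 4 * pi * of_int M - p + s + pi)^2)
         * exp (\<i> * of_int M * y)))"
    unfolding phi11_def infsum_cmult_right' ..
  also have "\<dots> = (\<Sum>\<^sub>\<infinity>L. adj_factor \<tau> p q s t x y * (?P' * ?t L))"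
    unfolding term_eq[symmetric] by (rule infsum_int_shift[symmetric])
  also have "\<dots> = adj_factor \<tau> p q s t x y * phit22 \<tau> p q s t x y"
    unfolding phit22_def infsum_cmult_right' ..
  finally show ?thesis .
qed

text \<open>The outer index is shifted by one, \<open>N = J + 1\<close>, while the inner sum over
  \<open>H\<close> stays untouched term by term.\<close>

lemma phi12_eq:
  assumes "\<tau> \<noteq> 0"
  shows "phi12 \<tau> p q s t \<theta> x y = - (adj_factor \<tau> p q s t x y * phit12 \<tau> p q s t \<theta> x y)"
proof -
  let ?c = "(cnj \<tau> - \<tau>) / (2 * \<tau>)"
  let ?t' = "\<lambda>J H. (-1) powi (J + H) * exp (- \<i> * (q - t) * of_int J - pi * \<i> / \<tau> * (of_int H - 2 * of_int J - 3/2)^2) * \<theta> H x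
         * exp (\<i> / (8 * pi * \<tau>) * (x + 4 * pi * of_int J - p + s + 3 * pi)^2) * exp (\<i> * of_int J * y)"
  let ?t = "\<lambda>N H. (-1) powi (N + H) * exp (- \<i> * (q - t) * of_int N - pi * \<i> / \<tau> * (of_int H - 2 * of_int N + 1/2)^2) * \<theta> H x
         * exp (\<i> / (8 * pi * \<tau>) * (x + 4 * pi * of_int N - p + s - pi)^2) * exp (\<i> * of_int N * y)"
  let ?E = "exp (- (\<i> / (4 * pi)) * (q - t + pi) * x - \<i> / (8 * pi * \<tau>) * (p - s + pi)^2)"
  let ?E' = "exp (- (\<i> / (4 * pi)) * (q - t - pi) * x + \<i> / 2 * y - \<i> / (8 * pi * \<tau>) * (p - s - pi)^2 - \<i> / 2 * (q - t))"
  let ?A = "exp (- \<i> / 2 * x + \<i> / 2 * y - \<i> / (2 * \<tau>) * (p - s) - \<i> / 2 * (q - t))"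
  have term_eq: "(?c * \<i> * ?E) * ?t (J + 1) H = - (adj_factor \<tau> p q s t x y * ((- ?c * ?E') * ?t' J H))" for J H :: int
  proof -
    have "?E * exp (- \<i> * (q - t) * of_int (J + 1) - pi * \<i> / \<tau> * (of_int H - 2 * of_int (J + 1) + 1/2)^2)
         * exp (\<i> / (8 * pi * \<tau>) * (x + 4 * pi * of_int (J + 1) - p + s - pi)^2) * exp (\<i> * of_int (J + 1) * y) =
      ?A * ?E' * exp (- \<i> * (q - t) * of_int J - pi * \<i> / \<tau> * (of_int H - 2 * of_int J - 3/2)^2)
         * exp (\<i> / (8 * pi * \<tau>) * (x + 4 * pi * of_int J - p + s + 3 * pi)^2) * exp (\<i> * of_int J * y)"
      (is "?L = ?R")
      unfolding mult_exp_exp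
      by (rule arg_cong[where f = exp]) (use assms in \<open>simp add: field_simps power2_eq_square\<close>)
    moreover have "(-1 :: complex) powi (J + 1 + H) = - ((-1) powi (J + H))"
      using minus_one_powi_succ[of "J + H"] by (simp add: ac_simps)
    moreover have "(?c * \<i> * ?E) * ?t (J + 1) H = ?c * \<i> * (-1) powi (J + 1 + H) * \<theta> H x * ?L" by (simp only: ac_simps)
    moreover have "- (adj_factor \<tau> p q s t x y * ((- ?c * ?E') * ?t' J H)) = - (- \<i> * - ?c * (-1) powi (J + H) * \<theta> H x * ?R)"
      unfolding adj_factor_def by (simp only: ac_simps)
    ultimately show ?thesis by simp
  qed
  have "phi12 \<tau> p q s t \<theta> x y = (\<Sum>\<^sub>\<infinity>N\<in>(UNIV::int set). \<Sum>\<^sub>\<infinity>H\<in>(UNIV::int set). (?c * \<i> * ?E) * ?t N H)"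
    unfolding phi12_def infsum_cmult_right' ..
  also have "\<dots> = (\<Sum>\<^sub>\<infinity>J. \<Sum>\<^sub>\<infinity>H. (?c * \<i> * ?E) * ?t (J + 1) H)"
    by (rule infsum_int_shift[of "\<lambda>N. \<Sum>\<^sub>\<infinity>H. (?c * \<i> * ?E) * ?t N H" 1, symmetric])
  also have "\<dots> = (\<Sum>\<^sub>\<infinity>J. \<Sum>\<^sub>\<infinity>H. - (adj_factor \<tau> p q s t x y * ((- ?c * ?E') * ?t' J H)))"
    unfolding term_eq ..
  also have "\<dots> = - (adj_factor \<tau> p q s t x y * phit12 \<tau> p q s t \<theta> x y)"
    unfolding phit12_def infsum_cmult_right' infsum_uminus ..
  finally show ?thesis .
qed

context cone_setup
begin

section \<open>The series of phi tilde as Zak transforms\<close>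

lemma phit21_eq: "phit21 \<tau> p q s t x y = u1 x y"
proof -
  have "exp (\<i> / (4 * pi) * (q - t + pi) * x + \<i> / (8 * pi * \<tau>) * (p - s + pi)^2) *
      ((-1) powi K * exp (- \<i> * (q - t) * of_int K - \<i> / (8 * pi * \<tau>) * (x - 4 * pi * of_int K - p + s - pi)^2)
         * exp (\<i> * of_int K * y)) = hh (x + - 4 * pi * of_int K) * fmode K y" for K :: int
  proof -
    \<comment> \<open>The sign is taken as \<open>exp (- (\<i> * pi * of_int K))\<close>, which is
      what translating \<open>hh\<close> produces; the exponents then agree on the nose and not just
      modulo periods.\<close>
    have "exp (\<i> / (4 * pi) * (q - t + pi) * x + \<i> / (8 * pi * \<tau>) * (p - s + pi)^2) *
      (exp (- (\<i> * pi * of_int K)) * exp (- \<i> * (q - t) * of_int K - \<i> / (8 * pi * \<tau>) * (x - 4 * pi * of_int K - p + s - pi)^2)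
         * exp (\<i> * of_int K * y)) = hh (x + - 4 * pi * of_int K) * fmode K y"
      unfolding hh_def mult_exp_exp
      by (rule arg_cong[where f = exp])
        (simp add: alpha_def beta_def sigma_def delta_def field_simps power2_eq_square)
    moreover have "exp (- (\<i> * pi * of_int K)) = (-1) powi K"
      using minus_one_powi_exp[of "- K"] by (simp add: minus_one_powi_uminus)
    ultimately show ?thesis by (simp only:)
  qed
  then show ?thesis unfolding phit21_def u1_def zak_def infsum_cmult_right'[symmetric] by (simp only:)
qed

lemma phit22_eq: "phit22 \<tau> p q s t x y = u2 x y"
proof -
  have "- \<i> * exp (\<i> / (4 * pi) * (q - t + pi) * x + \<i> / 2 * y + \<i> / (8 * pi * \<tau>) * (p - s + pi)^2 - \<i> / 2 * (q - t)) *
      ((-1) powi K * exp (- \<i> * (q - t) * of_int K - \<i> / (8 * pi * \<tau>) * (x - 4 * pi * of_int K - p + s - 3 * pi)^2)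
         * exp (\<i> * of_int K * y)) = exp (\<i> / 2 * of_real y) * (hh (x + - 4 * pi * of_int K + - 2 * pi) * fmode K y)" for K :: int
  proof -
    \<comment> \<open>The prefactor \<open>- \<i>\<close> enters as the value that the shift of
      \<open>hh\<close> by \<open>- 2 * pi\<close> generates.\<close>
    have "exp (- (\<i> * pi / 2)) * exp (\<i> / (4 * pi) * (q - t + pi) * x + \<i> / 2 * y + \<i> / (8 * pi * \<tau>) * (p - s + pi)^2 - \<i> / 2 * (q - t)) *
      (exp (- (\<i> * pi * of_int K)) * exp (- \<i> * (q - t) * of_int K - \<i> / (8 * pi * \<tau>) * (x - 4 * pi * of_int K - p + s - 3 * pi)^2)
         * exp (\<i> * of_int K * y)) = exp (\<i> / 2 * of_real y) * (hh (x + - 4 * pi * of_int K + - 2 * pi) * fmode K y)"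
      unfolding hh_def mult_exp_exp
      by (rule arg_cong[where f = exp])
        (simp add: alpha_def beta_def sigma_def delta_def field_simps power2_eq_square)
    moreover have "exp (- (\<i> * pi * of_int K)) = (-1) powi K"
      using minus_one_powi_exp[of "- K"] by (simp add: minus_one_powi_uminus)
    moreover have "exp (- (\<i> * pi / 2)) = - \<i>"
      using cis_pi_half by (simp add: cis_conv_exp exp_minus)
    ultimately show ?thesis by (simp only:)
  qed
  then show ?thesis unfolding phit22_def u2_def zak_def infsum_cmult_right'[symmetric] by (simp only:)
qed

abbreviation thetas :: "int \<Rightarrow> real \<Rightarrow> complex" where
  "thetas \<equiv> \<lambda>H x. \<theta> (x + 2 * pi * of_int H)"

lemma phit11_eq: "phit11 \<tau> p q s t thetas x y = a1 x y"
proof -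
  let ?c = "- ((cnj \<tau> - \<tau>) / (2 * \<tau>)) * \<i>"
  let ?E = "exp (- (\<i> / (4 * pi)) * (q - t - pi) * x - \<i> / (8 * pi * \<tau>) * (p - s - pi)^2)"
  let ?t = "\<lambda>I H. (-1) powi (I + H) * exp (- \<i> * (q - t) * of_int I - pi * \<i> / \<tau> * (of_int H - 2 * of_int I - 1/2)^2) * \<theta> (x + 2 * pi * of_int H)
         * exp (\<i> / (8 * pi * \<tau>) * (x + 4 * pi * of_int I - p + s + pi)^2) * exp (\<i> * of_int I * y)"
  \<comment> \<open>With \<open>H = n + 2 * I\<close> the translates of \<open>\<theta>\<close>
    become those occurring in \<open>Theta\<close> at \<open>x + 4 * pi * of_int I\<close>.\<close>
  have term_eq: "(?c * ?E) * ?t I (n + 2 * I) =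
      (Ck * (exp (- alpha * of_real (x + 4 * pi * of_int I) ^ 2 + beta' * of_real (x + 4 * pi * of_int I) + 0) * fmode I y)) *
      (eps n * \<theta> (x + 4 * pi * of_int I + 2 * pi * of_int n))" for I n :: int
  proof -
    have 1: "(-1 :: complex) powi (I + (n + 2 * I)) = exp (\<i> * pi * of_int I) * exp (\<i> * pi * of_int n)"
      unfolding minus_one_powi_exp[symmetric] by (simp add: power_int_minus_left)
    have 2: "x + 2 * pi * of_int (n + 2 * I) = x + 4 * pi * of_int I + 2 * pi * of_int n"
      by (simp add: algebra_simps)
    have "?E * (exp (\<i> * pi * of_int I) * exp (\<i> * pi * of_int n) *
         exp (- \<i> * (q - t) * of_int I - pi * \<i> / \<tau> * (of_int (n + 2 * I) - 2 * of_int I - 1/2)^2)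
         * exp (\<i> / (8 * pi * \<tau>) * (x + 4 * pi * of_int I - p + s + pi)^2) * exp (\<i> * of_int I * y)) =
      exp (- alpha * of_real (x + 4 * pi * of_int I) ^ 2 + beta' * of_real (x + 4 * pi * of_int I) + 0) * fmode I y * eps n" (is "?L = ?R")
      unfolding eps_def minus_one_powi_exp mult_exp_exp
      by (rule arg_cong[where f = exp])
        (simp add: alpha_def beta'_def sigma_def delta_def field_simps power2_eq_square)
    moreover have "(?c * ?E) * ?t I (n + 2 * I) = ?c * \<theta> (x + 2 * pi * of_int (n + 2 * I)) * ?L"
      unfolding 1 by (simp only: ac_simps)
    moreover have "(Ck * (exp (- alpha * of_real (x + 4 * pi * of_int I) ^ 2 + beta' * of_real (x + 4 * pi * of_int I) + 0) * fmode I y)) *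
      (eps n * \<theta> (x + 4 * pi * of_int I + 2 * pi * of_int n)) = Ck * \<theta> (x + 4 * pi * of_int I + 2 * pi * of_int n) * ?R"
      by (simp only: ac_simps)
    ultimately show ?thesis unfolding 2 Ck_def by (simp only:)
  qed
  have "phit11 \<tau> p q s t thetas x y = (\<Sum>\<^sub>\<infinity>I\<in>(UNIV::int set). \<Sum>\<^sub>\<infinity>H\<in>(UNIV::int set). (?c * ?E) * ?t I H)"
    unfolding phit11_def infsum_cmult_right' ..
  \<comment> \<open>Only the inner sum is reindexed, separately for each \<open>I\<close>; the order
    of summation is kept.\<close>
  also have "\<dots> = (\<Sum>\<^sub>\<infinity>I. \<Sum>\<^sub>\<infinity>n. (?c * ?E) * ?t I (n + 2 * I))"
    by (rule infsum_cong) (rule infsum_int_shift[of "\<lambda>H. (?c * ?E) * ?t I H" "2 * I" for I, symmetric])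
  also have "\<dots> = a1 x y"
    unfolding term_eq infsum_cmult_right' a1_def zak_def kk_def Theta_def
    by (rule infsum_cong) (simp only: ac_simps)
  finally show ?thesis .
qed

lemma phit12_eq: "phit12 \<tau> p q s t thetas x y = a2 x y"
proof -
  let ?c = "- ((cnj \<tau> - \<tau>) / (2 * \<tau>))"
  let ?E = "exp (- (\<i> / (4 * pi)) * (q - t - pi) * x + \<i> / 2 * y - \<i> / (8 * pi * \<tau>) * (p - s - pi)^2 - \<i> / 2 * (q - t))"
  let ?t = "\<lambda>J H. (-1) powi (J + H) * exp (- \<i> * (q - t) * of_int J - pi * \<i> / \<tau> * (of_int H - 2 * of_int J - 3/2)^2) * \<theta> (x + 2 * pi * of_int H)
         * exp (\<i> / (8 * pi * \<tau>) * (x + 4 * pi * of_int J - p + s + 3 * pi)^2) * exp (\<i> * of_int J * y)"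
  \<comment> \<open>The shift is one larger because the centre is \<open>3/2\<close> instead of
    \<open>1/2\<close>; it accounts for the argument \<open>x + 2 * pi\<close> of \<open>kk\<close>
    in \<open>a2\<close>.\<close>
  have term_eq: "(?c * ?E) * ?t I (n + (2 * I + 1)) =
      exp (\<i> / 2 * of_real y) * ((Ck * (exp (- alpha * of_real (x + 4 * pi * of_int I + 2 * pi) ^ 2 + beta' * of_real (x + 4 * pi * of_int I + 2 * pi) + 0) * fmode I y)) *
      (eps n * \<theta> (x + 4 * pi * of_int I + 2 * pi + 2 * pi * of_int n)))" for I n :: int
  proof -
    have 1: "(-1 :: complex) powi (I + (n + (2 * I + 1))) = - (exp (\<i> * pi * of_int I) * exp (\<i> * pi * of_int n))"
      unfolding minus_one_powi_exp[symmetric] by (simp add: power_int_minus_left)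
    have 2: "x + 2 * pi * of_int (n + (2 * I + 1)) = x + 4 * pi * of_int I + 2 * pi + 2 * pi * of_int n"
      by (simp add: algebra_simps)
    have 3: "- 1 = \<i> * exp (\<i> * pi / 2)" using cis_pi_half by (simp add: cis_conv_exp)
    have "exp (\<i> * pi / 2) * (?E * (exp (\<i> * pi * of_int I) * exp (\<i> * pi * of_int n) *
         exp (- \<i> * (q - t) * of_int I - pi * \<i> / \<tau> * (of_int (n + (2 * I + 1)) - 2 * of_int I - 3/2)^2)
         * exp (\<i> / (8 * pi * \<tau>) * (x + 4 * pi * of_int I - p + s + 3 * pi)^2) * exp (\<i> * of_int I * y))) =
      exp (\<i> / 2 * of_real y) * exp (- alpha * of_real (x + 4 * pi * of_int I + 2 * pi) ^ 2 + beta' * of_real (x + 4 * pi * of_int I + 2 * pi) + 0) * fmode I y * eps n" (is "?L = ?R")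
      unfolding eps_def minus_one_powi_exp mult_exp_exp
      by (rule arg_cong[where f = exp])
        (simp add: alpha_def beta'_def sigma_def delta_def field_simps power2_eq_square)
    moreover have "(?c * ?E) * ?t I (n + (2 * I + 1)) = (?c * \<i>) * \<theta> (x + 2 * pi * of_int (n + (2 * I + 1))) * ?L"
    proof -
      have gen: "(c * E) * (- a * b * th * d * e) = (c * \<i>) * th * (w * (E * (a * b * d * e)))"
        if "- 1 = \<i> * w" for c E a b th d e w :: complex
      proof -
        have "(c * \<i>) * th * (w * (E * (a * b * d * e))) = (\<i> * w) * (c * E * a * b * th * d * e)" by simp
        then show ?thesis by (simp add: that[symmetric])
      qed
      show ?thesis unfolding 1 by (rule gen[OF 3])
    qed
    moreover have "exp (\<i> / 2 * of_real y) * ((Ck * (exp (- alpha * of_real (x + 4 * pi * of_int I + 2 * pi) ^ 2 + beta' * of_real (x + 4 * pi * of_int I + 2 * pi) + 0) * fmode I y)) *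
      (eps n * \<theta> (x + 4 * pi * of_int I + 2 * pi + 2 * pi * of_int n))) = Ck * \<theta> (x + 4 * pi * of_int I + 2 * pi + 2 * pi * of_int n) * ?R"
      by (simp only: ac_simps)
    ultimately show ?thesis unfolding 2 Ck_def by (simp only:)
  qed
  have "phit12 \<tau> p q s t thetas x y = (\<Sum>\<^sub>\<infinity>I\<in>(UNIV::int set). \<Sum>\<^sub>\<infinity>H\<in>(UNIV::int set). (?c * ?E) * ?t I H)"
    unfolding phit12_def infsum_cmult_right' ..
  also have "\<dots> = (\<Sum>\<^sub>\<infinity>I. \<Sum>\<^sub>\<infinity>n. (?c * ?E) * ?t I (n + (2 * I + 1)))"
    by (rule infsum_cong) (rule infsum_int_shift[of "\<lambda>H. (?c * ?E) * ?t I H" "2 * I + 1" for I, symmetric])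
  also have "\<dots> = a2 x y"
    unfolding term_eq infsum_cmult_right' a2_def zak_def kk_def Theta_def
    by (rule arg_cong[where f = "\<lambda>w. _ * w"], rule infsum_cong) (simp only: ac_simps)
  finally show ?thesis .
qed

text \<open>The definition of \<open>kk\<close> is inverted: \<open>Theta\<close> is the bounded
  function \<open>kk / Ck\<close> times a decaying Gaussian.\<close>

lemma superexp_Theta: "superexp Theta"
proof -
  have a: "Re alpha < 0" by (rule Re_alpha)
  have "exp (- alpha * of_real x ^ 2 + beta' * of_real x + 0) * exp (alpha * of_real x ^ 2 + (- beta') * of_real x + 0) = 1" for x :: real
    unfolding mult_exp_exp by simp
  then have "kk x / Ck * exp (alpha * of_real x ^ 2 + (- beta') * of_real x + 0) = Theta x" for x
    using Ck_nz by (simp add: kk_def mult_ac)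
  then have eq: "Theta = (\<lambda>x. kk x / Ck * exp (alpha * of_real x ^ 2 + (- beta') * of_real x + 0))" by auto
  have "schwartz (\<lambda>x. (1 / Ck) * kk x)" by (rule schwartz_cmult[OF schwartz_kk])
  then obtain B where "\<And>x. norm ((1 / Ck) * kk x) \<le> B" using rapid_bounded[OF schwartz_rapid] by metis
  then have B: "norm (kk x / Ck) \<le> B" for x by simp
  show ?thesis unfolding eq by (rule superexp_mult_bounded[OF superexp_gaussian[OF a] B])
qed

end

section \<open>The determinant\<close>

lemma infsum_diff:
  fixes f g :: "'a \<Rightarrow> complex"
  assumes "f summable_on A" "g summable_on A"
  shows "infsum (\<lambda>x. f x - g x) A = infsum f A - infsum g A"
proof -
  have "(\<lambda>x. - g x) summable_on A" using assms(2) by (simp add: summable_on_uminus)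
  from infsum_add[OF assms(1) this] show ?thesis by (simp add: infsum_uminus)
qed

context cone_setup
begin

lemma superexp_theta_step: "superexp (\<lambda>x. \<theta> x - \<theta> (x - 2 * pi))"
  by (rule superexp_difference[OF superexp_theta' theta_has_vector_derivative]) simp

text \<open>Provides the relation demanded by \<open>theta_step_sum\<close>. The increments of
  \<open>\<theta>\<close> decay at both ends although \<open>\<theta>\<close> does not, so sums over
  the lattice may be rearranged from here on.\<close>

lemma Theta_step:
  "Theta (x + 2 * pi * of_int m) - Theta (x + 2 * pi * of_int (m - 1)) =
     (\<Sum>\<^sub>\<infinity>h. eps h * (\<theta> (x + 2 * pi * of_int (h + m)) - \<theta> (x + 2 * pi * of_int (h + m) - 2 * pi)))"
proof -
  have s: "(\<lambda>h. eps h * \<theta> (z + 2 * pi * of_int h)) summable_on UNIV" for z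
    by (rule abs_summable_summable[OF Theta_summable])
  have 1: "Theta (x + 2 * pi * of_int m) = (\<Sum>\<^sub>\<infinity>h. eps h * \<theta> (x + 2 * pi * of_int (h + m)))"
    unfolding Theta_def by (rule infsum_cong) (simp add: algebra_simps)
  have 2: "Theta (x + 2 * pi * of_int (m - 1)) = (\<Sum>\<^sub>\<infinity>h. eps h * \<theta> (x + 2 * pi * of_int (h + m) - 2 * pi))"
    unfolding Theta_def by (rule infsum_cong) (simp add: algebra_simps)
  show ?thesis unfolding 1 2 right_diff_distrib
  proof (rule infsum_diff[symmetric])
    show "(\<lambda>h. eps h * \<theta> (x + 2 * pi * of_int (h + m))) summable_on UNIV"
      using s[of "x + 2 * pi * of_int m"] by (simp add: algebra_simps)
    show "(\<lambda>h. eps h * \<theta> (x + 2 * pi * of_int (h + m) - 2 * pi)) summable_on UNIV"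
      using s[of "x + 2 * pi * of_int m - 2 * pi"] by (simp add: algebra_simps)
  qed
qed

lemma Theta_lattice_summable:
  "(\<lambda>m. norm (of_int m ^ k * (Theta (x + 2 * pi * of_int m) * exp (c * of_int m)))) summable_on UNIV"
  using superexp_lattice_summable[OF superexp_Theta pi_ge_1(4)] .

lemma theta_step_lattice_summable:
  "(\<lambda>j. norm (of_int j ^ k * ((\<theta> (x + 2 * pi * of_int j) - \<theta> (x + 2 * pi * of_int j - 2 * pi)) * exp (c * of_int j)))) summable_on UNIV"
  using superexp_lattice_summable[OF superexp_theta_step pi_ge_1(4)] .

lemma Theta_twisted_sum:
  assumes "M \<noteq> 0"
  shows "(\<Sum>\<^sub>\<infinity>m. Theta (x + 2 * pi * of_int m) * exp ((2 * pi * \<i> * of_int M / \<tau>) * of_int m)) = 0"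
proof -
  let ?c = "2 * pi * \<i> * of_int M / \<tau>"
  have "(1 - exp ?c) * (\<Sum>\<^sub>\<infinity>m. Theta (x + 2 * pi * of_int m) * exp (?c * of_int m)) = 0"
  proof (rule theta_step_sum[OF Theta_step])
    show "(\<lambda>m. norm (Theta (x + 2 * pi * of_int m) * exp (?c * of_int m))) summable_on UNIV"
      using Theta_lattice_summable[of 0 x ?c] by simp
    show "(\<lambda>j. norm ((\<theta> (x + 2 * pi * of_int j) - \<theta> (x + 2 * pi * of_int j - 2 * pi)) * exp (?c * of_int j))) summable_on UNIV"
      using theta_step_lattice_summable[of 0 x ?c] by simp
    show "(\<lambda>h. norm (eps h * exp (- ?c * of_int h))) summable_on UNIV"
      using eps_summable[of 0 "- ?c"] by simp
    show "(\<Sum>\<^sub>\<infinity>h. eps h * exp (- ?c * of_int h)) = 0" by (rule eps_sum)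
  qed
  \<comment> \<open>Its norm is the exponential of a nonzero multiple of
    \<open>Re (\<i> / \<tau>)\<close>.\<close>
  moreover have "exp ?c \<noteq> 1"
  proof
    assume e: "exp ?c = 1"
    have "?c = of_real (2 * pi * of_int M) * (\<i> / \<tau>)" by simp
    then have "Re ?c = 2 * pi * of_int M * Re (\<i> / \<tau>)" by (simp only: Re_of_real_mult)
    moreover have "norm (exp ?c) = exp (Re ?c)" by simp
    ultimately have "2 * pi * of_int M * Re (\<i> / \<tau>) = 0" using e by (metis exp_eq_one_iff norm_one)
    then show False using Re_ii_div assms by auto
  qed
  ultimately show ?thesis by simp
qed

text \<open>Telescoping from the limit 0 at the bottom to the limit 1 at the top, along symmetric
  partial sums.\<close>

lemma theta_step_total: "(\<Sum>\<^sub>\<infinity>j::int. \<theta> (x + 2 * pi * of_int j) - \<theta> (x + 2 * pi * of_int j - 2 * pi)) = 1"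
proof -
  define b where "b = (\<lambda>j::int. \<theta> (x + 2 * pi * of_int j) - \<theta> (x + 2 * pi * of_int j - 2 * pi))"
  define L where "L = (\<lambda>j::int. - \<theta> (x + 2 * pi * of_int j))"
  have eq: "b = (\<lambda>j. L (j - 1) - L j)"
    by (simp add: fun_eq_iff b_def L_def algebra_simps)
  have "(\<lambda>j. norm (of_int j ^ 0 * (b j * exp (0 * of_int j)))) summable_on UNIV"
    unfolding b_def by (rule theta_step_lattice_summable)
  from abs_summable_summable[OF this] have "b summable_on UNIV"
    by (simp only: power_0 mult_1_left mult_zero_left exp_zero mult_1_right)
  from has_sum_int_symmetric_limit[OF has_sum_infsum[OF this]]
  have "(\<lambda>N. L (- int N - 1) - L (int N)) \<longlonglongrightarrow> infsum b UNIV"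
    unfolding eq sum_int_telescope .
  moreover have "(\<lambda>N. L (- int N - 1) - L (int N)) \<longlonglongrightarrow> - 0 - - 1"
    unfolding L_def
  proof (intro tendsto_diff tendsto_minus)
    have "filterlim (\<lambda>N::nat. x + 2 * pi * real N) at_top sequentially" by real_asymp
    then show "(\<lambda>N. \<theta> (x + 2 * pi * of_int (int N))) \<longlonglongrightarrow> 1"
      unfolding of_int_of_nat_eq by (rule filterlim_compose[OF theta_top])
    have "filterlim (\<lambda>N::nat. x + 2 * pi * (- real N - 1)) at_bot sequentially" by real_asymp
    then show "(\<lambda>N. \<theta> (x + 2 * pi * of_int (- int N - 1))) \<longlonglongrightarrow> 0"
      unfolding of_int_diff of_int_minus of_int_of_nat_eq of_int_1 by (rule filterlim_compose[OF theta_bot])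
  qed
  ultimately have "infsum b UNIV = - 0 - - 1" by (rule LIMSEQ_unique)
  then show ?thesis by (simp add: b_def)
qed

text \<open>Putting \<open>h = l + 1\<close> turns the odd weight into \<open>2 * h - 1\<close> with
  a change of sign, and the constant part drops out because \<open>eps\<close> sums to 0.\<close>

lemma c_const_eq: "c_const \<tau> = Ck * (\<Sum>\<^sub>\<infinity>h. of_int h * eps h)"
proof -
  let ?f = "\<lambda>h. - (2 * (of_int h * eps h) - eps h)"
  have s: "(\<lambda>h. of_int h * eps h) summable_on UNIV"
    by (rule abs_summable_summable) (use eps_summable[of 1 0] in simp)
  have "(\<Sum>\<^sub>\<infinity>l\<in>(UNIV::int set). (-1) powi l * of_int (2 * l + 1) * exp (- (pi * \<i> / \<tau>) * (of_int l + 1/2)^2)) = (\<Sum>\<^sub>\<infinity>l. ?f (l + 1))"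
    by (rule infsum_cong) (simp add: eps_def minus_one_powi_succ algebra_simps)
  also have "\<dots> = (\<Sum>\<^sub>\<infinity>h. ?f h)" by (rule infsum_int_shift)
  also have "\<dots> = - (\<Sum>\<^sub>\<infinity>h. 2 * (of_int h * eps h) - eps h)" by (rule infsum_uminus)
  also have "(\<Sum>\<^sub>\<infinity>h. 2 * (of_int h * eps h) - eps h) = (\<Sum>\<^sub>\<infinity>h. 2 * (of_int h * eps h)) - (\<Sum>\<^sub>\<infinity>h. eps h)"
    by (rule infsum_diff[OF summable_on_cmult_right[OF s] abs_summable_summable[OF eps_summable0]])
  also have "(\<Sum>\<^sub>\<infinity>h. eps h) = 0" using eps_sum[of 0] by simp
  also have "(\<Sum>\<^sub>\<infinity>h. 2 * (of_int h * eps h)) = 2 * (\<Sum>\<^sub>\<infinity>h. of_int h * eps h)" by (rule infsum_cmult_right')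
  finally have S: "(\<Sum>\<^sub>\<infinity>l\<in>(UNIV::int set). (-1) powi l * of_int (2 * l + 1) * exp (- (pi * \<i> / \<tau>) * (of_int l + 1/2)^2)) =
    - (2 * (\<Sum>\<^sub>\<infinity>h. of_int h * eps h) - 0)" .
  show ?thesis unfolding c_const_def S Ck_def by (simp add: field_simps)
qed

text \<open>The first moment of \<open>eps\<close>, times the total increment 1 of
  \<open>\<theta>\<close>.\<close>

lemma Ck_Theta_sum: "Ck * (\<Sum>\<^sub>\<infinity>m. Theta (x + 2 * pi * of_int m)) = c_const \<tau>"
proof -
  have "(\<Sum>\<^sub>\<infinity>m. Theta (x + 2 * pi * of_int m)) = (\<Sum>\<^sub>\<infinity>h. of_int h * eps h) *
      (\<Sum>\<^sub>\<infinity>j::int. \<theta> (x + 2 * pi * of_int j) - \<theta> (x + 2 * pi * of_int j - 2 * pi))"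
  proof (rule theta_step_sum_1[OF Theta_step])
    show "(\<lambda>m. norm (Theta (x + 2 * pi * of_int m))) summable_on UNIV"
      "(\<lambda>m. norm (of_int m * Theta (x + 2 * pi * of_int m))) summable_on UNIV"
      using Theta_lattice_summable[of 0 x 0] Theta_lattice_summable[of 1 x 0] by simp_all
    show "(\<lambda>j::int. norm (\<theta> (x + 2 * pi * of_int j) - \<theta> (x + 2 * pi * of_int j - 2 * pi))) summable_on UNIV"
      "(\<lambda>j::int. norm (of_int j * (\<theta> (x + 2 * pi * of_int j) - \<theta> (x + 2 * pi * of_int j - 2 * pi)))) summable_on UNIV"
      using theta_step_lattice_summable[of 0 x 0] theta_step_lattice_summable[of 1 x 0] by simp_all
    show "(\<lambda>h. norm (eps h)) summable_on UNIV" "(\<lambda>h. norm (of_int h * eps h)) summable_on UNIV"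
      using eps_summable[of 0 0] eps_summable[of 1 0] by simp_all
    show "(\<Sum>\<^sub>\<infinity>h. eps h) = 0" using eps_sum[of 0] by simp
  qed
  then show ?thesis by (simp add: theta_step_total c_const_eq)
qed

definition det_const :: "int \<Rightarrow> real \<Rightarrow> complex" where
  "det_const N x = exp (alpha * of_real (4 * pi * of_int N + 2 * pi) ^ 2 - beta * of_real (4 * pi * of_int N + 2 * pi) +
     (\<i> / 2 + \<i> / \<tau> * (of_int N + 1)) * of_real x)"

text \<open>The growing and the decaying Gaussian have opposite quadratic parts, so the product
  depends on \<open>n\<close> only through \<open>Theta\<close> and a linear exponential whose rate
  is proportional to \<open>N + 1\<close>.\<close>

lemma det_term:
  "exp (\<i> * pi * of_int n) * (kk (x + 2 * pi * of_int n) * hh (x + 2 * pi * of_int n - 4 * pi * of_int N - 2 * pi)) =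
     Ck * det_const N x * (Theta (x + 2 * pi * of_int n) * exp ((2 * pi * \<i> * of_int (N + 1) / \<tau>) * of_int n))"
proof -
  let ?X = "x + 2 * pi * of_int n"
  \<comment> \<open>The parity sign is replaced by its inverse so that the exponents match
    exactly.\<close>
  have "exp (\<i> * pi * of_int n) = exp (- (\<i> * pi * of_int n))"
    using minus_one_powi_uminus[of n] minus_one_powi_exp[of "- n"] minus_one_powi_exp[of n] by simp
  moreover have "exp (- (\<i> * pi * of_int n)) * (exp (- alpha * of_real ?X ^ 2 + beta' * of_real ?X + 0) *
      hh (?X - 4 * pi * of_int N - 2 * pi)) = det_const N x * exp ((2 * pi * \<i> * of_int (N + 1) / \<tau>) * of_int n)"
    unfolding hh_def det_const_def mult_exp_exp
    by (rule arg_cong[where f = exp])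
      (simp add: alpha_def beta_def beta'_def sigma_def delta_def field_simps power2_eq_square)
  ultimately have "exp (\<i> * pi * of_int n) * (exp (- alpha * of_real ?X ^ 2 + beta' * of_real ?X + 0) *
      hh (?X - 4 * pi * of_int N - 2 * pi)) = det_const N x * exp ((2 * pi * \<i> * of_int (N + 1) / \<tau>) * of_int n)" by (simp only:)
  moreover have "e * ((C * (g * T)) * h) = C * d * (T * f)" if "e * (g * h) = d * f" for e g h d f C T :: complex
  proof -
    have "e * ((C * (g * T)) * h) = C * T * (e * (g * h))" by (simp only: ac_simps)
    then show ?thesis unfolding that by (simp only: ac_simps)
  qed
  ultimately show ?thesis unfolding kk_def by blast
qed

text \<open>The two products sample the same sequence at even and at odd points, so their difference
  is one alternating sum. The sign is absorbed in \<open>det_term\<close>, and the twisted sum of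
  \<open>Theta\<close> vanishes unless the twist is trivial, that is \<open>N = - 1\<close>.\<close>

lemma det_coeff:
  "(\<Sum>\<^sub>\<infinity>m. kk (x + 4 * pi * of_int m) * hh (x + - 4 * pi * of_int (N - m) + - 2 * pi)) -
   (\<Sum>\<^sub>\<infinity>m. kk (x + 4 * pi * of_int m + 2 * pi) * hh (x + - 4 * pi * of_int (N - m))) =
   (if N = - 1 then det_const (- 1) x * c_const \<tau> else 0)"
proof -
  let ?F = "\<lambda>n::int. kk (x + 2 * pi * of_int n) * hh (x + 2 * pi * of_int n - 4 * pi * of_int N - 2 * pi)"
  let ?c = "2 * pi * \<i> * of_int (N + 1) / \<tau>"
  have "(\<lambda>n. norm (exp (\<i> * pi * of_int n) * ?F n)) summable_on UNIV"
    unfolding det_term norm_mult[of "Ck * det_const N x"]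
    using Theta_lattice_summable[of 0 x ?c] by (intro summable_on_cmult_right) simp
  then have F: "(\<lambda>n. norm (?F n)) summable_on UNIV" by (simp add: norm_mult)
  have "(\<Sum>\<^sub>\<infinity>m. kk (x + 4 * pi * of_int m) * hh (x + - 4 * pi * of_int (N - m) + - 2 * pi)) = (\<Sum>\<^sub>\<infinity>m. ?F (2 * m))"
    by (rule infsum_cong) (simp add: algebra_simps)
  moreover have "(\<Sum>\<^sub>\<infinity>m. kk (x + 4 * pi * of_int m + 2 * pi) * hh (x + - 4 * pi * of_int (N - m))) = (\<Sum>\<^sub>\<infinity>m. ?F (2 * m + 1))"
    by (rule infsum_cong) (simp add: algebra_simps)
  ultimately have "(\<Sum>\<^sub>\<infinity>m. kk (x + 4 * pi * of_int m) * hh (x + - 4 * pi * of_int (N - m) + - 2 * pi)) -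
   (\<Sum>\<^sub>\<infinity>m. kk (x + 4 * pi * of_int m + 2 * pi) * hh (x + - 4 * pi * of_int (N - m))) =
     (\<Sum>\<^sub>\<infinity>n. exp (\<i> * pi * of_int n) * ?F n)"
    using infsum_parity[OF F] by (simp only:)
  also have "\<dots> = Ck * det_const N x * (\<Sum>\<^sub>\<infinity>n. Theta (x + 2 * pi * of_int n) * exp (?c * of_int n))"
    unfolding det_term infsum_cmult_right' ..
  also have "\<dots> = (if N = - 1 then det_const (- 1) x * c_const \<tau> else 0)"
  proof (cases "N = - 1")
    case True
    then show ?thesis by (simp add: Ck_Theta_sum[of x, symmetric])
  next
    case False
    then have "N + 1 \<noteq> 0" by simp
    from Theta_twisted_sum[OF this, of x] False show ?thesis by (simp only: mult_zero_right if_False)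
  qed
  finally show ?thesis .
qed

lemma det_eq:
  "a1 x y * u2 x y - a2 x y * u1 x y =
     \<i> * exp (\<i> / 2 * (sigma / \<tau> + delta)) * c_const \<tau> * exp (\<i> / 2 * of_real (x - y))"
proof -
  have k: "(\<lambda>n::int. norm (kk (x + 4 * pi * of_int n))) summable_on UNIV" for x
    using rapid_lattice_summable[OF schwartz_rapid[OF schwartz_kk] pi_ge_1(2), of 0] by simp
  have h: "(\<lambda>n::int. norm (hh (x + - 4 * pi * of_int n))) summable_on UNIV" for x
    using rapid_lattice_summable[OF schwartz_rapid[OF schwartz_hh] pi_ge_1(3), of 0] by simp
  have k2: "(\<lambda>n::int. norm (kk (x + 4 * pi * of_int n + 2 * pi))) summable_on UNIV"
    using k[of "x + 2 * pi"] by (simp add: algebra_simps)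
  have h2: "(\<lambda>n::int. norm (hh (x + - 4 * pi * of_int n + - 2 * pi))) summable_on UNIV"
    using h[of "x + - 2 * pi"] by (simp add: algebra_simps)
  let ?A = "\<lambda>N::int. \<Sum>\<^sub>\<infinity>m. kk (x + 4 * pi * of_int m) * hh (x + - 4 * pi * of_int (N - m) + - 2 * pi)"
  let ?B = "\<lambda>N::int. \<Sum>\<^sub>\<infinity>m. kk (x + 4 * pi * of_int m + 2 * pi) * hh (x + - 4 * pi * of_int (N - m))"
  have sA: "(\<lambda>N. ?A N * fmode N y) summable_on UNIV"
    by (rule abs_summable_summable) (use convolution_summable[OF k h2] in \<open>simp add: norm_mult\<close>)
  have sB: "(\<lambda>N. ?B N * fmode N y) summable_on UNIV"
    by (rule abs_summable_summable) (use convolution_summable[OF k2 h] in \<open>simp add: norm_mult\<close>)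
  have "a1 x y * u2 x y - a2 x y * u1 x y = exp (\<i> / 2 * of_real y) *
      ((\<Sum>\<^sub>\<infinity>n. kk (x + 4 * pi * of_int n) * fmode n y) * (\<Sum>\<^sub>\<infinity>n. hh (x + - 4 * pi * of_int n + - 2 * pi) * fmode n y) -
       (\<Sum>\<^sub>\<infinity>n. kk (x + 4 * pi * of_int n + 2 * pi) * fmode n y) * (\<Sum>\<^sub>\<infinity>n. hh (x + - 4 * pi * of_int n) * fmode n y))"
    unfolding a1_def a2_def u1_def u2_def zak_def by (simp only: right_diff_distrib ac_simps)
  also have "\<dots> = exp (\<i> / 2 * of_real y) * ((\<Sum>\<^sub>\<infinity>N. ?A N * fmode N y) - (\<Sum>\<^sub>\<infinity>N. ?B N * fmode N y))"
    unfolding fourier_series_mult[OF k h2] fourier_series_mult[OF k2 h] ..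
  also have "(\<Sum>\<^sub>\<infinity>N. ?A N * fmode N y) - (\<Sum>\<^sub>\<infinity>N. ?B N * fmode N y) = (\<Sum>\<^sub>\<infinity>N. (?A N - ?B N) * fmode N y)"
    unfolding left_diff_distrib by (rule infsum_diff[OF sA sB, symmetric])
  \<comment> \<open>A single Fourier mode survives, so the determinant is an exponential without
    zeros.\<close>
  also have "\<dots> = (\<Sum>\<^sub>\<infinity>N\<in>{-1}. (det_const (- 1) x * c_const \<tau>) * fmode N y)"
    unfolding det_coeff by (rule infsum_cong_neutral) auto
  also have "\<dots> = (det_const (- 1) x * fmode (-1) y) * c_const \<tau>" by simp
  finally have "a1 x y * u2 x y - a2 x y * u1 x y =
      (exp (\<i> / 2 * of_real y) * (det_const (- 1) x * fmode (-1) y)) * c_const \<tau>" by (simp only: mult.assoc)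
  also have "exp (\<i> / 2 * of_real y) * (det_const (- 1) x * fmode (-1) y) =
      exp (\<i> * pi / 2) * (exp (\<i> / 2 * (sigma / \<tau> + delta)) * exp (\<i> / 2 * of_real (x - y)))"
    unfolding det_const_def mult_exp_exp
    by (rule arg_cong[where f = exp])
      (simp add: alpha_def beta_def sigma_def delta_def field_simps power2_eq_square)
  also have "exp (\<i> * pi / 2) = \<i>" using cis_pi_half by (simp add: cis_conv_exp)
  finally show ?thesis by (simp only: ac_simps)
qed

lemma adj_factor_det: "adj_factor \<tau> p q s t x y * (a1 x y * u2 x y - a2 x y * u1 x y) = c_const \<tau>"
proof -
  have "exp (- \<i> / 2 * x + \<i> / 2 * y - \<i> / (2 * \<tau>) * (p - s) - \<i> / 2 * (q - t)) *
      (exp (\<i> / 2 * (sigma / \<tau> + delta)) * exp (\<i> / 2 * of_real (x - y))) = exp 0"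
    unfolding mult_exp_exp
    by (rule arg_cong[where f = exp]) (simp add: sigma_def delta_def field_simps)
  moreover have "(- \<i> * e) * (\<i> * f * c * g) = c" if "e * (f * g) = exp 0" for e f g c :: complex
  proof -
    have "(- \<i> * e) * (\<i> * f * c * g) = - (\<i> * \<i>) * (e * (f * g)) * c" by algebra
    then show ?thesis unfolding that by simp
  qed
  ultimately show ?thesis unfolding det_eq adj_factor_def by blast
qed

end

section \<open>The isomorphism of the cone with the bundle of rank two\<close>

lemma dbar_coeff_cmult:
  assumes "smooth f"
  shows "dbar_coeff \<tau> (\<lambda>x y. c * f x y) x y = c * dbar_coeff \<tau> f x y"
proof -
  have "dbar_coeff \<tau> (\<lambda>x y. c) x y = 0" by (simp add: dbar_coeff_def partial_x_def partial_y_def)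
  then show ?thesis using dbar_coeff_mult[OF smooth_const assms, of \<tau> c x y] by simp
qed

lemma dbar_coeff_conversion:
  fixes \<tau> w a p :: complex
  assumes "cnj \<tau> - \<tau> \<noteq> 0"
  shows "2 / (\<tau> - cnj \<tau>) * (- (\<i> / (4 * pi) * w) * a + (cnj \<tau> - \<tau>) / 2 * p) =
     \<i> / (pi * (cnj \<tau> - \<tau>)) * (w / 2) * a - p"
proof -
  have "\<tau> - cnj \<tau> = - (cnj \<tau> - \<tau>)" by simp
  moreover have "2 / (- D) * (- (\<i> / (4 * pi) * w) * a + D / 2 * p) = \<i> / (pi * D) * (w / 2) * a - p"
    if "D \<noteq> 0" for D :: complex using that by (simp add: field_simps)
  ultimately show ?thesis using assms by presburger
qed

context cone_setup
begin

lemma cnj_tau_diff_nz: "cnj \<tau> - \<tau> \<noteq> 0"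
  using Im_tau by (simp add: complex_eq_iff)

lemma dbar_coeff_a1: "dbar_coeff \<tau> a1 x y =
    \<i> / (pi * (cnj \<tau> - \<tau>)) * ((sigma + delta * \<tau> - of_real x - pi - pi * \<tau>) / 2) * a1 x y - psi x y * u1 x y"
  unfolding dbar_coeff_def a1_dbar by (rule dbar_coeff_conversion[OF cnj_tau_diff_nz])

lemma dbar_coeff_a2: "dbar_coeff \<tau> a2 x y =
    \<i> / (pi * (cnj \<tau> - \<tau>)) * ((sigma + delta * \<tau> - of_real x - pi - pi * \<tau>) / 2) * a2 x y - psi x y * u2 x y"
  unfolding dbar_coeff_def a2_dbar by (rule dbar_coeff_conversion[OF cnj_tau_diff_nz])

lemma dbar_coeff_u1: "dbar_coeff \<tau> u1 x y =
    \<i> / (pi * (cnj \<tau> - \<tau>)) * ((of_real x - sigma - delta * \<tau> - pi - pi * \<tau>) / 2) * u1 x y"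
  unfolding dbar_coeff_def u1_dbar
  by (rule dbar_coeff_conversion[OF cnj_tau_diff_nz, of _ _ 0, unfolded mult_zero_right add_0_right diff_0_right])

lemma dbar_coeff_u2: "dbar_coeff \<tau> u2 x y =
    \<i> / (pi * (cnj \<tau> - \<tau>)) * ((of_real x - sigma - delta * \<tau> - pi - pi * \<tau>) / 2) * u2 x y"
  unfolding dbar_coeff_def u2_dbar
  by (rule dbar_coeff_conversion[OF cnj_tau_diff_nz, of _ _ 0, unfolded mult_zero_right add_0_right diff_0_right])

lemma smooth_adj_factor: "smooth (adj_factor \<tau> p q s t)"
proof -
  have "smooth (\<lambda>x y. - \<i> * exp (- \<i> / 2 * of_real x + \<i> / 2 * of_real y + (- \<i> / (2 * \<tau>) * (p - s) - \<i> / 2 * (q - t))))"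
    by (intro smooth_mult smooth_const smooth_exp_affine)
  moreover have "adj_factor \<tau> p q s t =
      (\<lambda>x y. - \<i> * exp (- \<i> / 2 * of_real x + \<i> / 2 * of_real y + (- \<i> / (2 * \<tau>) * (p - s) - \<i> / 2 * (q - t))))"
    by (simp add: fun_eq_iff adj_factor_def algebra_simps)
  ultimately show ?thesis by simp
qed

text \<open>Independent scalings of the rows serve both applications: equal factors
  \<open>1 / r\<close> give the symmetric normalization, and unequal ones absorb the constant
  between a given cocycle and the normalized one.\<close>

lemma cone_inverse_isos:
  fixes \<psi> :: "real \<Rightarrow> real \<Rightarrow> complex^1^1" and \<mu> \<nu> \<eta> :: complex
  assumes c: "c1 \<noteq> 0" "c2 \<noteq> 0" and \<psi>: "\<And>x y. c1 * psi x y = c2 * \<psi> x y $ 1 $ 1"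
    and \<mu>: "\<mu> = p + q * \<tau>" and \<nu>: "\<nu> = s + t * \<tau>" and \<eta>: "\<eta> = \<mu> + \<nu> + pi + pi * \<tau>"
  defines "k \<equiv> \<lambda>x y. adj_factor \<tau> p q s t x y / (c1 * c2 * c_const \<tau>)"
  shows "inverse_isos \<tau> (mapping_cone (E_deg0 \<tau> \<mu>) (E_deg1 \<tau> \<nu>) \<psi>) (E_half \<tau> (\<eta> / 2))
     (\<lambda>x y. mat22 (k x y * (c2 * u2 x y)) (- (k x y * (c1 * a2 x y))) (- (k x y * (c2 * u1 x y))) (k x y * (c1 * a1 x y)))
     (\<lambda>x y. mat22 (c1 * a1 x y) (c1 * a2 x y) (c2 * u1 x y) (c2 * u2 x y))"
    (is "inverse_isos \<tau> ?C ?E ?\<Phi> ?\<Psi>")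
proof (rule inverse_isosI)
  have sm: "smooth (\<lambda>x y. c * f x y)" if "smooth f" for c :: complex and f
    by (intro smooth_mult smooth_const that)
  have sk: "smooth k"
    unfolding k_def divide_inverse by (intro smooth_mult smooth_adj_factor smooth_const)
  have neg: "smooth (\<lambda>x y. - f x y)" if "smooth f" for f :: "real \<Rightarrow> real \<Rightarrow> complex"
    using sm[OF that, of "-1"] by simp
  note smooths = smooth_a1 smooth_a2 smooth_u1 smooth_u2
  show "smooth ?\<Phi>"
    by (intro smooth_mat22 neg smooth_mult[OF sk] sm smooths)
  have det: "k x y * c1 * c2 * (a1 x y * u2 x y - a2 x y * u1 x y) = 1" for x y
  proof -
    have "k x y * c1 * c2 * (a1 x y * u2 x y - a2 x y * u1 x y) =
        (c1 * c2 / (c1 * c2 * c_const \<tau>)) * (adj_factor \<tau> p q s t x y * (a1 x y * u2 x y - a2 x y * u1 x y))"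
      by (simp add: k_def)
    then show ?thesis unfolding adj_factor_det using c c_const_nonzero[OF Im_tau] by simp
  qed
  show "?\<Psi> x y ** ?\<Phi> x y = mat 1" for x y
    unfolding mat22_mult mat_eq_mat22 det[of x y, symmetric] by (simp add: mat22_eq_iff algebra_simps)
  show "?\<Phi> x y ** ?\<Psi> x y = mat 1" for x y
    unfolding mat22_mult mat_eq_mat22 det[of x y, symmetric] by (simp add: mat22_eq_iff algebra_simps)
  show "holomorphic_map \<tau> ?E ?C ?\<Psi>"
  proof (rule holomorphic_map_mat22I)
    fix x y :: real
    let ?M = "\<lambda>x y. mat22 (c1 * a1 x y) (c1 * a2 x y) (c2 * u1 x y) (c2 * u2 x y)"
    let ?e = "exp (\<i> / 2 * complex_of_real y)"
    have x: "c * f * ?e = c * g" if "f * ?e = g" for c f g :: complex using that by simp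
    show "?M (x + 2 * pi) y ** trans_x ?E x y = trans_x ?C x y ** ?M x y"
      using x[OF a1_x[of x y], of c1] x[OF a2_x[of x y], of c1] u1_x[of x y] u2_x[of x y]
      by (simp add: E_half_def mapping_cone_def E_deg0_def E_deg1_def mat_eq_mat22 mat22_mult mat22_eq_iff mat_def mult.left_commute)
    show "?M x (y + 2 * pi) ** trans_y ?E x y = trans_y ?C x y ** ?M x y"
      by (simp add: E_half_def mapping_cone_def E_deg0_def E_deg1_def mat22_mult mat22_eq_iff mat_def a1_y a2_y u1_y u2_y)
    let ?K = "\<i> / (pi * (cnj \<tau> - \<tau>))"
    have w1: "sigma + delta * \<tau> - of_real x - pi - pi * \<tau> = 2 * \<mu> - of_real x - \<eta>"
      and w2: "of_real x - sigma - delta * \<tau> - pi - pi * \<tau> = of_real x + 2 * \<nu> - \<eta>"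
      by (simp_all add: \<mu> \<nu> \<eta> sigma_def delta_def algebra_simps)
    \<comment> \<open>The source of the first row cancels against the off-diagonal entry of the
      cone's operator; this is where the relation between \<open>psi\<close> and
      \<open>\<psi>\<close> is used.\<close>
    have top: "c1 * (K * ((2 * \<mu> - X - \<eta>) / 2) * a - ps * u) + (- K * \<mu> * (c1 * a) + P * (c2 * u)) = c1 * a * (- K * (X / 2 + \<eta> / 2))"
      if "c1 * ps = c2 * P" for K X a ps u P :: complex
    proof -
      have "c1 * (K * ((2 * \<mu> - X - \<eta>) / 2) * a - ps * u) + (- K * \<mu> * (c1 * a) + P * (c2 * u)) =
         c1 * a * (- K * (X / 2 + \<eta> / 2)) - (c1 * ps) * u + (c2 * P) * u" by (simp add: field_simps)
      then show ?thesis using that by simp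
    qed
    have bot: "c2 * (K * ((X + 2 * \<nu> - \<eta>) / 2) * u) + (- K * (X + \<nu>)) * (c2 * u) = c2 * u * (- K * (X / 2 + \<eta> / 2))"
      for K X u :: complex by (simp add: field_simps)
    have conns: "conn ?C x y = mat22 (- ?K * \<mu>) (\<psi> x y $ 1 $ 1) 0 (- ?K * (of_real x + \<nu>))"
      "conn ?E x y = mat22 (- ?K * (of_real x / 2 + \<eta> / 2)) 0 0 (- ?K * (of_real x / 2 + \<eta> / 2))"
      unfolding mapping_cone_def E_deg0_def E_deg1_def E_half_def hbundle.simps mat_eq_mat22[symmetric] by (simp_all add: mat_def)
    have add: "mat22 a b c d + mat22 a' b' c' d' = mat22 (a + a') (b + b') (c + c') (d + d')" for a b c d a' b' c' d'
      by (simp add: mat22_eq_iff)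
    show "mat22 (dbar_coeff \<tau> (\<lambda>x y. c1 * a1 x y) x y) (dbar_coeff \<tau> (\<lambda>x y. c1 * a2 x y) x y)
         (dbar_coeff \<tau> (\<lambda>x y. c2 * u1 x y) x y) (dbar_coeff \<tau> (\<lambda>x y. c2 * u2 x y) x y) + conn ?C x y ** ?M x y =
       ?M x y ** conn ?E x y"
      unfolding conns add mat22_mult mult_zero_left mult_zero_right add_0_left add_0_right
        dbar_coeff_cmult[OF smooth_a1] dbar_coeff_cmult[OF smooth_a2] dbar_coeff_cmult[OF smooth_u1] dbar_coeff_cmult[OF smooth_u2]
        dbar_coeff_a1 dbar_coeff_a2 dbar_coeff_u1 dbar_coeff_u2 w1 w2 top[OF \<psi>] bot ..
  qed (intro sm smooths)+
qed

end

section \<open>The weighted integral\<close>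

lemma weight_gaussian:
  fixes \<tau> :: complex and p q s t x :: real
  assumes "\<tau> \<noteq> 0"
  shows "weight \<tau> p q s t 0 x = exp (- (\<i> / (4 * pi * \<tau>)) * of_real x ^ 2 +
     \<i> / (2 * pi) * ((of_real p - of_real s) / \<tau> + (of_real q - of_real t)) * of_real x + 0)"
  unfolding weight_def
  by (rule arg_cong[where f = exp]) (use assms in \<open>simp add: field_simps power2_eq_square\<close>)

lemma Re_weight_exponent:
  fixes \<tau> :: complex
  assumes "Im \<tau> > 0"
  shows "Re (\<i> / (4 * pi * \<tau>)) > 0"
proof -
  have "\<i> / (4 * pi * \<tau>) = of_real (1 / (4 * pi)) * (\<i> / \<tau>)" by simp
  then have "Re (\<i> / (4 * pi * \<tau>)) = 1 / (4 * pi) * Re (\<i> / \<tau>)" by (simp only: Re_of_real_mult)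
  moreover have "Re (\<i> / \<tau>) > 0" unfolding Re_ii_divide using assms by (cases "\<tau> = 0") auto
  ultimately show ?thesis by simp
qed

lemma
  fixes \<tau> :: complex and p q s t :: real
  assumes "Im \<tau> > 0" "schwartz \<psi>0"
  shows continuous_weight_mult: "continuous_on UNIV (\<lambda>x. weight \<tau> p q s t 0 x * \<psi>0 x)"
    and integrable_weight_mult: "integrable lborel (\<lambda>x. weight \<tau> p q s t 0 x * \<psi>0 x)"
proof -
  have [simp]: "\<tau> \<noteq> 0" using assms by auto
  show c: "continuous_on UNIV (\<lambda>x. weight \<tau> p q s t 0 x * \<psi>0 x)"
    unfolding weight_def by (intro continuous_intros schwartz_continuous[OF assms(2)]) auto
  obtain B where B: "\<And>x. norm (\<psi>0 x) \<le> B" using rapid_bounded[OF schwartz_rapid[OF assms(2)]] by metis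
  have "Re (- (\<i> / (4 * pi * \<tau>))) < 0" using Re_weight_exponent[OF assms(1)] by simp
  from superexp_mult_bounded[OF superexp_gaussian[OF this] B]
  have "superexp (\<lambda>x. weight \<tau> p q s t 0 x * \<psi>0 x)"
    unfolding weight_gaussian[OF \<open>\<tau> \<noteq> 0\<close>] by (subst mult.commute)
  then show "integrable lborel (\<lambda>x. weight \<tau> p q s t 0 x * \<psi>0 x)"
    by (intro integrable_rapid superexp_imp_rapid c)
qed

text \<open>Rescaling \<open>\<psi>0\<close> makes its weighted integral the prescribed constant,
  while \<open>\<theta>\<close> is a quotient of integrals and is unaffected by the scaling; its
  limits are 0 and 1.\<close>

lemma cone_setupI:
  fixes \<tau> :: complex and p q s t :: real
  assumes "Im \<tau> > 0" "schwartz \<psi>0" and nz: "(LINT r|lborel. weight \<tau> p q s t 0 r * \<psi>0 r) \<noteq> 0" (is "?l \<noteq> 0")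
  shows "cone_setup \<tau> p q s t (\<lambda>x. exp (\<i> / \<tau> * (- pi / 2 * \<tau> - pi / 4)) / ?l * \<psi>0 x)
    (\<lambda>x. (LINT r:{..x}|lborel. weight \<tau> p q s t 0 r * \<psi>0 r) / ?l)"
proof unfold_locales
  let ?f = "\<lambda>r. weight \<tau> p q s t 0 r * \<psi>0 r"
  note cont = continuous_weight_mult[OF assms(1,2), of p q s t] and int = integrable_weight_mult[OF assms(1,2), of p q s t]
  show "((\<lambda>x. (LINT r:{..x}|lborel. ?f r) / ?l) has_vector_derivative
      weight \<tau> p q s t 0 x * (exp (\<i> / \<tau> * (- pi / 2 * \<tau> - pi / 4)) / ?l * \<psi>0 x) / exp (\<i> / \<tau> * (- pi / 2 * \<tau> - pi / 4))) (at x)" for x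
  proof -
    from has_vector_derivative_mult_right[OF LINT_atMost_has_vector_derivative[OF cont int, of x], of "1 / ?l"]
    show ?thesis by simp
  qed
  show "((\<lambda>x. (LINT r:{..x}|lborel. ?f r) / ?l) \<longlongrightarrow> 0) at_bot"
    using tendsto_divide[OF LINT_atMost_at_bot[OF int] tendsto_const[of ?l] nz] by simp
  show "((\<lambda>x. (LINT r:{..x}|lborel. ?f r) / ?l) \<longlongrightarrow> 1) at_top"
    using tendsto_divide[OF LINT_atMost_at_top[OF int] tendsto_const[of ?l] nz] nz by simp
qed (intro assms schwartz_cmult)+

section \<open>The normalized bump cocycle\<close>

lemma deriv_eq_0_outside:
  assumes "\<And>x. x \<notin> {-e..e} \<Longrightarrow> (f :: real \<Rightarrow> real) x = 0" "x \<notin> {-e..e}"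
  shows "deriv f x = 0"
proof -
  have "open (- {-e..e})" by auto
  then have "\<forall>\<^sub>F y in nhds x. y \<in> - {-e..e}" using assms(2) by (intro eventually_nhds_in_open) auto
  then have "\<forall>\<^sub>F y in nhds x. f y = 0" by (rule eventually_mono) (use assms(1) in blast)
  then have "(f has_field_derivative 0) (at x) \<longleftrightarrow> ((\<lambda>y. 0) has_field_derivative 0) (at x)"
    by (rule DERIV_cong_ev[OF refl _ refl])
  then show ?thesis by (simp add: DERIV_imp_deriv)
qed

lemma rapid_compact_support:
  assumes "continuous_on UNIV (f :: real \<Rightarrow> complex)" "\<And>x. x \<notin> {-e..e} \<Longrightarrow> f x = 0"
  shows "rapid f"
proof (rule rapidI)
  fix k
  have "compact ((\<lambda>x. norm (f x) * (1 + \<bar>x\<bar>) ^ k) ` {-e..e})"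
    by (intro compact_continuous_image continuous_intros continuous_on_subset[OF assms(1)]) auto
  then obtain B where B: "\<And>x. x \<in> {-e..e} \<Longrightarrow> norm (norm (f x) * (1 + \<bar>x\<bar>) ^ k) \<le> B"
    by (meson bounded_iff compact_imp_bounded image_eqI)
  have "norm (f x) * (1 + \<bar>x\<bar>) ^ k \<le> max B 0" for x
  proof (cases "x \<in> {-e..e}")
    case True
    from B[OF this] show ?thesis by simp
  qed (simp add: assms(2))
  then show "\<exists>C. \<forall>x. norm (f x) * (1 + \<bar>x\<bar>) ^ k \<le> C" by blast
qed

lemma schwartz_smooth_compact_support:
  assumes "smooth_real \<rho>" "\<And>x. x \<notin> {-e..e} \<Longrightarrow> \<rho> x = 0"
  shows "schwartz (\<lambda>x. complex_of_real (\<rho> x))"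
proof (rule schwartz_coinduct[where F = "range (\<lambda>n x. complex_of_real ((deriv ^^ n) \<rho> x))"])
  have diff: "(deriv ^^ n) \<rho> differentiable (at x)" for n x using assms(1) by (simp add: smooth_real_def)
  have zero: "x \<notin> {-e..e} \<Longrightarrow> (deriv ^^ n) \<rho> x = 0" for n x
    by (induction n arbitrary: x) (auto simp del: atLeastAtMost_iff intro: assms(2) deriv_eq_0_outside[of e])
  have cont: "continuous_on UNIV ((deriv ^^ n) \<rho>)" for n
    by (intro continuous_at_imp_continuous_on ballI differentiable_imp_continuous_within diff)
  show "(\<lambda>x. complex_of_real (\<rho> x)) \<in> range (\<lambda>n x. complex_of_real ((deriv ^^ n) \<rho> x))"
    by (rule range_eqI[where x = 0]) simp
  fix f assume "f \<in> range (\<lambda>n x. complex_of_real ((deriv ^^ n) \<rho> x))"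
  then obtain n where f: "f = (\<lambda>x. complex_of_real ((deriv ^^ n) \<rho> x))" by auto
  show "rapid f"
    unfolding f by (rule rapid_compact_support[where e = e]) (auto intro!: continuous_intros cont simp: zero)
  show "\<exists>f'\<in>range (\<lambda>n x. complex_of_real ((deriv ^^ n) \<rho> x)). \<forall>x. (f has_vector_derivative f' x) (at x)"
  proof (intro bexI allI)
    fix x
    have "((deriv ^^ n) \<rho> has_real_derivative (deriv ^^ Suc n) \<rho> x) (at x)"
      using diff[of n x] by (simp add: DERIV_deriv_iff_real_differentiable)
    then have "((deriv ^^ n) \<rho> has_vector_derivative (deriv ^^ Suc n) \<rho> x) (at x)"
      by (simp add: has_real_derivative_iff_has_vector_derivative)
    then show "(f has_vector_derivative complex_of_real ((deriv ^^ Suc n) \<rho> x)) (at x)"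
      unfolding f by (rule bounded_linear.has_vector_derivative[OF bounded_linear_of_real])
  qed blast
qed

lemma normalized_bump_isos:
  fixes \<tau> \<mu> \<nu> \<eta> \<kappa> r :: complex and p q s t :: real
  assumes \<tau>: "Im \<tau> > 0" and \<mu>: "\<mu> = p + q * \<tau>" and \<nu>: "\<nu> = s + t * \<tau>" and \<eta>: "\<eta> = \<mu> + \<nu> + pi + pi * \<tau>"
    and bump: "normalized_bump \<tau> p q s t \<epsilon> \<rho> \<kappa>" and r: "r\<^sup>2 = c_const \<tau>"
  shows "inverse_isos \<tau> (mapping_cone (E_deg0 \<tau> \<mu>) (E_deg1 \<tau> \<nu>) (bump_cocycle p s \<rho> \<kappa>)) (E_half \<tau> (\<eta> / 2))
              (\<lambda>x y. mat (1 / r) ** phi \<tau> p q s t \<rho> \<kappa> x y)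
              (\<lambda>x y. mat (1 / r) ** phi_tilde \<tau> p q s t \<rho> \<kappa> x y)"
proof -
  have \<tau>0: "\<tau> \<noteq> 0" using \<tau> by auto
  define \<psi>0 where "\<psi>0 = psi_H p s \<rho> \<kappa> 0"
  define \<theta> where "\<theta> = (\<lambda>x. (LINT r:{..x}|lborel. weight \<tau> p q s t 0 r * \<psi>0 r) / lambda_H \<tau> p q s t \<rho> \<kappa> 0)"
  have sm: "smooth_real \<rho>" and supp: "\<And>x. x \<notin> {-\<epsilon>..\<epsilon>} \<Longrightarrow> \<rho> x = 0"
    using bump by (simp_all add: normalized_bump_def)
  have lam: "lambda_H \<tau> p q s t \<rho> \<kappa> 0 = exp (\<i> / \<tau> * (- pi / 2 * \<tau> - pi / 4))"
    using bump by (simp add: normalized_bump_def)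
  have \<psi>0: "schwartz \<psi>0"
  proof -
    have "schwartz (\<lambda>x. \<kappa> * of_real (\<rho> (x + (s - p))))"
      by (intro schwartz_cmult schwartz_shift[OF schwartz_smooth_compact_support[OF sm supp]])
    then show ?thesis by (simp add: \<psi>0_def psi_H_def[abs_def] algebra_simps)
  qed
  have l: "(LINT r|lborel. weight \<tau> p q s t 0 r * \<psi>0 r) = lambda_H \<tau> p q s t \<rho> \<kappa> 0"
    by (simp add: \<psi>0_def lambda_H_def)
  have "cone_setup \<tau> p q s t \<psi>0 \<theta>"
    using cone_setupI[OF \<tau> \<psi>0, of p q s t] unfolding l \<theta>_def lam by simp
  then interpret cone_setup \<tau> p q s t \<psi>0 \<theta> .
  have thetas: "theta_H \<tau> p q s t \<rho> \<kappa> = thetas"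
    by (simp add: fun_eq_iff theta_H_def theta_eps_def \<theta>_def \<psi>0_def algebra_simps)
  have psi_H: "psi_H p s \<rho> \<kappa> H x = \<psi>0 (x + 2 * pi * of_int H)" for H x
    by (simp add: \<psi>0_def psi_H_def algebra_simps)
  have cocycle: "bump_cocycle p s \<rho> \<kappa> x y = mat (psi x y)" for x y
    unfolding bump_cocycle_def psi_def zak_def psi_H ..
  have r0: "r \<noteq> 0" using c_const_nonzero[OF \<tau>] r by auto
  \<comment> \<open>Both rows carry \<open>1 / r\<close>, and \<open>r\<close> squares to
    \<open>c_const \<tau>\<close>, so the scalars in the inverse cancel.\<close>
  have k: "adj_factor \<tau> p q s t x y / (1 / r * (1 / r) * c_const \<tau>) = adj_factor \<tau> p q s t x y" for x y
    using r0 by (simp add: r[symmetric] power2_eq_square)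
  have mats: "(mat (1 / r) :: complex^2^2) ** mat22 a b c d = mat22 (1 / r * a) (1 / r * b) (1 / r * c) (1 / r * d)" for a b c d
    unfolding mat_eq_mat22 mat22_mult by simp
  have "inverse_isos \<tau> (mapping_cone (E_deg0 \<tau> \<mu>) (E_deg1 \<tau> \<nu>) (bump_cocycle p s \<rho> \<kappa>)) (E_half \<tau> (\<eta> / 2))
     (\<lambda>x y. mat22 (adj_factor \<tau> p q s t x y * (1 / r * u2 x y)) (- (adj_factor \<tau> p q s t x y * (1 / r * a2 x y)))
        (- (adj_factor \<tau> p q s t x y * (1 / r * u1 x y))) (adj_factor \<tau> p q s t x y * (1 / r * a1 x y)))
     (\<lambda>x y. mat22 (1 / r * a1 x y) (1 / r * a2 x y) (1 / r * u1 x y) (1 / r * u2 x y))"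
    by (rule cone_inverse_isos[OF _ _ _ \<mu> \<nu> \<eta>, where ?c1.0 = "1 / r" and ?c2.0 = "1 / r", unfolded k])
      (simp_all add: r0 cocycle mat_def)
  moreover have "mat (1 / r) ** phi \<tau> p q s t \<rho> \<kappa> x y =
      mat22 (adj_factor \<tau> p q s t x y * (1 / r * u2 x y)) (- (adj_factor \<tau> p q s t x y * (1 / r * a2 x y)))
        (- (adj_factor \<tau> p q s t x y * (1 / r * u1 x y))) (adj_factor \<tau> p q s t x y * (1 / r * a1 x y))" for x y
    unfolding phi_def Let_def mats thetas phi11_eq[OF \<tau>0] phi12_eq[OF \<tau>0] phi21_eq[OF \<tau>0] phi22_eq[OF \<tau>0]
      phit11_eq phit12_eq phit21_eq phit22_eq by simp
  moreover have "mat (1 / r) ** phi_tilde \<tau> p q s t \<rho> \<kappa> x y =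
      mat22 (1 / r * a1 x y) (1 / r * a2 x y) (1 / r * u1 x y) (1 / r * u2 x y)" for x y
    unfolding phi_tilde_def Let_def mats thetas phit11_eq phit12_eq phit21_eq phit22_eq ..
  ultimately show ?thesis by (simp only:)
qed

section \<open>Translating the second index of the bundle of rank two\<close>

text \<open>The step is \<open>pi\<close> and not \<open>2 * pi\<close> because the index of the
  bundle is half of \<open>\<eta>\<close>. The character then only acquires signs over the periods,
  which the constant matrix compensates.\<close>

lemma E_half_shift:
  fixes \<tau> w :: complex and m n :: int
  assumes "Im \<tau> > 0"
  shows "hol_isomorphic \<tau> (E_half \<tau> (w + pi * (of_int m + of_int n * \<tau>))) (E_half \<tau> w)"
proof -
  let ?w = "w + pi * (of_int m + of_int n * \<tau>)"
  define sn :: complex where "sn = (if even n then 1 else - 1)"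
  \<comment> \<open>Even \<open>m\<close> requires commuting with \<open>mat22 1 0 0 (-1)\<close>,
    hence a diagonal matrix; odd \<open>m\<close> requires anticommuting, hence an antidiagonal one.
    The sign \<open>sn\<close> settles whether it commutes or anticommutes with the exchange of
    coordinates.\<close>
  define A B C D :: complex where "A = (if even m then 1 else 0)" and "B = (if even m then 0 else sn)"
    and "C = (if even m then 0 else 1)" and "D = (if even m then sn else 0)"
  \<comment> \<open>These exponents make \<open>g\<close> solve the equation whose coefficient is
    the difference of the two connections.\<close>
  define a b where "a = - \<i> / 2 * of_int n" and "b = \<i> / 2 * of_int m"
  define g where "g = (\<lambda>x y. exp (a * of_real x + b * of_real y + 0))"
  define g' where "g' = (\<lambda>x y. exp (- a * of_real x + - b * of_real y + 0))"
  have smg: "smooth g" and smg': "smooth g'" unfolding g_def g'_def by (intro smooth_exp_affine)+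
  have gg': "g x y * g' x y = 1" for x y unfolding g_def g'_def mult_exp_exp by simp
  have sn2: "sn * sn = 1" by (simp add: sn_def)
  let ?K = "\<i> / (pi * (cnj \<tau> - \<tau>))"
  have nz: "cnj \<tau> - \<tau> \<noteq> 0" using assms by (simp add: complex_eq_iff)
  have dg: "dbar_coeff \<tau> g x y = ?K * (?w - w) * g x y" for x y
  proof -
    have "2 / (- d) * (\<tau> * a - b) = \<i> / (pi * d) * (pi * (of_int m + of_int n * \<tau>))" if "d \<noteq> 0" for d :: complex
      using that by (simp add: a_def b_def field_simps)
    from this[OF nz] have "2 / (\<tau> - cnj \<tau>) * (\<tau> * a - b) = ?K * (?w - w)" by simp
    moreover have "dbar_coeff \<tau> g x y = 2 / (\<tau> - cnj \<tau>) * (\<tau> * a - b) * g x y"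
      unfolding dbar_coeff_def g_def partial_exp_affine by (simp only: left_diff_distrib right_diff_distrib mult.assoc)
    ultimately show ?thesis by simp
  qed
  have gx: "g (x + 2 * pi) y = sn * g x y" for x y
  proof -
    have "g (x + 2 * pi) y = exp (\<i> * pi * of_int (- n)) * g x y"
      unfolding g_def mult_exp_exp by (rule arg_cong[where f = exp]) (simp add: a_def algebra_simps)
    then show ?thesis unfolding minus_one_powi_exp[symmetric] by (simp add: sn_def power_int_minus_left)
  qed
  have gy: "g x (y + 2 * pi) = (if even m then 1 else - 1) * g x y" for x y
  proof -
    have "g x (y + 2 * pi) = exp (\<i> * pi * of_int m) * g x y"
      unfolding g_def mult_exp_exp by (rule arg_cong[where f = exp]) (simp add: b_def algebra_simps)
    then show ?thesis unfolding minus_one_powi_exp[symmetric] by (simp add: power_int_minus_left)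
  qed
  have sm: "smooth (\<lambda>x y. c * f x y)" if "smooth f" for c :: complex and f
    by (intro smooth_mult smooth_const that)
  have "holomorphic_map \<tau> (E_half \<tau> w) (E_half \<tau> ?w) (\<lambda>x y. mat22 (A * g x y) (B * g x y) (C * g x y) (D * g x y))"
  proof (rule holomorphic_map_mat22I)
    fix x y :: real
    let ?M = "\<lambda>x y. mat22 (A * g x y) (B * g x y) (C * g x y) (D * g x y)"
    show "?M (x + 2 * pi) y ** trans_x (E_half \<tau> w) x y = trans_x (E_half \<tau> ?w) x y ** ?M x y"
      unfolding gx by (simp add: E_half_def mat_eq_mat22 mat22_mult A_def B_def C_def D_def sn2)
        (simp add: mat22_eq_iff sn_def)
    show "?M x (y + 2 * pi) ** trans_y (E_half \<tau> w) x y = trans_y (E_half \<tau> ?w) x y ** ?M x y"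
      unfolding gy by (simp add: E_half_def mat22_mult A_def B_def C_def D_def)
    have conns: "conn (E_half \<tau> v) x y = mat22 (- ?K * (of_real x / 2 + v)) 0 0 (- ?K * (of_real x / 2 + v))" for v
      unfolding E_half_def hbundle.simps mat_eq_mat22[symmetric] ..
    have add: "mat22 a b c d + mat22 a' b' c' d' = mat22 (a + a') (b + b') (c + c') (d + d')" for a b c d a' b' c' d'
      by (simp add: mat22_eq_iff)
    have entry: "c * (K * (w' - w) * G) + (- K * (X + w')) * (c * G) = (c * G) * (- K * (X + w))" for c K w' G X :: complex
      by (simp add: algebra_simps)
    show "mat22 (dbar_coeff \<tau> (\<lambda>x y. A * g x y) x y) (dbar_coeff \<tau> (\<lambda>x y. B * g x y) x y)
         (dbar_coeff \<tau> (\<lambda>x y. C * g x y) x y) (dbar_coeff \<tau> (\<lambda>x y. D * g x y) x y) + conn (E_half \<tau> ?w) x y ** ?M x y =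
       ?M x y ** conn (E_half \<tau> w) x y"
      unfolding conns add mat22_mult mult_zero_left mult_zero_right add_0_left add_0_right dbar_coeff_cmult[OF smg] dg entry ..
  qed (intro sm smg)+
  moreover have "smooth (\<lambda>x y. mat22 (A * g' x y) (C * g' x y) (B * g' x y) (D * g' x y))"
    by (intro smooth_mat22 sm smg')
  ultimately have "inverse_isos \<tau> (E_half \<tau> ?w) (E_half \<tau> w) (\<lambda>x y. mat22 (A * g' x y) (C * g' x y) (B * g' x y) (D * g' x y))
      (\<lambda>x y. mat22 (A * g x y) (B * g x y) (C * g x y) (D * g x y))"
  proof (rule inverse_isosI)
    fix x y
    show "mat22 (A * g x y) (B * g x y) (C * g x y) (D * g x y) ** mat22 (A * g' x y) (C * g' x y) (B * g' x y) (D * g' x y) = mat 1"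
      using gg'[of x y] sn2 unfolding mat22_mult mat_eq_mat22
      by (cases "even m") (auto simp: A_def B_def C_def D_def mult.assoc mult.left_commute)
    show "mat22 (A * g' x y) (C * g' x y) (B * g' x y) (D * g' x y) ** mat22 (A * g x y) (B * g x y) (C * g x y) (D * g x y) = mat 1"
      using gg'[of x y] sn2 unfolding mat22_mult mat_eq_mat22
      by (cases "even m") (auto simp: A_def B_def C_def D_def mult.commute mult.left_commute)
  qed
  then show ?thesis unfolding hol_isomorphic_def by blast
qed

section \<open>Arbitrary non-trivial extensions\<close>

lemma matrix_11_mult_nth: "(A ** B) $ i $ j = A $ 1 $ 1 * B $ 1 $ 1" for A B :: "complex^1^1"
  unfolding num1_eq1[of i] num1_eq1[of j] by (simp add: matrix_matrix_mult_def sum_1)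

lemma matrix_11_eq_iff: "A = B \<longleftrightarrow> A $ 1 $ 1 = B $ 1 $ 1" for A B :: "complex^1^1"
  by (simp add: vec_eq_iff forall_1)

lemma quasi_periodic_degree_one:
  assumes "degree_one_morphism (E_deg1 \<tau> \<nu>) (E_deg0 \<tau> \<mu>) \<psi>"
  shows "quasi_periodic (2 * pi) (\<lambda>x y. \<psi> x y $ 1 $ 1)"
proof -
  have "\<psi> (x + 2 * pi) y $ 1 $ 1 * exp (\<i> * of_real y) = \<psi> x y $ 1 $ 1" and "\<psi> x (y + 2 * pi) $ 1 $ 1 = \<psi> x y $ 1 $ 1" for x y
    using assms by (simp_all add: bundle_map_def E_deg0_def E_deg1_def matrix_11_eq_iff matrix_11_mult_nth mat_def)
  moreover have "smooth (\<lambda>x y. \<psi> x y $ 1 $ 1)"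
    using assms by (intro smooth_vec_nth) (simp add: bundle_map_def)
  moreover have "u = exp (- \<i> * of_real y) * v" if "u * exp (\<i> * of_real y) = v" for u v and y :: real
    unfolding that[symmetric] by (simp add: exp_minus)
  ultimately show ?thesis unfolding quasi_periodic_def by blast
qed

text \<open>For line bundles the commutator on sections is multiplication by one scalar, so a scalar
  equation for the primitive is enough.\<close>

lemma ext_trivialI:
  fixes \<tau> \<mu> \<nu> :: complex
  assumes F: "quasi_periodic (2 * pi) F"
    and dbar: "\<And>x y. dbar_coeff \<tau> F x y + \<i> / (pi * (cnj \<tau> - \<tau>)) * (of_real x + \<nu> - \<mu>) * F x y = \<psi> x y $ 1 $ 1"
  shows "ext_trivial \<tau> (E_deg1 \<tau> \<nu>) (E_deg0 \<tau> \<mu>) \<psi>"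
proof -
  let ?f = "\<lambda>x y. (mat (F x y) :: complex^1^1)"
  have f: "?f x y $ i $ j = F x y" for x y i j
    unfolding num1_eq1[of i] num1_eq1[of j] by (simp add: mat_def)
  have smF: "smooth F" using F by (simp add: quasi_periodic_def)
  have sm: "smooth ?f" by (intro smooth_vecI) (simp only: f smF)
  have "bundle_map (E_deg1 \<tau> \<nu>) (E_deg0 \<tau> \<mu>) ?f"
    using sm F by (simp add: bundle_map_def E_deg0_def E_deg1_def matrix_11_eq_iff matrix_11_mult_nth mat_def quasi_periodic_def exp_minus)
  moreover have "\<psi> x y *v g x y = hol_op \<tau> (E_deg0 \<tau> \<mu>) (\<lambda>x y. ?f x y *v g x y) x y - ?f x y *v hol_op \<tau> (E_deg1 \<tau> \<nu>) g x y"
    if "smooth_section (E_deg1 \<tau> \<nu>) g" for g x y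
  proof -
    have "smooth g" using that by (simp add: smooth_section_def)
    have "(hol_op \<tau> (E_deg0 \<tau> \<mu>) (\<lambda>x y. ?f x y *v g x y) x y - ?f x y *v hol_op \<tau> (E_deg1 \<tau> \<nu>) g x y) $ 1 = \<psi> x y $ 1 $ 1 * g x y $ 1"
      unfolding hol_op_commutator[OF sm \<open>smooth g\<close>] sum_1 f matrix_11_mult_nth dbar[symmetric]
      by (simp add: E_deg0_def E_deg1_def mat_def algebra_simps add_divide_distrib diff_divide_distrib)
    then show ?thesis by (simp add: vec_eq_iff forall_1 matrix_vector_mult_def sum_1)
  qed
  ultimately show ?thesis unfolding ext_trivial_def by blast
qed

text \<open>The condition \<open>lam\<close> makes the solution of the ordinary differential equation for the zero mode decay at both ends.\<close>

lemma ext_trivial_of_integral_zero: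
  fixes \<tau> \<mu> \<nu> :: complex and p q s t :: real
  assumes \<tau>: "Im \<tau> > 0" and \<mu>: "\<mu> = p + q * \<tau>" and \<nu>: "\<nu> = s + t * \<tau>" and \<psi>0: "schwartz \<psi>0"
    and \<psi>: "\<And>x y. \<psi> x y $ 1 $ 1 = zak (2 * pi) \<psi>0 x y"
    and lam: "(LINT r|lborel. weight \<tau> p q s t 0 r * \<psi>0 r) = 0"
  shows "ext_trivial \<tau> (E_deg1 \<tau> \<nu>) (E_deg0 \<tau> \<mu>) \<psi>"
proof -
  have \<tau>0: "\<tau> \<noteq> 0" using \<tau> by auto
  have nz: "\<tau> - cnj \<tau> \<noteq> 0" using \<tau> by (simp add: complex_eq_iff)
  note cont = continuous_weight_mult[OF \<tau> \<psi>0, of p q s t] and int = integrable_weight_mult[OF \<tau> \<psi>0, of p q s t]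
  let ?a = "\<i> / (4 * pi * \<tau>)"
  let ?b = "- (\<i> / (2 * pi) * ((of_real p - of_real s) / \<tau> + (of_real q - of_real t)))"
  \<comment> \<open>Chosen so that the source is exactly \<open>\<psi>0\<close> once the equation is
    multiplied by \<open>\<tau>\<close> and by the factor \<open>2 / (\<tau> - cnj \<tau>)\<close>
    of \<open>dbar_coeff\<close>. The exponents \<open>?a\<close> and \<open>?b\<close> are the
    negatives of those of \<open>weight\<close>.\<close>
  let ?c = "(\<tau> - cnj \<tau>) / (2 * \<tau>)"
  define \<Theta> where "\<Theta> = (\<lambda>x. ?c * (LINT r:{..x}|lborel. weight \<tau> p q s t 0 r * \<psi>0 r))"
  define k where "k = (\<lambda>x. exp (?a * of_real x ^ 2 + ?b * of_real x + 0) * \<Theta> x)"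
  have "- (?a * of_real x ^ 2 + ?b * of_real x + 0) = - ?a * of_real x ^ 2 +
     \<i> / (2 * pi) * ((of_real p - of_real s) / \<tau> + (of_real q - of_real t)) * of_real x + 0" for x :: real
    by (simp add: algebra_simps)
  then have w: "exp (- (?a * of_real x ^ 2 + ?b * of_real x + 0)) = weight \<tau> p q s t 0 x" for x :: real
    unfolding weight_gaussian[OF \<tau>0] by (simp only:)
  have der: "(\<Theta> has_vector_derivative exp (- (?a * of_real x ^ 2 + ?b * of_real x + 0)) * (?c * \<psi>0 x)) (at x)" for x
    using has_vector_derivative_mult_right[OF LINT_atMost_has_vector_derivative[OF cont int, of x], of ?c]
    unfolding w \<Theta>_def by (simp only: ac_simps)
  have top: "(\<Theta> \<longlongrightarrow> 0) at_top"
    unfolding \<Theta>_def using tendsto_mult_left[OF LINT_atMost_at_top[OF int], of ?c] by (simp only: lam mult_zero_right)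
  have bot: "(\<Theta> \<longlongrightarrow> 0) at_bot"
    unfolding \<Theta>_def using tendsto_mult_left[OF LINT_atMost_at_bot[OF int], of ?c] by (simp only: mult_zero_right)
  note sol = schwartz_ode_solution[OF Re_weight_exponent[OF \<tau>] schwartz_cmult[OF \<psi>0, of ?c] der top bot]
  have k: "schwartz k" unfolding k_def by (rule sol(1))
  have k_deriv: "(k has_vector_derivative (2 * ?a * of_real x + ?b) * k x + ?c * \<psi>0 x) (at x)" for x
    unfolding k_def by (rule sol(2))
  obtain k' where k': "schwartz k'" "\<And>x. (k has_vector_derivative k' x) (at x)"
    using k by (metis schwartzE)
  have k'_eq: "k' x = (2 * ?a * of_real x + ?b) * k x + ?c * \<psi>0 x" for x
    using vector_derivative_unique_at[OF k'(2) k_deriv] .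
  let ?A = "- (\<i> / (2 * pi))" and ?B = "\<i> / (2 * pi) * (\<mu> - \<nu>)"
  have ode: "\<tau> * k' x + (?A * of_real x + ?B) * k x = (\<tau> - cnj \<tau>) / 2 * \<psi>0 x" for x
  proof -
    have "\<tau> * (2 * ?a * of_real x + ?b) = - (?A * of_real x + ?B)"
      using \<tau>0 by (simp add: \<mu> \<nu> field_simps)
    moreover have "\<tau> * k' x = (\<tau> * (2 * ?a * of_real x + ?b)) * k x + (\<tau> * ?c) * \<psi>0 x"
      unfolding k'_eq by (simp add: algebra_simps)
    moreover have "\<tau> * ?c = (\<tau> - cnj \<tau>) / 2" using \<tau>0 by simp
    ultimately show ?thesis by (simp only: minus_mult_left[symmetric]) simp
  qed
  have pi1: "\<bar>2 * pi\<bar> \<ge> 1" using pi_gt3 by simp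
  have pde: "\<tau> * partial_x (zak (2 * pi) k) x y - partial_y (zak (2 * pi) k) x y + (?A * of_real x + ?B) * zak (2 * pi) k x y =
      zak (2 * pi) (\<lambda>x. (\<tau> - cnj \<tau>) / 2 * \<psi>0 x) x y" for x y
    by (rule zak_ode[OF k k'(2,1) ode pi1]) simp
  have "zak (2 * pi) (\<lambda>x. (\<tau> - cnj \<tau>) / 2 * \<psi>0 x) x y = (\<tau> - cnj \<tau>) / 2 * zak (2 * pi) \<psi>0 x y" for x y
    unfolding zak_def infsum_cmult_right'[symmetric] by (simp only: mult.assoc)
  then have pde': "\<tau> * partial_x (zak (2 * pi) k) x y - partial_y (zak (2 * pi) k) x y =
      (\<tau> - cnj \<tau>) / 2 * \<psi> x y $ 1 $ 1 - (?A * of_real x + ?B) * zak (2 * pi) k x y" for x y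
    using pde[of x y] \<psi>[of x y] by (simp add: eq_diff_eq)
  show ?thesis
  proof (rule ext_trivialI)
    show "quasi_periodic (2 * pi) (zak (2 * pi) k)" by (rule quasi_periodic_zak[OF k pi1])
    show "dbar_coeff \<tau> (zak (2 * pi) k) x y + \<i> / (pi * (cnj \<tau> - \<tau>)) * (of_real x + \<nu> - \<mu>) * zak (2 * pi) k x y = \<psi> x y $ 1 $ 1" for x y
    proof -
      have "2 / d * (d / 2 * P - (?A * X + ?B) * Z) + \<i> / (pi * (- d)) * (X + \<nu> - \<mu>) * Z = P" if "d \<noteq> 0" for d P X Z :: complex
        using that by (simp add: field_simps)
      from this[OF nz] show ?thesis unfolding dbar_coeff_def pde' by simp
    qed
  qed
qed

lemma cone_isomorphic:
  fixes \<tau> \<mu> \<nu> \<eta> :: complex and p q s t :: real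
  assumes \<tau>: "Im \<tau> > 0" and \<mu>: "\<mu> = p + q * \<tau>" and \<nu>: "\<nu> = s + t * \<tau>" and \<eta>: "\<eta> = \<mu> + \<nu> + pi + pi * \<tau>"
    and \<psi>: "degree_one_morphism (E_deg1 \<tau> \<nu>) (E_deg0 \<tau> \<mu>) \<psi>"
    and nontrivial: "\<not> ext_trivial \<tau> (E_deg1 \<tau> \<nu>) (E_deg0 \<tau> \<mu>) \<psi>"
  shows "hol_isomorphic \<tau> (mapping_cone (E_deg0 \<tau> \<mu>) (E_deg1 \<tau> \<nu>) \<psi>) (E_half \<tau> (\<eta> / 2))"
proof -
  let ?F = "\<lambda>x y. \<psi> x y $ 1 $ 1"
  define \<psi>0 where "\<psi>0 = zero_mode ?F"
  have F: "quasi_periodic (2 * pi) ?F" by (rule quasi_periodic_degree_one[OF \<psi>])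
  have \<psi>0: "schwartz \<psi>0" unfolding \<psi>0_def by (rule schwartz_zero_mode[OF F]) simp
  have "2 * pi \<ge> 1" using pi_gt3 by simp
  from zak_zero_mode[OF F this] have Fz: "\<psi> x y $ 1 $ 1 = zak (2 * pi) \<psi>0 x y" for x y
    unfolding \<psi>0_def by (rule fun_cong[THEN fun_cong])
  let ?l = "LINT r|lborel. weight \<tau> p q s t 0 r * \<psi>0 r"
  \<comment> \<open>The scaling of \<open>\<psi>0\<close> that gives its weighted integral the
    prescribed value; the class being non-trivial makes the denominator nonzero.\<close>
  let ?c = "exp (\<i> / \<tau> * (- pi / 2 * \<tau> - pi / 4)) / ?l"
  have l: "?l \<noteq> 0" using ext_trivial_of_integral_zero[OF \<tau> \<mu> \<nu> \<psi>0 Fz] nontrivial by blast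
  interpret cone_setup \<tau> p q s t "\<lambda>x. ?c * \<psi>0 x" "\<lambda>x. (LINT r:{..x}|lborel. weight \<tau> p q s t 0 r * \<psi>0 r) / ?l"
    by (rule cone_setupI[OF \<tau> \<psi>0 l])
  \<comment> \<open>The first row stays unscaled; the second is multiplied by \<open>?c\<close> to
    return from the normalized cocycle to the given one.\<close>
  have "1 * psi x y = ?c * \<psi> x y $ 1 $ 1" for x y
    unfolding psi_def Fz zak_def infsum_cmult_right'[symmetric] mult_1_left by (simp only: mult.assoc)
  moreover have "?c \<noteq> 0" using l by simp
  ultimately show ?thesis
    unfolding hol_isomorphic_def using cone_inverse_isos[OF one_neq_zero _ _ \<mu> \<nu> \<eta>] by blast
qed

theorem theorem4p10:
  fixes \<tau> \<mu> \<nu> :: complex and p q s t :: real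
    and \<psi> :: "real \<Rightarrow> real \<Rightarrow> complex^1^1"
  assumes "Im \<tau> > 0"
    and "\<mu> = p + q * \<tau>" and "\<nu> = s + t * \<tau>"
    and "degree_one_morphism (E_deg1 \<tau> \<nu>) (E_deg0 \<tau> \<mu>) \<psi>"
    and "\<not> ext_trivial \<tau> (E_deg1 \<tau> \<nu>) (E_deg0 \<tau> \<mu>) \<psi>"
  shows "(\<forall>\<eta>::complex.
            (\<exists>m n::int. \<eta> - (\<mu> + \<nu> + pi + pi * \<tau>) = 2 * pi * (of_int m + of_int n * \<tau>)) \<longrightarrow>
            hol_isomorphic \<tau> (mapping_cone (E_deg0 \<tau> \<mu>) (E_deg1 \<tau> \<nu>) \<psi>) (E_half \<tau> (\<eta> / 2)))
       \<and> (\<forall>(\<epsilon>::real) (\<rho>::real \<Rightarrow> real) (\<kappa>::complex) (\<eta>::complex) (r::complex).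
            normalized_bump \<tau> p q s t \<epsilon> \<rho> \<kappa> \<and> \<psi> = bump_cocycle p s \<rho> \<kappa> \<and>
            \<eta> = \<mu> + \<nu> + pi + pi * \<tau> \<and> r^2 = c_const \<tau> \<longrightarrow>
            inverse_isos \<tau> (mapping_cone (E_deg0 \<tau> \<mu>) (E_deg1 \<tau> \<nu>) \<psi>) (E_half \<tau> (\<eta> / 2))
              (\<lambda>x y. mat (1 / r) ** phi \<tau> p q s t \<rho> \<kappa> x y)
              (\<lambda>x y. mat (1 / r) ** phi_tilde \<tau> p q s t \<rho> \<kappa> x y))"
proof (intro conjI allI impI)
  fix \<eta> :: complex
  assume "\<exists>m n::int. \<eta> - (\<mu> + \<nu> + pi + pi * \<tau>) = 2 * pi * (of_int m + of_int n * \<tau>)"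
  then obtain m n :: int where "\<eta> - (\<mu> + \<nu> + pi + pi * \<tau>) = 2 * pi * (of_int m + of_int n * \<tau>)" by blast
  \<comment> \<open>The signs are reversed because \<open>E_half_shift\<close> leads from the
    translated index to \<open>\<eta> / 2\<close>.\<close>
  then have eq: "(\<mu> + \<nu> + pi + pi * \<tau>) / 2 = \<eta> / 2 + pi * (of_int (- m) + of_int (- n) * \<tau>)"
    by (simp add: field_simps)
  show "hol_isomorphic \<tau> (mapping_cone (E_deg0 \<tau> \<mu>) (E_deg1 \<tau> \<nu>) \<psi>) (E_half \<tau> (\<eta> / 2))"
    using hol_isomorphic_trans[OF cone_isomorphic[OF assms(1,2,3) refl assms(4,5)]
      E_half_shift[OF assms(1), of "\<eta> / 2" "- m" "- n", folded eq]] .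
next
  fix \<epsilon> :: real and \<rho> :: "real \<Rightarrow> real" and \<kappa> \<eta> r :: complex
  assume "normalized_bump \<tau> p q s t \<epsilon> \<rho> \<kappa> \<and> \<psi> = bump_cocycle p s \<rho> \<kappa> \<and>
            \<eta> = \<mu> + \<nu> + pi + pi * \<tau> \<and> r^2 = c_const \<tau>"
  then show "inverse_isos \<tau> (mapping_cone (E_deg0 \<tau> \<mu>) (E_deg1 \<tau> \<nu>) \<psi>) (E_half \<tau> (\<eta> / 2))
              (\<lambda>x y. mat (1 / r) ** phi \<tau> p q s t \<rho> \<kappa> x y)
              (\<lambda>x y. mat (1 / r) ** phi_tilde \<tau> p q s t \<rho> \<kappa> x y)"
    using normalized_bump_isos[OF assms(1,2,3)] by blast
qed

end
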